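(* Let $A$ be a cubic three-dimensional AS regular $\Bbbk$-algebra faithfully graded by a nonabelian group $G$, the grading refining the $\mathbb{N}$-grading. Then $A$ is isomorphic, as a graded algebra, to one of the following algebras, in such a way that $x$ and $y$ are $G$-homogeneous and $G$ is a quotient of the indicated group, with $\deg_G(x)$ and $\deg_G(y)$ the images of $a$ and $b$ respectively: - $\mathcal{F}_q^\pm=\Bbbk\langle x,y\rangle/(xy^2+qy^2x,\ x^2y\pm qyx^2)$ for some $q\in\Bbbk^\times$, with group $\langle a,b\mid a^2,\ b^2\text{ are central}\rangle$; - $\mathcal{G}^\pm=\Bbbk\langle x,y\rangle/(x^3+xy^2+y^2x,\ x^2y\pm yx^2)$, with group $\Gamma=\langle a,b\mid a^2=b^2\rangle$; - $\mathcal{H}_q=\Bbbk\langle x,y\rangle/(xy^2+y^2x+qx^3,\ x^2y+yx^2+qy^3)$ for some $q\in\Bbbk^\times$, with group $\Gamma=\langle a,b\mid a^2=b^2\rangle$; - $\mathcal{I}_q=\Bbbk\langle x,y\rangle/(x^3+qyxy,\ y^3+qxyx)$ for some $q\in\Bbbk^\times$, with group $G_5=\langle a,b\mid a^3=bab,\ b^3=aba\rangle$.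
   Context: $\Bbbk$ is an algebraically closed field of characteristic zero. A connected $\mathbb{N}$-graded $\Bbbk$-algebra $A$ ($A_0=\Bbbk$) is AS regular of dimension $d$ if it has finite global dimension $d$, finite GK-dimension, and $\operatorname{Ext}^i_A(\Bbbk,A)$ is $0$ for $i\ne d$ and $\Bbbk(\ell)$ for $i=d$ (some $\ell\in\mathbb{Z}$), both as left and right modules. A cubic three-dimensional AS regular algebra is one of dimension $3$ generated in degree $1$ by $2$ elements with $2$ cubic relations. A grading $A=\bigoplus_{g\in G}A_g$ by a group $G$ is faithful if $\{g: A_g\neq 0\}$ generates $G$, and refines the $\mathbb{N}$-grading if $A_n=\bigoplus_g (A_n\cap A_g)$ for all $n$. *)

theory Defs
  imports "HOL-Algebra.Algebra" "HOL-Library.Extended_Real" "HOL-Library.Extended_Nat"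
    "HOL-Library.Liminf_Limsup"
begin

text \<open>
  Everything is carrier-based. The record type of \<open>HOL-Algebra.Module\<close> serves for algebras over a
  field (ring operations plus scalar multiplication) and for modules over a noncommutative ring (where
  its multiplicative fields carry no meaning). A right module over \<open>A\<close> is a left module over \<open>opp A\<close>.
\<close>

section \<open>Algebras and gradings\<close>

text \<open>The locale \<open>algebra\<close> of the library asks for commutativity.\<close>

locale assoc_algebra = module K A + ring A
  for K :: "('k, 'l) ring_scheme" and A :: "('k, 'a, 'b) module_scheme" +
  assumes smult_mult_left:
      "\<lbrakk>c \<in> carrier K; x \<in> carrier A; y \<in> carrier A\<rbrakk> \<Longrightarrow>
        (c \<odot>\<^bsub>A\<^esub> x) \<otimes>\<^bsub>A\<^esub> y = c \<odot>\<^bsub>A\<^esub> (x \<otimes>\<^bsub>A\<^esub> y)"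
    and smult_mult_right:
      "\<lbrakk>c \<in> carrier K; x \<in> carrier A; y \<in> carrier A\<rbrakk> \<Longrightarrow>
        x \<otimes>\<^bsub>A\<^esub> (c \<odot>\<^bsub>A\<^esub> y) = c \<odot>\<^bsub>A\<^esub> (x \<otimes>\<^bsub>A\<^esub> y)"

definition opp :: "('a, 'b) ring_scheme \<Rightarrow> ('a, 'b) ring_scheme" where
  "opp A = A\<lparr>mult := (\<lambda>x y. y \<otimes>\<^bsub>A\<^esub> x)\<rparr>"

definition internal_direct_sum ::
  "('a, 'b) ring_scheme \<Rightarrow> 'i set \<Rightarrow> ('i \<Rightarrow> 'a set) \<Rightarrow> 'a set \<Rightarrow> bool" where
  "internal_direct_sum M I V E \<longleftrightarrow>
     additive_subgroup E M \<and>
     (\<forall>i\<in>I. additive_subgroup (V i) M \<and> V i \<subseteq> E) \<and>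
     (\<forall>v\<in>E. \<exists>!f. f \<in> (\<Pi>\<^sub>E i\<in>I. V i) \<and> finite {i\<in>I. f i \<noteq> \<zero>\<^bsub>M\<^esub>} \<and>
        v = (\<Oplus>\<^bsub>M\<^esub>i\<in>{i\<in>I. f i \<noteq> \<zero>\<^bsub>M\<^esub>}. f i))"

text \<open>Gradings by a monoid \<open>G\<close>; the components outside \<open>carrier G\<close> are irrelevant.\<close>

definition graded_algebra ::
  "('k, 'l) ring_scheme \<Rightarrow> ('k, 'a, 'b) module_scheme \<Rightarrow> ('g, 'c) monoid_scheme \<Rightarrow> ('g \<Rightarrow> 'a set) \<Rightarrow> bool"
where
  "graded_algebra K A G V \<longleftrightarrow>
     assoc_algebra K A \<and>
     (\<forall>g\<in>carrier G. submodule (V g) K A) \<and>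
     internal_direct_sum A (carrier G) V (carrier A) \<and>
     \<one>\<^bsub>A\<^esub> \<in> V \<one>\<^bsub>G\<^esub> \<and>
     (\<forall>g\<in>carrier G. \<forall>h\<in>carrier G. \<forall>x\<in>V g. \<forall>y\<in>V h. x \<otimes>\<^bsub>A\<^esub> y \<in> V (g \<otimes>\<^bsub>G\<^esub> h))"

definition nat_add_monoid :: "nat monoid" where
  "nat_add_monoid = \<lparr>carrier = UNIV, monoid.mult = (+), one = 0\<rparr>"

definition connected_graded ::
  "('k, 'l) ring_scheme \<Rightarrow> ('k, 'a, 'b) module_scheme \<Rightarrow> (nat \<Rightarrow> 'a set) \<Rightarrow> bool" where
  "connected_graded K A \<A> \<longleftrightarrow>
     graded_algebra K A nat_add_monoid \<A> \<and>
     \<A> 0 = (\<lambda>c. c \<odot>\<^bsub>A\<^esub> \<one>\<^bsub>A\<^esub>) ` carrier K \<and> \<one>\<^bsub>A\<^esub> \<noteq> \<zero>\<^bsub>A\<^esub>"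

definition faithful_grading ::
  "('a, 'b) ring_scheme \<Rightarrow> ('g, 'c) monoid_scheme \<Rightarrow> ('g \<Rightarrow> 'a set) \<Rightarrow> bool" where
  "faithful_grading A G V \<longleftrightarrow> generate G {g \<in> carrier G. V g \<noteq> {\<zero>\<^bsub>A\<^esub>}} = carrier G"

definition refines_grading ::
  "('a, 'b) ring_scheme \<Rightarrow> (nat \<Rightarrow> 'a set) \<Rightarrow> ('g, 'c) monoid_scheme \<Rightarrow> ('g \<Rightarrow> 'a set) \<Rightarrow> bool" where
  "refines_grading A \<A> G V \<longleftrightarrow>
     (\<forall>n. internal_direct_sum A (carrier G) (\<lambda>g. \<A> n \<inter> V g) (\<A> n))"

section \<open>Gelfand--Kirillov dimension\<close>

definition lin_span :: "('k, 'l) ring_scheme \<Rightarrow> ('k, 'a, 'b) module_scheme \<Rightarrow> 'a set \<Rightarrow> 'a set" where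
  "lin_span K A S = \<Inter>{H. submodule H K A \<and> S \<subseteq> H}"

text \<open>Dimension of the \<open>K\<close>-span of \<open>S\<close>; only meaningful when it is finite.\<close>

definition span_dim :: "('k, 'l) ring_scheme \<Rightarrow> ('k, 'a, 'b) module_scheme \<Rightarrow> 'a set \<Rightarrow> nat" where
  "span_dim K A S =
     (LEAST n. \<exists>T. finite T \<and> card T = n \<and> T \<subseteq> carrier A \<and> lin_span K A T = lin_span K A S)"

definition products_upto :: "('a, 'b) ring_scheme \<Rightarrow> 'a set \<Rightarrow> nat \<Rightarrow> 'a set" where
  "products_upto A S n = {foldr (\<otimes>\<^bsub>A\<^esub>) w \<one>\<^bsub>A\<^esub> | w. set w \<subseteq> S \<and> length w \<le> n}"

definition gk_dim :: "('k, 'l) ring_scheme \<Rightarrow> ('k, 'a, 'b) module_scheme \<Rightarrow> ereal" where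
  "gk_dim K A =
     (SUP S\<in>{S. finite S \<and> S \<subseteq> carrier A}.
        limsup (\<lambda>n. ereal (log (real n) (real (span_dim K A (products_upto A S n))))))"

section \<open>Modules over noncommutative rings, projective and global dimension\<close>

text \<open>The axioms of the library locale \<open>module\<close> without commutativity of the ring.\<close>

locale left_module = R?: ring R + M?: abelian_group M
  for R :: "('a, 'b) ring_scheme" and M :: "('a, 'm, 'c) module_scheme" (structure) +
  assumes act_closed: "\<lbrakk>a \<in> carrier R; x \<in> carrier M\<rbrakk> \<Longrightarrow> a \<odot>\<^bsub>M\<^esub> x \<in> carrier M"
    and act_l_distr:
      "\<lbrakk>a \<in> carrier R; b \<in> carrier R; x \<in> carrier M\<rbrakk> \<Longrightarrow>
        (a \<oplus>\<^bsub>R\<^esub> b) \<odot>\<^bsub>M\<^esub> x = a \<odot>\<^bsub>M\<^esub> x \<oplus>\<^bsub>M\<^esub> b \<odot>\<^bsub>M\<^esub> x"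
    and act_r_distr:
      "\<lbrakk>a \<in> carrier R; x \<in> carrier M; y \<in> carrier M\<rbrakk> \<Longrightarrow>
        a \<odot>\<^bsub>M\<^esub> (x \<oplus>\<^bsub>M\<^esub> y) = a \<odot>\<^bsub>M\<^esub> x \<oplus>\<^bsub>M\<^esub> a \<odot>\<^bsub>M\<^esub> y"
    and act_assoc:
      "\<lbrakk>a \<in> carrier R; b \<in> carrier R; x \<in> carrier M\<rbrakk> \<Longrightarrow>
        (a \<otimes>\<^bsub>R\<^esub> b) \<odot>\<^bsub>M\<^esub> x = a \<odot>\<^bsub>M\<^esub> (b \<odot>\<^bsub>M\<^esub> x)"
    and act_one: "x \<in> carrier M \<Longrightarrow> \<one>\<^bsub>R\<^esub> \<odot>\<^bsub>M\<^esub> x = x"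

text \<open>Homomorphisms are extensional, so that equality of functions is equality of homomorphisms.\<close>

definition mod_hom ::
  "('a, 'b) ring_scheme \<Rightarrow> ('a, 'm, 'c) module_scheme \<Rightarrow> ('a, 'n, 'd) module_scheme \<Rightarrow> ('m \<Rightarrow> 'n) set"
where
  "mod_hom A M N =
     {f \<in> carrier M \<rightarrow>\<^sub>E carrier N.
        (\<forall>x\<in>carrier M. \<forall>y\<in>carrier M. f (x \<oplus>\<^bsub>M\<^esub> y) = f x \<oplus>\<^bsub>N\<^esub> f y) \<and>
        (\<forall>a\<in>carrier A. \<forall>x\<in>carrier M. f (a \<odot>\<^bsub>M\<^esub> x) = a \<odot>\<^bsub>N\<^esub> f x)}"

definition free_module :: "('a, 'b) ring_scheme \<Rightarrow> 'i set \<Rightarrow> ('a, 'i \<Rightarrow> 'a) module" where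
  "free_module A I =
     \<lparr>carrier = {f. (\<forall>i. f i \<in> carrier A) \<and> finite {i. f i \<noteq> \<zero>\<^bsub>A\<^esub>} \<and> {i. f i \<noteq> \<zero>\<^bsub>A\<^esub>} \<subseteq> I},
      monoid.mult = undefined, one = undefined,
      ring.zero = (\<lambda>i. \<zero>\<^bsub>A\<^esub>), add = (\<lambda>f g i. f i \<oplus>\<^bsub>A\<^esub> g i),
      smult = (\<lambda>a f i. a \<otimes>\<^bsub>A\<^esub> f i)\<rparr>"

text \<open>
  Projective means direct summand of a free module. Indexing the free module by elements of the
  type of \<open>P\<close> is no restriction: if \<open>P\<close> is projective, the free module on \<open>carrier P\<close> will do.
\<close>

definition projective_module :: "('a, 'b) ring_scheme \<Rightarrow> ('a, 'p) module \<Rightarrow> bool" where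
  "projective_module A P \<longleftrightarrow>
     left_module A P \<and>
     (\<exists>I::'p set. \<exists>s\<in>mod_hom A P (free_module A I). \<exists>r\<in>mod_hom A (free_module A I) P.
        \<forall>p\<in>carrier P. r (s p) = p)"

definition mod_kernel :: "('a, 'm, 'c) module_scheme \<Rightarrow> ('a, 'n, 'd) module_scheme \<Rightarrow> ('m \<Rightarrow> 'n) \<Rightarrow> 'm set"
  where "mod_kernel M N f = {x \<in> carrier M. f x = \<zero>\<^bsub>N\<^esub>}"

text \<open>The exact complex \<open>\<dots> \<rightarrow> P 2 \<rightarrow> P 1 \<rightarrow> P 0 \<rightarrow> M \<rightarrow> 0\<close> with maps \<open>\<delta> i : P (i + 1) \<rightarrow> P i\<close> and \<open>\<epsilon>\<close>.\<close>

definition projective_resolution ::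
  "('a, 'b) ring_scheme \<Rightarrow> ('a, 'm, 'c) module_scheme \<Rightarrow> (nat \<Rightarrow> ('a, 'p) module) \<Rightarrow>
     ('p \<Rightarrow> 'm) \<Rightarrow> (nat \<Rightarrow> 'p \<Rightarrow> 'p) \<Rightarrow> bool" where
  "projective_resolution A M P \<epsilon> \<delta> \<longleftrightarrow>
     (\<forall>i. projective_module A (P i)) \<and>
     \<epsilon> \<in> mod_hom A (P 0) M \<and> \<epsilon> ` carrier (P 0) = carrier M \<and>
     (\<forall>i. \<delta> i \<in> mod_hom A (P (Suc i)) (P i)) \<and>
     \<delta> 0 ` carrier (P 1) = mod_kernel (P 0) M \<epsilon> \<and>
     (\<forall>i. \<delta> (Suc i) ` carrier (P (Suc (Suc i))) = mod_kernel (P (Suc i)) (P i) (\<delta> i))"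

text \<open>
  For an infinite ring, the type \<open>'m \<Rightarrow> 'a\<close> has room for the terms of a shortest projective resolution
  of any module with elements in \<open>'m\<close>, since a module has a resolution by free modules whose
  cardinality does not exceed that of the module and the ring.
\<close>

definition proj_dim :: "('a, 'b) ring_scheme \<Rightarrow> ('a, 'm, 'c) module_scheme \<Rightarrow> enat" where
  "proj_dim A M =
     Inf {enat n | n. \<exists>(P :: nat \<Rightarrow> ('a, 'm \<Rightarrow> 'a) module) \<epsilon> \<delta>.
            projective_resolution A M P \<epsilon> \<delta> \<and> (\<forall>i>n. carrier (P i) = {\<zero>\<^bsub>P i\<^esub>})}"

text \<open>
  A formula cannot quantify over types. The supremum runs over all modules with elements in
  \<open>'a set\<close>. These include the cyclic modules \<open>A/J\<close> for left ideals \<open>J\<close> (consisting of cosets), which by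
  Auslander's theorem already determine the global dimension.
\<close>

definition left_gl_dim :: "('a, 'b) ring_scheme \<Rightarrow> enat" where
  "left_gl_dim A = (SUP M\<in>{M :: ('a, 'a set) module. left_module A M}. proj_dim A M)"

section \<open>Graded Ext\<close>

definition graded_module ::
  "('a, 'b) ring_scheme \<Rightarrow> (nat \<Rightarrow> 'a set) \<Rightarrow> ('a, 'm, 'c) module_scheme \<Rightarrow> (int \<Rightarrow> 'm set) \<Rightarrow> bool" where
  "graded_module A \<A> M \<M> \<longleftrightarrow>
     left_module A M \<and> internal_direct_sum M UNIV \<M> (carrier M) \<and>
     (\<forall>n j. \<forall>a\<in>\<A> n. \<forall>x\<in>\<M> j. a \<odot>\<^bsub>M\<^esub> x \<in> \<M> (int n + j))"

definition graded_projective_resolution ::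
  "('a, 'b) ring_scheme \<Rightarrow> (nat \<Rightarrow> 'a set) \<Rightarrow> ('a, 'm, 'c) module_scheme \<Rightarrow> (int \<Rightarrow> 'm set) \<Rightarrow>
     (nat \<Rightarrow> ('a, 'p) module) \<Rightarrow> (nat \<Rightarrow> int \<Rightarrow> 'p set) \<Rightarrow>
     ('p \<Rightarrow> 'm) \<Rightarrow> (nat \<Rightarrow> 'p \<Rightarrow> 'p) \<Rightarrow> bool" where
  "graded_projective_resolution A \<A> M \<M> P \<P> \<epsilon> \<delta> \<longleftrightarrow>
     projective_resolution A M P \<epsilon> \<delta> \<and>
     (\<forall>i. graded_module A \<A> (P i) (\<P> i)) \<and>
     (\<forall>j. \<epsilon> ` \<P> 0 j \<subseteq> \<M> j) \<and>
     (\<forall>i j. \<delta> i ` \<P> (Suc i) j \<subseteq> \<P> i j)"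

definition regular_module :: "('a, 'b) ring_scheme \<Rightarrow> ('a, 'a) module" where
  "regular_module A =
     \<lparr>carrier = carrier A, monoid.mult = monoid.mult A, one = \<one>\<^bsub>A\<^esub>, ring.zero = \<zero>\<^bsub>A\<^esub>,
      add = add A, smult = monoid.mult A\<rparr>"

definition regular_grading :: "('a, 'b) ring_scheme \<Rightarrow> (nat \<Rightarrow> 'a set) \<Rightarrow> int \<Rightarrow> 'a set" where
  "regular_grading A \<A> j = (if j < 0 then {\<zero>\<^bsub>A\<^esub>} else \<A> (nat j))"

definition homs_of_degree ::
  "('a, 'b) ring_scheme \<Rightarrow> (nat \<Rightarrow> 'a set) \<Rightarrow> ('a, 'p) module \<Rightarrow> (int \<Rightarrow> 'p set) \<Rightarrow> int \<Rightarrow> ('p \<Rightarrow> 'a) set"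
where
  "homs_of_degree A \<A> P \<P> e =
     {f \<in> mod_hom A P (regular_module A). \<forall>j. f ` \<P> j \<subseteq> regular_grading A \<A> (j + e)}"

text \<open>
  The graded Hom of \<open>P\<close> and \<open>A\<close>, the sum of the spaces of homomorphisms of degree \<open>e\<close> for all
  integers \<open>e\<close>, as a right \<open>A\<close>-module, that is, a left module over \<open>opp A\<close>, via \<open>(f a) p = (f p) a\<close>.
\<close>

definition graded_Hom ::
  "('a, 'b) ring_scheme \<Rightarrow> (nat \<Rightarrow> 'a set) \<Rightarrow> ('a, 'p) module \<Rightarrow> (int \<Rightarrow> 'p set) \<Rightarrow> ('a, 'p \<Rightarrow> 'a) module"
where
  "graded_Hom A \<A> P \<P> =
     \<lparr>carrier = {\<lambda>p\<in>carrier P. \<Oplus>\<^bsub>A\<^esub>e\<in>E. \<phi> e p | E \<phi>.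
                   finite E \<and> (\<forall>e\<in>E. \<phi> e \<in> homs_of_degree A \<A> P \<P> e)},
      monoid.mult = undefined, one = undefined,
      ring.zero = (\<lambda>p\<in>carrier P. \<zero>\<^bsub>A\<^esub>),
      add = (\<lambda>f g. \<lambda>p\<in>carrier P. f p \<oplus>\<^bsub>A\<^esub> g p),
      smult = (\<lambda>a f. \<lambda>p\<in>carrier P. f p \<otimes>\<^bsub>A\<^esub> a)\<rparr>"

text \<open>The quotient \<open>Z/B\<close> of submodules \<open>B \<subseteq> Z\<close> of \<open>M\<close>.\<close>

definition subquotient :: "('a, 'm, 'c) module_scheme \<Rightarrow> 'm set \<Rightarrow> 'm set \<Rightarrow> ('a, 'm set) module" where
  "subquotient M Z B =
     \<lparr>carrier = (\<lambda>z. B +>\<^bsub>M\<^esub> z) ` Z, monoid.mult = undefined, one = undefined,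
      ring.zero = B, add = set_add M, smult = (\<lambda>a C. \<Union>z\<in>C. B +>\<^bsub>M\<^esub> (a \<odot>\<^bsub>M\<^esub> z))\<rparr>"

definition Ext_cocycles ::
  "('a, 'b) ring_scheme \<Rightarrow> (nat \<Rightarrow> 'a set) \<Rightarrow> (nat \<Rightarrow> ('a, 'p) module) \<Rightarrow> (nat \<Rightarrow> int \<Rightarrow> 'p set) \<Rightarrow>
     (nat \<Rightarrow> 'p \<Rightarrow> 'p) \<Rightarrow> nat \<Rightarrow> ('p \<Rightarrow> 'a) set" where
  "Ext_cocycles A \<A> P \<P> \<delta> i =
     {f \<in> carrier (graded_Hom A \<A> (P i) (\<P> i)). \<forall>p\<in>carrier (P (Suc i)). f (\<delta> i p) = \<zero>\<^bsub>A\<^esub>}"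

definition Ext_coboundaries ::
  "('a, 'b) ring_scheme \<Rightarrow> (nat \<Rightarrow> 'a set) \<Rightarrow> (nat \<Rightarrow> ('a, 'p) module) \<Rightarrow> (nat \<Rightarrow> int \<Rightarrow> 'p set) \<Rightarrow>
     (nat \<Rightarrow> 'p \<Rightarrow> 'p) \<Rightarrow> nat \<Rightarrow> ('p \<Rightarrow> 'a) set" where
  "Ext_coboundaries A \<A> P \<P> \<delta> i =
     (case i of
        0 \<Rightarrow> {\<zero>\<^bsub>graded_Hom A \<A> (P 0) (\<P> 0)\<^esub>}
      | Suc i' \<Rightarrow> (\<lambda>g. \<lambda>p\<in>carrier (P i). g (\<delta> i' p)) ` carrier (graded_Hom A \<A> (P i') (\<P> i')))"

text \<open>
  \<open>Ext\<^sup>i(M, A)\<close> as a graded right \<open>A\<close>-module, computed from the graded projective resolution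
  \<open>(P, \<delta>)\<close> of \<open>M\<close>. Another resolution gives an isomorphic graded module.
\<close>

definition Ext_module ::
  "('a, 'b) ring_scheme \<Rightarrow> (nat \<Rightarrow> 'a set) \<Rightarrow> (nat \<Rightarrow> ('a, 'p) module) \<Rightarrow> (nat \<Rightarrow> int \<Rightarrow> 'p set) \<Rightarrow>
     (nat \<Rightarrow> 'p \<Rightarrow> 'p) \<Rightarrow> nat \<Rightarrow> ('a, ('p \<Rightarrow> 'a) set) module" where
  "Ext_module A \<A> P \<P> \<delta> i =
     subquotient (graded_Hom A \<A> (P i) (\<P> i)) (Ext_cocycles A \<A> P \<P> \<delta> i) (Ext_coboundaries A \<A> P \<P> \<delta> i)"

definition Ext_grading ::
  "('a, 'b) ring_scheme \<Rightarrow> (nat \<Rightarrow> 'a set) \<Rightarrow> (nat \<Rightarrow> ('a, 'p) module) \<Rightarrow> (nat \<Rightarrow> int \<Rightarrow> 'p set) \<Rightarrow>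
     (nat \<Rightarrow> 'p \<Rightarrow> 'p) \<Rightarrow> nat \<Rightarrow> int \<Rightarrow> ('p \<Rightarrow> 'a) set set" where
  "Ext_grading A \<A> P \<P> \<delta> i e =
     (\<lambda>z. Ext_coboundaries A \<A> P \<P> \<delta> i +>\<^bsub>graded_Hom A \<A> (P i) (\<P> i)\<^esub> z) `
       (Ext_cocycles A \<A> P \<P> \<delta> i \<inter> homs_of_degree A \<A> (P i) (\<P> i) e)"

section \<open>AS regular algebras\<close>

text \<open>The degree zero component of \<open>a\<close>, as an element of the field.\<close>

definition augmentation ::
  "('k, 'l) ring_scheme \<Rightarrow> ('k, 'a, 'b) module_scheme \<Rightarrow> (nat \<Rightarrow> 'a set) \<Rightarrow> 'a \<Rightarrow> 'k" where
  "augmentation K A \<A> a =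
     (THE c. c \<in> carrier K \<and> a \<ominus>\<^bsub>A\<^esub> (c \<odot>\<^bsub>A\<^esub> \<one>\<^bsub>A\<^esub>) \<in> lin_span K A (\<Union>n\<in>{0<..}. \<A> n))"

text \<open>
  The field as an \<open>A\<close>-module. It is also its own right-hand version, since the augmentation
  of \<open>opp A\<close> is that of \<open>A\<close>.
\<close>

definition trivial_module ::
  "('k, 'l) ring_scheme \<Rightarrow> ('k, 'a, 'b) module_scheme \<Rightarrow> (nat \<Rightarrow> 'a set) \<Rightarrow> ('a, 'k) module" where
  "trivial_module K A \<A> =
     \<lparr>carrier = carrier K, monoid.mult = monoid.mult K, one = \<one>\<^bsub>K\<^esub>, ring.zero = \<zero>\<^bsub>K\<^esub>, add = add K,
      smult = (\<lambda>a c. augmentation K A \<A> a \<otimes>\<^bsub>K\<^esub> c)\<rparr>"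

definition trivial_grading :: "('k, 'l) ring_scheme \<Rightarrow> int \<Rightarrow> 'k set" where
  "trivial_grading K j = (if j = 0 then carrier K else {\<zero>\<^bsub>K\<^esub>})"

text \<open>\<open>M(l)\<close>, with \<open>M(l)\<^sub>j = M\<^sub>l\<^sub>+\<^sub>j\<close>.\<close>

definition shift_grading :: "int \<Rightarrow> (int \<Rightarrow> 'm set) \<Rightarrow> int \<Rightarrow> 'm set" where
  "shift_grading l \<M> j = \<M> (l + j)"

definition graded_module_iso ::
  "('a, 'b) ring_scheme \<Rightarrow> ('a, 'm, 'c) module_scheme \<Rightarrow> (int \<Rightarrow> 'm set) \<Rightarrow>
     ('a, 'n, 'd) module_scheme \<Rightarrow> (int \<Rightarrow> 'n set) \<Rightarrow> bool" where
  "graded_module_iso A M \<M> N \<N> \<longleftrightarrow>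
     (\<exists>f\<in>mod_hom A M N. bij_betw f (carrier M) (carrier N) \<and> (\<forall>j. f ` \<M> j = \<N> j))"

text \<open>
  The condition on \<open>Ext\<^sup>i(K, A)\<close> for left modules. The trivial module has a resolution by
  graded free modules on subsets of \<open>A\<close>, whose elements have type \<open>'a \<Rightarrow> 'a\<close>.
\<close>

definition left_AS_Gorenstein ::
  "('k, 'l) ring_scheme \<Rightarrow> ('k, 'a, 'b) module_scheme \<Rightarrow> (nat \<Rightarrow> 'a set) \<Rightarrow> nat \<Rightarrow> bool" where
  "left_AS_Gorenstein K A \<A> d \<longleftrightarrow>
     (\<exists>(P :: nat \<Rightarrow> ('a, 'a \<Rightarrow> 'a) module) \<P> \<epsilon> \<delta>.
        graded_projective_resolution A \<A> (trivial_module K A \<A>) (trivial_grading K) P \<P> \<epsilon> \<delta> \<and>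
        (\<forall>i. i \<noteq> d \<longrightarrow>
           carrier (Ext_module A \<A> P \<P> \<delta> i) = {\<zero>\<^bsub>Ext_module A \<A> P \<P> \<delta> i\<^esub>}) \<and>
        (\<exists>l. graded_module_iso (opp A)
           (Ext_module A \<A> P \<P> \<delta> d) (Ext_grading A \<A> P \<P> \<delta> d)
           (trivial_module K A \<A>) (shift_grading l (trivial_grading K))))"

definition AS_regular ::
  "('k, 'l) ring_scheme \<Rightarrow> ('k, 'a, 'b) module_scheme \<Rightarrow> (nat \<Rightarrow> 'a set) \<Rightarrow> nat \<Rightarrow> bool" where
  "AS_regular K A \<A> d \<longleftrightarrow>
     connected_graded K A \<A> \<and>
     left_gl_dim A = enat d \<and> left_gl_dim (opp A) = enat d \<and>
     gk_dim K A < \<infinity> \<and>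
     left_AS_Gorenstein K A \<A> d \<and> left_AS_Gorenstein K (opp A) \<A> d"

section \<open>Free algebras and presentations\<close>

text \<open>Elements of the free algebra are the finitely supported functions from words to \<open>K\<close>.\<close>

definition free_algebra :: "('k, 'l) ring_scheme \<Rightarrow> ('k, 'v list \<Rightarrow> 'k) module" where
  "free_algebra K =
     \<lparr>carrier = {f. (\<forall>w. f w \<in> carrier K) \<and> finite {w. f w \<noteq> \<zero>\<^bsub>K\<^esub>}},
      monoid.mult = (\<lambda>f g w. \<Oplus>\<^bsub>K\<^esub>i\<in>{..length w}. f (take i w) \<otimes>\<^bsub>K\<^esub> g (drop i w)),
      one = (\<lambda>w. if w = [] then \<one>\<^bsub>K\<^esub> else \<zero>\<^bsub>K\<^esub>),
      ring.zero = (\<lambda>w. \<zero>\<^bsub>K\<^esub>),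
      add = (\<lambda>f g w. f w \<oplus>\<^bsub>K\<^esub> g w),
      smult = (\<lambda>c f w. c \<otimes>\<^bsub>K\<^esub> f w)\<rparr>"

definition monomial :: "('k, 'l) ring_scheme \<Rightarrow> 'v list \<Rightarrow> 'v list \<Rightarrow> 'k" where
  "monomial K u = (\<lambda>w. if w = u then \<one>\<^bsub>K\<^esub> else \<zero>\<^bsub>K\<^esub>)"

definition free_homogeneous :: "('k, 'l) ring_scheme \<Rightarrow> nat \<Rightarrow> ('v list \<Rightarrow> 'k) set" where
  "free_homogeneous K n = {f \<in> carrier (free_algebra K). \<forall>w. f w \<noteq> \<zero>\<^bsub>K\<^esub> \<longrightarrow> length w = n}"

definition presented_algebra ::
  "('k, 'l) ring_scheme \<Rightarrow> ('v list \<Rightarrow> 'k) set \<Rightarrow> ('k, ('v list \<Rightarrow> 'k) set) module" where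
  "presented_algebra K R =
     (let F = free_algebra K; J = Idl\<^bsub>F\<^esub> R; Q = F Quot J in
      \<lparr>carrier = carrier Q, monoid.mult = monoid.mult Q, one = \<one>\<^bsub>Q\<^esub>, ring.zero = \<zero>\<^bsub>Q\<^esub>, add = add Q,
       smult = (\<lambda>c C. \<Union>f\<in>C. J +>\<^bsub>F\<^esub> (c \<odot>\<^bsub>F\<^esub> f))\<rparr>)"

definition presented_grading ::
  "('k, 'l) ring_scheme \<Rightarrow> ('v list \<Rightarrow> 'k) set \<Rightarrow> nat \<Rightarrow> ('v list \<Rightarrow> 'k) set set" where
  "presented_grading K R n =
     (\<lambda>f. Idl\<^bsub>free_algebra K\<^esub> R +>\<^bsub>free_algebra K\<^esub> f) ` free_homogeneous K n"

definition algebra_gen :: "('k, 'l) ring_scheme \<Rightarrow> ('v list \<Rightarrow> 'k) set \<Rightarrow> 'v \<Rightarrow> ('v list \<Rightarrow> 'k) set" where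
  "algebra_gen K R v = Idl\<^bsub>free_algebra K\<^esub> R +>\<^bsub>free_algebra K\<^esub> monomial K [v]"

definition graded_algebra_iso ::
  "('k, 'l) ring_scheme \<Rightarrow> ('k, 'a, 'b) module_scheme \<Rightarrow> (nat \<Rightarrow> 'a set) \<Rightarrow>
     ('k, 'c, 'd) module_scheme \<Rightarrow> (nat \<Rightarrow> 'c set) \<Rightarrow> ('a \<Rightarrow> 'c) set" where
  "graded_algebra_iso K A \<A> B \<B> =
     {f \<in> ring_iso A B.
        (\<forall>c\<in>carrier K. \<forall>x\<in>carrier A. f (c \<odot>\<^bsub>A\<^esub> x) = c \<odot>\<^bsub>B\<^esub> f x) \<and> (\<forall>n. f ` \<A> n = \<B> n)}"

datatype var = Vx | Vy

definition cubic_AS_regular ::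
  "('k, 'l) ring_scheme \<Rightarrow> ('k, 'a, 'b) module_scheme \<Rightarrow> (nat \<Rightarrow> 'a set) \<Rightarrow> bool" where
  "cubic_AS_regular K A \<A> \<longleftrightarrow>
     AS_regular K A \<A> 3 \<and>
     (\<exists>r1\<in>free_homogeneous K 3. \<exists>r2\<in>free_homogeneous K 3.
        (\<forall>c1\<in>carrier K. \<forall>c2\<in>carrier K.
           c1 \<odot>\<^bsub>free_algebra K\<^esub> r1 \<oplus>\<^bsub>free_algebra K\<^esub> c2 \<odot>\<^bsub>free_algebra K\<^esub> r2 = \<zero>\<^bsub>free_algebra K\<^esub> \<longrightarrow>
             c1 = \<zero>\<^bsub>K\<^esub> \<and> c2 = \<zero>\<^bsub>K\<^esub>) \<and>
        graded_algebra_iso K A \<A>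
          (presented_algebra K {r1, r2 :: var list \<Rightarrow> 'k}) (presented_grading K {r1, r2}) \<noteq> {})"

text \<open>
  Group presentations. A letter \<open>(v, True)\<close> is the generator \<open>v\<close> and \<open>(v, False)\<close> its inverse;
  the relations are equations between words.
\<close>

type_synonym 'v group_word = "('v \<times> bool) list"

inductive pres_eq :: "('v group_word \<times> 'v group_word) set \<Rightarrow> 'v group_word \<Rightarrow> 'v group_word \<Rightarrow> bool"
  for R where
    rel: "(u, v) \<in> R \<Longrightarrow> pres_eq R u v"
  | cancel: "pres_eq R [(v, b), (v, \<not> b)] []"
  | refl: "pres_eq R u u"
  | sym: "pres_eq R u v \<Longrightarrow> pres_eq R v u"
  | trans: "pres_eq R u v \<Longrightarrow> pres_eq R v w \<Longrightarrow> pres_eq R u w"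
  | congr: "pres_eq R u v \<Longrightarrow> pres_eq R (p @ u @ s) (p @ v @ s)"

definition presented_group ::
  "('v group_word \<times> 'v group_word) set \<Rightarrow> 'v group_word set monoid" where
  "presented_group R =
     \<lparr>carrier = range (\<lambda>u. Collect (pres_eq R u)),
      monoid.mult = (\<lambda>C D. \<Union>u\<in>C. \<Union>v\<in>D. Collect (pres_eq R (u @ v))),
      one = Collect (pres_eq R [])\<rparr>"

definition group_gen :: "('v group_word \<times> 'v group_word) set \<Rightarrow> 'v \<Rightarrow> 'v group_word set" where
  "group_gen R v = Collect (pres_eq R [(v, True)])"

section \<open>The four families\<close>

abbreviation (input) a_letter :: "var \<times> bool" where "a_letter \<equiv> (Vx, True)"
abbreviation (input) b_letter :: "var \<times> bool" where "b_letter \<equiv> (Vy, True)"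

definition central_squares_rels :: "(var group_word \<times> var group_word) set" where
  "central_squares_rels =
     {([a_letter, a_letter, b_letter], [b_letter, a_letter, a_letter]),
      ([b_letter, b_letter, a_letter], [a_letter, b_letter, b_letter])}"

definition Gamma_rels :: "(var group_word \<times> var group_word) set" where
  "Gamma_rels = {([a_letter, a_letter], [b_letter, b_letter])}"

definition G5_rels :: "(var group_word \<times> var group_word) set" where
  "G5_rels =
     {([a_letter, a_letter, a_letter], [b_letter, a_letter, b_letter]),
      ([b_letter, b_letter, b_letter], [a_letter, b_letter, a_letter])}"

text \<open>In the first two families \<open>s\<close> is the sign, \<open>1\<close> or \<open>-1\<close> in \<open>K\<close>.\<close>

definition F_rels :: "('k, 'l) ring_scheme \<Rightarrow> 'k \<Rightarrow> 'k \<Rightarrow> (var list \<Rightarrow> 'k) set" where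
  "F_rels K s q = (let F = free_algebra K in
     {monomial K [Vx, Vy, Vy] \<oplus>\<^bsub>F\<^esub> q \<odot>\<^bsub>F\<^esub> monomial K [Vy, Vy, Vx],
      monomial K [Vx, Vx, Vy] \<oplus>\<^bsub>F\<^esub> s \<odot>\<^bsub>F\<^esub> (q \<odot>\<^bsub>F\<^esub> monomial K [Vy, Vx, Vx])})"

definition G_rels :: "('k, 'l) ring_scheme \<Rightarrow> 'k \<Rightarrow> (var list \<Rightarrow> 'k) set" where
  "G_rels K s = (let F = free_algebra K in
     {monomial K [Vx, Vx, Vx] \<oplus>\<^bsub>F\<^esub> monomial K [Vx, Vy, Vy] \<oplus>\<^bsub>F\<^esub> monomial K [Vy, Vy, Vx],
      monomial K [Vx, Vx, Vy] \<oplus>\<^bsub>F\<^esub> s \<odot>\<^bsub>F\<^esub> monomial K [Vy, Vx, Vx]})"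

definition H_rels :: "('k, 'l) ring_scheme \<Rightarrow> 'k \<Rightarrow> (var list \<Rightarrow> 'k) set" where
  "H_rels K q = (let F = free_algebra K in
     {monomial K [Vx, Vy, Vy] \<oplus>\<^bsub>F\<^esub> monomial K [Vy, Vy, Vx] \<oplus>\<^bsub>F\<^esub> q \<odot>\<^bsub>F\<^esub> monomial K [Vx, Vx, Vx],
      monomial K [Vx, Vx, Vy] \<oplus>\<^bsub>F\<^esub> monomial K [Vy, Vx, Vx] \<oplus>\<^bsub>F\<^esub> q \<odot>\<^bsub>F\<^esub> monomial K [Vy, Vy, Vy]})"

definition I_rels :: "('k, 'l) ring_scheme \<Rightarrow> 'k \<Rightarrow> (var list \<Rightarrow> 'k) set" where
  "I_rels K q = (let F = free_algebra K in
     {monomial K [Vx, Vx, Vx] \<oplus>\<^bsub>F\<^esub> q \<odot>\<^bsub>F\<^esub> monomial K [Vy, Vx, Vy],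
      monomial K [Vy, Vy, Vy] \<oplus>\<^bsub>F\<^esub> q \<odot>\<^bsub>F\<^esub> monomial K [Vx, Vy, Vx]})"

text \<open>
  The algebra \<open>A\<close> is isomorphic, as a graded algebra, to the algebra with relations \<open>R\<close> in such a
  way that the elements corresponding to the generators are \<open>G\<close>-homogeneous, of degrees the images of \<open>a\<close>
  and \<open>b\<close> under a surjection onto \<open>G\<close> from the group with relations \<open>S\<close>.
\<close>

definition graded_iso_to ::
  "('k, 'l) ring_scheme \<Rightarrow> ('k, 'a, 'b) module_scheme \<Rightarrow> (nat \<Rightarrow> 'a set) \<Rightarrow>
     ('g, 'c) monoid_scheme \<Rightarrow> ('g \<Rightarrow> 'a set) \<Rightarrow>
     (var list \<Rightarrow> 'k) set \<Rightarrow> (var group_word \<times> var group_word) set \<Rightarrow> bool" where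
  "graded_iso_to K A \<A> G V R S \<longleftrightarrow>
     (\<exists>f\<in>graded_algebra_iso K A \<A> (presented_algebra K R) (presented_grading K R).
      \<exists>p\<in>epi (presented_group S) G.
      \<exists>x\<in>V (p (group_gen S Vx)). \<exists>y\<in>V (p (group_gen S Vy)).
        f x = algebra_gen K R Vx \<and> f y = algebra_gen K R Vy)"

end

theory Submission
  imports Defs
begin

text \<open>
  The relations give an exact sequence \<open>A\<^sup>2 \<rightarrow> A\<^sup>2 \<rightarrow> A \<rightarrow> K \<rightarrow> 0\<close>. Comparing it with the resolutions provided by the
  hypotheses on the global dimension and on \<open>Ext\<close> shows that the kernel on the left is free on one
  generator, whose two coordinates form a basis of \<open>A\<^sub>1\<close>. Hence \<open>A\<close> is the derivation-quotient algebra of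
  a potential \<open>w\<close> of degree four, unique up to a scalar, for any choice of generators. For
  \<open>G\<close>-homogeneous generators \<open>x\<close> and \<open>y\<close>, uniqueness makes \<open>w\<close> homogeneous, and since the degrees of \<open>x\<close> and
  \<open>y\<close> do not commute, a cyclic rotation of \<open>w\<close> only multiplies its coefficients by nonzero scalars.
  The words of a common degree that noncommutativity allows are the rotations of either \<open>xxyy\<close> or \<open>xyxy\<close>,
  together with \<open>xxxx\<close> and \<open>yyyy\<close>; rescaling and possibly swapping the generators gives the four families.
\<close>

section \<open>Modules and free modules\<close>

text \<open>The hypotheses speak of two different resolutions: a short one without grading, for a
  copy of the trivial module, and a graded one of unknown length that computes \<open>Ext\<close>.
  Neither is known to be free, finitely generated or minimal, so ranks cannot be read off. Instead
  each is compared with the explicit maps \<open>d1\<close> and \<open>d2\<close> by chain maps in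
  both directions. The round trip on \<open>A\<^sup>2\<close> is the identity up to a homotopy and a
  map into the kernel \<open>K3\<close>. Since the explicit maps have coefficients of positive
  degree, these error terms are invisible to the augmentation, and this takes the place of an
  argument with minimal resolutions. Shortness makes \<open>K3\<close> detectable by linear forms,
  \<open>Ext\<^sup>2 = 0\<close> makes it nonzero, and the dimension of \<open>Ext\<^sup>3\<close>
  leaves room for one generator. Its degree comes from multiplying the coordinate form of the
  generator by elements of \<open>A\<^sub>1\<close>: the product extends to
  \<open>A\<^sup>2\<close>, which puts \<open>A\<^sub>1\<close> into the right ideal of the two
  coordinates. These therefore have degree one, and the potential has degree 1 + 3.\<close>

lemma left_moduleI:
  fixes R (structure) and M (structure)
  assumes "ring R" "abelian_group M"
    and "\<And>a x. \<lbrakk>a \<in> carrier R; x \<in> carrier M\<rbrakk> \<Longrightarrow> a \<odot>\<^bsub>M\<^esub> x \<in> carrier M"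
    and "\<And>a b x. \<lbrakk>a \<in> carrier R; b \<in> carrier R; x \<in> carrier M\<rbrakk> \<Longrightarrow>
        (a \<oplus>\<^bsub>R\<^esub> b) \<odot>\<^bsub>M\<^esub> x = a \<odot>\<^bsub>M\<^esub> x \<oplus>\<^bsub>M\<^esub> b \<odot>\<^bsub>M\<^esub> x"
    and "\<And>a x y. \<lbrakk>a \<in> carrier R; x \<in> carrier M; y \<in> carrier M\<rbrakk> \<Longrightarrow>
        a \<odot>\<^bsub>M\<^esub> (x \<oplus>\<^bsub>M\<^esub> y) = a \<odot>\<^bsub>M\<^esub> x \<oplus>\<^bsub>M\<^esub> a \<odot>\<^bsub>M\<^esub> y"
    and "\<And>a b x. \<lbrakk>a \<in> carrier R; b \<in> carrier R; x \<in> carrier M\<rbrakk> \<Longrightarrow>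
        (a \<otimes>\<^bsub>R\<^esub> b) \<odot>\<^bsub>M\<^esub> x = a \<odot>\<^bsub>M\<^esub> (b \<odot>\<^bsub>M\<^esub> x)"
    and "\<And>x. x \<in> carrier M \<Longrightarrow> \<one>\<^bsub>R\<^esub> \<odot>\<^bsub>M\<^esub> x = x"
  shows "left_module R M"
  using assms by (auto intro!: left_module.intro left_module_axioms.intro simp: abelian_group_def)

context left_module begin

lemma act_l_null [simp]: "x \<in> carrier M \<Longrightarrow> \<zero>\<^bsub>R\<^esub> \<odot>\<^bsub>M\<^esub> x = \<zero>\<^bsub>M\<^esub>"
  using act_l_distr[of "\<zero>\<^bsub>R\<^esub>" "\<zero>\<^bsub>R\<^esub>" x] act_closed[of "\<zero>\<^bsub>R\<^esub>" x]
  by (metis M.add.r_cancel_one R.l_zero R.zero_closed)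

lemma act_r_null [simp]: "a \<in> carrier R \<Longrightarrow> a \<odot>\<^bsub>M\<^esub> \<zero>\<^bsub>M\<^esub> = \<zero>\<^bsub>M\<^esub>"
  using act_r_distr[of a "\<zero>\<^bsub>M\<^esub>" "\<zero>\<^bsub>M\<^esub>"] act_closed[of a "\<zero>\<^bsub>M\<^esub>"]
  by (metis M.add.r_cancel_one M.l_zero M.zero_closed)

lemma act_r_minus: "\<lbrakk>a \<in> carrier R; x \<in> carrier M\<rbrakk> \<Longrightarrow> a \<odot>\<^bsub>M\<^esub> (\<ominus>\<^bsub>M\<^esub> x) = \<ominus>\<^bsub>M\<^esub> (a \<odot>\<^bsub>M\<^esub> x)"
  using act_r_distr[of a x "\<ominus>\<^bsub>M\<^esub> x"] act_closed[of a x] act_closed[of a "\<ominus>\<^bsub>M\<^esub> x"]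
  by (metis M.add.inv_closed M.add.inv_equality M.add.m_comm M.r_neg act_r_null)

lemma act_l_minus: "\<lbrakk>a \<in> carrier R; x \<in> carrier M\<rbrakk> \<Longrightarrow> (\<ominus>\<^bsub>R\<^esub> a) \<odot>\<^bsub>M\<^esub> x = \<ominus>\<^bsub>M\<^esub> (a \<odot>\<^bsub>M\<^esub> x)"
  using act_l_distr[of a "\<ominus>\<^bsub>R\<^esub> a" x] act_closed[of a x] act_closed[of "\<ominus>\<^bsub>R\<^esub> a" x]
  by (metis M.add.inv_equality M.add.m_comm R.add.inv_closed R.r_neg act_l_null)

lemma act_finsum:
  assumes "finite S" "a \<in> carrier R" "f \<in> S \<rightarrow> carrier M"
  shows "a \<odot>\<^bsub>M\<^esub> (\<Oplus>\<^bsub>M\<^esub>i\<in>S. f i) = (\<Oplus>\<^bsub>M\<^esub>i\<in>S. a \<odot>\<^bsub>M\<^esub> f i)"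
  using assms
proof (induction S rule: finite_induct)
  case empty then show ?case by simp
next
  case (insert i S)
  then have "f \<in> S \<rightarrow> carrier M" "f i \<in> carrier M" by auto
  with insert show ?case
    by (simp add: act_r_distr Pi_def act_closed M.finsum_closed)
qed

end

text \<open>Members of \<open>mod_hom\<close> are extensional. Without that condition composites,
  pointwise sums and explicit formulas are linear maps as they stand; \<open>mod_hom_lhom\<close>
  admits the given homomorphisms.\<close>

definition lhom where
  "lhom R M N f \<longleftrightarrow> f \<in> carrier M \<rightarrow> carrier N \<and>
     (\<forall>x\<in>carrier M. \<forall>y\<in>carrier M. f (x \<oplus>\<^bsub>M\<^esub> y) = f x \<oplus>\<^bsub>N\<^esub> f y) \<and>
     (\<forall>a\<in>carrier R. \<forall>x\<in>carrier M. f (a \<odot>\<^bsub>M\<^esub> x) = a \<odot>\<^bsub>N\<^esub> f x)"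

lemma lhomI:
  assumes "\<And>x. x \<in> carrier M \<Longrightarrow> f x \<in> carrier N"
    "\<And>x y. \<lbrakk>x \<in> carrier M; y \<in> carrier M\<rbrakk> \<Longrightarrow> f (x \<oplus>\<^bsub>M\<^esub> y) = f x \<oplus>\<^bsub>N\<^esub> f y"
    "\<And>a x. \<lbrakk>a \<in> carrier R; x \<in> carrier M\<rbrakk> \<Longrightarrow> f (a \<odot>\<^bsub>M\<^esub> x) = a \<odot>\<^bsub>N\<^esub> f x"
  shows "lhom R M N f"
  using assms by (auto simp: lhom_def)

lemma lhom_closed: "lhom R M N f \<Longrightarrow> x \<in> carrier M \<Longrightarrow> f x \<in> carrier N"
  and lhom_add: "lhom R M N f \<Longrightarrow> x \<in> carrier M \<Longrightarrow> y \<in> carrier M \<Longrightarrow> f (x \<oplus>\<^bsub>M\<^esub> y) = f x \<oplus>\<^bsub>N\<^esub> f y"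
  and lhom_smult: "lhom R M N f \<Longrightarrow> a \<in> carrier R \<Longrightarrow> x \<in> carrier M \<Longrightarrow> f (a \<odot>\<^bsub>M\<^esub> x) = a \<odot>\<^bsub>N\<^esub> f x"
  by (auto simp: lhom_def)

lemma mod_hom_lhom: "f \<in> mod_hom R M N \<Longrightarrow> lhom R M N f"
  by (auto simp: mod_hom_def lhom_def)

lemma lhom_compose: "lhom R M N f \<Longrightarrow> lhom R N L g \<Longrightarrow> lhom R M L (\<lambda>x. g (f x))"
  by (auto simp: lhom_def Pi_def)

lemma additive_zero:
  assumes "abelian_group M" "abelian_group N" "f \<in> carrier M \<rightarrow> carrier N"
    "\<And>x y. \<lbrakk>x \<in> carrier M; y \<in> carrier M\<rbrakk> \<Longrightarrow> f (x \<oplus>\<^bsub>M\<^esub> y) = f x \<oplus>\<^bsub>N\<^esub> f y"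
  shows "f \<zero>\<^bsub>M\<^esub> = \<zero>\<^bsub>N\<^esub>"
proof -
  interpret M: abelian_group M by fact
  interpret N: abelian_group N by fact
  have "f \<zero>\<^bsub>M\<^esub> \<in> carrier N" using assms(3) by auto
  moreover have "f \<zero>\<^bsub>M\<^esub> \<oplus>\<^bsub>N\<^esub> f \<zero>\<^bsub>M\<^esub> = f \<zero>\<^bsub>M\<^esub>"
    using assms(4)[of "\<zero>\<^bsub>M\<^esub>" "\<zero>\<^bsub>M\<^esub>"] by simp
  ultimately show ?thesis using N.add.r_cancel_one by blast
qed

lemma additive_minus:
  assumes "abelian_group M" "abelian_group N" "f \<in> carrier M \<rightarrow> carrier N"
    "\<And>x y. \<lbrakk>x \<in> carrier M; y \<in> carrier M\<rbrakk> \<Longrightarrow> f (x \<oplus>\<^bsub>M\<^esub> y) = f x \<oplus>\<^bsub>N\<^esub> f y"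
    and x: "x \<in> carrier M"
  shows "f (\<ominus>\<^bsub>M\<^esub> x) = \<ominus>\<^bsub>N\<^esub> (f x)"
proof -
  interpret M: abelian_group M by fact
  interpret N: abelian_group N by fact
  have "f (\<ominus>\<^bsub>M\<^esub> x) \<oplus>\<^bsub>N\<^esub> f x = \<zero>\<^bsub>N\<^esub>"
    using assms(4)[of "\<ominus>\<^bsub>M\<^esub> x" x] additive_zero[OF assms(1-4)] x by (simp add: M.l_neg)
  then show ?thesis using x assms(3) by (intro N.minus_equality[symmetric]) auto
qed

lemma additive_finsum:
  assumes "abelian_group M" "abelian_group N" "f \<in> carrier M \<rightarrow> carrier N"
    "\<And>x y. \<lbrakk>x \<in> carrier M; y \<in> carrier M\<rbrakk> \<Longrightarrow> f (x \<oplus>\<^bsub>M\<^esub> y) = f x \<oplus>\<^bsub>N\<^esub> f y"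
    and "finite S" "g \<in> S \<rightarrow> carrier M"
  shows "f (\<Oplus>\<^bsub>M\<^esub>i\<in>S. g i) = (\<Oplus>\<^bsub>N\<^esub>i\<in>S. f (g i))"
  using assms(5,6)
proof (induction S rule: finite_induct)
  interpret M: abelian_group M by fact
  interpret N: abelian_group N by fact
  case empty then show ?case using additive_zero[OF assms(1-4)] by simp
next
  interpret M: abelian_group M by fact
  interpret N: abelian_group N by fact
  case (insert i S)
  then have "g \<in> S \<rightarrow> carrier M" "g i \<in> carrier M" "f \<circ> g \<in> S \<rightarrow> carrier N" "f (g i) \<in> carrier N"
    using assms(3) by auto
  with insert show ?case
    using assms(4) by (simp add: Pi_def M.finsum_closed)
qed

lemma lhom_zero:
  assumes "abelian_group M" "abelian_group N" "lhom R M N f"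
  shows "f \<zero>\<^bsub>M\<^esub> = \<zero>\<^bsub>N\<^esub>"
  using additive_zero[OF assms(1,2)] assms(3) by (auto simp: lhom_def)

lemma lhom_minus:
  assumes "abelian_group M" "abelian_group N" "lhom R M N f" "x \<in> carrier M"
  shows "f (\<ominus>\<^bsub>M\<^esub> x) = \<ominus>\<^bsub>N\<^esub> f x"
  using additive_minus[OF assms(1,2), of f x] assms(3,4) by (auto simp: lhom_def)

lemma lhom_addf:
  assumes "left_module R N" "lhom R M N f" "lhom R M N g"
  shows "lhom R M N (\<lambda>x. f x \<oplus>\<^bsub>N\<^esub> g x)"
proof -
  interpret N: left_module R N by fact
  show ?thesis using assms(2,3)
    by (intro lhomI) (simp_all add: lhom_closed lhom_add lhom_smult N.act_r_distr N.M.add.m_ac)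
qed

lemma lhom_uminus:
  assumes "left_module R N" "lhom R M N f"
  shows "lhom R M N (\<lambda>x. \<ominus>\<^bsub>N\<^esub> f x)"
proof -
  interpret N: left_module R N by fact
  show ?thesis using assms(2)
    by (intro lhomI) (simp_all add: lhom_closed lhom_add lhom_smult N.act_r_minus N.M.minus_add)
qed

lemma lhom_minusf:
  assumes "left_module R N" "lhom R M N f" "lhom R M N g"
  shows "lhom R M N (\<lambda>x. f x \<ominus>\<^bsub>N\<^esub> g x)"
  using lhom_addf[OF assms(1,2) lhom_uminus[OF assms(1,3)]] by (simp add: a_minus_def)

section \<open>Free modules and lifting through epimorphisms\<close>

definition unit_vec :: "('a, 'b) ring_scheme \<Rightarrow> 'i \<Rightarrow> 'i \<Rightarrow> 'a" where
  "unit_vec R i = (\<lambda>j. if j = i then \<one>\<^bsub>R\<^esub> else \<zero>\<^bsub>R\<^esub>)"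

definition lin_ext where
  "lin_ext R M m v = (\<Oplus>\<^bsub>M\<^esub>i\<in>{i. v i \<noteq> \<zero>\<^bsub>R\<^esub>}. v i \<odot>\<^bsub>M\<^esub> m i)"

lemma free_module_simps:
  "f \<in> carrier (free_module R I) \<longleftrightarrow>
     (\<forall>i. f i \<in> carrier R) \<and> finite {i. f i \<noteq> \<zero>\<^bsub>R\<^esub>} \<and> {i. f i \<noteq> \<zero>\<^bsub>R\<^esub>} \<subseteq> I"
  "\<zero>\<^bsub>free_module R I\<^esub> = (\<lambda>i. \<zero>\<^bsub>R\<^esub>)"
  "f \<oplus>\<^bsub>free_module R I\<^esub> g = (\<lambda>i. f i \<oplus>\<^bsub>R\<^esub> g i)"
  "a \<odot>\<^bsub>free_module R I\<^esub> f = (\<lambda>i. a \<otimes>\<^bsub>R\<^esub> f i)"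
  by (simp_all add: free_module_def)

context ring begin

lemma free_module_is_module: "left_module R (free_module R I)"
proof (rule left_moduleI)
  show "ring R" by (rule ring_axioms)
  show "abelian_group (free_module R I)"
  proof (rule abelian_groupI)
    fix f g assume fg: "f \<in> carrier (free_module R I)" "g \<in> carrier (free_module R I)"
    have "{i. f i \<oplus> g i \<noteq> \<zero>} \<subseteq> {i. f i \<noteq> \<zero>} \<union> {i. g i \<noteq> \<zero>}" by auto
    then show "f \<oplus>\<^bsub>free_module R I\<^esub> g \<in> carrier (free_module R I)"
      using fg by (auto simp: free_module_simps intro: finite_subset)
  next
    fix f assume f: "f \<in> carrier (free_module R I)"
    have "{i. \<ominus> f i \<noteq> \<zero>} \<subseteq> {i. f i \<noteq> \<zero>}" by auto
    then show "\<exists>g\<in>carrier (free_module R I). g \<oplus>\<^bsub>free_module R I\<^esub> f = \<zero>\<^bsub>free_module R I\<^esub>"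
      using f by (intro bexI[of _ "\<lambda>i. \<ominus> f i"]) (auto simp: free_module_simps l_neg intro: finite_subset)
  qed (auto simp: free_module_simps add.m_ac)
next
  fix a f assume "a \<in> carrier R" and f: "f \<in> carrier (free_module R I)"
  then have "{i. a \<otimes> f i \<noteq> \<zero>} \<subseteq> {i. f i \<noteq> \<zero>}" by auto
  then show "a \<odot>\<^bsub>free_module R I\<^esub> f \<in> carrier (free_module R I)"
    using f \<open>a \<in> carrier R\<close> by (auto simp: free_module_simps intro: finite_subset)
qed (auto simp: free_module_simps l_distr r_distr m_assoc)

lemma unit_vec_closed [simp]: "i \<in> I \<Longrightarrow> unit_vec R i \<in> carrier (free_module R I)"
proof -
  assume "i \<in> I"
  then have "{j. unit_vec R i j \<noteq> \<zero>} \<subseteq> {i}" by (auto simp: unit_vec_def)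
  with \<open>i \<in> I\<close> show ?thesis
    by (auto simp: free_module_simps unit_vec_def intro: finite_subset)
qed

text \<open>Induction on the support: resetting one coordinate to zero removes exactly one
  index.\<close>

lemma free_module_induct [consumes 1, case_names zero add]:
  assumes v: "v \<in> carrier (free_module R I)"
    and zero: "P (\<lambda>i. \<zero>)"
    and step: "\<And>c i v. \<lbrakk>c \<in> carrier R; i \<in> I; v \<in> carrier (free_module R I); P v\<rbrakk> \<Longrightarrow>
      P (c \<odot>\<^bsub>free_module R I\<^esub> unit_vec R i \<oplus>\<^bsub>free_module R I\<^esub> v)"
  shows "P v"
proof -
  define S where "S = {i. v i \<noteq> \<zero>}"
  have "finite S" using v by (simp add: S_def free_module_simps)
  then show ?thesis using v S_def
  proof (induction S arbitrary: v rule: finite_induct)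
    case empty
    then have "v = (\<lambda>i. \<zero>)" by auto
    then show ?case using zero by simp
  next
    case (insert i S)
    let ?u = "v(i := \<zero>)"
    have supp: "{j. ?u j \<noteq> \<zero>} = S" using insert.hyps insert.prems by auto
    have u: "?u \<in> carrier (free_module R I)"
      using insert supp by (auto simp: free_module_simps)
    have iI: "i \<in> I" and vi: "\<And>j. v j \<in> carrier R" using insert.prems by (auto simp: free_module_simps)
    have "v = v i \<odot>\<^bsub>free_module R I\<^esub> unit_vec R i \<oplus>\<^bsub>free_module R I\<^esub> ?u"
      using vi by (auto simp: free_module_simps unit_vec_def)
    moreover have "P ?u" by (rule insert.IH[OF u supp[symmetric]])
    ultimately show ?case using step[OF vi[of i] iI u] by metis
  qed
qed

lemma lhom_free_eq:
  assumes N: "abelian_group N" and f: "lhom R (free_module R I) N f" and g: "lhom R (free_module R I) N g"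
    and eq: "\<And>i. i \<in> I \<Longrightarrow> f (unit_vec R i) = g (unit_vec R i)"
    and v: "v \<in> carrier (free_module R I)"
  shows "f v = g v"
proof -
  interpret F: left_module R "free_module R I" by (rule free_module_is_module)
  show ?thesis using v
  proof (induction v rule: free_module_induct)
    case zero
    show ?case using lhom_zero[OF F.abelian_group_axioms N f] lhom_zero[OF F.abelian_group_axioms N g]
      by (simp add: free_module_simps)
  next
    case (add c i v)
    have "c \<odot>\<^bsub>free_module R I\<^esub> unit_vec R i \<in> carrier (free_module R I)"
      using add by (intro F.act_closed) auto
    then show ?case using add f g eq by (simp add: lhom_add lhom_smult)
  qed
qed

text \<open>The sum in \<open>lin_ext\<close> runs over the support of \<open>v\<close>, which can
  shrink under addition and scalar multiplication. Linearity is proved on a larger range that serves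
  all vectors involved.\<close>

lemma lin_ext_superset:
  assumes "left_module R M" "finite S" "{i. v i \<noteq> \<zero>} \<subseteq> S" "\<And>i. v i \<in> carrier R"
    "\<And>i. i \<in> S \<Longrightarrow> m i \<in> carrier M"
  shows "lin_ext R M m v = (\<Oplus>\<^bsub>M\<^esub>i\<in>S. v i \<odot>\<^bsub>M\<^esub> m i)"
proof -
  interpret M: left_module R M by fact
  show ?thesis unfolding lin_ext_def using assms
    by (intro M.M.add.finprod_mono_neutral_cong_left) (auto simp: M.act_closed)
qed

lemma lin_ext_lhom:
  assumes M: "left_module R M" and m: "\<And>i. i \<in> I \<Longrightarrow> m i \<in> carrier M"
  shows "lhom R (free_module R I) M (lin_ext R M m)"
proof (rule lhomI)
  interpret M: left_module R M by fact
  interpret F: left_module R "free_module R I" by (rule free_module_is_module)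
  fix u v assume uv: "u \<in> carrier (free_module R I)" "v \<in> carrier (free_module R I)"
  let ?S = "{i. u i \<noteq> \<zero>} \<union> {i. v i \<noteq> \<zero>}"
  have S: "finite ?S" "?S \<subseteq> I" and c: "\<And>i. u i \<in> carrier R" "\<And>i. v i \<in> carrier R"
    using uv by (auto simp: free_module_simps)
  have mS: "\<And>i. i \<in> ?S \<Longrightarrow> m i \<in> carrier M" using S m by auto
  have "lin_ext R M m (\<lambda>i. u i \<oplus> v i) = (\<Oplus>\<^bsub>M\<^esub>i\<in>?S. (u i \<oplus> v i) \<odot>\<^bsub>M\<^esub> m i)"
    using S c mS by (intro lin_ext_superset M) auto
  also have "\<dots> = (\<Oplus>\<^bsub>M\<^esub>i\<in>?S. u i \<odot>\<^bsub>M\<^esub> m i \<oplus>\<^bsub>M\<^esub> v i \<odot>\<^bsub>M\<^esub> m i)"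
    using c mS by (intro M.M.finsum_cong') (auto simp: M.act_l_distr M.act_closed)
  also have "\<dots> = (\<Oplus>\<^bsub>M\<^esub>i\<in>?S. u i \<odot>\<^bsub>M\<^esub> m i) \<oplus>\<^bsub>M\<^esub> (\<Oplus>\<^bsub>M\<^esub>i\<in>?S. v i \<odot>\<^bsub>M\<^esub> m i)"
    using c mS by (intro M.M.finsum_addf) (auto simp: M.act_closed)
  also have "(\<Oplus>\<^bsub>M\<^esub>i\<in>?S. u i \<odot>\<^bsub>M\<^esub> m i) = lin_ext R M m u"
    using S c mS by (intro lin_ext_superset[symmetric] M) auto
  also have "(\<Oplus>\<^bsub>M\<^esub>i\<in>?S. v i \<odot>\<^bsub>M\<^esub> m i) = lin_ext R M m v"
    using S c mS by (intro lin_ext_superset[symmetric] M) auto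
  finally show "lin_ext R M m (u \<oplus>\<^bsub>free_module R I\<^esub> v) = lin_ext R M m u \<oplus>\<^bsub>M\<^esub> lin_ext R M m v"
    by (simp add: free_module_simps)
next
  interpret M: left_module R M by fact
  fix u assume u: "u \<in> carrier (free_module R I)"
  show "lin_ext R M m u \<in> carrier M"
    unfolding lin_ext_def using u m by (intro M.M.finsum_closed) (auto simp: free_module_simps M.act_closed)
  fix a assume a: "a \<in> carrier R"
  let ?S = "{i. u i \<noteq> \<zero>}"
  have S: "finite ?S" "?S \<subseteq> I" and c: "\<And>i. u i \<in> carrier R"
    using u by (auto simp: free_module_simps)
  have mS: "\<And>i. i \<in> ?S \<Longrightarrow> m i \<in> carrier M" using S m by auto
  have "lin_ext R M m (\<lambda>i. a \<otimes> u i) = (\<Oplus>\<^bsub>M\<^esub>i\<in>?S. (a \<otimes> u i) \<odot>\<^bsub>M\<^esub> m i)"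
    using S c mS a by (intro lin_ext_superset M) auto
  also have "\<dots> = (\<Oplus>\<^bsub>M\<^esub>i\<in>?S. a \<odot>\<^bsub>M\<^esub> (u i \<odot>\<^bsub>M\<^esub> m i))"
    using c mS a by (intro M.M.finsum_cong') (auto simp: M.act_assoc M.act_closed)
  also have "\<dots> = a \<odot>\<^bsub>M\<^esub> lin_ext R M m u"
    unfolding lin_ext_def using S c mS a by (intro M.act_finsum[symmetric]) (auto simp: M.act_closed)
  finally show "lin_ext R M m (a \<odot>\<^bsub>free_module R I\<^esub> u) = a \<odot>\<^bsub>M\<^esub> lin_ext R M m u"
    by (simp add: free_module_simps)
qed

lemma lin_ext_unit_vec:
  assumes M: "left_module R M" and m: "m i \<in> carrier M"
  shows "lin_ext R M m (unit_vec R i) = m i"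
proof -
  interpret M: left_module R M by fact
  have "lin_ext R M m (unit_vec R i) = (\<Oplus>\<^bsub>M\<^esub>j\<in>{i}. unit_vec R i j \<odot>\<^bsub>M\<^esub> m j)"
    using m by (intro lin_ext_superset M) (auto simp: unit_vec_def)
  then show ?thesis using m by (simp add: unit_vec_def M.act_one)
qed

text \<open>Preimages are chosen for the images of the basis vectors and extended linearly, so
  \<open>im\<close> speaks of basis vectors alone.\<close>

lemma free_module_lift:
  assumes M: "left_module R M" and N: "abelian_group N" and p: "lhom R M N p"
    and f: "lhom R (free_module R I) N f"
    and im: "\<And>i. i \<in> I \<Longrightarrow> f (unit_vec R i) \<in> p ` carrier M"
  obtains h where "lhom R (free_module R I) M h" "\<And>v. v \<in> carrier (free_module R I) \<Longrightarrow> p (h v) = f v"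
proof -
  from im have "\<forall>i\<in>I. \<exists>m\<in>carrier M. p m = f (unit_vec R i)" by (metis imageE)
  then obtain m where m: "\<And>i. i \<in> I \<Longrightarrow> m i \<in> carrier M" "\<And>i. i \<in> I \<Longrightarrow> p (m i) = f (unit_vec R i)"
    by metis
  show ?thesis
  proof (rule that)
    show l: "lhom R (free_module R I) M (lin_ext R M m)" using M m by (intro lin_ext_lhom) auto
    show "p (lin_ext R M m v) = f v" if "v \<in> carrier (free_module R I)" for v
      by (rule lhom_free_eq[OF N lhom_compose[OF l p] f _ that]) (simp add: lin_ext_unit_vec[OF M] m)
  qed
qed

text \<open>The map \<open>f\<close> is extended to the free module along the retraction
  \<open>r\<close>, lifted there, and pulled back along the section \<open>s\<close>.\<close>

lemma projective_lift:
  fixes P :: "('a, 'p) module"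
  assumes P: "projective_module R P" and M: "left_module R M" and N: "abelian_group N"
    and p: "lhom R M N p" and f: "lhom R P N f" and im: "f ` carrier P \<subseteq> p ` carrier M"
  obtains h where "lhom R P M h" "\<And>v. v \<in> carrier P \<Longrightarrow> p (h v) = f v"
proof -
  from P obtain I :: "'p set" and s r where sr: "s \<in> mod_hom R P (free_module R I)" "r \<in> mod_hom R (free_module R I) P"
    "\<And>p. p \<in> carrier P \<Longrightarrow> r (s p) = p"
    unfolding projective_module_def by blast
  have s: "lhom R P (free_module R I) s" and r: "lhom R (free_module R I) P r"
    using mod_hom_lhom[OF sr(1)] mod_hom_lhom[OF sr(2)] by auto
  have "f (r (unit_vec R i)) \<in> p ` carrier M" if "i \<in> I" for i
    using im lhom_closed[OF r unit_vec_closed[OF that]] by blast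
  from free_module_lift[OF M N p lhom_compose[OF r f] this]
  obtain h where h: "lhom R (free_module R I) M h" "\<And>v. v \<in> carrier (free_module R I) \<Longrightarrow> p (h v) = f (r v)"
    by blast
  show ?thesis
  proof (rule that)
    show "lhom R P M (\<lambda>x. h (s x))" by (rule lhom_compose[OF s h(1)])
    show "p (h (s v)) = f v" if "v \<in> carrier P" for v
      using h(2)[OF lhom_closed[OF s that]] sr(3)[OF that] by simp
  qed
qed

section \<open>The ring as a left module\<close>

lemma regular_module_simps [simp]:
  "carrier (regular_module R) = carrier R" "x \<oplus>\<^bsub>regular_module R\<^esub> y = x \<oplus> y"
  "\<zero>\<^bsub>regular_module R\<^esub> = \<zero>" "x \<odot>\<^bsub>regular_module R\<^esub> y = x \<otimes> y"
  by (simp_all add: regular_module_def)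

lemma regular_module_is_module: "left_module R (regular_module R)"
proof (rule left_moduleI)
  show "abelian_group (regular_module R)"
  proof (rule abelian_groupI)
    fix x assume "x \<in> carrier (regular_module R)"
    then show "\<exists>y\<in>carrier (regular_module R). y \<oplus>\<^bsub>regular_module R\<^esub> x = \<zero>\<^bsub>regular_module R\<^esub>"
      by (intro bexI[of _ "\<ominus> x"]) (auto simp: l_neg)
  qed (auto simp: a_ac)
qed (auto simp: l_distr r_distr m_assoc ring_axioms)

lemma regular_minus [simp]:
  assumes "x \<in> carrier R" shows "\<ominus>\<^bsub>regular_module R\<^esub> x = \<ominus> x"
proof -
  interpret L: left_module R "regular_module R" by (rule regular_module_is_module)
  show ?thesis using assms by (intro L.M.minus_equality) (auto simp: l_neg)
qed

lemma regular_lhom: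
  assumes M: "left_module R M" and m: "m \<in> carrier M"
  shows "lhom R (regular_module R) M (\<lambda>a. a \<odot>\<^bsub>M\<^esub> m)"
proof -
  interpret M: left_module R M by fact
  show ?thesis using m by (intro lhomI) (auto simp: M.act_closed M.act_l_distr M.act_assoc)
qed

end

section \<open>Homogeneous components\<close>

text \<open>The projections of a direct sum as additive maps. Unlike the unique families in
  \<open>internal_direct_sum\<close> they can be applied to both sides of an equation, which is how
  degrees are compared throughout.\<close>

definition components where
  "components M I V c \<longleftrightarrow>
     (\<forall>i\<in>I. c i \<in> carrier M \<rightarrow> V i \<and> V i \<subseteq> carrier M) \<and>
     (\<forall>i\<in>I. \<forall>u\<in>carrier M. \<forall>v\<in>carrier M. c i (u \<oplus>\<^bsub>M\<^esub> v) = c i u \<oplus>\<^bsub>M\<^esub> c i v) \<and>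
     (\<forall>i\<in>I. \<forall>j\<in>I. \<forall>v\<in>V j. c i v = (if i = j then v else \<zero>\<^bsub>M\<^esub>)) \<and>
     (\<forall>v\<in>carrier M. finite {i\<in>I. c i v \<noteq> \<zero>\<^bsub>M\<^esub>} \<and> v = (\<Oplus>\<^bsub>M\<^esub>i\<in>{i\<in>I. c i v \<noteq> \<zero>\<^bsub>M\<^esub>}. c i v))"

lemma
  assumes "components M I V c" "i \<in> I"
  shows components_closed: "v \<in> carrier M \<Longrightarrow> c i v \<in> V i"
    and components_sub: "v \<in> V i \<Longrightarrow> v \<in> carrier M"
    and components_carrier: "v \<in> carrier M \<Longrightarrow> c i v \<in> carrier M"
    and components_add: "\<lbrakk>u \<in> carrier M; v \<in> carrier M\<rbrakk> \<Longrightarrow> c i (u \<oplus>\<^bsub>M\<^esub> v) = c i u \<oplus>\<^bsub>M\<^esub> c i v"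
    and components_same: "v \<in> V i \<Longrightarrow> c i v = v"
    and components_other: "\<lbrakk>j \<in> I; i \<noteq> j; v \<in> V j\<rbrakk> \<Longrightarrow> c i v = \<zero>\<^bsub>M\<^esub>"
  using assms by (auto simp: components_def Pi_def)

lemma
  assumes "components M I V c"
  shows components_finite: "v \<in> carrier M \<Longrightarrow> finite {i\<in>I. c i v \<noteq> \<zero>\<^bsub>M\<^esub>}"
    and components_sum: "v \<in> carrier M \<Longrightarrow> v = (\<Oplus>\<^bsub>M\<^esub>i\<in>{i\<in>I. c i v \<noteq> \<zero>\<^bsub>M\<^esub>}. c i v)"
  using assms by (auto simp: components_def)

lemma components_zero:
  assumes "abelian_group M" "components M I V c" "i \<in> I"
  shows "c i \<zero>\<^bsub>M\<^esub> = \<zero>\<^bsub>M\<^esub>"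
  using assms by (intro additive_zero) (auto simp: components_add components_carrier)

lemma components_minus:
  assumes "abelian_group M" "components M I V c" "i \<in> I" "v \<in> carrier M"
  shows "c i (\<ominus>\<^bsub>M\<^esub> v) = \<ominus>\<^bsub>M\<^esub> c i v"
  using assms by (intro additive_minus) (auto simp: components_add components_carrier)

lemma components_zero_mem:
  assumes "abelian_group M" "components M I V c" "i \<in> I"
  shows "\<zero>\<^bsub>M\<^esub> \<in> V i"
  using components_zero[OF assms] components_closed[OF assms(2,3)]
  by (metis abelian_group_def abelian_monoid.zero_closed assms(1))

lemma components_add_mem:
  assumes "abelian_group M" "components M I V c" "i \<in> I" "u \<in> V i" "v \<in> V i"
  shows "u \<oplus>\<^bsub>M\<^esub> v \<in> V i"
proof -
  interpret abelian_group M by fact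
  have uv: "u \<in> carrier M" "v \<in> carrier M" using assms by (auto dest: components_sub)
  then have "c i (u \<oplus>\<^bsub>M\<^esub> v) = u \<oplus>\<^bsub>M\<^esub> v" using assms by (simp add: components_add components_same)
  then show ?thesis using uv components_closed[OF assms(2,3), of "u \<oplus>\<^bsub>M\<^esub> v"] by simp
qed

lemma components_minus_mem:
  assumes "abelian_group M" "components M I V c" "i \<in> I" "u \<in> V i"
  shows "\<ominus>\<^bsub>M\<^esub> u \<in> V i"
proof -
  interpret abelian_group M by fact
  have u: "u \<in> carrier M" using assms by (auto dest: components_sub)
  then have "c i (\<ominus>\<^bsub>M\<^esub> u) = \<ominus>\<^bsub>M\<^esub> u" using assms by (simp add: components_minus components_same)
  then show ?thesis using u components_closed[OF assms(2,3), of "\<ominus>\<^bsub>M\<^esub> u"] by simp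
qed

lemma finsum_induct:
  assumes M: "abelian_group M" and fin: "finite S" and c: "\<And>i. i \<in> S \<Longrightarrow> f i \<in> carrier M \<and> P (f i)"
    and zero: "P \<zero>\<^bsub>M\<^esub>"
    and add: "\<And>x y. \<lbrakk>x \<in> carrier M; y \<in> carrier M; P x; P y\<rbrakk> \<Longrightarrow> P (x \<oplus>\<^bsub>M\<^esub> y)"
  shows "P (\<Oplus>\<^bsub>M\<^esub>i\<in>S. f i)"
proof -
  interpret abelian_group M by fact
  show ?thesis using fin c
  proof (induction S rule: finite_induct)
    case empty then show ?case using zero by simp
  next
    case (insert i S)
    then have "f \<in> S \<rightarrow> carrier M" "f i \<in> carrier M" "P (\<Oplus>\<^bsub>M\<^esub>i\<in>S. f i)" "P (f i)" by auto
    with insert.hyps show ?case using add[of "f i" "finsum M f S"] by simp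
  qed
qed

lemma components_induct [consumes 3, case_names zero add hom]:
  assumes M: "abelian_group M" and c: "components M I V c" and v: "v \<in> carrier M"
    and zero: "P \<zero>\<^bsub>M\<^esub>"
    and add: "\<And>x y. \<lbrakk>x \<in> carrier M; y \<in> carrier M; P x; P y\<rbrakk> \<Longrightarrow> P (x \<oplus>\<^bsub>M\<^esub> y)"
    and hom: "\<And>i x. \<lbrakk>i \<in> I; x \<in> V i\<rbrakk> \<Longrightarrow> P x"
  shows "P v"
proof -
  have "P (\<Oplus>\<^bsub>M\<^esub>i\<in>{i\<in>I. c i v \<noteq> \<zero>\<^bsub>M\<^esub>}. c i v)"
  proof (rule finsum_induct[where P = P, OF M components_finite[OF c v] _ zero])
    fix i assume i: "i \<in> {i \<in> I. c i v \<noteq> \<zero>\<^bsub>M\<^esub>}"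
    then have "c i v \<in> V i" using components_closed[OF c _ v] by auto
    then show "c i v \<in> carrier M \<and> P (c i v)" using hom i components_sub[OF c] by auto
  qed (rule add)
  then show ?thesis using components_sum[OF c v] by simp
qed

lemma components_eqI:
  assumes M: "abelian_group M" and c: "components M I V c" and "u \<in> carrier M" "v \<in> carrier M"
    and eq: "\<And>i. i \<in> I \<Longrightarrow> c i u = c i v"
  shows "u = v"
proof -
  have "{i\<in>I. c i u \<noteq> \<zero>\<^bsub>M\<^esub>} = {i\<in>I. c i v \<noteq> \<zero>\<^bsub>M\<^esub>}" using eq by auto
  then have "(\<Oplus>\<^bsub>M\<^esub>i\<in>{i\<in>I. c i u \<noteq> \<zero>\<^bsub>M\<^esub>}. c i u) = (\<Oplus>\<^bsub>M\<^esub>i\<in>{i\<in>I. c i v \<noteq> \<zero>\<^bsub>M\<^esub>}. c i v)"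
    using eq components_carrier[OF c _ assms(4)] M
    by (intro abelian_monoid.finsum_cong') (auto simp: abelian_group_def)
  then show ?thesis using components_sum[OF c assms(3)] components_sum[OF c assms(4)] by simp
qed

text \<open>All laws come from uniqueness: an explicit family representing the element is exhibited,
  and so it must be the chosen one.\<close>

lemma internal_direct_sum_components:
  assumes M: "abelian_group M" and ds: "internal_direct_sum M I V (carrier M)"
  obtains c where "components M I V c"
proof -
  interpret abelian_group M by fact
  define Q where "Q v f \<longleftrightarrow> f \<in> (\<Pi>\<^sub>E i\<in>I. V i) \<and> finite {i\<in>I. f i \<noteq> \<zero>\<^bsub>M\<^esub>} \<and>
        v = (\<Oplus>\<^bsub>M\<^esub>i\<in>{i\<in>I. f i \<noteq> \<zero>\<^bsub>M\<^esub>}. f i)" for v f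
  have sg: "additive_subgroup (V i) M" "V i \<subseteq> carrier M" if "i \<in> I" for i
    using ds that by (auto simp: internal_direct_sum_def)
  have ex1: "\<exists>!f. Q v f" if "v \<in> carrier M" for v
    using ds that unfolding internal_direct_sum_def Q_def by blast
  define F where "F v = (THE f. Q v f)" for v
  have F: "Q v (F v)" if "v \<in> carrier M" for v
    unfolding F_def using theI'[OF ex1[OF that]] .
  have Fu: "F v = f" if "v \<in> carrier M" "Q v f" for v f
    using ex1[OF that(1)] F[OF that(1)] that(2) by blast
  have z: "\<zero>\<^bsub>M\<^esub> \<in> V i" if "i \<in> I" for i
    using additive_subgroup.zero_closed[OF sg(1)[OF that]] .
  have ad: "x \<oplus>\<^bsub>M\<^esub> y \<in> V i" if "i \<in> I" "x \<in> V i" "y \<in> V i" for i x y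
    using additive_subgroup.a_closed[OF sg(1)[OF that(1)]] that by blast
  have "components M I V (\<lambda>i v. F v i)"
    unfolding components_def
  proof (intro conjI ballI)
    fix i assume i: "i \<in> I"
    show "(\<lambda>v. F v i) \<in> carrier M \<rightarrow> V i" using F i unfolding Q_def by (blast intro: PiE_mem)
    show "V i \<subseteq> carrier M" by (rule sg(2)[OF i])
    fix u v assume uv: "u \<in> carrier M" "v \<in> carrier M"
    let ?f = "\<lambda>i\<in>I. F u i \<oplus>\<^bsub>M\<^esub> F v i"
    \<comment> \<open>Sums are taken over the union of the supports; cancellation may make the
      support of \<open>?f\<close> smaller.\<close>
    let ?S = "{i\<in>I. F u i \<noteq> \<zero>\<^bsub>M\<^esub>} \<union> {i\<in>I. F v i \<noteq> \<zero>\<^bsub>M\<^esub>}"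
    note qu = F[OF uv(1), unfolded Q_def] and qv = F[OF uv(2), unfolded Q_def]
    have fV: "F u i \<in> V i" "F v i \<in> V i" if "i \<in> I" for i using qu qv that by (auto intro: PiE_mem)
    have fc: "F u i \<in> carrier M" "F v i \<in> carrier M" if "i \<in> I" for i using fV[OF that] sg(2)[OF that] by auto
    have finS: "finite ?S" using qu qv by blast
    have sub: "{i\<in>I. ?f i \<noteq> \<zero>\<^bsub>M\<^esub>} \<subseteq> ?S" using fc by auto
    have "u \<oplus>\<^bsub>M\<^esub> v = (\<Oplus>\<^bsub>M\<^esub>i\<in>?S. F u i) \<oplus>\<^bsub>M\<^esub> (\<Oplus>\<^bsub>M\<^esub>i\<in>?S. F v i)"
    proof -
      have "(\<Oplus>\<^bsub>M\<^esub>i\<in>{i\<in>I. F u i \<noteq> \<zero>\<^bsub>M\<^esub>}. F u i) = (\<Oplus>\<^bsub>M\<^esub>i\<in>?S. F u i)"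
        using finS fc by (intro add.finprod_mono_neutral_cong_left) auto
      moreover have "(\<Oplus>\<^bsub>M\<^esub>i\<in>{i\<in>I. F v i \<noteq> \<zero>\<^bsub>M\<^esub>}. F v i) = (\<Oplus>\<^bsub>M\<^esub>i\<in>?S. F v i)"
        using finS fc by (intro add.finprod_mono_neutral_cong_left) auto
      ultimately show ?thesis using qu qv by metis
    qed
    also have "\<dots> = (\<Oplus>\<^bsub>M\<^esub>i\<in>?S. F u i \<oplus>\<^bsub>M\<^esub> F v i)"
      using fc by (intro finsum_addf[symmetric]) auto
    also have "\<dots> = (\<Oplus>\<^bsub>M\<^esub>i\<in>{i\<in>I. ?f i \<noteq> \<zero>\<^bsub>M\<^esub>}. ?f i)"
      using finS fc sub by (intro add.finprod_mono_neutral_cong_right) auto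
    finally have eq: "u \<oplus>\<^bsub>M\<^esub> v = (\<Oplus>\<^bsub>M\<^esub>i\<in>{i\<in>I. ?f i \<noteq> \<zero>\<^bsub>M\<^esub>}. ?f i)" .
    have "?f \<in> (\<Pi>\<^sub>E i\<in>I. V i)" using fV ad by auto
    then have "Q (u \<oplus>\<^bsub>M\<^esub> v) ?f"
      unfolding Q_def using eq finite_subset[OF sub finS] by (intro conjI)
    then have "F (u \<oplus>\<^bsub>M\<^esub> v) = ?f" using Fu uv by simp
    then show "F (u \<oplus>\<^bsub>M\<^esub> v) i = F u i \<oplus>\<^bsub>M\<^esub> F v i" using i by simp
  next
    fix i j v assume i: "i \<in> I" and j: "j \<in> I" and v: "v \<in> V j"
    let ?f = "\<lambda>i\<in>I. if i = j then v else \<zero>\<^bsub>M\<^esub>"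
    have vc: "v \<in> carrier M" using sg(2)[OF j] v by auto
    have sub: "{i\<in>I. ?f i \<noteq> \<zero>\<^bsub>M\<^esub>} \<subseteq> {j}" by auto
    have "(\<Oplus>\<^bsub>M\<^esub>i\<in>{i\<in>I. ?f i \<noteq> \<zero>\<^bsub>M\<^esub>}. ?f i) = (\<Oplus>\<^bsub>M\<^esub>i\<in>{j}. ?f i)"
      using sub vc j by (intro add.finprod_mono_neutral_cong_left) auto
    also have "\<dots> = v" using vc j by simp
    finally have eq: "(\<Oplus>\<^bsub>M\<^esub>i\<in>{i\<in>I. ?f i \<noteq> \<zero>\<^bsub>M\<^esub>}. ?f i) = v" .
    have "?f \<in> (\<Pi>\<^sub>E i\<in>I. V i)" using z v by auto
    then have "Q v ?f" unfolding Q_def using eq[symmetric] finite_subset[OF sub finite.insertI[OF finite.emptyI]] by (intro conjI)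
    then have "F v = ?f" using Fu vc by simp
    then show "F v i = (if i = j then v else \<zero>\<^bsub>M\<^esub>)" using i by simp
  next
    fix v assume v: "v \<in> carrier M"
    show "finite {i \<in> I. F v i \<noteq> \<zero>\<^bsub>M\<^esub>}" "v = (\<Oplus>\<^bsub>M\<^esub>i\<in>{i \<in> I. F v i \<noteq> \<zero>\<^bsub>M\<^esub>}. F v i)"
      using F[OF v] unfolding Q_def by blast+
  qed
  then show ?thesis by (rule that)
qed

section \<open>Graded modules and graded maps\<close>

definition gmod where
  "gmod A \<A> M \<M> d \<longleftrightarrow> left_module A M \<and> components M (UNIV :: int set) \<M> d \<and>
     (\<forall>n j. \<forall>a\<in>\<A> n. \<forall>x\<in>\<M> j. a \<odot>\<^bsub>M\<^esub> x \<in> \<M> (int n + j))"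

lemma gmod_module: "gmod A \<A> M \<M> d \<Longrightarrow> left_module A M"
  and gmod_components: "gmod A \<A> M \<M> d \<Longrightarrow> components M UNIV \<M> d"
  and gmod_act: "gmod A \<A> M \<M> d \<Longrightarrow> a \<in> \<A> n \<Longrightarrow> x \<in> \<M> j \<Longrightarrow> a \<odot>\<^bsub>M\<^esub> x \<in> \<M> (int n + j)"
  by (auto simp: gmod_def)

lemma left_module_abelian_group: "left_module A M \<Longrightarrow> abelian_group M"
  by (simp add: left_module_def)

lemma graded_module_gmod:
  assumes "graded_module A \<A> M \<M>"
  obtains d where "gmod A \<A> M \<M> d"
proof -
  have M: "left_module A M" and ds: "internal_direct_sum M UNIV \<M> (carrier M)"
    and act: "\<forall>n j. \<forall>a\<in>\<A> n. \<forall>x\<in>\<M> j. a \<odot>\<^bsub>M\<^esub> x \<in> \<M> (int n + j)"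
    using assms by (auto simp: graded_module_def)
  obtain d where "components M UNIV \<M> d"
    using internal_direct_sum_components[OF left_module_abelian_group[OF M] ds] .
  with M act that show ?thesis by (auto simp: gmod_def)
qed

lemma gmod_component_act:
  assumes M: "gmod A \<A> M \<M> d" and A: "\<A> n \<subseteq> carrier A" and a: "a \<in> \<A> n" and x: "x \<in> carrier M"
  shows "d (int n + j) (a \<odot>\<^bsub>M\<^esub> x) = a \<odot>\<^bsub>M\<^esub> d j x"
proof -
  interpret M: left_module A M by (rule gmod_module[OF M])
  note c = gmod_components[OF M]
  note ab = M.M.abelian_group_axioms
  have aA: "a \<in> carrier A" using A a by auto
  from ab c x show ?thesis
  proof (induction x rule: components_induct)
    case zero
    then show ?case using aA by (simp add: components_zero[OF ab c])
  next
    case (add x y)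
    then show ?case using aA
      by (simp add: M.act_r_distr components_add[OF c] components_carrier[OF c] M.act_closed)
  next
    case (hom k x)
    then have "a \<odot>\<^bsub>M\<^esub> x \<in> \<M> (int n + k)" using gmod_act[OF M a] by auto
    then show ?case using hom aA
      by (cases "j = k") (auto simp: components_same[OF c] components_other[OF c, of _ k] components_other[OF c, of _ "int n + k"])
  qed
qed

text \<open>The part of degree \<open>e\<close> of a linear map. Multiplication by a homogeneous
  scalar shifts all degrees equally, so linearity survives for such scalars and then for all. This
  makes graded lifts out of lifts that ignore the grading, and homogeneous linear forms out of
  arbitrary ones.\<close>

lemma degree_component:
  assumes comp: "components A UNIV \<A> ca"
    and P: "gmod A \<A> P \<P> c" and M: "gmod A \<A> M \<M> d" and h: "lhom A P M h"
  obtains h' where "lhom A P M h'" "\<And>j p. p \<in> \<P> j \<Longrightarrow> h' p = d (j + e) (h p)"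
proof -
  interpret P: left_module A P by (rule gmod_module[OF P])
  interpret M: left_module A M by (rule gmod_module[OF M])
  note cP = gmod_components[OF P] and cM = gmod_components[OF M]
  define S where "S p = {j. c j p \<noteq> \<zero>\<^bsub>P\<^esub>}" for p
  define h' where "h' p = (\<Oplus>\<^bsub>M\<^esub>j\<in>S p. d (j + e) (h (c j p)))" for p
  have trm: "d (j + e) (h (c j p)) \<in> carrier M" if "p \<in> carrier P" for j p
    using that h by (simp add: components_carrier[OF cP] components_carrier[OF cM] lhom_closed)
  have finS: "finite (S p)" if "p \<in> carrier P" for p
    using components_finite[OF cP that] by (simp add: S_def)
  \<comment> \<open>The range \<open>S p\<close> depends on \<open>p\<close>; additivity needs a
    range common to several arguments.\<close>
  have h'_sup: "h' p = (\<Oplus>\<^bsub>M\<^esub>j\<in>T. d (j + e) (h (c j p)))" if "p \<in> carrier P" "finite T" "S p \<subseteq> T" for p T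
  proof -
    have "d (j + e) (h (c j p)) = \<zero>\<^bsub>M\<^esub>" if "j \<notin> S p" for j
      using that lhom_zero[OF P.M.abelian_group_axioms M.M.abelian_group_axioms h]
        components_zero[OF M.M.abelian_group_axioms cM] by (simp add: S_def)
    then show ?thesis unfolding h'_def using that trm
      by (intro M.M.add.finprod_mono_neutral_cong_left) auto
  qed
  have h'_add: "h' (p \<oplus>\<^bsub>P\<^esub> q) = h' p \<oplus>\<^bsub>M\<^esub> h' q" if pq: "p \<in> carrier P" "q \<in> carrier P" for p q
  proof -
    let ?T = "S p \<union> S q \<union> S (p \<oplus>\<^bsub>P\<^esub> q)"
    have T: "finite ?T" using finS pq by auto
    have "h' (p \<oplus>\<^bsub>P\<^esub> q) = (\<Oplus>\<^bsub>M\<^esub>j\<in>?T. d (j + e) (h (c j (p \<oplus>\<^bsub>P\<^esub> q))))"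
      using T pq by (intro h'_sup) auto
    also have "\<dots> = (\<Oplus>\<^bsub>M\<^esub>j\<in>?T. d (j + e) (h (c j p)) \<oplus>\<^bsub>M\<^esub> d (j + e) (h (c j q)))"
      using pq trm h by (intro M.M.finsum_cong')
        (auto simp: components_add[OF cP] components_add[OF cM] lhom_add[OF h] lhom_closed[OF h] components_carrier[OF cP])
    also have "\<dots> = h' p \<oplus>\<^bsub>M\<^esub> h' q"
    proof -
      have "S p \<subseteq> ?T" "S q \<subseteq> ?T" by auto
      then show ?thesis
        unfolding h'_sup[OF pq(1) T \<open>S p \<subseteq> ?T\<close>] h'_sup[OF pq(2) T \<open>S q \<subseteq> ?T\<close>]
        using pq trm by (intro M.M.finsum_addf) auto
    qed
    finally show ?thesis .
  qed
  have h'_closed: "h' p \<in> carrier M" if "p \<in> carrier P" for p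
    unfolding h'_def using that trm by (intro M.M.finsum_closed) auto
  have h'_hom: "h' p = d (j + e) (h p)" if p: "p \<in> \<P> j" for p j
  proof -
    have pc: "p \<in> carrier P" using components_sub[OF cP _ p] by simp
    have "S p \<subseteq> {j}" using components_other[OF cP _ _ _ p] by (auto simp: S_def)
    then have "h' p = (\<Oplus>\<^bsub>M\<^esub>j\<in>{j}. d (j + e) (h (c j p)))" using pc by (intro h'_sup) auto
    then show ?thesis using trm[OF pc, of j] components_same[OF cP _ p] by simp
  qed
  have h'_zero: "h' \<zero>\<^bsub>P\<^esub> = \<zero>\<^bsub>M\<^esub>"
    using additive_zero[OF P.M.abelian_group_axioms M.M.abelian_group_axioms, of h'] h'_closed h'_add by auto
  have h'_smult: "h' (a \<odot>\<^bsub>P\<^esub> p) = a \<odot>\<^bsub>M\<^esub> h' p" if "a \<in> carrier A" "p \<in> carrier P" for a p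
    using P.R.abelian_group_axioms comp \<open>a \<in> carrier A\<close>
  proof (induction a rule: components_induct)
    case zero then show ?case using that h'_closed h'_zero by simp
  next
    case (add a b)
    then show ?case using that h'_closed h'_add by (simp add: P.act_l_distr M.act_l_distr P.act_closed)
  next
    case (hom n a)
    have An: "\<A> n \<subseteq> carrier A" using components_sub[OF comp] by auto
    have a: "a \<in> carrier A" using An hom by auto
    from P.M.abelian_group_axioms cP \<open>p \<in> carrier P\<close> show ?case
    proof (induction p rule: components_induct)
      case zero then show ?case using a h'_zero by simp
    next
      case (add p q)
      then show ?case using a h'_closed h'_add by (simp add: P.act_r_distr M.act_r_distr P.act_closed)
    next
      case (hom j p)
      have pc: "p \<in> carrier P" using components_sub[OF cP _ hom(2)] by simp
      have "h' (a \<odot>\<^bsub>P\<^esub> p) = d (int n + (j + e)) (h (a \<odot>\<^bsub>P\<^esub> p))"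
        using h'_hom[OF gmod_act[OF P \<open>a \<in> \<A> n\<close> hom(2)]] by (simp add: ac_simps)
      also have "\<dots> = a \<odot>\<^bsub>M\<^esub> d (j + e) (h p)"
        using gmod_component_act[OF M An \<open>a \<in> \<A> n\<close>] pc h a by (simp add: lhom_smult lhom_closed)
      finally show ?case using h'_hom[OF hom(2)] by simp
    qed
  qed
  show ?thesis
    by (rule that[of h']) (auto intro!: lhomI simp: h'_closed h'_add h'_smult h'_hom)
qed

definition graded_hom where
  "graded_hom A M \<M> N \<N> f \<longleftrightarrow> lhom A M N f \<and> (\<forall>j. f ` \<M> j \<subseteq> \<N> j)"

lemma graded_hom_component:
  assumes M: "gmod A \<A> M \<M> d" and N: "gmod A \<A> N \<N> e" and f: "graded_hom A M \<M> N \<N> f"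
    and x: "x \<in> carrier M"
  shows "f (d j x) = e j (f x)"
proof -
  interpret M: left_module A M by (rule gmod_module[OF M])
  interpret N: left_module A N by (rule gmod_module[OF N])
  note ab = M.M.abelian_group_axioms N.M.abelian_group_axioms
  note cM = gmod_components[OF M] and cN = gmod_components[OF N]
  have l: "lhom A M N f" and g: "\<And>j y. y \<in> \<M> j \<Longrightarrow> f y \<in> \<N> j"
    using f by (auto simp: graded_hom_def)
  from ab(1) cM x show ?thesis
  proof (induction x rule: components_induct)
    case zero
    then show ?case by (simp add: components_zero[OF ab(1) cM] components_zero[OF ab(2) cN] lhom_zero[OF ab l])
  next
    case (add x y)
    then show ?case
      by (simp add: components_add[OF cM] components_add[OF cN] lhom_add[OF l] lhom_closed[OF l] components_carrier[OF cM])
  next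
    case (hom k x)
    then show ?case using g[OF hom(2)]
      by (cases "j = k") (auto simp: components_same[OF cM] components_same[OF cN]
         components_other[OF cM, of _ k] components_other[OF cN, of _ k] lhom_zero[OF ab l])
  qed
qed

text \<open>An ungraded lift is replaced by its part of degree zero, which is still a lift because
  \<open>p\<close> and \<open>f\<close> respect degrees.\<close>

lemma graded_projective_lift:
  fixes P :: "('a, 'p) module"
  assumes comp: "components A UNIV \<A> ca"
    and P: "projective_module A P" "gmod A \<A> P \<P> c" and M: "gmod A \<A> M \<M> d" and N: "gmod A \<A> N \<N> e"
    and p: "graded_hom A M \<M> N \<N> p" and f: "graded_hom A P \<P> N \<N> f"
    and im: "f ` carrier P \<subseteq> p ` carrier M"
  obtains h where "graded_hom A P \<P> M \<M> h" "\<And>v. v \<in> carrier P \<Longrightarrow> p (h v) = f v"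
proof -
  interpret M: left_module A M by (rule gmod_module[OF M])
  interpret N: left_module A N by (rule gmod_module[OF N])
  interpret P: left_module A P by (rule gmod_module[OF P(2)])
  note cM = gmod_components[OF M] and cP = gmod_components[OF P(2)]
  have lp: "lhom A M N p" and lf: "lhom A P N f" using p f by (auto simp: graded_hom_def)
  obtain h0 where h0: "lhom A P M h0" "\<And>v. v \<in> carrier P \<Longrightarrow> p (h0 v) = f v"
    using M.R.projective_lift[OF P(1) M.left_module_axioms N.M.abelian_group_axioms lp lf im] by blast
  obtain h where h: "lhom A P M h" "\<And>j p. p \<in> \<P> j \<Longrightarrow> h p = d (j + 0) (h0 p)"
    using degree_component[OF comp P(2) M h0(1)] by blast
  have gr: "graded_hom A P \<P> M \<M> h"
    unfolding graded_hom_def using h components_closed[OF cM] lhom_closed[OF h0(1)] components_sub[OF cP]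
    by fastforce
  have "p (h v) = f v" if v: "v \<in> carrier P" for v
    using P.M.abelian_group_axioms cP v
  proof (induction v rule: components_induct)
    case zero
    then show ?case
      using lhom_zero[OF P.M.abelian_group_axioms N.M.abelian_group_axioms lf]
        lhom_zero[OF P.M.abelian_group_axioms N.M.abelian_group_axioms lhom_compose[OF h(1) lp]] by simp
  next
    case (add x y)
    then show ?case by (simp add: lhom_add[OF lf] lhom_add[OF h(1)] lhom_add[OF lp] lhom_closed[OF h(1)])
  next
    case (hom j x)
    have x: "x \<in> carrier P" using components_sub[OF cP _ hom(2)] by simp
    have "p (h x) = e j (p (h0 x))"
      using h(2)[OF hom(2)] graded_hom_component[OF M N p] lhom_closed[OF h0(1) x] by simp
    also have "\<dots> = f x" using h0(2)[OF x] f hom(2)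
      components_same[OF gmod_components[OF N], of j "f x"] by (auto simp: graded_hom_def)
    finally show ?case .
  qed
  with gr that show ?thesis by blast
qed

section \<open>The free algebra\<close>

lemma free_algebra_simps:
  "f \<in> carrier (free_algebra K) \<longleftrightarrow> (\<forall>w. f w \<in> carrier K) \<and> finite {w. f w \<noteq> \<zero>\<^bsub>K\<^esub>}"
  "\<zero>\<^bsub>free_algebra K\<^esub> = (\<lambda>w. \<zero>\<^bsub>K\<^esub>)"
  "f \<oplus>\<^bsub>free_algebra K\<^esub> g = (\<lambda>w. f w \<oplus>\<^bsub>K\<^esub> g w)"
  "c \<odot>\<^bsub>free_algebra K\<^esub> f = (\<lambda>w. c \<otimes>\<^bsub>K\<^esub> f w)"
  "\<one>\<^bsub>free_algebra K\<^esub> = monomial K []"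
  by (simp_all add: free_algebra_def monomial_def)

lemma monomial_unit_vec: "monomial K u = unit_vec K u"
  by (simp add: monomial_def unit_vec_def)

lemma free_algebra_free_module:
  "carrier (free_algebra K) = carrier (free_module K UNIV)"
  "\<zero>\<^bsub>free_algebra K\<^esub> = \<zero>\<^bsub>free_module K UNIV\<^esub>"
  "add (free_algebra K) = add (free_module K UNIV)"
  "smult (free_algebra K) = smult (free_module K UNIV)"
  by (simp_all add: free_algebra_def free_module_def)

lemma lhom_free_algebra: "lhom K (free_algebra K) N f \<longleftrightarrow> lhom K (free_module K UNIV) N f"
  by (simp add: lhom_def free_algebra_free_module)

definition conv where
  "conv K f g w = (\<Oplus>\<^bsub>K\<^esub>i\<in>{..length w}. f (take i w) \<otimes>\<^bsub>K\<^esub> g (drop i w))"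

lemma free_algebra_mult: "f \<otimes>\<^bsub>free_algebra K\<^esub> g = conv K f g"
  by (simp add: free_algebra_def conv_def fun_eq_iff)

text \<open>Division by a letter: the words of \<open>f\<close> that begin (\<open>lder\<close>) or
  end (\<open>rder\<close>) with \<open>c\<close>, with that letter removed. For a potential these
  are the noncommutative partial derivatives from either side.\<close>

definition lder :: "'v \<Rightarrow> ('v list \<Rightarrow> 'k) \<Rightarrow> 'v list \<Rightarrow> 'k" where "lder c f = (\<lambda>w. f (c # w))"
definition rder :: "'v \<Rightarrow> ('v list \<Rightarrow> 'k) \<Rightarrow> 'v list \<Rightarrow> 'k" where "rder c f = (\<lambda>w. f (w @ [c]))"

context cring begin

abbreviation T where "T \<equiv> free_algebra R"

lemma conv_closed [simp]: "(\<And>w. f w \<in> carrier R) \<Longrightarrow> (\<And>w. g w \<in> carrier R) \<Longrightarrow> conv R f g w \<in> carrier R"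
  unfolding conv_def by (intro finsum_closed) auto

lemma conv_Nil: "(\<And>w. f w \<in> carrier R) \<Longrightarrow> (\<And>w. g w \<in> carrier R) \<Longrightarrow> conv R f g [] = f [] \<otimes> g []"
  by (simp add: conv_def)

text \<open>Either the whole word goes to the right factor, and the left one contributes its
  constant term, or the first letter is divided off the left factor. This recursion drives the
  inductions on words.\<close>

lemma conv_Cons:
  assumes "\<And>w. f w \<in> carrier R" "\<And>w. g w \<in> carrier R"
  shows "conv R f g (c # w) = f [] \<otimes> g (c # w) \<oplus> conv R (lder c f) g w"
  unfolding conv_def lder_def using assms
  by (simp del: finsum_Suc add: finsum_Suc2 a_comm)

lemma conv_snoc:
  assumes "\<And>w. f w \<in> carrier R" "\<And>w. g w \<in> carrier R"
  shows "conv R f g (w @ [c]) = conv R f (rder c g) w \<oplus> f (w @ [c]) \<otimes> g []"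
proof -
  have "(\<Oplus>i\<in>{..length w}. f (take i (w @ [c])) \<otimes> g (drop i (w @ [c]))) = conv R f (rder c g) w"
    unfolding conv_def rder_def using assms by (intro finsum_cong') auto
  moreover have "conv R f g (w @ [c]) = f (w @ [c]) \<otimes> g [] \<oplus>
      (\<Oplus>i\<in>{..length w}. f (take i (w @ [c])) \<otimes> g (drop i (w @ [c])))"
    unfolding conv_def using assms by (simp del: take_append drop_append)
  moreover have "conv R f (rder c g) w \<in> carrier R" using assms by (intro conv_closed) (auto simp: rder_def)
  ultimately show ?thesis
    using assms by (simp add: a_comm)
qed

lemma conv_add_l:
  assumes "\<And>w. f w \<in> carrier R" "\<And>w. g w \<in> carrier R" "\<And>w. h w \<in> carrier R"
  shows "conv R (\<lambda>w. f w \<oplus> g w) h w = conv R f h w \<oplus> conv R g h w"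
proof -
  have "conv R (\<lambda>w. f w \<oplus> g w) h w = (\<Oplus>i\<in>{..length w}. f (take i w) \<otimes> h (drop i w) \<oplus> g (take i w) \<otimes> h (drop i w))"
    unfolding conv_def using assms by (intro finsum_cong') (auto simp: l_distr)
  also have "\<dots> = conv R f h w \<oplus> conv R g h w"
    unfolding conv_def using assms by (intro finsum_addf) auto
  finally show ?thesis .
qed

lemma conv_add_r:
  assumes "\<And>w. f w \<in> carrier R" "\<And>w. g w \<in> carrier R" "\<And>w. h w \<in> carrier R"
  shows "conv R h (\<lambda>w. f w \<oplus> g w) w = conv R h f w \<oplus> conv R h g w"
proof -
  have "conv R h (\<lambda>w. f w \<oplus> g w) w = (\<Oplus>i\<in>{..length w}. h (take i w) \<otimes> f (drop i w) \<oplus> h (take i w) \<otimes> g (drop i w))"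
    unfolding conv_def using assms by (intro finsum_cong') (auto simp: r_distr)
  also have "\<dots> = conv R h f w \<oplus> conv R h g w"
    unfolding conv_def using assms by (intro finsum_addf) auto
  finally show ?thesis .
qed

lemma conv_smult_l:
  assumes "\<And>w. f w \<in> carrier R" "\<And>w. g w \<in> carrier R" "c \<in> carrier R"
  shows "conv R (\<lambda>w. c \<otimes> f w) g w = c \<otimes> conv R f g w"
proof -
  have "conv R (\<lambda>w. c \<otimes> f w) g w = (\<Oplus>i\<in>{..length w}. c \<otimes> (f (take i w) \<otimes> g (drop i w)))"
    unfolding conv_def using assms by (intro finsum_cong') (auto simp: m_assoc)
  also have "\<dots> = c \<otimes> conv R f g w"
    unfolding conv_def using assms by (intro finsum_rdistr[symmetric]) auto
  finally show ?thesis .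
qed

lemma conv_smult_r:
  assumes "\<And>w. f w \<in> carrier R" "\<And>w. g w \<in> carrier R" "c \<in> carrier R"
  shows "conv R f (\<lambda>w. c \<otimes> g w) w = c \<otimes> conv R f g w"
proof -
  have "conv R f (\<lambda>w. c \<otimes> g w) w = (\<Oplus>i\<in>{..length w}. c \<otimes> (f (take i w) \<otimes> g (drop i w)))"
    unfolding conv_def using assms by (intro finsum_cong') (auto simp: m_lcomm)
  also have "\<dots> = c \<otimes> conv R f g w"
    unfolding conv_def using assms by (intro finsum_rdistr[symmetric]) auto
  finally show ?thesis .
qed

lemma lder_closed: "(\<And>w. f w \<in> carrier R) \<Longrightarrow> lder c f w \<in> carrier R"
  and rder_closed: "(\<And>w. f w \<in> carrier R) \<Longrightarrow> rder c f w \<in> carrier R"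
  by (auto simp: lder_def rder_def)

text \<open>Dividing off the first letter leads to triple products that start with
  \<open>lder c f\<close> or, weighted by \<open>f []\<close>, with \<open>lder c g\<close>; hence
  the induction on the word for arbitrary \<open>f\<close> and \<open>g\<close>.\<close>

lemma conv_assoc:
  assumes "\<And>w. f w \<in> carrier R" "\<And>w. g w \<in> carrier R" "\<And>w. h w \<in> carrier R"
  shows "conv R (conv R f g) h w = conv R f (conv R g h) w"
  using assms
proof (induction w arbitrary: f g)
  case Nil
  then show ?case by (simp add: conv_Nil m_assoc)
next
  case (Cons c w)
  have "lder c (conv R f g) = (\<lambda>w. f [] \<otimes> lder c g w \<oplus> conv R (lder c f) g w)"
    using Cons.prems by (simp add: lder_def[of c "conv R f g"] conv_Cons) (simp add: lder_def)
  then have "conv R (lder c (conv R f g)) h w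
      = f [] \<otimes> conv R (lder c g) h w \<oplus> conv R (lder c f) (conv R g h) w"
    using Cons by (simp add: conv_add_l conv_smult_l lder_closed)
  then show ?case using Cons.prems
    by (simp add: conv_Cons conv_Nil lder_closed m_assoc r_distr a_assoc)
qed

lemma conv_zero_l: "(\<And>w. g w \<in> carrier R) \<Longrightarrow> conv R (\<lambda>w. \<zero>) g w = \<zero>"
proof -
  assume "\<And>w. g w \<in> carrier R"
  then have "conv R (\<lambda>w. \<zero>) g w = (\<Oplus>i\<in>{..length w}. \<zero>)" unfolding conv_def by (intro finsum_cong') auto
  then show ?thesis by simp
qed

section \<open>Monomials and supports\<close>

lemma monomial_closed [simp]: "monomial R u w \<in> carrier R"
  by (simp add: monomial_def)

lemma lder_monomial_Cons: "lder d (monomial R (c # u)) = (if c = d then monomial R u else (\<lambda>w. \<zero>))"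
  by (auto simp: lder_def monomial_def fun_eq_iff)

lemma lder_monomial_Nil: "lder d (monomial R []) = (\<lambda>w. \<zero>)"
  by (auto simp: lder_def monomial_def fun_eq_iff)

lemma conv_monomial_l:
  assumes "\<And>w. g w \<in> carrier R"
  shows "conv R (monomial R u) g w = (if take (length u) w = u then g (drop (length u) w) else \<zero>)"
  using assms
proof (induction u arbitrary: w)
  case Nil
  show ?case using Nil by (cases w) (simp_all add: conv_Nil conv_Cons lder_monomial_Nil conv_zero_l, simp_all add: monomial_def)
next
  case (Cons c u)
  show ?case
  proof (cases w)
    case Nil then show ?thesis using Cons.prems by (simp add: conv_Nil) (simp add: monomial_def)
  next
    case (Cons d v)
    have "monomial R (c # u) [] = \<zero>" by (simp add: monomial_def)
    then show ?thesis using Cons \<open>\<And>w. g w \<in> carrier R\<close> Cons.IH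
      by (auto simp: conv_Cons lder_monomial_Cons conv_zero_l)
  qed
qed

lemma conv_one_l: "(\<And>w. g w \<in> carrier R) \<Longrightarrow> conv R (monomial R []) g w = g w"
  by (simp add: conv_monomial_l)

lemma conv_one_r: "(\<And>w. g w \<in> carrier R) \<Longrightarrow> conv R g (monomial R []) w = g w"
proof (induction w arbitrary: g)
  case Nil then show ?case by (simp add: conv_Nil) (simp add: monomial_def)
next
  case (Cons c w)
  have "conv R (lder c g) (monomial R []) w = lder c g w" using Cons by (simp add: lder_closed)
  then show ?case using Cons.prems by (simp add: conv_Cons) (simp add: monomial_def lder_def)
qed

text \<open>Words of a product are concatenations of words of the factors. This gives both the
  finiteness of supports and the additivity of degrees.\<close>

lemma conv_support:
  assumes "conv R f g w \<noteq> \<zero>" "\<And>w. f w \<in> carrier R" "\<And>w. g w \<in> carrier R"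
  obtains u v where "w = u @ v" "f u \<noteq> \<zero>" "g v \<noteq> \<zero>"
proof -
  have "\<exists>i\<in>{..length w}. f (take i w) \<otimes> g (drop i w) \<noteq> \<zero>"
  proof (rule ccontr)
    assume "\<not> ?thesis"
    then have "conv R f g w = (\<Oplus>i\<in>{..length w}. \<zero>)" unfolding conv_def using assms by (intro finsum_cong') auto
    with assms(1) show False by simp
  qed
  then obtain i where "f (take i w) \<otimes> g (drop i w) \<noteq> \<zero>" by blast
  with assms(2,3) have "f (take i w) \<noteq> \<zero>" "g (drop i w) \<noteq> \<zero>" by (metis l_null) (metis r_null assms(2,3) \<open>f (take i w) \<otimes> g (drop i w) \<noteq> \<zero>\<close>)
  then show ?thesis using that[of "take i w" "drop i w"] by simp
qed

lemma free_algebra_ring: "ring (free_algebra R :: ('a, 'v list \<Rightarrow> 'a) module)"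
proof (rule ringI)
  interpret F: left_module R "free_module R (UNIV :: 'v list set)" by (rule free_module_is_module)
  have "abelian_group (free_module R (UNIV :: 'v list set))" ..
  then show "abelian_group (free_algebra R :: ('a, 'v list \<Rightarrow> 'a) module)"
    unfolding abelian_group_def abelian_group_axioms_def abelian_monoid_def
    by (simp add: free_algebra_free_module)
  show "monoid (free_algebra R :: ('a, 'v list \<Rightarrow> 'a) module)"
  proof (rule monoidI)
    fix f g :: "'v list \<Rightarrow> 'a" assume fg: "f \<in> carrier T" "g \<in> carrier T"
    have "{w. conv R f g w \<noteq> \<zero>} \<subseteq> (\<lambda>(u, v). u @ v) ` ({w. f w \<noteq> \<zero>} \<times> {w. g w \<noteq> \<zero>})"
      using fg by (auto elim!: conv_support simp: free_algebra_simps)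
    then show "f \<otimes>\<^bsub>T\<^esub> g \<in> carrier T"
      using fg by (auto simp: free_algebra_simps free_algebra_mult intro: finite_subset)
    fix h :: "'v list \<Rightarrow> 'a" assume "h \<in> carrier T"
    then show "f \<otimes>\<^bsub>T\<^esub> g \<otimes>\<^bsub>T\<^esub> h = f \<otimes>\<^bsub>T\<^esub> (g \<otimes>\<^bsub>T\<^esub> h)"
      using fg by (auto simp: free_algebra_simps free_algebra_mult conv_assoc fun_eq_iff)
  next
    show "\<one>\<^bsub>T\<^esub> \<in> carrier (free_algebra R :: ('a, 'v list \<Rightarrow> 'a) module)"
      by (auto simp: free_algebra_simps) (auto simp: monomial_def)
  qed (auto simp: free_algebra_simps free_algebra_mult conv_one_l conv_one_r fun_eq_iff)
qed (auto simp: free_algebra_simps free_algebra_mult conv_add_l conv_add_r fun_eq_iff)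

lemma free_algebra_assoc_algebra: "assoc_algebra R (free_algebra R :: ('a, 'v list \<Rightarrow> 'a) module)"
proof -
  interpret T: ring "free_algebra R :: ('a, 'v list \<Rightarrow> 'a) module" by (rule free_algebra_ring)
  interpret F: left_module R "free_module R (UNIV :: 'v list set)" by (rule free_module_is_module)
  have "module R (free_algebra R :: ('a, 'v list \<Rightarrow> 'a) module)"
    using F.act_closed F.act_l_distr F.act_r_distr F.act_assoc F.act_one
    by (intro moduleI T.abelian_group_axioms cring_axioms) (auto simp: free_algebra_free_module)
  then show ?thesis
    by (intro assoc_algebra.intro T.ring_axioms assoc_algebra_axioms.intro)
      (auto simp: free_algebra_simps free_algebra_mult conv_smult_l conv_smult_r fun_eq_iff)
qed

lemma monomial_mem [simp]: "monomial R u \<in> carrier T"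
  by (auto simp: free_algebra_simps) (auto simp: monomial_def)

lemma monomial_mult: "monomial R u \<otimes>\<^bsub>T\<^esub> monomial R v = monomial R (u @ v)"
proof
  fix w
  have "take (length u) w = u \<and> drop (length u) w = v \<longleftrightarrow> w = u @ v"
    by (metis append_eq_conv_conj)
  then show "(monomial R u \<otimes>\<^bsub>T\<^esub> monomial R v) w = monomial R (u @ v) w"
    by (simp add: free_algebra_mult conv_monomial_l) (auto simp: monomial_def)
qed

lemma free_algebra_induct [consumes 1, case_names zero add]:
  assumes v: "f \<in> carrier T"
    and zero: "P \<zero>\<^bsub>T\<^esub>"
    and step: "\<And>c u f. \<lbrakk>c \<in> carrier R; f \<in> carrier T; P f\<rbrakk> \<Longrightarrow> P (c \<odot>\<^bsub>T\<^esub> monomial R u \<oplus>\<^bsub>T\<^esub> f)"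
  shows "P f"
  using v[unfolded free_algebra_free_module]
proof (induction f rule: free_module_induct)
  case zero then show ?case using assms(2) by (simp add: free_algebra_simps)
next
  case (add c i v)
  then show ?case using step[of c v i] by (simp add: free_algebra_free_module monomial_unit_vec)
qed

lemma lder_mem: "f \<in> carrier T \<Longrightarrow> lder c f \<in> carrier T"
proof -
  assume f: "f \<in> carrier T"
  have "{w. f (c # w) \<noteq> \<zero>} \<subseteq> tl ` {w. f w \<noteq> \<zero>}"
    by (metis (mono_tags, lifting) image_iff list.sel(3) mem_Collect_eq subsetI)
  then show ?thesis using f by (auto simp: free_algebra_simps lder_def intro: finite_subset)
qed

lemma rder_mem: "f \<in> carrier T \<Longrightarrow> rder c f \<in> carrier T"
proof -
  assume f: "f \<in> carrier T"
  have "{w. f (w @ [c]) \<noteq> \<zero>} \<subseteq> butlast ` {w. f w \<noteq> \<zero>}"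
    by (metis (mono_tags, lifting) image_iff butlast_snoc mem_Collect_eq subsetI)
  then show ?thesis using f by (auto simp: free_algebra_simps rder_def intro: finite_subset)
qed

lemma mult_letter_r:
  assumes "f \<in> carrier T"
  shows "(f \<otimes>\<^bsub>T\<^esub> monomial R [c]) [] = \<zero>"
    and "(f \<otimes>\<^bsub>T\<^esub> monomial R [c]) (w @ [d]) = (if c = d then f w else \<zero>)"
proof -
  have f: "\<And>w. f w \<in> carrier R" using assms by (simp add: free_algebra_simps)
  have "rder d (monomial R [c]) = (if c = d then monomial R [] else (\<lambda>w. \<zero>))"
    by (auto simp: rder_def monomial_def fun_eq_iff)
  moreover have "conv R f (\<lambda>w. \<zero>) w = (\<Oplus>i\<in>{..length w}. \<zero>)"
    unfolding conv_def using f by (intro finsum_cong') auto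
  then have "conv R f (\<lambda>w. \<zero>) w = \<zero>" by simp
  moreover have "monomial R [c] [] = \<zero>" by (simp add: monomial_def)
  ultimately show "(f \<otimes>\<^bsub>T\<^esub> monomial R [c]) [] = \<zero>"
    "(f \<otimes>\<^bsub>T\<^esub> monomial R [c]) (w @ [d]) = (if c = d then f w else \<zero>)"
    using f by (auto simp: free_algebra_mult conv_Nil conv_snoc conv_one_r)
qed

lemma mult_letter_l:
  assumes "f \<in> carrier T"
  shows "(monomial R [c] \<otimes>\<^bsub>T\<^esub> f) [] = \<zero>"
    and "(monomial R [c] \<otimes>\<^bsub>T\<^esub> f) (d # w) = (if c = d then f w else \<zero>)"
  using assms by (auto simp: free_algebra_mult conv_monomial_l free_algebra_simps)

text \<open>The last letter of a word comes from \<open>g\<close> unless \<open>g\<close>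
  contributes its constant term. Where \<open>g\<close> has no constant term \<open>rder c\<close>
  is compatible with multiplication by \<open>f\<close> from the left, which is why right
  derivatives of relations define maps of left modules.\<close>

lemma rder_mult:
  assumes "f \<in> carrier T" "g \<in> carrier T"
  shows "rder c (f \<otimes>\<^bsub>T\<^esub> g) = f \<otimes>\<^bsub>T\<^esub> rder c g \<oplus>\<^bsub>T\<^esub> g [] \<odot>\<^bsub>T\<^esub> rder c f"
proof
  fix w
  have f: "\<And>w. f w \<in> carrier R" and g: "\<And>w. g w \<in> carrier R" using assms by (auto simp: free_algebra_simps)
  have "rder c (f \<otimes>\<^bsub>T\<^esub> g) w = conv R f (rder c g) w \<oplus> f (w @ [c]) \<otimes> g []"
    unfolding free_algebra_mult rder_def[of c "conv R f g"] by (rule conv_snoc) (rule f g)+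
  also have "\<dots> = (f \<otimes>\<^bsub>T\<^esub> rder c g \<oplus>\<^bsub>T\<^esub> g [] \<odot>\<^bsub>T\<^esub> rder c f) w"
    using f g by (simp add: free_algebra_simps(3,4) free_algebra_mult rder_def m_comm)
  finally show "rder c (f \<otimes>\<^bsub>T\<^esub> g) w = (f \<otimes>\<^bsub>T\<^esub> rder c g \<oplus>\<^bsub>T\<^esub> g [] \<odot>\<^bsub>T\<^esub> rder c f) w" .
qed

end

lemma var_UNIV: "(UNIV :: var set) = {Vx, Vy}"
  using var.exhaust by auto

context cring begin

lemma right_division:
  assumes "f \<in> carrier T" "f [] = \<zero>"
  shows "f = rder Vx f \<otimes>\<^bsub>T\<^esub> monomial R [Vx] \<oplus>\<^bsub>T\<^esub> rder Vy f \<otimes>\<^bsub>T\<^esub> monomial R [Vy]"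
proof
  fix w show "f w = (rder Vx f \<otimes>\<^bsub>T\<^esub> monomial R [Vx] \<oplus>\<^bsub>T\<^esub> rder Vy f \<otimes>\<^bsub>T\<^esub> monomial R [Vy]) w"
  proof (cases w rule: rev_cases)
    case Nil then show ?thesis using assms rder_mem[OF assms(1)]
      by (simp add: free_algebra_simps(3) mult_letter_r)
  next
    case (snoc v c)
    have "f (v @ [c]) \<in> carrier R" using assms by (simp add: free_algebra_simps)
    then show ?thesis using snoc rder_mem[OF assms(1)]
      by (cases c) (simp_all add: free_algebra_simps(3) mult_letter_r, simp_all add: rder_def)
  qed
qed

lemma left_division:
  assumes "f \<in> carrier T" "f [] = \<zero>"
  shows "f = monomial R [Vx] \<otimes>\<^bsub>T\<^esub> lder Vx f \<oplus>\<^bsub>T\<^esub> monomial R [Vy] \<otimes>\<^bsub>T\<^esub> lder Vy f"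
proof
  fix w show "f w = (monomial R [Vx] \<otimes>\<^bsub>T\<^esub> lder Vx f \<oplus>\<^bsub>T\<^esub> monomial R [Vy] \<otimes>\<^bsub>T\<^esub> lder Vy f) w"
  proof (cases w)
    case Nil then show ?thesis using assms lder_mem[OF assms(1)]
      by (simp add: free_algebra_simps(3) mult_letter_l)
  next
    case (Cons c v)
    have "f (c # v) \<in> carrier R" using assms by (simp add: free_algebra_simps)
    then show ?thesis using Cons lder_mem[OF assms(1)]
      by (cases c) (simp_all add: free_algebra_simps(3) mult_letter_l, simp_all add: lder_def)
  qed
qed

end

section \<open>Evaluation\<close>

definition word_prod :: "('a, 'b) ring_scheme \<Rightarrow> ('v \<Rightarrow> 'a) \<Rightarrow> 'v list \<Rightarrow> 'a" where
  "word_prod A x w = foldr (\<lambda>c p. x c \<otimes>\<^bsub>A\<^esub> p) w \<one>\<^bsub>A\<^esub>"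

text \<open>The value of a noncommutative polynomial at \<open>x\<close>, written as a linear
  extension so that linearity is inherited and multiplicativity reduces to words.\<close>

definition eval_at where "eval_at K A x f = lin_ext K A (word_prod A x) f"

lemma assoc_algebra_left_module: "assoc_algebra K A \<Longrightarrow> left_module K A"
proof -
  assume "assoc_algebra K A"
  then interpret assoc_algebra K A .
  show ?thesis by (intro left_moduleI R.ring_axioms M.abelian_group_axioms)
    (auto simp: smult_l_distr smult_r_distr smult_assoc1)
qed

locale evaluation = assoc_algebra K A for K :: "('k, 'l) ring_scheme" (structure)
    and A :: "('k, 'a, 'b) module_scheme" +
  fixes x :: "'v \<Rightarrow> 'a"
  assumes x_closed [simp]: "x c \<in> carrier A"
begin

abbreviation T :: "('k, 'v list \<Rightarrow> 'k) module" where "T \<equiv> free_algebra K"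

sublocale TR: ring "free_algebra K :: ('k, 'v list \<Rightarrow> 'k) module" by (rule R.free_algebra_ring)
sublocale TA: assoc_algebra K "free_algebra K :: ('k, 'v list \<Rightarrow> 'k) module" by (rule R.free_algebra_assoc_algebra)
sublocale LA: left_module K A by (rule assoc_algebra_left_module) unfold_locales

lemma word_prod_closed [simp]: "word_prod A x w \<in> carrier A"
  by (induction w) (auto simp: word_prod_def)

lemma word_prod_simps [simp]:
  "word_prod A x [] = \<one>\<^bsub>A\<^esub>" "word_prod A x (c # w) = x c \<otimes>\<^bsub>A\<^esub> word_prod A x w"
  by (auto simp: word_prod_def)

lemma word_prod_append: "word_prod A x (u @ v) = word_prod A x u \<otimes>\<^bsub>A\<^esub> word_prod A x v"
  by (induction u) (auto simp: m_assoc)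

abbreviation ev where "ev \<equiv> eval_at K A x"

lemma ev_lhom: "lhom K T A ev"
  unfolding lhom_free_algebra eval_at_def[abs_def]
  by (rule R.lin_ext_lhom[OF LA.left_module_axioms]) simp

lemma ev_closed [simp]: "f \<in> carrier T \<Longrightarrow> ev f \<in> carrier A"
  and ev_add: "f \<in> carrier T \<Longrightarrow> g \<in> carrier T \<Longrightarrow> ev (f \<oplus>\<^bsub>T\<^esub> g) = ev f \<oplus>\<^bsub>A\<^esub> ev g"
  and ev_smult: "c \<in> carrier K \<Longrightarrow> f \<in> carrier T \<Longrightarrow> ev (c \<odot>\<^bsub>T\<^esub> f) = c \<odot>\<^bsub>A\<^esub> ev f"
  using ev_lhom by (auto simp: lhom_def)

lemma ev_zero [simp]: "ev \<zero>\<^bsub>T\<^esub> = \<zero>\<^bsub>A\<^esub>"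
  using lhom_zero[OF TR.abelian_group_axioms M.abelian_group_axioms ev_lhom] .

lemma ev_minus: "f \<in> carrier T \<Longrightarrow> ev (\<ominus>\<^bsub>T\<^esub> f) = \<ominus>\<^bsub>A\<^esub> ev f"
  using lhom_minus[OF TR.abelian_group_axioms M.abelian_group_axioms ev_lhom] .

lemma ev_monomial [simp]: "ev (monomial K w) = word_prod A x w"
  unfolding eval_at_def monomial_unit_vec by (rule R.lin_ext_unit_vec[OF LA.left_module_axioms]) simp

lemma ev_one [simp]: "ev \<one>\<^bsub>T\<^esub> = \<one>\<^bsub>A\<^esub>"
  by (simp add: free_algebra_simps)

text \<open>Both sides are bilinear. The right factor is decomposed into monomials while the left
  one is a monomial, then the left factor is decomposed.\<close>

lemma linear_mult_eq:
  assumes h: "lhom K T B h" and B: "assoc_algebra K B"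
    and one: "h \<one>\<^bsub>T\<^esub> = \<one>\<^bsub>B\<^esub>"
    and mon: "\<And>u v. h (monomial K (u @ v)) = h (monomial K u) \<otimes>\<^bsub>B\<^esub> h (monomial K v)"
    and fg: "f \<in> carrier T" "g \<in> carrier T"
  shows "h (f \<otimes>\<^bsub>T\<^esub> g) = h f \<otimes>\<^bsub>B\<^esub> h g"
proof -
  interpret B: assoc_algebra K B by fact
  have hz: "h \<zero>\<^bsub>T\<^esub> = \<zero>\<^bsub>B\<^esub>"
    using lhom_zero[OF TR.abelian_group_axioms B.M.abelian_group_axioms h] .
  have hc: "h f \<in> carrier B" if "f \<in> carrier T" for f using lhom_closed[OF h that] .
  have 1: "h (monomial K u \<otimes>\<^bsub>T\<^esub> g) = h (monomial K u) \<otimes>\<^bsub>B\<^esub> h g" if "g \<in> carrier T" for u g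
    using that
  proof (induction g rule: R.free_algebra_induct)
    case zero then show ?case using hc[of "monomial K u"] by (simp add: hz)
  next
    case (add c v g)
    have "h (monomial K u \<otimes>\<^bsub>T\<^esub> (c \<odot>\<^bsub>T\<^esub> monomial K v \<oplus>\<^bsub>T\<^esub> g))
        = c \<odot>\<^bsub>B\<^esub> h (monomial K (u @ v)) \<oplus>\<^bsub>B\<^esub> h (monomial K u \<otimes>\<^bsub>T\<^esub> g)"
      using add by (simp add: TR.r_distr TA.smult_mult_right R.monomial_mult lhom_add[OF h] lhom_smult[OF h])
    also have "\<dots> = h (monomial K u) \<otimes>\<^bsub>B\<^esub> h (c \<odot>\<^bsub>T\<^esub> monomial K v \<oplus>\<^bsub>T\<^esub> g)"
      using add hc by (simp add: B.r_distr B.smult_mult_right mon lhom_add[OF h] lhom_smult[OF h])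
    finally show ?case .
  qed
  show ?thesis using fg(1)
  proof (induction f rule: R.free_algebra_induct)
    case zero then show ?case using hc[OF fg(2)] fg(2) by (simp add: hz)
  next
    case (add c v f)
    have "h ((c \<odot>\<^bsub>T\<^esub> monomial K v \<oplus>\<^bsub>T\<^esub> f) \<otimes>\<^bsub>T\<^esub> g)
        = c \<odot>\<^bsub>B\<^esub> h (monomial K v \<otimes>\<^bsub>T\<^esub> g) \<oplus>\<^bsub>B\<^esub> h (f \<otimes>\<^bsub>T\<^esub> g)"
      using add fg by (simp add: TR.l_distr TA.smult_mult_left lhom_add[OF h] lhom_smult[OF h])
    also have "\<dots> = h (c \<odot>\<^bsub>T\<^esub> monomial K v \<oplus>\<^bsub>T\<^esub> f) \<otimes>\<^bsub>B\<^esub> h g"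
      using add fg hc by (simp add: B.l_distr B.smult_mult_left 1 lhom_add[OF h] lhom_smult[OF h])
    finally show ?case .
  qed
qed

lemma ev_mult: "f \<in> carrier T \<Longrightarrow> g \<in> carrier T \<Longrightarrow> ev (f \<otimes>\<^bsub>T\<^esub> g) = ev f \<otimes>\<^bsub>A\<^esub> ev g"
  by (rule linear_mult_eq[OF ev_lhom]) (auto simp: word_prod_append, unfold_locales)

lemma ev_ring_hom: "ev \<in> ring_hom T A"
  by (rule ring_hom_memI) (auto simp: ev_mult ev_add)

lemma ev_unique:
  assumes h: "lhom K T A h" and hm: "h \<in> ring_hom T A"
    and gen: "\<And>c. h (monomial K [c]) = x c" and f: "f \<in> carrier T"
  shows "h f = ev f"
proof -
  have mon: "h (monomial K w) = word_prod A x w" for w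
  proof (induction w)
    case Nil then show ?case using ring_hom_one[OF hm] by (simp add: free_algebra_simps)
  next
    case (Cons c w)
    have "monomial K (c # w) = monomial K [c] \<otimes>\<^bsub>T\<^esub> monomial K w" by (simp add: R.monomial_mult)
    then show ?case using ring_hom_mult[OF hm, of "monomial K [c]" "monomial K w"] Cons gen by simp
  qed
  show ?thesis using f
  proof (induction f rule: R.free_algebra_induct)
    case zero
    then show ?case using lhom_zero[OF TR.abelian_group_axioms M.abelian_group_axioms h] by simp
  next
    case (add c u f)
    then show ?case by (simp add: lhom_add[OF h] lhom_smult[OF h] ev_add ev_smult mon)
  qed
qed

end

section \<open>Connected graded algebras\<close>

locale connected_alg = assoc_algebra K A for K :: "('k, 'l) ring_scheme" (structure)
    and A :: "('k, 'a, 'b) module_scheme" +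
  fixes \<A> :: "nat \<Rightarrow> 'a set"
  assumes K_field: "field K" and conn: "connected_graded K A \<A>"
begin

sublocale KF: field K by (rule K_field)
sublocale LA: left_module K A by (rule assoc_algebra_left_module) unfold_locales

lemma A_ab: "abelian_group A" by (rule M.abelian_group_axioms)

lemma smult_one_eq_zero: "c \<in> carrier K \<Longrightarrow> c \<odot>\<^bsub>A\<^esub> \<one>\<^bsub>A\<^esub> = \<zero>\<^bsub>A\<^esub> \<Longrightarrow> c = \<zero>"
proof (rule ccontr)
  assume c: "c \<in> carrier K" "c \<odot>\<^bsub>A\<^esub> \<one>\<^bsub>A\<^esub> = \<zero>\<^bsub>A\<^esub>" "c \<noteq> \<zero>"
  then have "inv c \<in> carrier K" "inv c \<otimes> c = \<one>" using KF.field_Units by auto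
  then have "\<one>\<^bsub>A\<^esub> = inv c \<odot>\<^bsub>A\<^esub> (c \<odot>\<^bsub>A\<^esub> \<one>\<^bsub>A\<^esub>)" using c by (metis smult_assoc1 smult_one one_closed)
  then have "\<one>\<^bsub>A\<^esub> = \<zero>\<^bsub>A\<^esub>" using c \<open>inv c \<in> carrier K\<close> by simp
  then show False using conn by (simp add: connected_graded_def)
qed

section \<open>Homogeneous components and the augmentation\<close>

definition cp where "cp = (SOME c. components A UNIV \<A> c)"

lemma cp: "components A UNIV \<A> cp"
proof -
  have "internal_direct_sum A UNIV \<A> (carrier A)"
    using conn by (simp add: connected_graded_def graded_algebra_def nat_add_monoid_def)
  then obtain c where "components A UNIV \<A> c" using internal_direct_sum_components[OF A_ab] by blast
  then show ?thesis unfolding cp_def by (rule someI[where P = "components A UNIV \<A>"])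
qed

lemma grade_sub: "a \<in> \<A> n \<Longrightarrow> a \<in> carrier A"
  using components_sub[OF cp] by simp

lemma grade_mult: "a \<in> \<A> m \<Longrightarrow> b \<in> \<A> n \<Longrightarrow> a \<otimes>\<^bsub>A\<^esub> b \<in> \<A> (m + n)"
  using conn by (simp add: connected_graded_def graded_algebra_def nat_add_monoid_def)

lemma grade_smult: "c \<in> carrier K \<Longrightarrow> a \<in> \<A> n \<Longrightarrow> c \<odot>\<^bsub>A\<^esub> a \<in> \<A> n"
  using conn submodule.smult_closed[of "\<A> n" K A c a]
  by (simp add: connected_graded_def graded_algebra_def nat_add_monoid_def)

lemma grade_one: "\<one>\<^bsub>A\<^esub> \<in> \<A> 0"
proof -
  have "graded_algebra K A nat_add_monoid \<A>" using conn by (simp add: connected_graded_def)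
  then show ?thesis by (simp add: graded_algebra_def nat_add_monoid_def)
qed

lemma grade_zero [simp]: "\<zero>\<^bsub>A\<^esub> \<in> \<A> n" using components_zero_mem[OF A_ab cp] by simp
lemma grade_add: "a \<in> \<A> n \<Longrightarrow> b \<in> \<A> n \<Longrightarrow> a \<oplus>\<^bsub>A\<^esub> b \<in> \<A> n" using components_add_mem[OF A_ab cp] by simp
lemma grade_minus: "a \<in> \<A> n \<Longrightarrow> \<ominus>\<^bsub>A\<^esub> a \<in> \<A> n" using components_minus_mem[OF A_ab cp] by simp

lemma cp_mem: "a \<in> carrier A \<Longrightarrow> cp n a \<in> \<A> n" using components_closed[OF cp] by simp
lemma cp_closed [simp]: "a \<in> carrier A \<Longrightarrow> cp n a \<in> carrier A" using components_carrier[OF cp] by simp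
lemma cp_add: "a \<in> carrier A \<Longrightarrow> b \<in> carrier A \<Longrightarrow> cp n (a \<oplus>\<^bsub>A\<^esub> b) = cp n a \<oplus>\<^bsub>A\<^esub> cp n b"
  using components_add[OF cp] by simp
lemma cp_zero [simp]: "cp n \<zero>\<^bsub>A\<^esub> = \<zero>\<^bsub>A\<^esub>" using components_zero[OF A_ab cp] by simp
lemma cp_minus: "a \<in> carrier A \<Longrightarrow> cp n (\<ominus>\<^bsub>A\<^esub> a) = \<ominus>\<^bsub>A\<^esub> cp n a" using components_minus[OF A_ab cp] by simp
lemma cp_same: "a \<in> \<A> n \<Longrightarrow> cp n a = a" using components_same[OF cp] by simp
lemma cp_other: "a \<in> \<A> n \<Longrightarrow> m \<noteq> n \<Longrightarrow> cp m a = \<zero>\<^bsub>A\<^esub>" using components_other[OF cp] by simp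
lemmas cp_eqI = components_eqI[OF A_ab cp]
lemmas A_induct = components_induct[OF A_ab cp, consumes 1, case_names zero add hom]

lemma cp_smult: "c \<in> carrier K \<Longrightarrow> a \<in> carrier A \<Longrightarrow> cp n (c \<odot>\<^bsub>A\<^esub> a) = c \<odot>\<^bsub>A\<^esub> cp n a"
proof -
  assume c: "c \<in> carrier K" and a: "a \<in> carrier A"
  from a show ?thesis
  proof (induction a rule: A_induct)
    case (hom k x)
    then show ?case using c grade_sub[OF hom(2)] by (cases "n = k") (simp_all add: cp_same cp_other[of _ k] grade_smult)
  qed (use c in \<open>simp_all add: cp_add smult_r_distr\<close>)
qed

text \<open>The case distinction stands for negative degrees, since \<open>m - n\<close> is
  truncated.\<close>

lemma cp_mult_l:
  assumes "a \<in> \<A> n" "b \<in> carrier A"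
  shows "cp m (a \<otimes>\<^bsub>A\<^esub> b) = (if m < n then \<zero>\<^bsub>A\<^esub> else a \<otimes>\<^bsub>A\<^esub> cp (m - n) b)"
  using assms(2)
proof (induction b rule: A_induct)
  case zero then show ?case using grade_sub[OF assms(1)] by simp
next
  case (add x y) then show ?case using grade_sub[OF assms(1)] by (simp add: r_distr cp_add)
next
  case (hom k b)
  then show ?case using grade_mult[OF assms(1) hom(2)] grade_sub[OF assms(1)] grade_sub[OF hom(2)]
    by (cases "m = n + k") (auto simp: cp_same cp_other[of _ "n + k"] cp_other[of b k])
qed

lemma cp_mult_r:
  assumes "b \<in> \<A> n" "a \<in> carrier A"
  shows "cp m (a \<otimes>\<^bsub>A\<^esub> b) = (if m < n then \<zero>\<^bsub>A\<^esub> else cp (m - n) a \<otimes>\<^bsub>A\<^esub> b)"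
  using assms(2)
proof (induction a rule: A_induct)
  case zero then show ?case using grade_sub[OF assms(1)] by simp
next
  case (add x y) then show ?case using grade_sub[OF assms(1)] by (simp add: l_distr cp_add)
next
  case (hom k a)
  then show ?case using grade_mult[OF hom(2) assms(1)] grade_sub[OF assms(1)] grade_sub[OF hom(2)]
    by (cases "m = k + n") (auto simp: cp_same cp_other[of _ "k + n"] cp_other[of a k])
qed

definition aug where "aug a = (THE c. c \<in> carrier K \<and> cp 0 a = c \<odot>\<^bsub>A\<^esub> \<one>\<^bsub>A\<^esub>)"

lemma smult_one_inj:
  assumes "c \<in> carrier K" "d \<in> carrier K" "c \<odot>\<^bsub>A\<^esub> \<one>\<^bsub>A\<^esub> = d \<odot>\<^bsub>A\<^esub> \<one>\<^bsub>A\<^esub>" shows "c = d"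
proof -
  have "(c \<ominus> d) \<odot>\<^bsub>A\<^esub> \<one>\<^bsub>A\<^esub> = \<zero>\<^bsub>A\<^esub>"
    using assms by (simp add: a_minus_def smult_l_distr smult_l_minus M.r_neg)
  then show ?thesis using smult_one_eq_zero[of "c \<ominus> d"] assms by simp
qed

lemma aug_ex1: "a \<in> carrier A \<Longrightarrow> \<exists>!c. c \<in> carrier K \<and> cp 0 a = c \<odot>\<^bsub>A\<^esub> \<one>\<^bsub>A\<^esub>"
proof -
  assume "a \<in> carrier A"
  then have "cp 0 a \<in> (\<lambda>c. c \<odot>\<^bsub>A\<^esub> \<one>\<^bsub>A\<^esub>) ` carrier K" using conn cp_mem[of a 0] by (simp add: connected_graded_def)
  then show ?thesis using smult_one_inj by auto
qed

lemma aug_closed [simp]: "a \<in> carrier A \<Longrightarrow> aug a \<in> carrier K"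
  and aug_eq: "a \<in> carrier A \<Longrightarrow> cp 0 a = aug a \<odot>\<^bsub>A\<^esub> \<one>\<^bsub>A\<^esub>"
  using theI'[OF aug_ex1[of a]] by (auto simp: aug_def)

lemma augI: "a \<in> carrier A \<Longrightarrow> c \<in> carrier K \<Longrightarrow> cp 0 a = c \<odot>\<^bsub>A\<^esub> \<one>\<^bsub>A\<^esub> \<Longrightarrow> aug a = c"
  by (rule smult_one_inj) (auto simp: aug_eq[symmetric])

lemma aug_zero_iff: "a \<in> carrier A \<Longrightarrow> aug a = \<zero> \<longleftrightarrow> cp 0 a = \<zero>\<^bsub>A\<^esub>"
  by (metis R.zero_closed augI aug_eq smult_one_eq_zero smult_l_null one_closed aug_closed)

lemma aug_add: "a \<in> carrier A \<Longrightarrow> b \<in> carrier A \<Longrightarrow> aug (a \<oplus>\<^bsub>A\<^esub> b) = aug a \<oplus> aug b"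
  by (rule augI) (auto simp: cp_add smult_l_distr aug_eq)

lemma aug_smult_one: "c \<in> carrier K \<Longrightarrow> aug (c \<odot>\<^bsub>A\<^esub> \<one>\<^bsub>A\<^esub>) = c"
  by (rule augI) (auto simp: cp_same grade_one grade_smult)

lemma cp0_mult: "a \<in> carrier A \<Longrightarrow> b \<in> carrier A \<Longrightarrow> cp 0 (a \<otimes>\<^bsub>A\<^esub> b) = cp 0 a \<otimes>\<^bsub>A\<^esub> cp 0 b"
proof -
  assume a: "a \<in> carrier A" and b: "b \<in> carrier A"
  from a show ?thesis
  proof (induction a rule: A_induct)
    case (hom k x)
    then show ?case using b grade_sub[OF hom(2)]
      by (cases "k = 0") (auto simp: cp_mult_l cp_same cp_other)
  qed (use b in \<open>simp_all add: cp_add l_distr\<close>)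
qed

lemma aug_mult: "a \<in> carrier A \<Longrightarrow> b \<in> carrier A \<Longrightarrow> aug (a \<otimes>\<^bsub>A\<^esub> b) = aug a \<otimes> aug b"
proof (rule augI)
  assume ab: "a \<in> carrier A" "b \<in> carrier A"
  have "cp 0 (a \<otimes>\<^bsub>A\<^esub> b) = aug a \<odot>\<^bsub>A\<^esub> (aug b \<odot>\<^bsub>A\<^esub> \<one>\<^bsub>A\<^esub>)"
    using ab by (subst cp0_mult) (simp_all add: aug_eq smult_mult_left)
  then show "cp 0 (a \<otimes>\<^bsub>A\<^esub> b) = (aug a \<otimes> aug b) \<odot>\<^bsub>A\<^esub> \<one>\<^bsub>A\<^esub>" using ab by (simp add: smult_assoc1)
qed auto

lemma aug_pos: "a \<in> \<A> n \<Longrightarrow> n > 0 \<Longrightarrow> aug a = \<zero>"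
  by (simp add: aug_zero_iff grade_sub cp_other)

text \<open>The span of the positive components is the kernel of \<open>cp 0\<close>, so the scalar
  in the definition is the degree zero component. From here on \<open>aug\<close> replaces the
  definition through spans.\<close>

lemma augmentation_eq:
  assumes a: "a \<in> carrier A" shows "augmentation K A \<A> a = aug a"
proof -
  let ?P = "{a \<in> carrier A. cp 0 a = \<zero>\<^bsub>A\<^esub>}"
  have sm: "submodule ?P K A"
    by (intro submoduleI) (auto simp: cp_add cp_minus cp_smult)
  have span: "lin_span K A (\<Union>n\<in>{0<..}. \<A> n) = ?P"
  proof
    show "lin_span K A (\<Union>n\<in>{0<..}. \<A> n) \<subseteq> ?P"
      unfolding lin_span_def using sm by (intro Inter_lower) (auto simp: grade_sub cp_other)
    show "?P \<subseteq> lin_span K A (\<Union>n\<in>{0<..}. \<A> n)"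
      unfolding lin_span_def
    proof clarify
      fix b H assume b: "b \<in> carrier A" "cp 0 b = \<zero>\<^bsub>A\<^esub>" and H: "submodule H K A" "(\<Union>n\<in>{0<..}. \<A> n) \<subseteq> H"
      have "(\<Oplus>\<^bsub>A\<^esub>i\<in>{i\<in>UNIV. cp i b \<noteq> \<zero>\<^bsub>A\<^esub>}. cp i b) \<in> H"
      proof (rule finsum_induct[where P = "\<lambda>a. a \<in> H", OF A_ab components_finite[OF cp b(1)]])
        fix i assume "i \<in> {i \<in> UNIV. cp i b \<noteq> \<zero>\<^bsub>A\<^esub>}"
        then have "i > 0" using b(2) by (cases i) auto
        then show "cp i b \<in> carrier A \<and> cp i b \<in> H" using H(2) cp_mem[OF b(1), of i] b(1) by auto
      next
        show "\<zero>\<^bsub>A\<^esub> \<in> H" using subgroup.one_closed[OF submodule.axioms(1)[OF H(1)]] by simp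
        fix x y assume "x \<in> H" "y \<in> H"
        then show "x \<oplus>\<^bsub>A\<^esub> y \<in> H" using subgroup.m_closed[OF submodule.axioms(1)[OF H(1)]] by simp
      qed
      then show "b \<in> H" using components_sum[OF cp b(1)] by simp
    qed
  qed
  have iff: "a \<ominus>\<^bsub>A\<^esub> c \<odot>\<^bsub>A\<^esub> \<one>\<^bsub>A\<^esub> \<in> ?P \<longleftrightarrow> cp 0 a = c \<odot>\<^bsub>A\<^esub> \<one>\<^bsub>A\<^esub>" if c: "c \<in> carrier K" for c
  proof -
    have "cp 0 (a \<ominus>\<^bsub>A\<^esub> c \<odot>\<^bsub>A\<^esub> \<one>\<^bsub>A\<^esub>) = cp 0 a \<ominus>\<^bsub>A\<^esub> c \<odot>\<^bsub>A\<^esub> \<one>\<^bsub>A\<^esub>"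
      using a c by (simp add: a_minus_def cp_add cp_minus cp_same[OF grade_smult[OF c grade_one]])
    then show ?thesis using a c by (simp add: M.minus_closed)
  qed
  show ?thesis unfolding augmentation_def aug_def span
    by (rule arg_cong[where f = The]) (rule ext, use iff in blast)
qed

end

section \<open>Presentations by two cubic relations\<close>

definition hom_part :: "('k, 'l) ring_scheme \<Rightarrow> nat \<Rightarrow> ('v list \<Rightarrow> 'k) \<Rightarrow> 'v list \<Rightarrow> 'k" where
  "hom_part K n f = (\<lambda>w. if length w = n then f w else \<zero>\<^bsub>K\<^esub>)"

text \<open>Closure under negation is multiplication by minus one.\<close>

lemma (in ring) ideal_criterion:
  assumes "I \<subseteq> carrier R" "\<zero> \<in> I" "\<And>a b. \<lbrakk>a \<in> I; b \<in> I\<rbrakk> \<Longrightarrow> a \<oplus> b \<in> I"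
    and l: "\<And>a b. \<lbrakk>a \<in> carrier R; b \<in> I\<rbrakk> \<Longrightarrow> a \<otimes> b \<in> I"
    and "\<And>a b. \<lbrakk>a \<in> carrier R; b \<in> I\<rbrakk> \<Longrightarrow> b \<otimes> a \<in> I"
  shows "ideal I R"
proof (rule idealI[OF ring_axioms])
  have "\<ominus> a \<in> I" if "a \<in> I" for a
    using l[of "\<ominus> \<one>" a] that assms(1) by (simp add: l_minus subset_iff)
  then show "subgroup I (add_monoid R)"
    using assms by (intro subgroup.intro) (auto simp: a_inv_def[symmetric])
qed (use assms in auto)

context cring begin

lemma hom_part_mem: "f \<in> carrier T \<Longrightarrow> hom_part R n f \<in> free_homogeneous R n"
proof -
  assume f: "f \<in> carrier T"
  have "{w. hom_part R n f w \<noteq> \<zero>} \<subseteq> {w. f w \<noteq> \<zero>}" by (auto simp: hom_part_def)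
  then show ?thesis using f
    by (auto simp: free_homogeneous_def free_algebra_simps hom_part_def intro: finite_subset split: if_splits)
qed

lemma hom_part_same: "f \<in> free_homogeneous R n \<Longrightarrow> hom_part R n f = f"
  by (rule ext) (simp add: hom_part_def free_homogeneous_def, metis)

lemma free_homogeneousD: "f \<in> free_homogeneous R n \<Longrightarrow> f \<in> carrier T"
  by (simp add: free_homogeneous_def)

lemma rder_homogeneous: "f \<in> free_homogeneous R (Suc n) \<Longrightarrow> rder c f \<in> free_homogeneous R n"
  using rder_mem by (auto simp: free_homogeneous_def rder_def)

lemma lder_homogeneous: "f \<in> free_homogeneous R (Suc n) \<Longrightarrow> lder c f \<in> free_homogeneous R n"
  using lder_mem by (auto simp: free_homogeneous_def lder_def)

lemma monomial_homogeneous: "length w = n \<Longrightarrow> monomial R w \<in> free_homogeneous R n"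
  unfolding free_homogeneous_def using monomial_mem[of w] by (auto simp: monomial_def split: if_splits)

text \<open>Cutting a word of length at most \<open>n\<close> leaves fewer than \<open>n\<close>
  letters for \<open>f\<close> unless the other factor receives the empty word.\<close>

lemma mult_low:
  assumes f: "f \<in> carrier T" and g: "g \<in> carrier T" and low: "\<And>w. length w < n \<Longrightarrow> f w = \<zero>"
    and w: "length w \<le> n"
  shows "(g \<otimes>\<^bsub>T\<^esub> f) w = g [] \<otimes> f w" "(f \<otimes>\<^bsub>T\<^esub> g) w = f w \<otimes> g []"
proof -
  have fc: "\<And>w. f w \<in> carrier R" and gc: "\<And>w. g w \<in> carrier R" using f g by (auto simp: free_algebra_simps)
  have 1: "conv R h f v = \<zero>" "conv R f h v = \<zero>" if "length v < n" "\<And>w. h w \<in> carrier R" for h v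
    using that low fc by (metis conv_support length_append linorder_not_less trans_le_add2 trans_le_add1)+
  show "(g \<otimes>\<^bsub>T\<^esub> f) w = g [] \<otimes> f w"
  proof (cases w)
    case Nil then show ?thesis using fc gc by (simp add: free_algebra_mult conv_Nil)
  next
    case (Cons c v)
    then have "conv R (lder c g) f v = \<zero>" using w gc by (intro 1) (auto simp: lder_closed)
    then show ?thesis using Cons fc gc by (simp add: free_algebra_mult conv_Cons)
  qed
  show "(f \<otimes>\<^bsub>T\<^esub> g) w = f w \<otimes> g []"
  proof (cases w rule: rev_cases)
    case Nil then show ?thesis using fc gc by (simp add: free_algebra_mult conv_Nil)
  next
    case (snoc v c)
    then have "conv R f (rder c g) v = \<zero>" using w gc by (intro 1) (auto simp: rder_closed)
    then show ?thesis using snoc fc gc by (simp add: free_algebra_mult conv_snoc)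
  qed
qed

end

text \<open>A presentation by an evaluation map instead of an isomorphism with a quotient ring.
  Generators \<open>x\<close> in \<open>A\<close> and relations \<open>r\<close> in the free algebra
  can then be replaced separately, by \<open>base_change\<close> and by
  \<open>change_relations\<close>.\<close>

locale cubic_presentation = connected_alg K A \<A> + evaluation K A x
  for K :: "('k, 'l) ring_scheme" (structure) and A :: "('k, 'a, 'b) module_scheme" and \<A> and x :: "var \<Rightarrow> 'a" +
  fixes r :: "var \<Rightarrow> var list \<Rightarrow> 'k"
  assumes x_deg: "x c \<in> \<A> 1"
    and r_hom: "r c \<in> free_homogeneous K 3"
    and r_indep: "\<lbrakk>\<alpha> \<in> carrier K; \<beta> \<in> carrier K;
        \<alpha> \<odot>\<^bsub>free_algebra K\<^esub> r Vx \<oplus>\<^bsub>free_algebra K\<^esub> \<beta> \<odot>\<^bsub>free_algebra K\<^esub> r Vy = \<zero>\<^bsub>free_algebra K\<^esub>\<rbrakk> \<Longrightarrow> \<alpha> = \<zero> \<and> \<beta> = \<zero>"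
    and ev_surj: "eval_at K A x ` carrier (free_algebra K) = carrier A"
    and ev_ker: "f \<in> carrier (free_algebra K) \<Longrightarrow>
        eval_at K A x f = \<zero>\<^bsub>A\<^esub> \<longleftrightarrow> f \<in> Idl\<^bsub>free_algebra K\<^esub> (range r)"
begin

lemma word_prod_grade: "word_prod A x w \<in> \<A> (length w)"
proof (induction w)
  case Nil then show ?case using grade_one by simp
next
  case (Cons c w) then show ?case using grade_mult[OF x_deg Cons, of c] by simp
qed

lemma cp_ev: "f \<in> carrier T \<Longrightarrow> cp n (ev f) = ev (hom_part K n f)"
proof (induction f rule: R.free_algebra_induct)
  case zero
  have "hom_part K n \<zero>\<^bsub>T\<^esub> = \<zero>\<^bsub>T\<^esub>" by (auto simp: hom_part_def free_algebra_simps)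
  then show ?case by simp
next
  case (add c u f)
  have 1: "hom_part K n (c \<odot>\<^bsub>T\<^esub> monomial K u \<oplus>\<^bsub>T\<^esub> f) =
     (if length u = n then c \<odot>\<^bsub>T\<^esub> monomial K u else \<zero>\<^bsub>T\<^esub>) \<oplus>\<^bsub>T\<^esub> hom_part K n f"
    using add(1,2) by (auto simp: hom_part_def free_algebra_simps monomial_def fun_eq_iff)
  have "hom_part K n f \<in> carrier T" using R.hom_part_mem[OF add(2)] R.free_homogeneousD by blast
  then show ?case using add word_prod_grade[of u] unfolding 1
    by (auto simp: ev_add ev_smult cp_add cp_smult cp_same cp_other[of _ "length u"])
qed

lemma ev_grade: "f \<in> free_homogeneous K n \<Longrightarrow> ev f \<in> \<A> n"
  using cp_ev[of f n] R.hom_part_same[of f n] cp_mem[of "ev f" n] R.free_homogeneousD[of f n] by simp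

lemma grade_ev: "a \<in> \<A> n \<Longrightarrow> \<exists>f\<in>free_homogeneous K n. a = ev f"
proof -
  assume a: "a \<in> \<A> n"
  then obtain f where f: "f \<in> carrier T" "a = ev f" using ev_surj grade_sub by blast
  then have "a = ev (hom_part K n f)" using cp_ev[OF f(1), of n] cp_same[OF a] by simp
  then show ?thesis using R.hom_part_mem[OF f(1)] by blast
qed

lemma r_mem [simp]: "r c \<in> carrier T" using r_hom R.free_homogeneousD by blast

lemma ideal_J: "ideal (Idl\<^bsub>T\<^esub> (range r)) T"
  by (rule TR.genideal_ideal) auto

lemma ev_r [simp]: "ev (r c) = \<zero>\<^bsub>A\<^esub>"
proof -
  have "range r \<subseteq> Idl\<^bsub>T\<^esub> (range r)" by (rule TR.genideal_self) auto
  then show ?thesis using ev_ker[of "r c"] by auto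
qed

text \<open>The two conclusions describe a set \<open>?I\<close> that is an ideal and contains the
  relations, hence contains the whole kernel. So \<open>A\<close> agrees with the free algebra below
  degree three, and the relations span the kernel in degree three.\<close>

lemma ker_low:
  assumes f: "f \<in> carrier T" and z: "ev f = \<zero>\<^bsub>A\<^esub>"
  shows "length w < 3 \<Longrightarrow> f w = \<zero>"
    and "\<exists>\<alpha>\<in>carrier K. \<exists>\<beta>\<in>carrier K. \<forall>w. length w = 3 \<longrightarrow> f w = \<alpha> \<otimes> r Vx w \<oplus> \<beta> \<otimes> r Vy w"
proof -
  let ?I = "{f \<in> carrier T. (\<forall>w. length w < 3 \<longrightarrow> f w = \<zero>) \<and>
     (\<exists>\<alpha>\<in>carrier K. \<exists>\<beta>\<in>carrier K. \<forall>w. length w = 3 \<longrightarrow> f w = \<alpha> \<otimes> r Vx w \<oplus> \<beta> \<otimes> r Vy w)}"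
  have rc: "r c w \<in> carrier K" for c w using r_mem[of c] by (simp add: free_algebra_simps)
  have memI: "f \<in> ?I" if "f \<in> carrier T" "\<And>w. length w < 3 \<Longrightarrow> f w = \<zero>" "\<alpha> \<in> carrier K" "\<beta> \<in> carrier K"
    "\<And>w. length w = 3 \<Longrightarrow> f w = \<alpha> \<otimes> r Vx w \<oplus> \<beta> \<otimes> r Vy w" for f \<alpha> \<beta> using that by blast
  have rl: "length w \<noteq> 3 \<Longrightarrow> r c w = \<zero>" for c w using r_hom[of c] by (auto simp: free_homogeneous_def)
  have "ideal ?I T"
  proof (rule TR.ideal_criterion)
    show "\<zero>\<^bsub>T\<^esub> \<in> ?I" using rc by (auto simp: free_algebra_simps intro!: bexI[of _ \<zero>])
  next
    fix a b assume "a \<in> ?I" and "b \<in> ?I"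
    then obtain \<alpha> \<beta> \<alpha>' \<beta>' where 1: "\<alpha> \<in> carrier K" "\<beta> \<in> carrier K" "\<alpha>' \<in> carrier K" "\<beta>' \<in> carrier K"
      "\<And>w. length w = 3 \<Longrightarrow> a w = \<alpha> \<otimes> r Vx w \<oplus> \<beta> \<otimes> r Vy w"
      "\<And>w. length w = 3 \<Longrightarrow> b w = \<alpha>' \<otimes> r Vx w \<oplus> \<beta>' \<otimes> r Vy w"
      and ab: "a \<in> carrier T" "b \<in> carrier T" "\<And>w. length w < 3 \<Longrightarrow> a w = \<zero>" "\<And>w. length w < 3 \<Longrightarrow> b w = \<zero>"
      by blast
    have "a w \<oplus> b w = (\<alpha> \<oplus> \<alpha>') \<otimes> r Vx w \<oplus> (\<beta> \<oplus> \<beta>') \<otimes> r Vy w" if "length w = 3" for w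
      using 1 rc that by (simp add: R.l_distr R.a_ac)
    moreover have "a w \<oplus> b w = \<zero>" if "length w < 3" for w using ab that by simp
    ultimately show "a \<oplus>\<^bsub>T\<^esub> b \<in> ?I" using 1 TR.a_closed[OF ab(1,2)]
      by (intro memI[of _ "\<alpha> \<oplus> \<alpha>'" "\<beta> \<oplus> \<beta>'"]) (simp_all add: free_algebra_simps(3))
  next
    fix g b assume g: "g \<in> carrier T" and "b \<in> ?I"
    then obtain \<alpha> \<beta> where 1: "\<alpha> \<in> carrier K" "\<beta> \<in> carrier K"
      "\<And>w. length w = 3 \<Longrightarrow> b w = \<alpha> \<otimes> r Vx w \<oplus> \<beta> \<otimes> r Vy w"
      and b: "b \<in> carrier T" "\<And>w. length w < 3 \<Longrightarrow> b w = \<zero>"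
      by blast
    have gc: "g [] \<in> carrier K" using g by (simp add: free_algebra_simps)
    note low = R.mult_low[OF b(1) g b(2)]
    have "(g \<otimes>\<^bsub>T\<^esub> b) w = (g [] \<otimes> \<alpha>) \<otimes> r Vx w \<oplus> (g [] \<otimes> \<beta>) \<otimes> r Vy w"
      "(b \<otimes>\<^bsub>T\<^esub> g) w = (g [] \<otimes> \<alpha>) \<otimes> r Vx w \<oplus> (g [] \<otimes> \<beta>) \<otimes> r Vy w" if "length w = 3" for w
      using 1 rc gc that low[of 3 w] by (simp_all add: R.r_distr R.m_assoc R.m_comm[of _ "g []"])
    moreover have "(g \<otimes>\<^bsub>T\<^esub> b) w = \<zero>" "(b \<otimes>\<^bsub>T\<^esub> g) w = \<zero>" if "length w < 3" for w
      using b(2)[OF that] gc that low[of 3 w] by simp_all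
    ultimately show "g \<otimes>\<^bsub>T\<^esub> b \<in> ?I" "b \<otimes>\<^bsub>T\<^esub> g \<in> ?I"
      using 1 g b gc by (intro memI[of _ "g [] \<otimes> \<alpha>" "g [] \<otimes> \<beta>"]; simp)+
  qed auto
  moreover have "r c \<in> ?I" for c
  proof (cases c)
    case Vx then show ?thesis using rc rl by (intro memI[of _ \<one> \<zero>]) auto
  next
    case Vy then show ?thesis using rc rl by (intro memI[of _ \<zero> \<one>]) auto
  qed
  then have "range r \<subseteq> ?I" by (rule image_subsetI)
  ultimately have "Idl\<^bsub>T\<^esub> (range r) \<subseteq> ?I" by (rule TR.genideal_minimal)
  then have "f \<in> ?I" using ev_ker[OF f] z by blast
  then show "length w < 3 \<Longrightarrow> f w = \<zero>" and "\<exists>\<alpha>\<in>carrier K. \<exists>\<beta>\<in>carrier K. \<forall>w. length w = 3 \<longrightarrow> f w = \<alpha> \<otimes> r Vx w \<oplus> \<beta> \<otimes> r Vy w"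
    by auto
qed

lemma ker_homogeneous_low: "f \<in> free_homogeneous K n \<Longrightarrow> n < 3 \<Longrightarrow> ev f = \<zero>\<^bsub>A\<^esub> \<Longrightarrow> f = \<zero>\<^bsub>T\<^esub>"
proof -
  assume f: "f \<in> free_homogeneous K n" and n: "n < 3" and z: "ev f = \<zero>\<^bsub>A\<^esub>"
  have "f w = \<zero>" for w
  proof (cases "length w = n")
    case True then show ?thesis using ker_low(1)[OF R.free_homogeneousD[OF f] z] n by simp
  next
    case False then show ?thesis using f unfolding free_homogeneous_def by blast
  qed
  then show ?thesis by (simp add: free_algebra_simps(2) fun_eq_iff)
qed

lemma ker_3:
  assumes f: "f \<in> free_homogeneous K 3" and z: "ev f = \<zero>\<^bsub>A\<^esub>"
  obtains \<alpha> \<beta> where "\<alpha> \<in> carrier K" "\<beta> \<in> carrier K" "f = \<alpha> \<odot>\<^bsub>T\<^esub> r Vx \<oplus>\<^bsub>T\<^esub> \<beta> \<odot>\<^bsub>T\<^esub> r Vy"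
proof -
  have fT: "f \<in> carrier T" using f R.free_homogeneousD by blast
  obtain \<alpha> \<beta> where ab: "\<alpha> \<in> carrier K" "\<beta> \<in> carrier K"
    "\<And>w. length w = 3 \<Longrightarrow> f w = \<alpha> \<otimes> r Vx w \<oplus> \<beta> \<otimes> r Vy w" using ker_low(2)[OF fT z] by blast
  have "f w = \<alpha> \<otimes> r Vx w \<oplus> \<beta> \<otimes> r Vy w" for w
  proof (cases "length w = 3")
    case False
    then have "f w = \<zero>" "r Vx w = \<zero>" "r Vy w = \<zero>"
      using f r_hom[of Vx] r_hom[of Vy] unfolding free_homogeneous_def by blast+
    then show ?thesis using ab by simp
  qed (rule ab)
  then show ?thesis using that[OF ab(1,2)] by (simp add: free_algebra_simps fun_eq_iff)
qed

text \<open>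
  Each relation is \<open>r i = (\<Sum>c. rder c (r i) c)\<close>, so \<open>m\<close> is the matrix of the second map in the minimal
  resolution of the trivial module.
\<close>

definition m where "m i c = ev (rder c (r i))"

lemma m_grade: "m i c \<in> \<A> 2"
  unfolding m_def using r_hom[of i] R.rder_homogeneous[of "r i" 2 c] by (intro ev_grade) (simp add: numeral_3_eq_3)

lemma m_closed [simp]: "m i c \<in> carrier A" using m_grade grade_sub by blast

text \<open>Exactness at the middle term, formulated in the free algebra. The conclusion again
  describes an ideal containing the relations. Multiplication from the left acts on \<open>a\<close>
  and \<open>b\<close>; multiplication from the right yields \<open>f\<close> times a derivative,
  which vanishes in \<open>A\<close>, and a scalar multiple of the old derivative.\<close>

lemma ker_rder:
  assumes f: "f \<in> carrier T" and z: "ev f = \<zero>\<^bsub>A\<^esub>"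
  shows "\<exists>a\<in>carrier A. \<exists>b\<in>carrier A. \<forall>c. ev (rder c f) = a \<otimes>\<^bsub>A\<^esub> m Vx c \<oplus>\<^bsub>A\<^esub> b \<otimes>\<^bsub>A\<^esub> m Vy c"
proof -
  let ?I = "{f \<in> carrier T. ev f = \<zero>\<^bsub>A\<^esub> \<and>
     (\<exists>a\<in>carrier A. \<exists>b\<in>carrier A. \<forall>c. ev (rder c f) = a \<otimes>\<^bsub>A\<^esub> m Vx c \<oplus>\<^bsub>A\<^esub> b \<otimes>\<^bsub>A\<^esub> m Vy c)}"
  have memI: "f \<in> ?I" if "f \<in> carrier T" "ev f = \<zero>\<^bsub>A\<^esub>" "a \<in> carrier A" "b \<in> carrier A"
    "\<And>c. ev (rder c f) = a \<otimes>\<^bsub>A\<^esub> m Vx c \<oplus>\<^bsub>A\<^esub> b \<otimes>\<^bsub>A\<^esub> m Vy c" for f a b using that by blast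
  have "ideal ?I T"
  proof (rule TR.ideal_criterion)
    have "rder c \<zero>\<^bsub>T\<^esub> = \<zero>\<^bsub>T\<^esub>" for c :: var by (auto simp: rder_def free_algebra_simps)
    then show "\<zero>\<^bsub>T\<^esub> \<in> ?I" by (intro memI[of _ "\<zero>\<^bsub>A\<^esub>" "\<zero>\<^bsub>A\<^esub>"]) auto
  next
    fix f g assume "f \<in> ?I" and "g \<in> ?I"
    then obtain a b a' b' where 1: "a \<in> carrier A" "b \<in> carrier A" "a' \<in> carrier A" "b' \<in> carrier A"
      "\<And>c. ev (rder c f) = a \<otimes>\<^bsub>A\<^esub> m Vx c \<oplus>\<^bsub>A\<^esub> b \<otimes>\<^bsub>A\<^esub> m Vy c"
      "\<And>c. ev (rder c g) = a' \<otimes>\<^bsub>A\<^esub> m Vx c \<oplus>\<^bsub>A\<^esub> b' \<otimes>\<^bsub>A\<^esub> m Vy c"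
      and fg: "f \<in> carrier T" "g \<in> carrier T" "ev f = \<zero>\<^bsub>A\<^esub>" "ev g = \<zero>\<^bsub>A\<^esub>"
      by blast
    have r: "rder c (f \<oplus>\<^bsub>T\<^esub> g) = rder c f \<oplus>\<^bsub>T\<^esub> rder c g" for c
      by (auto simp: rder_def free_algebra_simps)
    have "ev (rder c (f \<oplus>\<^bsub>T\<^esub> g)) = (a \<oplus>\<^bsub>A\<^esub> a') \<otimes>\<^bsub>A\<^esub> m Vx c \<oplus>\<^bsub>A\<^esub> (b \<oplus>\<^bsub>A\<^esub> b') \<otimes>\<^bsub>A\<^esub> m Vy c" for c
      unfolding r using 1 fg by (simp add: ev_add R.rder_mem l_distr M.add.m_ac)
    then show "f \<oplus>\<^bsub>T\<^esub> g \<in> ?I" using 1 fg by (intro memI[of _ "a \<oplus>\<^bsub>A\<^esub> a'" "b \<oplus>\<^bsub>A\<^esub> b'"]) (auto simp: ev_add)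
  next
    fix g f assume g: "g \<in> carrier T" and "f \<in> ?I"
    then obtain a b where 1: "a \<in> carrier A" "b \<in> carrier A"
      "\<And>c. ev (rder c f) = a \<otimes>\<^bsub>A\<^esub> m Vx c \<oplus>\<^bsub>A\<^esub> b \<otimes>\<^bsub>A\<^esub> m Vy c"
      and f: "f \<in> carrier T" "ev f = \<zero>\<^bsub>A\<^esub>"
      by blast
    \<comment> \<open>This removes the term of the Leibniz rule that would contain the derivative of
      \<open>g\<close>.\<close>
    have f0: "f [] = \<zero>" using ker_low(1)[OF f, of "[]"] by simp
    have g0: "g [] \<in> carrier K" using g by (simp add: free_algebra_simps)
    have "\<zero> \<odot>\<^bsub>T\<^esub> h = \<zero>\<^bsub>T\<^esub>" if "h \<in> carrier T" for h :: "var list \<Rightarrow> 'k" using that by (auto simp: free_algebra_simps)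
    then have "ev (rder c (g \<otimes>\<^bsub>T\<^esub> f)) = (ev g \<otimes>\<^bsub>A\<^esub> a) \<otimes>\<^bsub>A\<^esub> m Vx c \<oplus>\<^bsub>A\<^esub> (ev g \<otimes>\<^bsub>A\<^esub> b) \<otimes>\<^bsub>A\<^esub> m Vy c" for c
      using f g 1 by (simp add: R.rder_mult f0 ev_add ev_mult R.rder_mem r_distr m_assoc)
    then show "g \<otimes>\<^bsub>T\<^esub> f \<in> ?I" using 1 f g
      by (intro memI[of _ "ev g \<otimes>\<^bsub>A\<^esub> a" "ev g \<otimes>\<^bsub>A\<^esub> b"]) (auto simp: ev_mult)
    have "ev (rder c (f \<otimes>\<^bsub>T\<^esub> g)) = (g [] \<odot>\<^bsub>A\<^esub> a) \<otimes>\<^bsub>A\<^esub> m Vx c \<oplus>\<^bsub>A\<^esub> (g [] \<odot>\<^bsub>A\<^esub> b) \<otimes>\<^bsub>A\<^esub> m Vy c" for c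
      using f g g0 1 by (simp add: R.rder_mult ev_add ev_mult ev_smult R.rder_mem smult_r_distr smult_mult_left TA.smult_closed)
    then show "f \<otimes>\<^bsub>T\<^esub> g \<in> ?I" using 1 f g g0
      by (intro memI[of _ "g [] \<odot>\<^bsub>A\<^esub> a" "g [] \<odot>\<^bsub>A\<^esub> b"]) (auto simp: ev_mult)
  qed auto
  moreover have "r c \<in> ?I" for c
  proof (cases c)
    case Vx then show ?thesis by (intro memI[of _ "\<one>\<^bsub>A\<^esub>" "\<zero>\<^bsub>A\<^esub>"]) (auto simp: m_def[symmetric])
  next
    case Vy then show ?thesis by (intro memI[of _ "\<zero>\<^bsub>A\<^esub>" "\<one>\<^bsub>A\<^esub>"]) (auto simp: m_def[symmetric])
  qed
  then have "range r \<subseteq> ?I" by (rule image_subsetI)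
  ultimately have "Idl\<^bsub>T\<^esub> (range r) \<subseteq> ?I" by (rule TR.genideal_minimal)
  then show ?thesis using ev_ker[OF f] z by blast
qed

text \<open>Lifts \<open>P\<close> and \<open>Q\<close> of \<open>p\<close> and \<open>q\<close> are
  the right derivatives of the polynomial that they define, which lies in the kernel;
  \<open>ker_rder\<close> applies to it.\<close>

lemma exact_1:
  assumes p: "p \<in> carrier A" "q \<in> carrier A" and z: "p \<otimes>\<^bsub>A\<^esub> x Vx \<oplus>\<^bsub>A\<^esub> q \<otimes>\<^bsub>A\<^esub> x Vy = \<zero>\<^bsub>A\<^esub>"
  obtains a b where "a \<in> carrier A" "b \<in> carrier A"
    "p = a \<otimes>\<^bsub>A\<^esub> m Vx Vx \<oplus>\<^bsub>A\<^esub> b \<otimes>\<^bsub>A\<^esub> m Vy Vx" "q = a \<otimes>\<^bsub>A\<^esub> m Vx Vy \<oplus>\<^bsub>A\<^esub> b \<otimes>\<^bsub>A\<^esub> m Vy Vy"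
proof -
  obtain P Q where PQ: "P \<in> carrier T" "p = ev P" "Q \<in> carrier T" "q = ev Q" using p ev_surj by blast
  let ?f = "P \<otimes>\<^bsub>T\<^esub> monomial K [Vx] \<oplus>\<^bsub>T\<^esub> Q \<otimes>\<^bsub>T\<^esub> monomial K [Vy]"
  have f: "?f \<in> carrier T" using PQ by simp
  have "ev ?f = \<zero>\<^bsub>A\<^esub>" using PQ z by (simp add: ev_add ev_mult)
  from ker_rder[OF f this] obtain a b where ab: "a \<in> carrier A" "b \<in> carrier A"
    "\<And>c. ev (rder c ?f) = a \<otimes>\<^bsub>A\<^esub> m Vx c \<oplus>\<^bsub>A\<^esub> b \<otimes>\<^bsub>A\<^esub> m Vy c" by blast
  have "P w \<in> carrier K" "Q w \<in> carrier K" for w using PQ by (auto simp: free_algebra_simps)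
  then have "rder Vx ?f = P" "rder Vy ?f = Q"
    using PQ by (auto simp: rder_def free_algebra_simps(3) R.mult_letter_r fun_eq_iff)
  with ab(3)[of Vx] ab(3)[of Vy] PQ that[OF ab(1,2)] show ?thesis by simp
qed

lemma m_rel: "m i Vx \<otimes>\<^bsub>A\<^esub> x Vx \<oplus>\<^bsub>A\<^esub> m i Vy \<otimes>\<^bsub>A\<^esub> x Vy = \<zero>\<^bsub>A\<^esub>"
proof -
  have "r i [] = \<zero>" using r_hom[of i] unfolding free_homogeneous_def by force
  from R.right_division[OF r_mem this] have "ev (r i) = m i Vx \<otimes>\<^bsub>A\<^esub> x Vx \<oplus>\<^bsub>A\<^esub> m i Vy \<otimes>\<^bsub>A\<^esub> x Vy"
    by (metis (no_types, lifting) R.monomial_mem R.rder_mem TR.m_closed ev_add ev_monomial ev_mult m_def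
       r_mem r_one word_prod_simps x_closed)
  then show ?thesis by simp
qed

lemma exact_0:
  assumes a: "a \<in> carrier A" "aug a = \<zero>"
  obtains p q where "p \<in> carrier A" "q \<in> carrier A" "a = p \<otimes>\<^bsub>A\<^esub> x Vx \<oplus>\<^bsub>A\<^esub> q \<otimes>\<^bsub>A\<^esub> x Vy"
proof -
  obtain f where f: "f \<in> carrier T" "a = ev f" using a ev_surj by blast
  have f0: "f [] \<in> carrier K" using f by (simp add: free_algebra_simps)
  have "hom_part K 0 f = f [] \<odot>\<^bsub>T\<^esub> \<one>\<^bsub>T\<^esub>"
    using f0 by (auto simp: hom_part_def free_algebra_simps monomial_def fun_eq_iff)
  then have "cp 0 a = f [] \<odot>\<^bsub>A\<^esub> \<one>\<^bsub>A\<^esub>" using cp_ev[OF f(1), of 0] f f0 by (simp add: ev_smult)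
  then have "f [] = \<zero>" using smult_one_eq_zero[OF f0] a by (simp add: aug_zero_iff)
  from R.right_division[OF f(1) this] have "ev f = ev (rder Vx f) \<otimes>\<^bsub>A\<^esub> x Vx \<oplus>\<^bsub>A\<^esub> ev (rder Vy f) \<otimes>\<^bsub>A\<^esub> x Vy"
    by (metis (no_types, lifting) R.monomial_mem R.rder_mem TR.m_closed ev_add ev_monomial ev_mult f(1)
       r_one word_prod_simps x_closed)
  then show ?thesis using f R.rder_mem[OF f(1)]
    by (intro that[of "ev (rder Vx f)" "ev (rder Vy f)"]) auto
qed

end

text \<open>Solves the definition of \<open>s2\<close> in \<open>chain_homotopy\<close> for the
  round trip.\<close>

lemma (in abelian_group) minus_minus_split:
  assumes "a \<in> carrier G" "b \<in> carrier G" "c \<in> carrier G"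
  shows "a = b \<oplus> c \<oplus> (a \<ominus> b \<ominus> c)"
proof -
  have "b \<oplus> c \<oplus> (a \<ominus> b \<ominus> c) = a \<oplus> (b \<oplus> \<ominus> b) \<oplus> (c \<oplus> \<ominus> c)"
    using assms by (simp only: a_minus_def add.m_ac a_closed a_inv_closed)
  then show ?thesis using assms by (simp add: r_neg)
qed

lemma (in abelian_group) minus_self_eq: "a \<in> carrier G \<Longrightarrow> b \<in> carrier G \<Longrightarrow> a \<ominus> b = \<zero> \<longleftrightarrow> a = b"
  by (metis a_minus_def add.inv_closed minus_equality minus_minus r_neg a_comm)

lemma finite_UNIV_var: "finite (UNIV :: var set)"
  by (simp add: var_UNIV)

section \<open>Graded submodules and free modules\<close>

text \<open>The sum condition follows from \<open>faithful\<close>: the difference between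
  \<open>v\<close> and the sum of its components has zero components.\<close>

lemma componentsI:
  assumes M: "abelian_group M"
    and mem: "\<And>i v. i \<in> I \<Longrightarrow> v \<in> carrier M \<Longrightarrow> c i v \<in> V i"
    and sub: "\<And>i. i \<in> I \<Longrightarrow> V i \<subseteq> carrier M"
    and add: "\<And>i u v. i \<in> I \<Longrightarrow> u \<in> carrier M \<Longrightarrow> v \<in> carrier M \<Longrightarrow> c i (u \<oplus>\<^bsub>M\<^esub> v) = c i u \<oplus>\<^bsub>M\<^esub> c i v"
    and same: "\<And>i v. i \<in> I \<Longrightarrow> v \<in> V i \<Longrightarrow> c i v = v"
    and other: "\<And>i j v. i \<in> I \<Longrightarrow> j \<in> I \<Longrightarrow> i \<noteq> j \<Longrightarrow> v \<in> V j \<Longrightarrow> c i v = \<zero>\<^bsub>M\<^esub>"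
    and fin: "\<And>v. v \<in> carrier M \<Longrightarrow> finite {i\<in>I. c i v \<noteq> \<zero>\<^bsub>M\<^esub>}"
    and faithful: "\<And>v. v \<in> carrier M \<Longrightarrow> (\<And>i. i \<in> I \<Longrightarrow> c i v = \<zero>\<^bsub>M\<^esub>) \<Longrightarrow> v = \<zero>\<^bsub>M\<^esub>"
  shows "components M I V c"
proof -
  interpret abelian_group M by fact
  have cl: "c i v \<in> carrier M" if "i \<in> I" "v \<in> carrier M" for i v using mem[OF that] sub[OF that(1)] by blast
  have "v = (\<Oplus>\<^bsub>M\<^esub>i\<in>{i\<in>I. c i v \<noteq> \<zero>\<^bsub>M\<^esub>}. c i v)" if v: "v \<in> carrier M" for v
  proof -
    let ?S = "{i\<in>I. c i v \<noteq> \<zero>\<^bsub>M\<^esub>}" and ?u = "\<Oplus>\<^bsub>M\<^esub>i\<in>{i\<in>I. c i v \<noteq> \<zero>\<^bsub>M\<^esub>}. c i v"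
    have u: "?u \<in> carrier M" using cl v by (intro finsum_closed) auto
    have cu: "c i ?u = c i v" if i: "i \<in> I" for i
    proof -
      have "c i ?u = (\<Oplus>\<^bsub>M\<^esub>j\<in>?S. c i (c j v))"
        using i v cl add fin by (intro additive_finsum[OF M M]) auto
      also have "\<dots> = (\<Oplus>\<^bsub>M\<^esub>j\<in>?S. if i = j then c j v else \<zero>\<^bsub>M\<^esub>)"
        using i v cl same other mem by (intro finsum_cong') auto
      also have "\<dots> = c i v"
      proof (cases "i \<in> ?S")
        case True
        then show ?thesis using finsum_singleton[OF True fin[OF v], of "\<lambda>j. c j v"] cl v by auto
      next
        case False
        then have "(\<Oplus>\<^bsub>M\<^esub>j\<in>?S. if i = j then c j v else \<zero>\<^bsub>M\<^esub>) = (\<Oplus>\<^bsub>M\<^esub>j\<in>?S. \<zero>\<^bsub>M\<^esub>)" by (intro finsum_cong') auto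
        then show ?thesis using False i by simp
      qed
      finally show ?thesis .
    qed
    have cz: "c i \<zero>\<^bsub>M\<^esub> = \<zero>\<^bsub>M\<^esub>" if "i \<in> I" for i
      using that add cl by (intro additive_zero[OF M M]) auto
    have "v \<ominus>\<^bsub>M\<^esub> ?u = \<zero>\<^bsub>M\<^esub>"
    proof (rule faithful)
      fix i assume i: "i \<in> I"
      have "c i (\<ominus>\<^bsub>M\<^esub> ?u) = \<ominus>\<^bsub>M\<^esub> c i ?u" using i add cl u by (intro additive_minus[OF M M]) auto
      then have "c i (v \<ominus>\<^bsub>M\<^esub> ?u) = c i v \<oplus>\<^bsub>M\<^esub> \<ominus>\<^bsub>M\<^esub> c i v"
        using add[OF i v, of "\<ominus>\<^bsub>M\<^esub> ?u"] u cu[OF i] by (simp add: a_minus_def)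
      then show "c i (v \<ominus>\<^bsub>M\<^esub> ?u) = \<zero>\<^bsub>M\<^esub>" using cl[OF i v] by (simp add: r_neg)
    qed (use u v in simp)
    then show ?thesis using minus_self_eq[OF v u] by simp
  qed
  then show ?thesis unfolding components_def using mem sub add same other fin by auto
qed

definition restrict_carrier :: "('a, 'm) module \<Rightarrow> 'm set \<Rightarrow> ('a, 'm) module" where
  "restrict_carrier M N = M\<lparr>carrier := N\<rparr>"

lemma restrict_carrier_simps [simp]:
  "carrier (restrict_carrier M N) = N" "add (restrict_carrier M N) = add M"
  "ring.zero (restrict_carrier M N) = ring.zero M" "smult (restrict_carrier M N) = smult M"
  by (simp_all add: restrict_carrier_def)

lemma restrict_carrier_module:
  assumes M: "left_module A M" and N: "N \<subseteq> carrier M" "\<zero>\<^bsub>M\<^esub> \<in> N"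
    "\<And>u v. u \<in> N \<Longrightarrow> v \<in> N \<Longrightarrow> u \<oplus>\<^bsub>M\<^esub> v \<in> N" "\<And>a v. a \<in> carrier A \<Longrightarrow> v \<in> N \<Longrightarrow> a \<odot>\<^bsub>M\<^esub> v \<in> N"
  shows "left_module A (restrict_carrier M N)"
proof -
  interpret M: left_module A M by fact
  have c: "v \<in> carrier M" if "v \<in> N" for v using N(1) that by auto
  show ?thesis
  proof (rule left_moduleI)
    show "abelian_group (restrict_carrier M N)"
    proof (rule abelian_groupI)
      fix v assume "v \<in> carrier (restrict_carrier M N)"
      then have v: "v \<in> N" by simp
      have "(\<ominus>\<^bsub>A\<^esub> \<one>\<^bsub>A\<^esub>) \<odot>\<^bsub>M\<^esub> v \<in> N" using N(4)[OF _ v] by simp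
      moreover have "(\<ominus>\<^bsub>A\<^esub> \<one>\<^bsub>A\<^esub>) \<odot>\<^bsub>M\<^esub> v = \<ominus>\<^bsub>M\<^esub> v" using c[OF v] by (simp add: M.act_l_minus M.act_one)
      ultimately show "\<exists>y\<in>carrier (restrict_carrier M N). y \<oplus>\<^bsub>restrict_carrier M N\<^esub> v = \<zero>\<^bsub>restrict_carrier M N\<^esub>"
        using c[OF v] by (intro bexI[of _ "\<ominus>\<^bsub>M\<^esub> v"]) (auto simp: M.M.l_neg)
    qed (auto simp: N c M.M.a_ac)
  qed (auto simp: N c M.R.ring_axioms M.act_l_distr M.act_r_distr M.act_assoc M.act_one)
qed

lemma restrict_carrier_components:
  assumes M: "abelian_group M" and c: "components M I V c" and N: "abelian_group (restrict_carrier M N)" "N \<subseteq> carrier M"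
    and st: "\<And>i v. i \<in> I \<Longrightarrow> v \<in> N \<Longrightarrow> c i v \<in> N"
  shows "components (restrict_carrier M N) I (\<lambda>i. V i \<inter> N) c"
proof (rule componentsI[OF N(1)])
  fix v assume "v \<in> carrier (restrict_carrier M N)" and z: "\<And>i. i \<in> I \<Longrightarrow> c i v = \<zero>\<^bsub>restrict_carrier M N\<^esub>"
  then have v: "v \<in> carrier M" using N(2) by auto
  interpret M: abelian_group M by fact
  show "v = \<zero>\<^bsub>restrict_carrier M N\<^esub>"
    using components_eqI[OF M c v M.zero_closed] z by (simp add: components_zero[OF M c])
next
  fix v assume "v \<in> carrier (restrict_carrier M N)"
  then show "finite {i \<in> I. c i v \<noteq> \<zero>\<^bsub>restrict_carrier M N\<^esub>}" using components_finite[OF c, of v] N(2) by auto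
next
  fix i v assume "i \<in> I" "v \<in> carrier (restrict_carrier M N)"
  then show "c i v \<in> V i \<inter> N" using st components_closed[OF c, of i v] N(2) by auto
next
  fix i u v assume "i \<in> I" "u \<in> carrier (restrict_carrier M N)" "v \<in> carrier (restrict_carrier M N)"
  then show "c i (u \<oplus>\<^bsub>restrict_carrier M N\<^esub> v) = c i u \<oplus>\<^bsub>restrict_carrier M N\<^esub> c i v"
    using components_add[OF c, of i u v] N(2) by (auto simp: subset_iff)
qed (auto simp: components_same[OF c] components_other[OF c])

context connected_alg begin

section \<open>Integer gradings on the algebra and on its free module of rank two\<close>

definition cpz where "cpz j a = (if j < 0 then \<zero>\<^bsub>A\<^esub> else cp (nat j) a)" for j :: int

lemma cpz_closed [simp]: "a \<in> carrier A \<Longrightarrow> cpz j a \<in> carrier A"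
  by (simp add: cpz_def)

lemma regular_components: "components A UNIV (regular_grading A \<A>) cpz"
proof (rule componentsI[OF A_ab])
  fix v assume v: "v \<in> carrier A"
  have "{i \<in> UNIV. cpz i v \<noteq> \<zero>\<^bsub>A\<^esub>} \<subseteq> int ` {i \<in> UNIV. cp i v \<noteq> \<zero>\<^bsub>A\<^esub>}"
    by (auto simp: cpz_def split: if_splits intro!: image_eqI[of _ int "nat _"])
  then show "finite {i \<in> UNIV. cpz i v \<noteq> \<zero>\<^bsub>A\<^esub>}"
    using components_finite[OF cp v] finite_surj by blast
  assume "\<And>i. i \<in> UNIV \<Longrightarrow> cpz i v = \<zero>\<^bsub>A\<^esub>"
  then have "cp n v = \<zero>\<^bsub>A\<^esub>" for n using \<open>\<And>i. i \<in> UNIV \<Longrightarrow> cpz i v = \<zero>\<^bsub>A\<^esub>\<close>[of "int n"] by (simp add: cpz_def)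
  then show "v = \<zero>\<^bsub>A\<^esub>" by - (rule cp_eqI[OF v M.zero_closed], simp)
next
  show "i \<noteq> j \<Longrightarrow> v \<in> regular_grading A \<A> j \<Longrightarrow> cpz i v = \<zero>\<^bsub>A\<^esub>" for i j v
    by (auto simp: cpz_def regular_grading_def cp_other[of v "nat j"] split: if_splits)
qed (auto simp: cpz_def regular_grading_def cp_mem cp_add cp_same dest: grade_sub split: if_splits)

lemma components_regular_module:
  assumes c: "components M I V c" and N: "carrier N = carrier M" "add N = add M" "ring.zero N = ring.zero M"
    and ab: "abelian_group M" "abelian_group N"
  shows "components N I V c"
proof (rule componentsI[OF ab(2)])
  interpret Ma: abelian_group M by (rule ab)
  fix v assume v: "v \<in> carrier N" and z: "\<And>i. i \<in> I \<Longrightarrow> c i v = \<zero>\<^bsub>N\<^esub>"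
  have "v = \<zero>\<^bsub>M\<^esub>"
    using v z N by (intro components_eqI[OF ab(1) c, of v "\<zero>\<^bsub>M\<^esub>"]) (auto simp: components_zero[OF ab(1) c])
  then show "v = \<zero>\<^bsub>N\<^esub>" by (simp add: N)
qed (use N c in \<open>auto dest: components_closed components_sub components_add components_same components_other components_finite\<close>)

lemma regular_grading_act:
  assumes "a \<in> \<A> n" "b \<in> regular_grading A \<A> j" shows "a \<otimes>\<^bsub>A\<^esub> b \<in> regular_grading A \<A> (int n + j)"
proof (cases "j < 0")
  case True
  then have "a \<otimes>\<^bsub>A\<^esub> b = \<zero>\<^bsub>A\<^esub>" using assms grade_sub[OF assms(1)] by (simp add: regular_grading_def)
  then show ?thesis by (simp add: regular_grading_def)
next
  case False
  then have "nat (int n + j) = n + nat j" "\<not> int n + j < 0" by auto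
  then show ?thesis using False assms grade_mult[OF assms(1), of b "nat j"] by (simp add: regular_grading_def)
qed

lemma regular_grading_act_r:
  assumes "b \<in> \<A> n" "a \<in> regular_grading A \<A> j" shows "a \<otimes>\<^bsub>A\<^esub> b \<in> regular_grading A \<A> (j + int n)"
proof (cases "j < 0")
  case True
  then have "a \<otimes>\<^bsub>A\<^esub> b = \<zero>\<^bsub>A\<^esub>" using assms grade_sub[OF assms(1)] by (simp add: regular_grading_def)
  then show ?thesis by (simp add: regular_grading_def)
next
  case False
  then have "nat (j + int n) = nat j + n" "\<not> j + int n < 0" by auto
  then show ?thesis using False assms(2) grade_mult[OF _ assms(1), of a "nat j"] by (simp add: regular_grading_def)
qed

lemma regular_gmod: "gmod A \<A> (regular_module A) (regular_grading A \<A>) cpz"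
  unfolding gmod_def
proof (intro conjI allI ballI)
  show L: "left_module A (regular_module A)" by (rule regular_module_is_module)
  show "components (regular_module A) UNIV (regular_grading A \<A>) cpz"
    by (rule components_regular_module[OF regular_components _ _ _ A_ab left_module_abelian_group[OF L]])
      (simp_all add: regular_module_def)
qed (simp add: regular_grading_act)

abbreviation F :: "('a, var \<Rightarrow> 'a) module" where "F \<equiv> free_module A (UNIV :: var set)"

lemma F_carrier: "v \<in> carrier F \<longleftrightarrow> (\<forall>c. v c \<in> carrier A)"
proof -
  have "finite {c :: var. v c \<noteq> \<zero>\<^bsub>A\<^esub>}" by (rule finite_subset[OF subset_UNIV finite_UNIV_var])
  then show ?thesis by (simp add: free_module_simps)
qed

lemma F_simps [simp]:
  "(u \<oplus>\<^bsub>F\<^esub> v) c = u c \<oplus>\<^bsub>A\<^esub> v c" "(a \<odot>\<^bsub>F\<^esub> v) c = a \<otimes>\<^bsub>A\<^esub> v c" "\<zero>\<^bsub>F\<^esub> c = \<zero>\<^bsub>A\<^esub>"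
  by (simp_all add: free_module_simps)

sublocale FM: left_module A F by (rule free_module_is_module)

lemma F_minus [simp]: "v \<in> carrier F \<Longrightarrow> (\<ominus>\<^bsub>F\<^esub> v) c = \<ominus>\<^bsub>A\<^esub> v c"
proof -
  assume v: "v \<in> carrier F"
  have "\<ominus>\<^bsub>F\<^esub> v = (\<lambda>c. \<ominus>\<^bsub>A\<^esub> v c)"
    using v by (intro FM.M.minus_equality) (auto simp: F_carrier l_neg fun_eq_iff)
  then show ?thesis by simp
qed

text \<open>The grading with both basis vectors in degree \<open>k\<close>: degree 1 when they map
  to the generators, degree 3 when they map to the relations.\<close>

definition Fg where "Fg k j = {v. \<forall>c :: var. v c \<in> regular_grading A \<A> (j - k)}" for k j :: int
definition Fc where "Fc k j v = (\<lambda>c :: var. cpz (j - k) (v c))" for k j :: int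

lemma F_components: "components F UNIV (Fg k) (Fc k)"
proof (rule componentsI[OF FM.M.abelian_group_axioms])
  note rc = regular_components
  note ab = A_ab
  {
    fix i v assume "v \<in> carrier F" then show "Fc k i v \<in> Fg k i"
      by (auto simp: Fc_def Fg_def F_carrier components_closed[OF rc])
  next
    fix i show "Fg k i \<subseteq> carrier F" using components_sub[OF rc UNIV_I, of _ "i - k"] by (auto simp: Fg_def F_carrier)
  next
    fix i u v assume "u \<in> carrier F" "v \<in> carrier F"
    then show "Fc k i (u \<oplus>\<^bsub>F\<^esub> v) = Fc k i u \<oplus>\<^bsub>F\<^esub> Fc k i v"
      by (auto simp: Fc_def F_carrier components_add[OF rc])
  next
    fix i v assume "v \<in> Fg k i" then show "Fc k i v = v"
      by (auto simp: Fc_def Fg_def components_same[OF rc])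
  next
    fix i j v assume "i \<noteq> j" "v \<in> Fg k j" then show "Fc k i v = \<zero>\<^bsub>F\<^esub>"
      using components_other[OF rc, of "i - k" "j - k"] by (auto simp: Fc_def Fg_def)
  next
    fix v assume v: "v \<in> carrier F"
    have "{i \<in> UNIV. Fc k i v \<noteq> \<zero>\<^bsub>F\<^esub>} \<subseteq> (\<Union>c. (\<lambda>j. j + k) ` {j \<in> UNIV. cpz j (v c) \<noteq> \<zero>\<^bsub>A\<^esub>})"
    proof
      fix i assume "i \<in> {i \<in> UNIV. Fc k i v \<noteq> \<zero>\<^bsub>F\<^esub>}"
      then obtain c where "cpz (i - k) (v c) \<noteq> \<zero>\<^bsub>A\<^esub>" by (auto simp: Fc_def fun_eq_iff)
      then show "i \<in> (\<Union>c. (\<lambda>j. j + k) ` {j \<in> UNIV. cpz j (v c) \<noteq> \<zero>\<^bsub>A\<^esub>})"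
        by (auto intro!: image_eqI[of i _ "i - k"] exI[of _ c])
    qed
    moreover have "finite (\<Union>c :: var. (\<lambda>j. j + k) ` {j \<in> UNIV. cpz j (v c) \<noteq> \<zero>\<^bsub>A\<^esub>})"
      using components_finite[OF rc] v by (intro finite_UN_I finite_UNIV_var) (auto simp: F_carrier)
    ultimately show "finite {i \<in> UNIV. Fc k i v \<noteq> \<zero>\<^bsub>F\<^esub>}" by (rule finite_subset)
    assume z: "\<And>i. i \<in> UNIV \<Longrightarrow> Fc k i v = \<zero>\<^bsub>F\<^esub>"
    have "v c = \<zero>\<^bsub>A\<^esub>" for c
    proof (rule components_eqI[OF ab rc])
      fix i :: int
      have "Fc k (i + k) v c = \<zero>\<^bsub>A\<^esub>" using z[of "i + k"] by simp
      then show "cpz i (v c) = cpz i \<zero>\<^bsub>A\<^esub>" by (simp add: Fc_def cpz_def)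
    qed (use v in \<open>auto simp: F_carrier\<close>)
    then show "v = \<zero>\<^bsub>F\<^esub>" by auto
  }
qed

lemma F_gmod: "gmod A \<A> F (Fg k) (Fc k)"
  unfolding gmod_def
proof (intro conjI allI ballI)
  show "left_module A F" ..
  show "components F UNIV (Fg k) (Fc k)" by (rule F_components)
  fix n j a v assume "a \<in> \<A> n" "v \<in> Fg k j"
  then show "a \<odot>\<^bsub>F\<^esub> v \<in> Fg k (int n + j)"
    using regular_grading_act[of a n _ "j - k"] by (auto simp: Fg_def add_diff_eq)
qed

end

section \<open>Comparison of resolutions\<close>

lemma graded_hom_compose:
  assumes "graded_hom A L \<L> M \<M> f" "graded_hom A M \<M> N \<N> g"
  shows "graded_hom A L \<L> N \<N> (\<lambda>u. g (f u))"
  unfolding graded_hom_def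
proof (intro conjI allI image_subsetI)
  show "lhom A L N (\<lambda>u. g (f u))" using assms unfolding graded_hom_def by (blast intro: lhom_compose)
  fix j u assume "u \<in> \<L> j"
  then have "f u \<in> \<M> j" using assms(1) unfolding graded_hom_def by blast
  then show "g (f u) \<in> \<N> j" using assms(2) unfolding graded_hom_def by blast
qed

context cubic_presentation begin

text \<open>Elements of \<open>F\<close> are row vectors, multiplied from the right by the column of
  generators and by the matrix \<open>m\<close>, so that the maps are left linear. The kernel
  \<open>K3\<close> is the third syzygy.\<close>

definition d1 where "d1 v = v Vx \<otimes>\<^bsub>A\<^esub> x Vx \<oplus>\<^bsub>A\<^esub> v Vy \<otimes>\<^bsub>A\<^esub> x Vy"
definition d2 where "d2 v = (\<lambda>c. v Vx \<otimes>\<^bsub>A\<^esub> m Vx c \<oplus>\<^bsub>A\<^esub> v Vy \<otimes>\<^bsub>A\<^esub> m Vy c)"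
definition K3 where "K3 = {v \<in> carrier F. d2 v = \<zero>\<^bsub>F\<^esub>}"

abbreviation "A0 \<equiv> regular_module A"

sublocale AM: left_module A A0 by (rule regular_module_is_module)

lemma d1_lhom: "lhom A F A0 d1"
  by (rule lhomI) (auto simp: F_carrier d1_def l_distr r_distr m_assoc M.add.m_ac)

lemma d2_lhom: "lhom A F F d2"
  by (rule lhomI) (auto simp: F_carrier d2_def l_distr r_distr m_assoc M.add.m_ac fun_eq_iff)

lemma d1_d2: "v \<in> carrier F \<Longrightarrow> d1 (d2 v) = \<zero>\<^bsub>A\<^esub>"
proof -
  assume v: "v \<in> carrier F"
  then have vc: "\<And>c. v c \<in> carrier A" by (simp add: F_carrier)
  have "d1 (d2 v) = v Vx \<otimes>\<^bsub>A\<^esub> (m Vx Vx \<otimes>\<^bsub>A\<^esub> x Vx \<oplus>\<^bsub>A\<^esub> m Vx Vy \<otimes>\<^bsub>A\<^esub> x Vy)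
      \<oplus>\<^bsub>A\<^esub> v Vy \<otimes>\<^bsub>A\<^esub> (m Vy Vx \<otimes>\<^bsub>A\<^esub> x Vx \<oplus>\<^bsub>A\<^esub> m Vy Vy \<otimes>\<^bsub>A\<^esub> x Vy)"
    using vc by (simp add: d1_def d2_def l_distr r_distr m_assoc M.add.m_ac)
  then show ?thesis using vc by (simp add: m_rel)
qed

lemma d1_exact:
  assumes "v \<in> carrier F" "d1 v = \<zero>\<^bsub>A\<^esub>"
  shows "v \<in> d2 ` carrier F"
proof -
  from exact_1[of "v Vx" "v Vy"] assms obtain a b where ab: "a \<in> carrier A" "b \<in> carrier A"
    "v Vx = a \<otimes>\<^bsub>A\<^esub> m Vx Vx \<oplus>\<^bsub>A\<^esub> b \<otimes>\<^bsub>A\<^esub> m Vy Vx" "v Vy = a \<otimes>\<^bsub>A\<^esub> m Vx Vy \<oplus>\<^bsub>A\<^esub> b \<otimes>\<^bsub>A\<^esub> m Vy Vy"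
    by (auto simp: d1_def F_carrier)
  let ?u = "\<lambda>c. if c = Vx then a else b"
  have "v c = d2 ?u c" for c using ab by (cases c) (simp_all add: d2_def)
  then show ?thesis using ab by (intro image_eqI[of _ _ ?u]) (auto simp: F_carrier)
qed

lemma aug_exact: "a \<in> carrier A \<Longrightarrow> aug a = \<zero> \<Longrightarrow> a \<in> d1 ` carrier F"
proof -
  assume "a \<in> carrier A" "aug a = \<zero>"
  then obtain p q where pq: "p \<in> carrier A" "q \<in> carrier A" "a = p \<otimes>\<^bsub>A\<^esub> x Vx \<oplus>\<^bsub>A\<^esub> q \<otimes>\<^bsub>A\<^esub> x Vy"
    by (rule exact_0)
  then show ?thesis
    by (intro image_eqI[of _ _ "\<lambda>c. if c = Vx then p else q"]) (auto simp: d1_def F_carrier)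
qed

lemma aug_d1: "v \<in> carrier F \<Longrightarrow> aug (d1 v) = \<zero>"
  using x_deg by (simp add: d1_def F_carrier aug_add aug_mult aug_pos[of _ 1])

lemma d1_graded: "graded_hom A F (Fg 1) A0 (regular_grading A \<A>) d1"
  unfolding graded_hom_def
proof (intro conjI allI d1_lhom image_subsetI)
  fix j v assume "v \<in> Fg 1 j"
  then have "v c \<otimes>\<^bsub>A\<^esub> x c \<in> regular_grading A \<A> j" for c
    using regular_grading_act_r[OF x_deg, of "v c" "j - 1" c] by (simp add: Fg_def)
  then show "d1 v \<in> regular_grading A \<A> j"
    unfolding d1_def by (intro components_add_mem[OF A_ab regular_components]) auto
qed

lemma d2_graded: "graded_hom A F (Fg (k + 2)) F (Fg k) d2"
  unfolding graded_hom_def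
proof (intro conjI allI d2_lhom image_subsetI)
  fix j v assume v: "v \<in> Fg (k + 2) j"
  have "v i \<otimes>\<^bsub>A\<^esub> m i c \<in> regular_grading A \<A> (j - k)" for i c
    using regular_grading_act_r[OF m_grade, of "v i" "j - (k + 2)" i c] v by (simp add: Fg_def)
  then show "d2 v \<in> Fg k j"
    unfolding d2_def Fg_def using components_add_mem[OF A_ab regular_components, of "j - k"] by auto
qed

text \<open>The trivial module up to isomorphism, given by its augmentation \<open>\<eta>\<close>.
  It is realised on the field for \<open>Ext\<close> and on sets of elements of \<open>A\<close> for
  the global dimension; the comparison of resolutions covers both.\<close>

definition trivial_quotient where
  "trivial_quotient N \<eta> \<longleftrightarrow> left_module A N \<and> lhom A A0 N \<eta> \<and> \<eta> ` carrier A = carrier N \<and>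
     (\<forall>a\<in>carrier A. \<eta> a = \<zero>\<^bsub>N\<^esub> \<longleftrightarrow> aug a = \<zero>)"

definition chain_to where
  "chain_to Q \<epsilon> \<delta> \<eta> h0 h1 h2 \<longleftrightarrow>
     lhom A (Q 0) A0 h0 \<and> lhom A (Q 1) F h1 \<and> lhom A (Q 2) F h2 \<and>
     (\<forall>u\<in>carrier (Q 0). \<eta> (h0 u) = \<epsilon> u) \<and>
     (\<forall>u\<in>carrier (Q 1). d1 (h1 u) = h0 (\<delta> (0::nat) u)) \<and>
     (\<forall>u\<in>carrier (Q (2::nat)). d2 (h2 u) = h1 (\<delta> 1 u))"

lemma resolutionD:
  assumes "projective_resolution A N Q \<epsilon> \<delta>"
  shows "projective_module A (Q i)" "left_module A (Q i)" "lhom A (Q 0) N \<epsilon>" "lhom A (Q (Suc i)) (Q i) (\<delta> i)"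
    "\<epsilon> ` carrier (Q 0) = carrier N"
    "u \<in> carrier (Q 1) \<Longrightarrow> \<epsilon> (\<delta> 0 u) = \<zero>\<^bsub>N\<^esub>"
    "u \<in> carrier (Q 0) \<Longrightarrow> \<epsilon> u = \<zero>\<^bsub>N\<^esub> \<Longrightarrow> u \<in> \<delta> 0 ` carrier (Q 1)"
    "u \<in> carrier (Q (Suc (Suc i))) \<Longrightarrow> \<delta> i (\<delta> (Suc i) u) = \<zero>\<^bsub>Q i\<^esub>"
    "u \<in> carrier (Q (Suc i)) \<Longrightarrow> \<delta> i u = \<zero>\<^bsub>Q i\<^esub> \<Longrightarrow> u \<in> \<delta> (Suc i) ` carrier (Q (Suc (Suc i)))"
proof -
  note a = assms[unfolded projective_resolution_def]
  show "projective_module A (Q i)" using a by blast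
  then show "left_module A (Q i)" by (simp add: projective_module_def)
  have "\<epsilon> \<in> mod_hom A (Q 0) N" "\<delta> i \<in> mod_hom A (Q (Suc i)) (Q i)" using a by auto
  then show "lhom A (Q 0) N \<epsilon>" "lhom A (Q (Suc i)) (Q i) (\<delta> i)" by (auto dest: mod_hom_lhom)
  show "\<epsilon> ` carrier (Q 0) = carrier N" using a by blast
  have 0: "\<delta> 0 ` carrier (Q 1) = mod_kernel (Q 0) N \<epsilon>" using a by blast
  have 1: "\<delta> (Suc i) ` carrier (Q (Suc (Suc i))) = mod_kernel (Q (Suc i)) (Q i) (\<delta> i)" using a by blast
  show "u \<in> carrier (Q 1) \<Longrightarrow> \<epsilon> (\<delta> 0 u) = \<zero>\<^bsub>N\<^esub>"
    "u \<in> carrier (Q 0) \<Longrightarrow> \<epsilon> u = \<zero>\<^bsub>N\<^esub> \<Longrightarrow> u \<in> \<delta> 0 ` carrier (Q 1)"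
    using 0 unfolding mod_kernel_def by blast+
  show "u \<in> carrier (Q (Suc (Suc i))) \<Longrightarrow> \<delta> i (\<delta> (Suc i) u) = \<zero>\<^bsub>Q i\<^esub>"
    "u \<in> carrier (Q (Suc i)) \<Longrightarrow> \<delta> i u = \<zero>\<^bsub>Q i\<^esub> \<Longrightarrow> u \<in> \<delta> (Suc i) ` carrier (Q (Suc (Suc i)))"
    using 1 unfolding mod_kernel_def by blast+
qed

text \<open>A chain map over the identity, from projectivity of \<open>Q\<close> and exactness of
  the explicit complex. It stops in degree two, where that exactness ends.\<close>

lemma chain_to_exists:
  fixes Q :: "nat \<Rightarrow> ('a, 'p) module"
  assumes N: "trivial_quotient N \<eta>" and Q: "projective_resolution A N Q \<epsilon> \<delta>"
  obtains h0 h1 h2 where "chain_to Q \<epsilon> \<delta> \<eta> h0 h1 h2"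
proof -
  note XD = resolutionD[OF Q]
  have ab: "abelian_group N" "left_module A N" and eta: "lhom A A0 N \<eta>"
    using N by (auto simp: trivial_quotient_def left_module_abelian_group)
  have "\<epsilon> ` carrier (Q 0) \<subseteq> \<eta> ` carrier A0" using N XD(5) by (simp add: trivial_quotient_def)
  from projective_lift[OF XD(1) AM.left_module_axioms ab(1) eta XD(3) this]
  obtain h0 where h0: "lhom A (Q 0) A0 h0" "\<And>u. u \<in> carrier (Q 0) \<Longrightarrow> \<eta> (h0 u) = \<epsilon> u" by blast
  note d0 = XD(4)[of 0, unfolded One_nat_def[symmetric]] and dl1 = XD(4)[of 1, unfolded Suc_1]
  have l1: "lhom A (Q 1) A0 (\<lambda>u. h0 (\<delta> 0 u))" by (rule lhom_compose[OF d0 h0(1)])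
  have "(\<lambda>u. h0 (\<delta> 0 u)) ` carrier (Q 1) \<subseteq> d1 ` carrier F"
  proof (rule image_subsetI)
    fix u assume u: "u \<in> carrier (Q 1)"
    then have "\<eta> (h0 (\<delta> 0 u)) = \<zero>\<^bsub>N\<^esub>" using h0(2)[OF lhom_closed[OF d0 u]] XD(6) by simp
    then show "h0 (\<delta> 0 u) \<in> d1 ` carrier F"
      using lhom_closed[OF l1 u] N by (intro aug_exact) (auto simp: trivial_quotient_def)
  qed
  from projective_lift[OF XD(1) FM.left_module_axioms AM.M.abelian_group_axioms d1_lhom l1 this]
  obtain h1 where h1: "lhom A (Q 1) F h1" "\<And>u. u \<in> carrier (Q 1) \<Longrightarrow> d1 (h1 u) = h0 (\<delta> 0 u)" by blast
  have l2: "lhom A (Q 2) F (\<lambda>u. h1 (\<delta> 1 u))" by (rule lhom_compose[OF dl1 h1(1)])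
  have "(\<lambda>u. h1 (\<delta> 1 u)) ` carrier (Q 2) \<subseteq> d2 ` carrier F"
  proof (rule image_subsetI)
    fix u assume u: "u \<in> carrier (Q 2)"
    then have "d1 (h1 (\<delta> 1 u)) = \<zero>\<^bsub>A\<^esub>"
      using h1(2)[OF lhom_closed[OF dl1 u]] XD(8)[of u 0] lhom_zero[OF left_module_abelian_group[OF XD(2)] AM.M.abelian_group_axioms h0(1)]
      by (simp add: numeral_2_eq_2)
    then show "h1 (\<delta> 1 u) \<in> d2 ` carrier F"
      using lhom_closed[OF l2 u] by (rule d1_exact[rotated])
  qed
  from projective_lift[OF XD(1) FM.left_module_axioms FM.M.abelian_group_axioms d2_lhom l2 this]
  obtain h2 where "lhom A (Q 2) F h2" "\<And>u. u \<in> carrier (Q 2) \<Longrightarrow> d2 (h2 u) = h1 (\<delta> 1 u)" by blast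
  with h0 h1 show ?thesis by (intro that[of h0 h1 h2]) (auto simp: chain_to_def)
qed

text \<open>The lifts can be taken of degree zero. The degree of \<open>h2\<close> matters later,
  when homogeneous linear forms on \<open>K3\<close> are pulled back to cocycles in the graded
  Hom.\<close>

lemma graded_chain_to_exists:
  fixes Q :: "nat \<Rightarrow> ('a, 'p) module"
  assumes N: "trivial_quotient N \<eta>" and Q: "graded_projective_resolution A \<A> N \<N> Q \<Q> \<epsilon> \<delta>"
    and NG: "gmod A \<A> N \<N> e" and eta_g: "\<And>j. \<eta> ` regular_grading A \<A> j \<subseteq> \<N> j"
  obtains h0 h1 h2 where "chain_to Q \<epsilon> \<delta> \<eta> h0 h1 h2" "graded_hom A (Q 2) (\<Q> 2) F (Fg 3) h2"
proof -
  note Xr = Q[unfolded graded_projective_resolution_def, THEN conjunct1]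
  note XD = resolutionD[OF Xr]
  have ab: "abelian_group N" "left_module A N" and eta: "lhom A A0 N \<eta>"
    using N by (auto simp: trivial_quotient_def left_module_abelian_group)
  have "\<exists>c. gmod A \<A> (Q i) (\<Q> i) c" for i
  proof -
    have "graded_module A \<A> (Q i) (\<Q> i)" using Q unfolding graded_projective_resolution_def by blast
    then show ?thesis by (metis graded_module_gmod)
  qed
  then obtain c where XG: "\<And>i. gmod A \<A> (Q i) (\<Q> i) (c i)" by metis
  have ge: "graded_hom A A0 (regular_grading A \<A>) N \<N> \<eta>" using eta eta_g by (simp add: graded_hom_def)
  have gX: "graded_hom A (Q 0) (\<Q> 0) N \<N> \<epsilon>" "\<And>i. graded_hom A (Q (Suc i)) (\<Q> (Suc i)) (Q i) (\<Q> i) (\<delta> i)"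
    using Q XD(3,4) unfolding graded_projective_resolution_def graded_hom_def by blast+
  have "\<epsilon> ` carrier (Q 0) \<subseteq> \<eta> ` carrier A0" using N XD(5) by (simp add: trivial_quotient_def)
  from graded_projective_lift[OF cp XD(1) XG regular_gmod NG ge gX(1) this]
  obtain h0 where h0: "graded_hom A (Q 0) (\<Q> 0) A0 (regular_grading A \<A>) h0" "\<And>u. u \<in> carrier (Q 0) \<Longrightarrow> \<eta> (h0 u) = \<epsilon> u" by blast
  have lh0: "lhom A (Q 0) A0 h0" using h0(1) by (simp add: graded_hom_def)
  note d0 = XD(4)[of 0, unfolded One_nat_def[symmetric]] and dl1 = XD(4)[of 1, unfolded Suc_1]
  have l1: "lhom A (Q 1) A0 (\<lambda>u. h0 (\<delta> 0 u))" by (rule lhom_compose[OF d0 lh0])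
  have g1: "graded_hom A (Q 1) (\<Q> 1) A0 (regular_grading A \<A>) (\<lambda>u. h0 (\<delta> 0 u))"
    using graded_hom_compose[OF gX(2)[of 0] h0(1)] by simp
  have "(\<lambda>u. h0 (\<delta> 0 u)) ` carrier (Q 1) \<subseteq> d1 ` carrier F"
  proof (rule image_subsetI)
    fix u assume u: "u \<in> carrier (Q 1)"
    then have "\<eta> (h0 (\<delta> 0 u)) = \<zero>\<^bsub>N\<^esub>" using h0(2)[OF lhom_closed[OF d0 u]] XD(6) by simp
    then show "h0 (\<delta> 0 u) \<in> d1 ` carrier F"
      using lhom_closed[OF l1 u] N by (intro aug_exact) (auto simp: trivial_quotient_def)
  qed
  from graded_projective_lift[OF cp XD(1) XG F_gmod regular_gmod d1_graded g1 this]
  obtain h1 where h1: "graded_hom A (Q 1) (\<Q> 1) F (Fg 1) h1" "\<And>u. u \<in> carrier (Q 1) \<Longrightarrow> d1 (h1 u) = h0 (\<delta> 0 u)" by blast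
  have lh1: "lhom A (Q 1) F h1" using h1(1) by (simp add: graded_hom_def)
  have l2: "lhom A (Q 2) F (\<lambda>u. h1 (\<delta> 1 u))" by (rule lhom_compose[OF dl1 lh1])
  have g2: "graded_hom A (Q 2) (\<Q> 2) F (Fg 1) (\<lambda>u. h1 (\<delta> 1 u))"
    using graded_hom_compose[OF gX(2)[of 1, unfolded Suc_1] h1(1)] .
  have "(\<lambda>u. h1 (\<delta> 1 u)) ` carrier (Q 2) \<subseteq> d2 ` carrier F"
  proof (rule image_subsetI)
    fix u assume u: "u \<in> carrier (Q 2)"
    then have "d1 (h1 (\<delta> 1 u)) = \<zero>\<^bsub>A\<^esub>"
      using h1(2)[OF lhom_closed[OF dl1 u]] XD(8)[of u 0] lhom_zero[OF left_module_abelian_group[OF XD(2)] AM.M.abelian_group_axioms lh0]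
      by (simp add: numeral_2_eq_2)
    then show "h1 (\<delta> 1 u) \<in> d2 ` carrier F"
      using lhom_closed[OF l2 u] by (rule d1_exact[rotated])
  qed
  from graded_projective_lift[OF cp XD(1) XG F_gmod[of 3] F_gmod[of 1] d2_graded[of 1, simplified] g2 this]
  obtain h2 where h2: "graded_hom A (Q 2) (\<Q> 2) F (Fg 3) h2" "\<And>u. u \<in> carrier (Q 2) \<Longrightarrow> d2 (h2 u) = h1 (\<delta> 1 u)" by blast
  have "lhom A (Q 2) F h2" using h2(1) by (simp add: graded_hom_def)
  then show ?thesis using h0(2) h1(2) h2 lh0 lh1 by (intro that[of h0 h1 h2]) (auto simp: chain_to_def)
qed

text \<open>Maps in the opposite direction exist because \<open>F\<close> is free and
  \<open>Q\<close> is exact. The round trip differs from the identity by a homotopy; its next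
  component would have to be lifted through a third differential, which the explicit complex does
  not have. What remains instead is the map \<open>s2\<close> into \<open>K3\<close>.\<close>

lemma chain_homotopy:
  assumes N: "trivial_quotient N \<eta>" and Q: "projective_resolution A N Q \<epsilon> \<delta>" and h: "chain_to Q \<epsilon> \<delta> \<eta> h0 h1 h2"
  obtains k1 k2 s1 s2 where
    "lhom A F (Q 1) k1" "lhom A F (Q 2) k2" "lhom A F F s1" "lhom A F F s2"
    "\<And>u. u \<in> carrier F \<Longrightarrow> \<delta> 1 (k2 u) = k1 (d2 u)"
    "\<And>u. u \<in> carrier F \<Longrightarrow> s2 u \<in> K3"
    "\<And>u. u \<in> carrier F \<Longrightarrow> h2 (k2 u) = u \<oplus>\<^bsub>F\<^esub> s1 (d2 u) \<oplus>\<^bsub>F\<^esub> s2 u"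
proof -
  note XD = resolutionD[OF Q]
  note d0 = XD(4)[of 0, unfolded One_nat_def[symmetric]] and dl1 = XD(4)[of 1, unfolded Suc_1]
  have NM: "left_module A N" and eta: "lhom A A0 N \<eta>" and ker: "\<And>a. a \<in> carrier A \<Longrightarrow> \<eta> a = \<zero>\<^bsub>N\<^esub> \<longleftrightarrow> aug a = \<zero>"
    using N by (auto simp: trivial_quotient_def)
  note ab = left_module_abelian_group[OF NM] and Xab = left_module_abelian_group[OF XD(2)]
  have h0: "lhom A (Q 0) A0 h0" and h1: "lhom A (Q 1) F h1" and h2: "lhom A (Q 2) F h2"
    and e0: "\<And>u. u \<in> carrier (Q 0) \<Longrightarrow> \<eta> (h0 u) = \<epsilon> u"
    and e1: "\<And>u. u \<in> carrier (Q 1) \<Longrightarrow> d1 (h1 u) = h0 (\<delta> 0 u)"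
    and e2: "\<And>u. u \<in> carrier (Q 2) \<Longrightarrow> d2 (h2 u) = h1 (\<delta> 1 u)"
    using h by (auto simp: chain_to_def)
  interpret NN: left_module A N by (rule NM)
  obtain x0 where x0: "x0 \<in> carrier (Q 0)" "\<epsilon> x0 = \<eta> \<one>\<^bsub>A\<^esub>"
    using XD(5) lhom_closed[OF eta, of "\<one>\<^bsub>A\<^esub>"] by (metis imageE one_closed regular_module_simps(1))
  define k0 where "k0 a = a \<odot>\<^bsub>Q 0\<^esub> x0" for a
  have k0: "lhom A A0 (Q 0) k0" unfolding k0_def[abs_def] by (rule regular_lhom[OF XD(2) x0(1)])
  have ek0: "\<epsilon> (k0 a) = \<eta> a" if a: "a \<in> carrier A" for a
    using lhom_smult[OF XD(3) a x0(1)] lhom_smult[OF eta a, of "\<one>\<^bsub>A\<^esub>"] a x0 by (simp add: k0_def)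
  have kd: "lhom A F (Q 0) (\<lambda>u. k0 (d1 u))" by (rule lhom_compose[OF d1_lhom k0])
  have "k0 (d1 (unit_vec A i)) \<in> \<delta> 0 ` carrier (Q 1)" for i
    using ek0 lhom_closed[OF d1_lhom] lhom_closed[OF kd] ker aug_d1 by (intro XD(7)) auto
  from free_module_lift[OF XD(2) Xab d0 kd this]
  obtain k1 where k1: "lhom A F (Q 1) k1" "\<And>u. u \<in> carrier F \<Longrightarrow> \<delta> 0 (k1 u) = k0 (d1 u)" by blast
  have kd2: "lhom A F (Q 1) (\<lambda>u. k1 (d2 u))" by (rule lhom_compose[OF d2_lhom k1(1)])
  have z0: "k0 \<zero>\<^bsub>A\<^esub> = \<zero>\<^bsub>Q 0\<^esub>" using lhom_zero[OF AM.M.abelian_group_axioms Xab k0] by simp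
  have "k1 (d2 (unit_vec A i)) \<in> \<delta> 1 ` carrier (Q 2)" for i
  proof -
    have "\<delta> 0 (k1 (d2 (unit_vec A i))) = \<zero>\<^bsub>Q 0\<^esub>"
      using k1(2)[OF lhom_closed[OF d2_lhom]] d1_d2 z0 by simp
    then show ?thesis using XD(9)[of "k1 (d2 (unit_vec A i))" 0] lhom_closed[OF kd2, of "unit_vec A i"]
      by (simp add: numeral_2_eq_2)
  qed
  from free_module_lift[OF XD(2) Xab dl1 kd2 this]
  obtain k2 where k2: "lhom A F (Q 2) k2" "\<And>u. u \<in> carrier F \<Longrightarrow> \<delta> 1 (k2 u) = k1 (d2 u)" by blast
  have hk0: "lhom A A0 A0 (\<lambda>a. h0 (k0 a))" by (rule lhom_compose[OF k0 h0])
  have hk0_mult: "h0 (k0 a) = a \<otimes>\<^bsub>A\<^esub> h0 (k0 \<one>\<^bsub>A\<^esub>)" if "a \<in> carrier A" for a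
    using lhom_smult[OF hk0 that, of "\<one>\<^bsub>A\<^esub>"] that by simp
  \<comment> \<open>The round trip on \<open>A\<close> is right multiplication by an element
    congruent to one modulo the augmentation ideal, and \<open>b\<close> is the difference. Being a
    boundary, \<open>b\<close> yields the homotopy \<open>s0\<close>.\<close>
  define b where "b = h0 (k0 \<one>\<^bsub>A\<^esub>) \<ominus>\<^bsub>A\<^esub> \<one>\<^bsub>A\<^esub>"
  have k1c: "k0 \<one>\<^bsub>A\<^esub> \<in> carrier (Q 0)" using lhom_closed[OF k0] by simp
  have hk1c: "h0 (k0 \<one>\<^bsub>A\<^esub>) \<in> carrier A" using lhom_closed[OF hk0, of "\<one>\<^bsub>A\<^esub>"] by simp
  have bc: "b \<in> carrier A" unfolding b_def using hk1c by simp
  have "\<eta> b = \<zero>\<^bsub>N\<^esub>"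
  proof -
    have "\<eta> (\<ominus>\<^bsub>A\<^esub> \<one>\<^bsub>A\<^esub>) = \<ominus>\<^bsub>N\<^esub> \<eta> \<one>\<^bsub>A\<^esub>"
      using lhom_minus[OF AM.M.abelian_group_axioms ab eta, of "\<one>\<^bsub>A\<^esub>"] by simp
    then have "\<eta> b = \<eta> (h0 (k0 \<one>\<^bsub>A\<^esub>)) \<oplus>\<^bsub>N\<^esub> \<ominus>\<^bsub>N\<^esub> \<eta> \<one>\<^bsub>A\<^esub>"
      unfolding b_def a_minus_def using lhom_add[OF eta, of "h0 (k0 \<one>\<^bsub>A\<^esub>)" "\<ominus>\<^bsub>A\<^esub> \<one>\<^bsub>A\<^esub>"] hk1c by simp
    also have "\<dots> = \<zero>\<^bsub>N\<^esub>" using e0[OF k1c] ek0[of "\<one>\<^bsub>A\<^esub>"] lhom_closed[OF eta, of "\<one>\<^bsub>A\<^esub>"] by (simp add: NN.M.r_neg)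
    finally show ?thesis .
  qed
  then obtain v0 where v0: "v0 \<in> carrier F" "d1 v0 = b" using aug_exact[OF bc] ker[OF bc] by auto
  define s0 where "s0 a = a \<odot>\<^bsub>F\<^esub> v0" for a
  have s0: "lhom A A0 F s0" unfolding s0_def[abs_def] by (rule regular_lhom[OF FM.left_module_axioms v0(1)])
  have ds0: "d1 (s0 a) = h0 (k0 a) \<ominus>\<^bsub>A\<^esub> a" if a: "a \<in> carrier A" for a
    using lhom_smult[OF d1_lhom a v0(1)] v0 a hk1c hk0_mult[OF a]
    by (simp add: s0_def b_def a_minus_def r_distr r_minus)
  have hk1: "lhom A F F (\<lambda>u. h1 (k1 u))" by (rule lhom_compose[OF k1(1) h1])
  have idF: "lhom A F F (\<lambda>u. u)" by (simp add: lhom_def)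
  have sd: "lhom A F F (\<lambda>u. s0 (d1 u))" by (rule lhom_compose[OF d1_lhom s0])
  \<comment> \<open>A cycle for \<open>d1\<close>, hence a boundary on basis vectors; freeness turns
    preimages into the homotopy \<open>s1\<close>.\<close>
  define f1 where "f1 u = h1 (k1 u) \<ominus>\<^bsub>F\<^esub> u \<ominus>\<^bsub>F\<^esub> s0 (d1 u)" for u
  have f1: "lhom A F F f1" unfolding f1_def[abs_def]
    by (intro lhom_minusf[OF FM.left_module_axioms] hk1 idF sd)
  have d_minus: "d (u \<ominus>\<^bsub>F\<^esub> v) = d u \<ominus>\<^bsub>M\<^esub> d v" if "lhom A F M d" "left_module A M" "u \<in> carrier F" "v \<in> carrier F"
    for d u v and M :: "('a, 'z) module"
    using that lhom_minus[OF FM.M.abelian_group_axioms left_module_abelian_group[OF that(2)] that(1)]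
    by (simp add: a_minus_def lhom_add)
  have A0m: "a \<ominus>\<^bsub>A0\<^esub> b = a \<ominus>\<^bsub>A\<^esub> b" if "b \<in> carrier A" for a b using that by (simp add: a_minus_def)
  have "d1 (f1 u) = \<zero>\<^bsub>A\<^esub>" if u: "u \<in> carrier F" for u
  proof -
    have c: "h1 (k1 u) \<in> carrier F" "s0 (d1 u) \<in> carrier F" "d1 u \<in> carrier A" "k0 (d1 u) \<in> carrier (Q 0)"
      using lhom_closed[OF hk1 u] lhom_closed[OF sd u] lhom_closed[OF d1_lhom u] lhom_closed[OF kd u] by auto
    have c2: "h0 (k0 (d1 u)) \<in> carrier A" using lhom_closed[OF h0 c(4)] by simp
    have "d1 (f1 u) = h0 (k0 (d1 u)) \<ominus>\<^bsub>A\<^esub> d1 u \<ominus>\<^bsub>A\<^esub> (h0 (k0 (d1 u)) \<ominus>\<^bsub>A\<^esub> d1 u)"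
      unfolding f1_def using c u e1[OF lhom_closed[OF k1(1) u]] k1(2)[OF u] c2
      by (simp add: d_minus[OF d1_lhom AM.left_module_axioms] A0m ds0 FM.M.minus_closed)
    then show ?thesis using c c2 by (simp add: M.minus_self_eq M.minus_closed)
  qed
  then have "f1 (unit_vec A i) \<in> d2 ` carrier F" for i
    using lhom_closed[OF f1] by (intro d1_exact) auto
  from free_module_lift[OF FM.left_module_axioms FM.M.abelian_group_axioms d2_lhom f1 this]
  obtain s1 where s1: "lhom A F F s1" "\<And>u. u \<in> carrier F \<Longrightarrow> d2 (s1 u) = f1 u" by blast
  have hk2: "lhom A F F (\<lambda>u. h2 (k2 u))" by (rule lhom_compose[OF k2(1) h2])
  have sd2: "lhom A F F (\<lambda>u. s1 (d2 u))" by (rule lhom_compose[OF d2_lhom s1(1)])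
  \<comment> \<open>The corresponding difference one step higher, again a cycle, but now there is
    nothing to lift through.\<close>
  define s2 where "s2 u = h2 (k2 u) \<ominus>\<^bsub>F\<^esub> u \<ominus>\<^bsub>F\<^esub> s1 (d2 u)" for u
  have s2: "lhom A F F s2" unfolding s2_def[abs_def]
    by (intro lhom_minusf[OF FM.left_module_axioms] hk2 idF sd2)
  have "s2 u \<in> K3" if u: "u \<in> carrier F" for u
  proof -
    have c: "h2 (k2 u) \<in> carrier F" "s1 (d2 u) \<in> carrier F" "d2 u \<in> carrier F" "h1 (k1 (d2 u)) \<in> carrier F"
      using lhom_closed[OF hk2 u] lhom_closed[OF sd2 u] lhom_closed[OF d2_lhom u] lhom_closed[OF hk1] by auto
    have z: "s0 (d1 (d2 u)) = \<zero>\<^bsub>F\<^esub>" using d1_d2[OF u] v0 by (simp add: s0_def)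
    have "d2 (s2 u) = h1 (k1 (d2 u)) \<ominus>\<^bsub>F\<^esub> d2 u \<ominus>\<^bsub>F\<^esub> f1 (d2 u)"
      unfolding s2_def using c u e2[OF lhom_closed[OF k2(1) u]] k2(2)[OF u] s1(2)
      by (simp add: d_minus[OF d2_lhom FM.left_module_axioms] FM.M.minus_closed)
    also have "\<dots> = \<zero>\<^bsub>F\<^esub>" unfolding f1_def z using c
      by (simp add: FM.M.minus_self_eq FM.M.minus_closed a_minus_def[of F _ "\<zero>\<^bsub>F\<^esub>"])
    finally show ?thesis using lhom_closed[OF s2 u] by (simp add: K3_def)
  qed
  moreover have "h2 (k2 u) = u \<oplus>\<^bsub>F\<^esub> s1 (d2 u) \<oplus>\<^bsub>F\<^esub> s2 u" if u: "u \<in> carrier F" for u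
    unfolding s2_def by (rule FM.M.minus_minus_split[OF lhom_closed[OF hk2 u] u lhom_closed[OF sd2 u]])
  ultimately show ?thesis using that[OF k1(1) k2(1) s1(1) s2 k2(2)] by blast
qed

end

section \<open>The third syzygy of the trivial module\<close>

context cubic_presentation begin

lemma K3_sub: "v \<in> K3 \<Longrightarrow> v \<in> carrier F"
  by (simp add: K3_def)

abbreviation K3m where "K3m \<equiv> restrict_carrier F K3"

lemma d2_zero: "d2 \<zero>\<^bsub>F\<^esub> = \<zero>\<^bsub>F\<^esub>"
  by (rule lhom_zero[OF FM.M.abelian_group_axioms FM.M.abelian_group_axioms d2_lhom])

lemma K3_module: "left_module A K3m"
  by (rule restrict_carrier_module[OF FM.left_module_axioms])
    (auto simp: K3_def d2_zero lhom_add[OF d2_lhom] lhom_smult[OF d2_lhom] FM.act_closed)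

lemma free_lhom_sum:
  assumes M: "left_module A M" and f: "lhom A (free_module A I) M f" and w: "w \<in> carrier (free_module A I)"
  shows "f w = (\<Oplus>\<^bsub>M\<^esub>i\<in>{i. w i \<noteq> \<zero>\<^bsub>A\<^esub>}. w i \<odot>\<^bsub>M\<^esub> f (unit_vec A i))"
proof -
  have c: "i \<in> I \<Longrightarrow> f (unit_vec A i) \<in> carrier M" for i using lhom_closed[OF f] by simp
  have "f w = lin_ext A M (\<lambda>i. f (unit_vec A i)) w"
    using lin_ext_lhom[OF M, of I "\<lambda>i. f (unit_vec A i)"] c
    by (intro lhom_free_eq[OF left_module_abelian_group[OF M] f _ _ w]) (auto simp: lin_ext_unit_vec[OF M])
  then show ?thesis by (simp add: lin_ext_def)
qed

text \<open>The value is a combination of values at basis vectors with coefficients in the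
  augmentation ideal. This is how minimality enters: after \<open>d2\<close>, or on
  \<open>K3\<close>, every linear form on \<open>F\<close> augments to zero.\<close>

lemma aug_lhom:
  assumes f: "lhom A F A0 f" and w: "w \<in> carrier F" "\<And>c. aug (w c) = \<zero>"
  shows "aug (f w) = \<zero>"
proof -
  have u: "unit_vec A c \<in> carrier F" for c :: var by simp
  have fu: "f (unit_vec A c) \<in> carrier A" for c using lhom_closed[OF f u] by simp
  have wc: "w c \<in> carrier A" for c using w by (simp add: F_carrier)
  have "f w \<in> {a \<in> carrier A. aug a = \<zero>}"
    unfolding free_lhom_sum[OF AM.left_module_axioms f w(1)]
  proof (rule finsum_induct[where P = "\<lambda>a. a \<in> {a \<in> carrier A. aug a = \<zero>}", OF AM.M.abelian_group_axioms])
    show "finite {i. w i \<noteq> \<zero>\<^bsub>A\<^esub>}" by (rule finite_subset[OF subset_UNIV finite_UNIV_var])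
    show "w i \<odot>\<^bsub>A0\<^esub> f (unit_vec A i) \<in> carrier A0 \<and> w i \<odot>\<^bsub>A0\<^esub> f (unit_vec A i) \<in> {a \<in> carrier A. aug a = \<zero>}" for i
      using wc fu w(2) by (simp add: aug_mult)
    show "\<zero>\<^bsub>A0\<^esub> \<in> {a \<in> carrier A. aug a = \<zero>}" by (simp add: aug_zero_iff)
  qed (simp add: aug_add)
  then show ?thesis by simp
qed

text \<open>The degree two part of \<open>d2 v = 0\<close> says that the combination of the
  relations with coefficients \<open>\<alpha>\<close> and \<open>\<beta>\<close> has right
  derivatives that vanish in \<open>A\<close>. They have degree two, where evaluation is injective,
  so the combination is zero and independence of the relations applies.\<close>

lemma K3_aug:
  assumes v: "v \<in> K3" shows "aug (v c) = \<zero>"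
proof -
  define \<alpha> \<beta> where "\<alpha> = aug (v Vx)" and "\<beta> = aug (v Vy)"
  have vc: "v c \<in> carrier A" for c using K3_sub[OF v] by (simp add: F_carrier)
  have ab: "\<alpha> \<in> carrier K" "\<beta> \<in> carrier K" using vc by (auto simp: \<alpha>_def \<beta>_def)
  let ?f = "\<alpha> \<odot>\<^bsub>T\<^esub> r Vx \<oplus>\<^bsub>T\<^esub> \<beta> \<odot>\<^bsub>T\<^esub> r Vy"
  have fT: "?f \<in> carrier T" using ab by simp
  have rd: "rder c ?f = \<alpha> \<odot>\<^bsub>T\<^esub> rder c (r Vx) \<oplus>\<^bsub>T\<^esub> \<beta> \<odot>\<^bsub>T\<^esub> rder c (r Vy)" for c
    by (simp add: rder_def free_algebra_simps)
  have rT: "rder c (r i) \<in> carrier T" for c i by (rule R.rder_mem[OF r_mem])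
  have "rder c ?f = \<zero>\<^bsub>T\<^esub>" for c
  proof (rule ker_homogeneous_low[of _ 2])
    have rh: "rder c (r i) \<in> free_homogeneous K 2" for i
      using R.rder_homogeneous[of "r i" 2 c] r_hom[of i] by (simp add: numeral_3_eq_3)
    have "rder c ?f \<in> carrier T" using fT by (rule R.rder_mem)
    moreover have "rder c ?f w = \<zero>" if "length w \<noteq> 2" for w
    proof -
      have "rder c (r Vx) w = \<zero>" "rder c (r Vy) w = \<zero>" using rh that unfolding free_homogeneous_def by blast+
      then show ?thesis unfolding rd using ab by (simp add: free_algebra_simps)
    qed
    ultimately show "rder c ?f \<in> free_homogeneous K 2" unfolding free_homogeneous_def by blast
    have mv: "cp 2 (v i \<otimes>\<^bsub>A\<^esub> m i c) = aug (v i) \<odot>\<^bsub>A\<^esub> m i c" for i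
      using cp_mult_r[OF m_grade[of i c] vc[of i], of 2] vc by (simp add: aug_eq smult_mult_left)
    have "\<zero>\<^bsub>A\<^esub> = cp 2 (d2 v c)" using v by (simp add: K3_def)
    also have "\<dots> = \<alpha> \<odot>\<^bsub>A\<^esub> m Vx c \<oplus>\<^bsub>A\<^esub> \<beta> \<odot>\<^bsub>A\<^esub> m Vy c"
      unfolding d2_def using vc by (simp add: cp_add mv \<alpha>_def \<beta>_def)
    also have "\<dots> = ev (rder c ?f)" unfolding rd using ab rT by (simp add: ev_add ev_smult m_def)
    finally show "ev (rder c ?f) = \<zero>\<^bsub>A\<^esub>" by simp
  qed simp
  moreover have "?f [] = \<zero>"
  proof -
    have "r Vx [] = \<zero>" "r Vy [] = \<zero>" using r_hom[of Vx] r_hom[of Vy] unfolding free_homogeneous_def by force+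
    then show ?thesis using ab by (simp add: free_algebra_simps)
  qed
  ultimately have "?f = \<zero>\<^bsub>T\<^esub>" using R.right_division[OF fT] by simp
  then show ?thesis using r_indep[OF ab] by (cases c) (auto simp: \<alpha>_def \<beta>_def)
qed

text \<open>
  The trivial module once more, because \<open>left_gl_dim\<close> only sees modules whose elements are subsets of \<open>A\<close>.
\<close>

definition N0 :: "('a, 'a set) module" where
  "N0 = \<lparr>carrier = (\<lambda>a. {a}) ` \<A> 0, monoid.mult = undefined, one = undefined, ring.zero = {\<zero>\<^bsub>A\<^esub>},
     add = (\<lambda>S T. {the_elem S \<oplus>\<^bsub>A\<^esub> the_elem T}), smult = (\<lambda>a S. {cp 0 a \<otimes>\<^bsub>A\<^esub> the_elem S})\<rparr>"

lemma N0_trivial: "trivial_quotient N0 (\<lambda>a. {cp 0 a})"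
proof -
  have c0: "a \<otimes>\<^bsub>A\<^esub> b \<in> \<A> 0" if "a \<in> \<A> 0" "b \<in> \<A> 0" for a b using grade_mult[OF that] by simp
  have "left_module A N0"
  proof (rule left_moduleI)
    show "abelian_group N0"
    proof (rule abelian_groupI)
      fix S assume "S \<in> carrier N0"
      then obtain a where a: "a \<in> \<A> 0" "S = {a}" by (auto simp: N0_def)
      then show "\<exists>S'\<in>carrier N0. S' \<oplus>\<^bsub>N0\<^esub> S = \<zero>\<^bsub>N0\<^esub>"
        using grade_minus[OF a(1)] grade_sub[OF a(1)] by (intro bexI[of _ "{\<ominus>\<^bsub>A\<^esub> a}"]) (auto simp: N0_def M.l_neg)
    qed (auto simp: N0_def grade_add grade_sub M.a_ac)
  qed (auto simp: N0_def grade_sub cp_mem c0 cp_add l_distr r_distr cp0_mult m_assoc cp_same[OF grade_one] ring_axioms)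
  moreover have "lhom A A0 N0 (\<lambda>a. {cp 0 a})"
    by (rule lhomI) (auto simp: N0_def cp_mem cp_add cp0_mult)
  moreover have "cp 0 ` carrier A = \<A> 0"
  proof (intro equalityI subsetI)
    fix a assume "a \<in> \<A> 0"
    then show "a \<in> cp 0 ` carrier A" by (intro image_eqI[of _ _ a]) (auto simp: cp_same grade_sub)
  qed (auto simp: cp_mem)
  then have "(\<lambda>a. {cp 0 a}) ` carrier A = carrier N0"
    by (simp add: N0_def image_image[symmetric, of "\<lambda>a. {a}" "cp 0"])
  moreover have "\<forall>a\<in>carrier A. {cp 0 a} = \<zero>\<^bsub>N0\<^esub> \<longleftrightarrow> aug a = \<zero>"
    by (simp add: N0_def aug_zero_iff)
  ultimately show ?thesis by (simp add: trivial_quotient_def)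
qed

end

locale regular_cubic = cubic_presentation K A \<A> x r
  for K :: "('k, 'l) ring_scheme" (structure) and A :: "('k, 'a, 'b) module_scheme" and \<A> x r +
  assumes AS: "AS_regular K A \<A> 3"
begin

text \<open>The projective dimension is an infimum of extended naturals. A finite bound shows that
  the set is nonempty and the infimum attained, by a resolution whose terms vanish beyond index
  3.\<close>

lemma short_resolution:
  obtains Q :: "nat \<Rightarrow> ('a, 'a set \<Rightarrow> 'a) module" and \<epsilon> \<delta>
  where "projective_resolution A N0 Q \<epsilon> \<delta>" "carrier (Q 4) = {\<zero>\<^bsub>Q 4\<^esub>}"
proof -
  have "proj_dim A N0 \<le> left_gl_dim A"
    unfolding left_gl_dim_def using N0_trivial by (intro SUP_upper) (simp add: trivial_quotient_def)
  then have le: "proj_dim A N0 \<le> enat 3" using AS by (simp add: AS_regular_def)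
  let ?S = "{enat n | n. \<exists>(P :: nat \<Rightarrow> ('a, 'a set \<Rightarrow> 'a) module) \<epsilon> \<delta>.
            projective_resolution A N0 P \<epsilon> \<delta> \<and> (\<forall>i>n. carrier (P i) = {\<zero>\<^bsub>P i\<^esub>})}"
  have S: "Inf ?S \<le> enat 3" using le by (simp add: proj_dim_def)
  then have "?S \<noteq> {}" by (metis Inf_enat_def enat_ord_simps(5) infinity_ileE)
  then have "Inf ?S \<in> ?S" unfolding Inf_enat_def using LeastI_ex[of "\<lambda>x. x \<in> ?S"] by auto
  then obtain n and P :: "nat \<Rightarrow> ('a, 'a set \<Rightarrow> 'a) module" and \<epsilon> \<delta> where
    n: "Inf ?S = enat n" and P: "projective_resolution A N0 P \<epsilon> \<delta>" "\<And>i. i > n \<Longrightarrow> carrier (P i) = {\<zero>\<^bsub>P i\<^esub>}" by blast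
  from n S have "n \<le> 3" by simp
  then show ?thesis using that P by simp
qed

text \<open>
  For \<open>S = A\<^sub>+ K3\<close> this is a weak form of projectivity of \<open>K3\<close>: the comparison maps embed it as a direct
  summand of a sum of projective modules, so an element is detected modulo \<open>A\<^sub>+\<close> by homomorphisms to \<open>A\<close>.
\<close>

lemma K3_aug_span:
  assumes v: "v \<in> K3" and f0: "\<And>f. lhom A K3m A0 f \<Longrightarrow> aug (f v) = \<zero>"
    and S: "\<zero>\<^bsub>F\<^esub> \<in> S" "\<And>u w. u \<in> S \<Longrightarrow> w \<in> S \<Longrightarrow> u \<oplus>\<^bsub>F\<^esub> w \<in> S"
      "\<And>a u. a \<in> carrier A \<Longrightarrow> aug a = \<zero> \<Longrightarrow> u \<in> K3 \<Longrightarrow> a \<odot>\<^bsub>F\<^esub> u \<in> S"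
  shows "v \<in> S"
proof -
  obtain Q :: "nat \<Rightarrow> ('a, 'a set \<Rightarrow> 'a) module" and \<epsilon> \<delta>
    where Q: "projective_resolution A N0 Q \<epsilon> \<delta>" and Q4: "carrier (Q 4) = {\<zero>\<^bsub>Q 4\<^esub>}"
    by (rule short_resolution)
  note QD = resolutionD[OF Q] and Qab = left_module_abelian_group[OF resolutionD(2)[OF Q]]
  obtain h0 h1 h2 where h: "chain_to Q \<epsilon> \<delta> (\<lambda>a. {cp 0 a}) h0 h1 h2"
    using chain_to_exists[OF N0_trivial Q] by blast
  obtain k1 k2 s1 s2 where
    k: "lhom A F (Q 1) k1" "lhom A F (Q 2) k2" and s: "lhom A F F s1" "lhom A F F s2"
    and dk: "\<And>u. u \<in> carrier F \<Longrightarrow> \<delta> 1 (k2 u) = k1 (d2 u)"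
    and s2K: "\<And>u. u \<in> carrier F \<Longrightarrow> s2 u \<in> K3"
    and hk: "\<And>u. u \<in> carrier F \<Longrightarrow> h2 (k2 u) = u \<oplus>\<^bsub>F\<^esub> s1 (d2 u) \<oplus>\<^bsub>F\<^esub> s2 u"
    by (rule chain_homotopy[OF N0_trivial Q h]) blast
  note dl1 = QD(4)[of 1, unfolded Suc_1] and dl2 = QD(4)[of 2, simplified]
  \<comment> \<open>Used twice: for the part of \<open>v\<close> that passes through the resolution
    and for the error term \<open>s2 v\<close>.\<close>
  have S_span: "g w \<in> S" if g: "lhom A (free_module A I) F g" "\<And>i. i \<in> I \<Longrightarrow> g (unit_vec A i) \<in> K3"
    and w: "w \<in> carrier (free_module A I)" "\<And>i. aug (w i) = \<zero>" for g and I :: "'z set" and w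
    unfolding free_lhom_sum[OF FM.left_module_axioms g(1) w(1)]
  proof (rule finsum_induct[where P = "\<lambda>u. u \<in> S", OF FM.M.abelian_group_axioms])
    show "finite {i. w i \<noteq> \<zero>\<^bsub>A\<^esub>}" using w by (simp add: free_module_simps)
    fix i assume "i \<in> {i. w i \<noteq> \<zero>\<^bsub>A\<^esub>}"
    then have "i \<in> I" "w i \<in> carrier A" using w by (auto simp: free_module_simps)
    then show "w i \<odot>\<^bsub>F\<^esub> g (unit_vec A i) \<in> carrier F \<and> w i \<odot>\<^bsub>F\<^esub> g (unit_vec A i) \<in> S"
      using g(2) w(2) by (intro conjI FM.act_closed S(3)) (auto intro: K3_sub)
  qed (use S in auto)
  have vF: "v \<in> carrier F" and dv: "d2 v = \<zero>\<^bsub>F\<^esub>" using v by (auto simp: K3_def)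
  have s1z: "s1 \<zero>\<^bsub>F\<^esub> = \<zero>\<^bsub>F\<^esub>" by (rule lhom_zero[OF FM.M.abelian_group_axioms FM.M.abelian_group_axioms s(1)])
  have k1z: "k1 \<zero>\<^bsub>F\<^esub> = \<zero>\<^bsub>Q 1\<^esub>" by (rule lhom_zero[OF FM.M.abelian_group_axioms Qab k(1)])
  \<comment> \<open>The vanishing of \<open>Q 4\<close> enters here. The differential out of
    \<open>Q 3\<close> is injective, so on \<open>K3\<close> the map \<open>k2\<close> factors
    through \<open>Q 3\<close> by a linear map \<open>j\<close>.\<close>
  have inj: "p = q" if pq: "p \<in> carrier (Q 3)" "q \<in> carrier (Q 3)" "\<delta> 2 p = \<delta> 2 q" for p q
  proof -
    interpret Q3: left_module A "Q 3" by (rule QD(2))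
    interpret Q2: left_module A "Q 2" by (rule QD(2))
    have "\<delta> 2 (p \<ominus>\<^bsub>Q 3\<^esub> q) = \<zero>\<^bsub>Q 2\<^esub>"
      using pq lhom_minus[OF Qab Qab dl2 pq(2)] lhom_closed[OF dl2 pq(2)]
      by (simp add: a_minus_def lhom_add[OF dl2] Q2.M.r_neg)
    moreover have "p \<ominus>\<^bsub>Q 3\<^esub> q \<in> carrier (Q 3)" using pq by simp
    ultimately have "p \<ominus>\<^bsub>Q 3\<^esub> q \<in> \<delta> 3 ` carrier (Q 4)"
      using QD(9)[of "p \<ominus>\<^bsub>Q 3\<^esub> q" 2] by (simp add: numeral_eq_Suc)
    then have "p \<ominus>\<^bsub>Q 3\<^esub> q = \<zero>\<^bsub>Q 3\<^esub>" using Q4 lhom_zero[OF Qab Qab QD(4)[of 3]] by (auto simp: numeral_eq_Suc)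
    then show ?thesis using Q3.M.minus_self_eq[OF pq(1,2)] by simp
  qed
  have ex: "\<exists>p\<in>carrier (Q 3). \<delta> 2 p = k2 u" if "u \<in> K3" for u
  proof -
    have u: "u \<in> carrier F" "d2 u = \<zero>\<^bsub>F\<^esub>" using that by (auto simp: K3_def)
    have "\<delta> 1 (k2 u) = \<zero>\<^bsub>Q 1\<^esub>" using dk[OF u(1)] u(2) k1z by simp
    then show ?thesis using QD(9)[of "k2 u" 1] lhom_closed[OF k(2) u(1)] by (auto simp: numeral_eq_Suc)
  qed
  define j where "j u = (SOME p. p \<in> carrier (Q 3) \<and> \<delta> 2 p = k2 u)" for u
  have j: "j u \<in> carrier (Q 3) \<and> \<delta> 2 (j u) = k2 u" if "u \<in> K3" for u
    unfolding j_def using ex[OF that] by (intro someI_ex[of "\<lambda>p. p \<in> carrier (Q 3) \<and> \<delta> 2 p = k2 u"]) auto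
  have jl: "lhom A K3m (Q 3) j"
  proof -
    interpret Q3: left_module A "Q 3" by (rule QD(2))
    interpret K: left_module A K3m by (rule K3_module)
    show ?thesis
    proof (rule lhomI)
      fix u w assume uw: "u \<in> carrier K3m" "w \<in> carrier K3m"
      then have "u \<in> K3" "w \<in> K3" "u \<oplus>\<^bsub>F\<^esub> w \<in> K3" using K.M.a_closed[OF uw] by auto
      note uwK = this
      have "j (u \<oplus>\<^bsub>F\<^esub> w) = j u \<oplus>\<^bsub>Q 3\<^esub> j w"
        by (rule inj[of "j (u \<oplus>\<^bsub>F\<^esub> w)"]) (use j uwK in \<open>auto simp: lhom_add[OF dl2] lhom_add[OF k(2)] K3_sub\<close>)
      then show "j (u \<oplus>\<^bsub>K3m\<^esub> w) = j u \<oplus>\<^bsub>Q 3\<^esub> j w" by simp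
    next
      fix a u assume au: "a \<in> carrier A" "u \<in> carrier K3m"
      then have "u \<in> K3" "a \<odot>\<^bsub>F\<^esub> u \<in> K3" using K.act_closed[OF au] by auto
      note auK = this
      have "j (a \<odot>\<^bsub>F\<^esub> u) = a \<odot>\<^bsub>Q 3\<^esub> j u"
        by (rule inj[of "j (a \<odot>\<^bsub>F\<^esub> u)"]) (use j au auK in \<open>auto simp: lhom_smult[OF dl2] lhom_smult[OF k(2)] K3_sub Q3.act_closed\<close>)
      then show "j (a \<odot>\<^bsub>K3m\<^esub> u) = a \<odot>\<^bsub>Q 3\<^esub> j u" by simp
    qed (use j in auto)
  qed
  from QD(1)[of 3] obtain I :: "('a set \<Rightarrow> 'a) set" and \<sigma> \<rho> where sr:
    "\<sigma> \<in> mod_hom A (Q 3) (free_module A I)" "\<rho> \<in> mod_hom A (free_module A I) (Q 3)"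
    "\<And>p. p \<in> carrier (Q 3) \<Longrightarrow> \<rho> (\<sigma> p) = p"
    unfolding projective_module_def by blast
  note sg = mod_hom_lhom[OF sr(1)] and rh = mod_hom_lhom[OF sr(2)]
  \<comment> \<open>The coordinates of \<open>\<sigma> (j u)\<close> are linear forms in
    \<open>u\<close>, so \<open>f0\<close> puts those of \<open>w\<close> into the augmentation
    ideal.\<close>
  define w where "w = \<sigma> (j v)"
  have wc: "w \<in> carrier (free_module A I)" unfolding w_def using lhom_closed[OF sg] j[OF v] by blast
  have w0: "aug (w i) = \<zero>" for i
    unfolding w_def
  proof (rule f0)
    have "lhom A (free_module A I) A0 (\<lambda>f. f i)" by (rule lhomI) (auto simp: free_module_simps)
    then show "lhom A K3m A0 (\<lambda>u. \<sigma> (j u) i)" using lhom_compose[OF lhom_compose[OF jl sg]] by blast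
  qed
  have l2: "lhom A (Q 2) F h2" and l1: "lhom A (Q 1) F h1" and e2: "\<And>u. u \<in> carrier (Q 2) \<Longrightarrow> d2 (h2 u) = h1 (\<delta> 1 u)"
    using h by (auto simp: chain_to_def)
  have phi: "lhom A (free_module A I) F (\<lambda>u. h2 (\<delta> 2 (\<rho> u)))"
    by (rule lhom_compose[OF lhom_compose[OF rh dl2] l2])
  have "h2 (\<delta> 2 (\<rho> w)) \<in> S"
  proof (rule S_span[OF phi _ wc w0])
    fix i assume "i \<in> I"
    then have c: "\<rho> (unit_vec A i) \<in> carrier (Q 3)" using lhom_closed[OF rh] by simp
    have "\<delta> 1 (\<delta> 2 (\<rho> (unit_vec A i))) = \<zero>\<^bsub>Q 1\<^esub>" using QD(8)[of "\<rho> (unit_vec A i)" 1] c by (simp add: numeral_eq_Suc)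
    then have "d2 (h2 (\<delta> 2 (\<rho> (unit_vec A i)))) = \<zero>\<^bsub>F\<^esub>"
      using e2[OF lhom_closed[OF dl2 c]] lhom_zero[OF Qab FM.M.abelian_group_axioms l1] by simp
    then show "h2 (\<delta> 2 (\<rho> (unit_vec A i))) \<in> K3" using lhom_closed[OF l2 lhom_closed[OF dl2 c]] by (simp add: K3_def)
  qed
  moreover have "\<rho> w = j v" unfolding w_def using sr(3) j[OF v] by blast
  ultimately have 1: "h2 (k2 v) \<in> S" using j[OF v] by simp
  have "\<ominus>\<^bsub>F\<^esub> s2 (unit_vec A i) \<in> K3" for i
  proof -
    have "s2 (unit_vec A i) \<in> K3" by (rule s2K) simp
    then show ?thesis unfolding K3_def
      using lhom_minus[OF FM.M.abelian_group_axioms FM.M.abelian_group_axioms d2_lhom, of "s2 (unit_vec A i)"] by simp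
  qed
  from S_span[OF lhom_uminus[OF FM.left_module_axioms s(2)] this vF K3_aug[OF v]]
  have "\<ominus>\<^bsub>F\<^esub> s2 v \<in> S" .
  then have "h2 (k2 v) \<oplus>\<^bsub>F\<^esub> \<ominus>\<^bsub>F\<^esub> s2 v \<in> S" using 1 S(2) by simp
  \<comment> \<open>On \<open>K3\<close> the homotopy term drops out because \<open>d2 v\<close> is
    zero.\<close>
  moreover have "h2 (k2 v) \<oplus>\<^bsub>F\<^esub> \<ominus>\<^bsub>F\<^esub> s2 v = v"
    using hk[OF vF] dv s1z vF lhom_closed[OF s(2) vF] by (simp add: FM.M.a_assoc FM.M.r_neg)
  ultimately show ?thesis by simp
qed

end

section \<open>Graded Ext with values in the algebra\<close>

context connected_alg begin

section \<open>Sums of homogeneous homomorphisms\<close>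

lemma graded_Hom_simps:
  "\<zero>\<^bsub>graded_Hom A \<A> P \<P>\<^esub> = (\<lambda>p\<in>carrier P. \<zero>\<^bsub>A\<^esub>)"
  "f \<oplus>\<^bsub>graded_Hom A \<A> P \<P>\<^esub> g = (\<lambda>p\<in>carrier P. f p \<oplus>\<^bsub>A\<^esub> g p)"
  "a \<odot>\<^bsub>graded_Hom A \<A> P \<P>\<^esub> f = (\<lambda>p\<in>carrier P. f p \<otimes>\<^bsub>A\<^esub> a)"
  by (simp_all add: graded_Hom_def)

lemma graded_HomI:
  assumes "finite E" "\<And>e. e \<in> E \<Longrightarrow> \<phi> e \<in> homs_of_degree A \<A> P \<P> e"
  shows "(\<lambda>p\<in>carrier P. \<Oplus>\<^bsub>A\<^esub>e\<in>E. \<phi> e p) \<in> carrier (graded_Hom A \<A> P \<P>)"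
  using assms unfolding graded_Hom_def by auto

lemma graded_HomE:
  assumes "f \<in> carrier (graded_Hom A \<A> P \<P>)"
  obtains E \<phi> where "finite E" "\<And>e. e \<in> E \<Longrightarrow> \<phi> e \<in> homs_of_degree A \<A> P \<P> e"
    "f = (\<lambda>p\<in>carrier P. \<Oplus>\<^bsub>A\<^esub>e\<in>E. \<phi> e p)"
  using assms unfolding graded_Hom_def by auto

lemma homs_of_degree_iff:
  "f \<in> homs_of_degree A \<A> P \<P> e \<longleftrightarrow> lhom A P (regular_module A) f \<and> f \<in> extensional (carrier P) \<and>
     (\<forall>j. \<forall>p\<in>\<P> j. f p \<in> regular_grading A \<A> (j + e))"
  unfolding homs_of_degree_def mod_hom_def lhom_def PiE_def image_subset_iff by auto

lemma lhom_restrict: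
  assumes P: "left_module A P" and f: "lhom A P N f"
  shows "lhom A P N (restrict f (carrier P))"
proof -
  interpret P: left_module A P by fact
  show ?thesis using f by (auto simp: lhom_def P.act_closed)
qed

lemma graded_Hom_lhom:
  assumes P: "left_module A P" and f: "f \<in> carrier (graded_Hom A \<A> P \<P>)"
  shows "lhom A P (regular_module A) f" "f \<in> extensional (carrier P)"
proof -
  from f obtain E \<phi> where E: "finite E" "\<And>e. e \<in> E \<Longrightarrow> \<phi> e \<in> homs_of_degree A \<A> P \<P> e"
    and f_eq: "f = (\<lambda>p\<in>carrier P. \<Oplus>\<^bsub>A\<^esub>e\<in>E. \<phi> e p)" by (rule graded_HomE) blast
  have "lhom A P (regular_module A) (\<lambda>p. \<Oplus>\<^bsub>A\<^esub>e\<in>E. \<phi> e p)"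
    using E
  proof (induction E rule: finite_induct)
    case empty then show ?case by (intro lhomI) auto
  next
    case (insert e E)
    have hom: "lhom A P (regular_module A) (\<phi> e')" if "e' \<in> insert e E" for e'
      using insert.prems[OF that] by (simp add: homs_of_degree_iff)
    have 1: "lhom A P (regular_module A) (\<lambda>p. \<phi> e p \<oplus>\<^bsub>regular_module A\<^esub> (\<Oplus>\<^bsub>A\<^esub>e\<in>E. \<phi> e p))"
      using insert hom by (intro lhom_addf regular_module_is_module) auto
    have eq: "(\<Oplus>\<^bsub>A\<^esub>e\<in>insert e E. \<phi> e p) = \<phi> e p \<oplus>\<^bsub>A\<^esub> (\<Oplus>\<^bsub>A\<^esub>e\<in>E. \<phi> e p)" if "p \<in> carrier P" for p
      using insert.hyps lhom_closed[OF hom that] by (intro M.finsum_insert) auto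
    interpret P: left_module A P by fact
    show ?case using 1 unfolding lhom_def by (simp add: eq Pi_def P.act_closed)
  qed
  from lhom_restrict[OF P this] show "lhom A P (regular_module A) f" using f_eq by simp
  show "f \<in> extensional (carrier P)" using f_eq by simp
qed

lemma graded_Hom_homogeneous:
  assumes f: "f \<in> homs_of_degree A \<A> P \<P> e"
  shows "f \<in> carrier (graded_Hom A \<A> P \<P>)"
proof -
  have "(\<lambda>p\<in>carrier P. \<Oplus>\<^bsub>A\<^esub>e\<in>{e}. f p) = f"
  proof
    fix p show "(\<lambda>p\<in>carrier P. \<Oplus>\<^bsub>A\<^esub>e\<in>{e}. f p) p = f p"
      using f lhom_closed[of A P "regular_module A" f p]
      by (cases "p \<in> carrier P") (auto simp: homs_of_degree_iff extensional_def)
  qed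
  then show ?thesis using graded_HomI[of "{e}" "\<lambda>_. f" P \<P>] f by simp
qed

lemma graded_Hom_zero: "(\<lambda>p\<in>carrier P. \<zero>\<^bsub>A\<^esub>) \<in> carrier (graded_Hom A \<A> P \<P>)"
  using graded_HomI[of "{}"] by simp

lemma homs_of_degree_add:
  assumes P: "left_module A P" and "f \<in> homs_of_degree A \<A> P \<P> e" "g \<in> homs_of_degree A \<A> P \<P> e"
    and sub: "\<And>j. \<P> j \<subseteq> carrier P"
  shows "(\<lambda>p\<in>carrier P. f p \<oplus>\<^bsub>A\<^esub> g p) \<in> homs_of_degree A \<A> P \<P> e"
proof -
  have "lhom A P (regular_module A) (\<lambda>p. f p \<oplus>\<^bsub>regular_module A\<^esub> g p)"
    using assms by (intro lhom_addf regular_module_is_module) (auto simp: homs_of_degree_iff)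
  from lhom_restrict[OF P this] show ?thesis using assms sub
    by (auto simp: homs_of_degree_iff subset_iff intro: components_add_mem[OF A_ab regular_components])
qed

lemma homs_of_degree_smult:
  assumes P: "left_module A P" and f: "f \<in> homs_of_degree A \<A> P \<P> e" and a: "\<alpha> \<in> carrier K"
    and sub: "\<And>j. \<P> j \<subseteq> carrier P"
  shows "(\<lambda>p\<in>carrier P. \<alpha> \<odot>\<^bsub>A\<^esub> f p) \<in> homs_of_degree A \<A> P \<P> e"
proof -
  have l: "lhom A P (regular_module A) f" using f by (simp add: homs_of_degree_iff)
  have "lhom A P (regular_module A) (\<lambda>p. \<alpha> \<odot>\<^bsub>A\<^esub> f p)"
    using l a lhom_closed[OF l]
    by (intro lhomI) (auto simp: lhom_add[OF l] lhom_smult[OF l] smult_r_distr smult_mult_right)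
  moreover have "\<alpha> \<odot>\<^bsub>A\<^esub> b \<in> regular_grading A \<A> j" if "b \<in> regular_grading A \<A> j" for b j
    using that a by (auto simp: regular_grading_def grade_smult split: if_splits)
  ultimately show ?thesis using f sub lhom_restrict[OF P]
    by (auto simp: homs_of_degree_iff subset_iff)
qed

lemma homs_of_degree_zero:
  assumes P: "left_module A P" and sub: "\<And>j. \<P> j \<subseteq> carrier P"
  shows "(\<lambda>p\<in>carrier P. \<zero>\<^bsub>A\<^esub>) \<in> homs_of_degree A \<A> P \<P> e"
proof -
  have "lhom A P (regular_module A) (\<lambda>p. \<zero>\<^bsub>A\<^esub>)" by (rule lhomI) auto
  from lhom_restrict[OF P this] show ?thesis using sub components_zero_mem[OF A_ab regular_components]
    by (auto simp: homs_of_degree_iff subset_iff)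
qed

text \<open>The finite sets of degrees of \<open>f\<close> and \<open>g\<close> may differ; both
  families are extended by zero to the union.\<close>

lemma graded_Hom_add:
  assumes P: "left_module A P" and f: "f \<in> carrier (graded_Hom A \<A> P \<P>)" and g: "g \<in> carrier (graded_Hom A \<A> P \<P>)"
    and sub: "\<And>j. \<P> j \<subseteq> carrier P"
  shows "(\<lambda>p\<in>carrier P. f p \<oplus>\<^bsub>A\<^esub> g p) \<in> carrier (graded_Hom A \<A> P \<P>)"
proof -
  obtain E \<phi> where E: "finite E" "\<And>e. e \<in> E \<Longrightarrow> \<phi> e \<in> homs_of_degree A \<A> P \<P> e"
    and f_eq: "f = (\<lambda>p\<in>carrier P. \<Oplus>\<^bsub>A\<^esub>e\<in>E. \<phi> e p)" using f by (rule graded_HomE) blast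
  obtain D \<psi> where D: "finite D" "\<And>e. e \<in> D \<Longrightarrow> \<psi> e \<in> homs_of_degree A \<A> P \<P> e"
    and g_eq: "g = (\<lambda>p\<in>carrier P. \<Oplus>\<^bsub>A\<^esub>e\<in>D. \<psi> e p)" using g by (rule graded_HomE) blast
  define z where "z = (\<lambda>p\<in>carrier P. \<zero>\<^bsub>A\<^esub>)"
  define \<phi>' where "\<phi>' e = (if e \<in> E then \<phi> e else z)" for e
  define \<psi>' where "\<psi>' e = (if e \<in> D then \<psi> e else z)" for e
  have m: "\<phi>' e \<in> homs_of_degree A \<A> P \<P> e" "\<psi>' e \<in> homs_of_degree A \<A> P \<P> e" for e
    using E D homs_of_degree_zero[OF P sub] by (auto simp: \<phi>'_def \<psi>'_def z_def)
  have c: "\<phi>' e p \<in> carrier A" "\<psi>' e p \<in> carrier A" if "p \<in> carrier P" for e p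
    using m[of e] that by (auto simp: homs_of_degree_iff dest!: lhom_closed)
  have "(\<Oplus>\<^bsub>A\<^esub>e\<in>E \<union> D. \<phi>' e p \<oplus>\<^bsub>A\<^esub> \<psi>' e p) = f p \<oplus>\<^bsub>A\<^esub> g p" if p: "p \<in> carrier P" for p
  proof -
    have "(\<Oplus>\<^bsub>A\<^esub>e\<in>E \<union> D. \<phi>' e p) = (\<Oplus>\<^bsub>A\<^esub>e\<in>E. \<phi> e p)"
      using E(1) D(1) c[OF p] p by (intro M.add.finprod_mono_neutral_cong_right) (auto simp: \<phi>'_def z_def split: if_splits)
    moreover have "(\<Oplus>\<^bsub>A\<^esub>e\<in>E \<union> D. \<psi>' e p) = (\<Oplus>\<^bsub>A\<^esub>e\<in>D. \<psi> e p)"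
      using E(1) D(1) c[OF p] p by (intro M.add.finprod_mono_neutral_cong_right) (auto simp: \<psi>'_def z_def split: if_splits)
    ultimately show ?thesis using c[OF p] p by (simp add: f_eq g_eq M.finsum_addf)
  qed
  then have "(\<lambda>p\<in>carrier P. f p \<oplus>\<^bsub>A\<^esub> g p) =
      (\<lambda>p\<in>carrier P. \<Oplus>\<^bsub>A\<^esub>e\<in>E \<union> D. (\<lambda>p\<in>carrier P. \<phi>' e p \<oplus>\<^bsub>A\<^esub> \<psi>' e p) p)"
    by (intro restrict_ext) simp
  then show ?thesis
    using graded_HomI[of "E \<union> D" "\<lambda>e. \<lambda>p\<in>carrier P. \<phi>' e p \<oplus>\<^bsub>A\<^esub> \<psi>' e p" P \<P>] E(1) D(1)
      homs_of_degree_add[OF P m sub] by simp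
qed

lemma graded_Hom_smult:
  assumes P: "left_module A P" and f: "f \<in> carrier (graded_Hom A \<A> P \<P>)" and a: "\<alpha> \<in> carrier K"
    and sub: "\<And>j. \<P> j \<subseteq> carrier P"
  shows "(\<lambda>p\<in>carrier P. \<alpha> \<odot>\<^bsub>A\<^esub> f p) \<in> carrier (graded_Hom A \<A> P \<P>)"
proof -
  obtain E \<phi> where E: "finite E" "\<And>e. e \<in> E \<Longrightarrow> \<phi> e \<in> homs_of_degree A \<A> P \<P> e"
    and f_eq: "f = (\<lambda>p\<in>carrier P. \<Oplus>\<^bsub>A\<^esub>e\<in>E. \<phi> e p)" using f by (rule graded_HomE) blast
  have c: "\<phi> e p \<in> carrier A" if "p \<in> carrier P" "e \<in> E" for e p
    using E(2)[OF that(2)] that by (auto simp: homs_of_degree_iff dest!: lhom_closed)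
  have "(\<Oplus>\<^bsub>A\<^esub>e\<in>E. \<alpha> \<odot>\<^bsub>A\<^esub> \<phi> e p) = \<alpha> \<odot>\<^bsub>A\<^esub> f p" if p: "p \<in> carrier P" for p
    using LA.act_finsum[OF E(1) a, of "\<lambda>e. \<phi> e p"] c p by (auto simp: f_eq)
  then have "(\<lambda>p\<in>carrier P. \<alpha> \<odot>\<^bsub>A\<^esub> f p) =
      (\<lambda>p\<in>carrier P. \<Oplus>\<^bsub>A\<^esub>e\<in>E. (\<lambda>p\<in>carrier P. \<alpha> \<odot>\<^bsub>A\<^esub> \<phi> e p) p)"
    by (intro restrict_ext) simp
  then show ?thesis
    using graded_HomI[of E "\<lambda>e. \<lambda>p\<in>carrier P. \<alpha> \<odot>\<^bsub>A\<^esub> \<phi> e p" P \<P>] E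
      homs_of_degree_smult[OF P _ a sub] by simp
qed

lemma graded_Hom_abelian_group:
  assumes P: "left_module A P" and sub: "\<And>j. \<P> j \<subseteq> carrier P"
  shows "abelian_group (graded_Hom A \<A> P \<P>)"
proof (rule abelian_groupI)
  let ?H = "graded_Hom A \<A> P \<P>"
  note L = graded_Hom_lhom[OF P]
  have c: "f p \<in> carrier A" if "f \<in> carrier ?H" "p \<in> carrier P" for f p
    using lhom_closed[OF L(1)[OF that(1)] that(2)] by simp
  {
    fix f g assume "f \<in> carrier ?H" "g \<in> carrier ?H"
    then show "f \<oplus>\<^bsub>?H\<^esub> g \<in> carrier ?H" using graded_Hom_add[OF P _ _ sub] by (simp add: graded_Hom_simps)
  next
    show "\<zero>\<^bsub>?H\<^esub> \<in> carrier ?H" using graded_Hom_zero by (simp add: graded_Hom_simps)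
  next
    fix f g h assume "f \<in> carrier ?H" "g \<in> carrier ?H" "h \<in> carrier ?H"
    then show "f \<oplus>\<^bsub>?H\<^esub> g \<oplus>\<^bsub>?H\<^esub> h = f \<oplus>\<^bsub>?H\<^esub> (g \<oplus>\<^bsub>?H\<^esub> h)" using c
      by (auto simp: graded_Hom_simps M.a_assoc intro!: restrict_ext)
  next
    fix f g assume "f \<in> carrier ?H" "g \<in> carrier ?H"
    then show "f \<oplus>\<^bsub>?H\<^esub> g = g \<oplus>\<^bsub>?H\<^esub> f" using c
      by (auto simp: graded_Hom_simps M.a_comm intro!: restrict_ext)
  next
    fix f assume f: "f \<in> carrier ?H"
    show "\<zero>\<^bsub>?H\<^esub> \<oplus>\<^bsub>?H\<^esub> f = f"
      using c[OF f] L(2)[OF f] by (auto simp: graded_Hom_simps extensional_def)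
  next
    fix f assume f: "f \<in> carrier ?H"
    show "\<exists>g\<in>carrier ?H. g \<oplus>\<^bsub>?H\<^esub> f = \<zero>\<^bsub>?H\<^esub>"
      using graded_Hom_smult[OF P f _ sub, of "\<ominus> \<one>"] c[OF f]
      by (intro bexI[of _ "\<lambda>p\<in>carrier P. (\<ominus> \<one>) \<odot>\<^bsub>A\<^esub> f p"])
        (auto simp: graded_Hom_simps smult_l_minus M.l_neg intro!: restrict_ext)
  }
qed

text \<open>If the quotient is zero, the coset of \<open>f\<close> is the set of coboundaries, and
  \<open>f\<close> belongs to its own coset.\<close>

lemma Ext_vanishing:
  assumes P: "\<And>i. left_module A (P i)" and sub: "\<And>i j. \<P> i j \<subseteq> carrier (P i)"
    and d: "\<And>p. p \<in> carrier (P (Suc i)) \<Longrightarrow> \<delta> i p \<in> carrier (P i)"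
    and zero: "carrier (Ext_module A \<A> P \<P> \<delta> (Suc i)) = {\<zero>\<^bsub>Ext_module A \<A> P \<P> \<delta> (Suc i)\<^esub>}"
    and f: "f \<in> Ext_cocycles A \<A> P \<P> \<delta> (Suc i)"
  obtains g where "g \<in> carrier (graded_Hom A \<A> (P i) (\<P> i))" "\<And>p. p \<in> carrier (P (Suc i)) \<Longrightarrow> f p = g (\<delta> i p)"
proof -
  let ?H = "graded_Hom A \<A> (P (Suc i)) (\<P> (Suc i))" and ?B = "Ext_coboundaries A \<A> P \<P> \<delta> (Suc i)"
  interpret H: abelian_group ?H by (rule graded_Hom_abelian_group[OF P sub])
  have fH: "f \<in> carrier ?H" using f by (simp add: Ext_cocycles_def)
  have "?B +>\<^bsub>?H\<^esub> f = ?B" using zero f by (auto simp: Ext_module_def subquotient_def)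
  moreover have "\<zero>\<^bsub>?H\<^esub> \<in> ?B"
    using graded_Hom_zero[of "P i" "\<P> i"] d
    by (auto simp: Ext_coboundaries_def graded_Hom_simps intro!: image_eqI[of _ _ "\<lambda>p\<in>carrier (P i). \<zero>\<^bsub>A\<^esub>"] restrict_ext)
  then have "f \<in> ?B +>\<^bsub>?H\<^esub> f" using fH unfolding a_r_coset_def r_coset_def by force
  ultimately have "f \<in> ?B" by simp
  then show ?thesis using that by (auto simp: Ext_coboundaries_def)
qed

text \<open>Two elements of a line are dependent. The field acts on \<open>Ext\<close> through the
  multiples of one in \<open>A\<close>, and most of the proof translates operations on cosets into
  operations on the representing functions.\<close>

lemma Ext_one_dimensional:
  assumes P: "\<And>i. left_module A (P i)" and sub: "\<And>i j. \<P> i j \<subseteq> carrier (P i)"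
    and d: "lhom A (P (Suc i)) (P i) (\<delta> i)" "lhom A (P (Suc (Suc i))) (P (Suc i)) (\<delta> (Suc i))"
    and dd: "\<And>p. p \<in> carrier (P (Suc (Suc i))) \<Longrightarrow> \<delta> i (\<delta> (Suc i) p) = \<zero>\<^bsub>P i\<^esub>"
    and dg: "\<And>g. g \<in> carrier (graded_Hom A \<A> (P i) (\<P> i)) \<Longrightarrow>
      (\<lambda>p\<in>carrier (P (Suc i)). g (\<delta> i p)) \<in> carrier (graded_Hom A \<A> (P (Suc i)) (\<P> (Suc i)))"
    and iso: "\<Phi> \<in> mod_hom (opp A) (Ext_module A \<A> P \<P> \<delta> (Suc i)) (trivial_module K A \<A>)"
      "inj_on \<Phi> (carrier (Ext_module A \<A> P \<P> \<delta> (Suc i)))"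
    and f: "f1 \<in> Ext_cocycles A \<A> P \<P> \<delta> (Suc i)" "f2 \<in> Ext_cocycles A \<A> P \<P> \<delta> (Suc i)"
  obtains \<alpha> \<beta> g where "\<alpha> \<in> carrier K" "\<beta> \<in> carrier K" "\<alpha> \<noteq> \<zero> \<or> \<beta> \<noteq> \<zero>" "g \<in> carrier (graded_Hom A \<A> (P i) (\<P> i))"
    "\<And>p. p \<in> carrier (P (Suc i)) \<Longrightarrow> \<alpha> \<odot>\<^bsub>A\<^esub> f1 p \<oplus>\<^bsub>A\<^esub> \<beta> \<odot>\<^bsub>A\<^esub> f2 p = g (\<delta> i p)"
proof -
  let ?H = "graded_Hom A \<A> (P (Suc i)) (\<P> (Suc i))" and ?Hi = "graded_Hom A \<A> (P i) (\<P> i)"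
  let ?B = "Ext_coboundaries A \<A> P \<P> \<delta> (Suc i)" and ?Z = "Ext_cocycles A \<A> P \<P> \<delta> (Suc i)"
  let ?E = "Ext_module A \<A> P \<P> \<delta> (Suc i)" and ?P = "carrier (P (Suc i))"
  interpret H: abelian_group ?H by (rule graded_Hom_abelian_group[OF P sub])
  have dc: "\<delta> i p \<in> carrier (P i)" if "p \<in> ?P" for p using lhom_closed[OF d(1) that] .
  define sc where "sc \<alpha> f = (\<lambda>p\<in>?P. \<alpha> \<odot>\<^bsub>A\<^esub> f p)" for \<alpha> f
  have fc: "f p \<in> carrier A" if "f \<in> carrier ?H" "p \<in> ?P" for f p
    using lhom_closed[OF graded_Hom_lhom(1)[OF P[of "Suc i"] that(1)] that(2)] by simp
  have gc: "g p \<in> carrier A" if "g \<in> carrier ?Hi" "p \<in> carrier (P i)" for g p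
    using lhom_closed[OF graded_Hom_lhom(1)[OF P[of i] that(1)] that(2)] by simp
  have act: "(\<alpha> \<odot>\<^bsub>A\<^esub> \<one>\<^bsub>A\<^esub>) \<odot>\<^bsub>?H\<^esub> f = sc \<alpha> f" if "\<alpha> \<in> carrier K" "f \<in> carrier ?H" for \<alpha> f
    using fc[OF that(2)] that by (auto simp: graded_Hom_simps sc_def smult_mult_right intro!: restrict_ext)
  have B_eq: "?B = (\<lambda>g. \<lambda>p\<in>?P. g (\<delta> i p)) ` carrier ?Hi" by (simp add: Ext_coboundaries_def)
  have BH: "?B \<subseteq> carrier ?H" unfolding B_eq using dg by auto
  have B_sc: "sc \<alpha> b \<in> ?B" if a: "\<alpha> \<in> carrier K" and b: "b \<in> ?B" for \<alpha> b
  proof -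
    from b obtain g where g: "g \<in> carrier ?Hi" "b = (\<lambda>p\<in>?P. g (\<delta> i p))" unfolding B_eq by blast
    have "sc \<alpha> b = (\<lambda>p\<in>?P. (\<lambda>p\<in>carrier (P i). \<alpha> \<odot>\<^bsub>A\<^esub> g p) (\<delta> i p))"
      unfolding sc_def g(2) using dc by (intro restrict_ext) auto
    then show ?thesis unfolding B_eq using graded_Hom_smult[OF P g(1) a sub] by blast
  qed
  have B_add: "b \<oplus>\<^bsub>?H\<^esub> b' \<in> ?B" if "b \<in> ?B" "b' \<in> ?B" for b b'
  proof -
    from that obtain g g' where g: "g \<in> carrier ?Hi" "b = (\<lambda>p\<in>?P. g (\<delta> i p))"
      "g' \<in> carrier ?Hi" "b' = (\<lambda>p\<in>?P. g' (\<delta> i p))" unfolding B_eq by blast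
    have "b \<oplus>\<^bsub>?H\<^esub> b' = (\<lambda>p\<in>?P. (\<lambda>p\<in>carrier (P i). g p \<oplus>\<^bsub>A\<^esub> g' p) (\<delta> i p))"
      unfolding graded_Hom_simps g(2,4) using dc by (intro restrict_ext) auto
    then show ?thesis unfolding B_eq using graded_Hom_add[OF P g(1,3) sub] by blast
  qed
  have B_zero: "\<zero>\<^bsub>?H\<^esub> \<in> ?B"
    unfolding B_eq using graded_Hom_zero[of "P i" "\<P> i"] dc
    by (auto simp: graded_Hom_simps intro!: image_eqI[of _ _ "\<lambda>p\<in>carrier (P i). \<zero>\<^bsub>A\<^esub>"] restrict_ext)
  have minus: "\<ominus>\<^bsub>?H\<^esub> f = sc (\<ominus> \<one>) f" if f: "f \<in> carrier ?H" for f
  proof (rule H.minus_equality)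
    show "sc (\<ominus> \<one>) f \<oplus>\<^bsub>?H\<^esub> f = \<zero>\<^bsub>?H\<^esub>" using fc[OF f]
      by (auto simp: graded_Hom_simps sc_def smult_l_minus M.l_neg intro!: restrict_ext)
    show "sc (\<ominus> \<one>) f \<in> carrier ?H" unfolding sc_def by (rule graded_Hom_smult[OF P f _ sub]) simp
  qed (rule f)
  have Bsg: "additive_subgroup ?B ?H"
  proof (rule additive_subgroup.intro, rule subgroup.intro)
    show "inv\<^bsub>add_monoid ?H\<^esub> b \<in> ?B" if "b \<in> ?B" for b
      using minus[of b] B_sc[OF _ that, of "\<ominus> \<one>"] that BH by (auto simp: a_inv_def[symmetric])
  qed (use BH B_add B_zero in auto)
  interpret B: abelian_subgroup ?B ?H by (rule abelian_subgroupI3[OF Bsg H.abelian_group_axioms])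
  have ZH: "?Z \<subseteq> carrier ?H" by (auto simp: Ext_cocycles_def)
  have Z_sc: "sc \<alpha> z \<in> ?Z" if a: "\<alpha> \<in> carrier K" and z: "z \<in> ?Z" for \<alpha> z
    using graded_Hom_smult[where f = z, OF P[of "Suc i"] _ a sub[of "Suc i"]] z a lhom_closed[OF d(2)]
    by (auto simp: Ext_cocycles_def sc_def)
  have Z_add: "z \<oplus>\<^bsub>?H\<^esub> z' \<in> ?Z" if z: "z \<in> ?Z" "z' \<in> ?Z" for z z'
    using graded_Hom_add[where f = z and g = z', OF P[of "Suc i"] _ _ sub[of "Suc i"]] z lhom_closed[OF d(2)]
    by (auto simp: Ext_cocycles_def graded_Hom_simps)
  have E_simps: "carrier ?E = (\<lambda>z. ?B +>\<^bsub>?H\<^esub> z) ` ?Z" "add ?E = set_add ?H"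
    "smult ?E = (\<lambda>a C. \<Union>z\<in>C. ?B +>\<^bsub>?H\<^esub> (a \<odot>\<^bsub>?H\<^esub> z))"
    by (simp_all add: Ext_module_def subquotient_def)
  have E_add: "(?B +>\<^bsub>?H\<^esub> z) \<oplus>\<^bsub>?E\<^esub> (?B +>\<^bsub>?H\<^esub> z') = ?B +>\<^bsub>?H\<^esub> (z \<oplus>\<^bsub>?H\<^esub> z')" if "z \<in> ?Z" "z' \<in> ?Z" for z z'
    unfolding E_simps using that ZH by (intro B.a_rcos_sum) auto
  \<comment> \<open>Scalar multiplication in \<open>subquotient\<close> is a union over the whole
    coset; every representative has to give the same result.\<close>
  have E_sc: "(\<alpha> \<odot>\<^bsub>A\<^esub> \<one>\<^bsub>A\<^esub>) \<odot>\<^bsub>?E\<^esub> (?B +>\<^bsub>?H\<^esub> z) = ?B +>\<^bsub>?H\<^esub> sc \<alpha> z" if a: "\<alpha> \<in> carrier K" and z: "z \<in> ?Z" for \<alpha> z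
  proof -
    have zH: "z \<in> carrier ?H" and sH: "sc \<alpha> z \<in> carrier ?H" using z ZH Z_sc[OF a z] by auto
    have "?B +>\<^bsub>?H\<^esub> ((\<alpha> \<odot>\<^bsub>A\<^esub> \<one>\<^bsub>A\<^esub>) \<odot>\<^bsub>?H\<^esub> y) = ?B +>\<^bsub>?H\<^esub> sc \<alpha> z" if "y \<in> ?B +>\<^bsub>?H\<^esub> z" for y
    proof -
      from that obtain b where b: "b \<in> ?B" "y = b \<oplus>\<^bsub>?H\<^esub> z" by (auto simp: a_r_coset_def r_coset_def)
      have bH: "b \<in> carrier ?H" using b BH by auto
      have yH: "y \<in> carrier ?H" using b(2) bH zH by simp
      have "sc \<alpha> y = sc \<alpha> b \<oplus>\<^bsub>?H\<^esub> sc \<alpha> z"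
        unfolding b(2) using fc[OF bH] fc[OF zH] a by (auto simp: sc_def graded_Hom_simps smult_r_distr intro!: restrict_ext)
      then have "sc \<alpha> y \<in> ?B +>\<^bsub>?H\<^esub> sc \<alpha> z"
        using B_sc[OF a b(1)] by (auto simp: a_r_coset_def r_coset_def)
      then have "?B +>\<^bsub>?H\<^esub> sc \<alpha> z = ?B +>\<^bsub>?H\<^esub> sc \<alpha> y"
        using sH by (rule H.a_repr_independence[OF _ _ B.a_subgroup])
      then show ?thesis using act[OF a yH] by simp
    qed
    moreover have "z \<in> ?B +>\<^bsub>?H\<^esub> z" by (rule B.a_rcos_self[OF zH])
    ultimately show ?thesis unfolding E_simps by blast
  qed
  have Phi_add: "\<Phi> (C \<oplus>\<^bsub>?E\<^esub> D) = \<Phi> C \<oplus> \<Phi> D" if "C \<in> carrier ?E" "D \<in> carrier ?E" for C D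
    using iso(1) that by (simp add: mod_hom_def trivial_module_def)
  have Phi_sc: "\<Phi> ((\<alpha> \<odot>\<^bsub>A\<^esub> \<one>\<^bsub>A\<^esub>) \<odot>\<^bsub>?E\<^esub> C) = \<alpha> \<otimes> \<Phi> C" if "C \<in> carrier ?E" "\<alpha> \<in> carrier K" for C \<alpha>
    using iso(1) that by (simp add: mod_hom_def trivial_module_def opp_def augmentation_eq aug_smult_one)
  have Phi_c: "\<Phi> C \<in> carrier K" if "C \<in> carrier ?E" for C
    using iso(1) that by (auto simp: mod_hom_def trivial_module_def)
  have mem: "?B +>\<^bsub>?H\<^esub> z \<in> carrier ?E" if "z \<in> ?Z" for z unfolding E_simps using that by blast
  define c1 c2 where "c1 = \<Phi> (?B +>\<^bsub>?H\<^esub> f1)" and "c2 = \<Phi> (?B +>\<^bsub>?H\<^esub> f2)"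
  have cK: "c1 \<in> carrier K" "c2 \<in> carrier K" using Phi_c mem f by (auto simp: c1_def c2_def)
  \<comment> \<open>Unless both images are zero, the dependence is
    \<open>c2 c1 - c1 c2 = 0\<close>.\<close>
  obtain \<alpha> \<beta> where ab: "\<alpha> \<in> carrier K" "\<beta> \<in> carrier K" "\<alpha> \<noteq> \<zero> \<or> \<beta> \<noteq> \<zero>" "\<alpha> \<otimes> c1 \<oplus> \<beta> \<otimes> c2 = \<zero>"
  proof (cases "c1 = \<zero> \<and> c2 = \<zero>")
    case True then show ?thesis using that[of \<one> \<zero>] by simp
  next
    case False
    have "c2 \<otimes> c1 \<oplus> (\<ominus> c1) \<otimes> c2 = \<zero>" using cK by (simp add: R.l_minus R.m_comm[of c2 c1] R.r_neg)
    moreover have "c2 \<noteq> \<zero> \<or> \<ominus> c1 \<noteq> \<zero>" using False cK by (metis R.minus_minus R.minus_zero)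
    ultimately show ?thesis using that[of c2 "\<ominus> c1"] cK by simp
  qed
  let ?f = "sc \<alpha> f1 \<oplus>\<^bsub>?H\<^esub> sc \<beta> f2"
  have fZ: "?f \<in> ?Z" using Z_add Z_sc ab f by blast
  have zero_sc: "sc \<zero> f1 = \<zero>\<^bsub>?H\<^esub>" using fc[of f1] f ZH by (auto simp: sc_def graded_Hom_simps intro!: restrict_ext)
  have Phi_f: "\<Phi> (?B +>\<^bsub>?H\<^esub> sc \<gamma> z) = \<gamma> \<otimes> \<Phi> (?B +>\<^bsub>?H\<^esub> z)" if "\<gamma> \<in> carrier K" "z \<in> ?Z" for \<gamma> z
    using Phi_sc[OF mem[OF that(2)] that(1)] E_sc[OF that] by simp
  have "\<Phi> (?B +>\<^bsub>?H\<^esub> ?f) = \<Phi> (?B +>\<^bsub>?H\<^esub> sc \<alpha> f1) \<oplus> \<Phi> (?B +>\<^bsub>?H\<^esub> sc \<beta> f2)"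
    using Phi_add[OF mem mem] E_add Z_sc ab f by metis
  then have "\<Phi> (?B +>\<^bsub>?H\<^esub> ?f) = \<zero>"
    using Phi_f ab f by (simp add: c1_def c2_def)
  moreover have "\<Phi> (?B +>\<^bsub>?H\<^esub> sc \<zero> f1) = \<zero>"
    using Phi_sc[OF mem[OF f(1)], of \<zero>] E_sc[OF _ f(1), of \<zero>] Phi_c[OF mem[OF f(1)]] by simp
  ultimately have "?B +>\<^bsub>?H\<^esub> ?f = ?B +>\<^bsub>?H\<^esub> sc \<zero> f1"
    using iso(2) mem[OF fZ] mem[OF Z_sc[OF R.zero_closed f(1)]] by (simp add: inj_on_def)
  also have "\<dots> = ?B" unfolding zero_sc by (rule H.a_coset_join2[OF _ B.a_subgroup B_zero]) simp
  finally have "?f \<in> ?B" using B.a_rcos_self[of ?f] fZ ZH by auto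
  then obtain g where g: "g \<in> carrier ?Hi" "?f = (\<lambda>p\<in>?P. g (\<delta> i p))" unfolding B_eq by blast
  have "\<alpha> \<odot>\<^bsub>A\<^esub> f1 p \<oplus>\<^bsub>A\<^esub> \<beta> \<odot>\<^bsub>A\<^esub> f2 p = g (\<delta> i p)" if "p \<in> ?P" for p
    using fun_cong[OF g(2), of p] that by (simp add: graded_Hom_simps sc_def)
  then show ?thesis using that ab g by blast
qed

lemma homs_of_degree_pullback:
  assumes P: "left_module A P" and d: "lhom A P Q \<delta>" "\<And>j. \<delta> ` \<P> j \<subseteq> \<Q> j" and sub: "\<And>j. \<P> j \<subseteq> carrier P"
    and g: "g \<in> homs_of_degree A \<A> Q \<Q> e"
  shows "(\<lambda>p\<in>carrier P. g (\<delta> p)) \<in> homs_of_degree A \<A> P \<P> e"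
  using lhom_restrict[OF P lhom_compose[OF d(1)], of "regular_module A" g] g d(2) sub
  by (auto simp: homs_of_degree_iff subset_iff image_subset_iff)

lemma graded_Hom_pullback:
  assumes P: "left_module A P" and d: "lhom A P Q \<delta>" "\<And>j. \<delta> ` \<P> j \<subseteq> \<Q> j" and sub: "\<And>j. \<P> j \<subseteq> carrier P"
    and g: "g \<in> carrier (graded_Hom A \<A> Q \<Q>)"
  shows "(\<lambda>p\<in>carrier P. g (\<delta> p)) \<in> carrier (graded_Hom A \<A> P \<P>)"
proof -
  obtain E \<phi> where E: "finite E" "\<And>e. e \<in> E \<Longrightarrow> \<phi> e \<in> homs_of_degree A \<A> Q \<Q> e"
    and g_eq: "g = (\<lambda>p\<in>carrier Q. \<Oplus>\<^bsub>A\<^esub>e\<in>E. \<phi> e p)" using g by (rule graded_HomE) blast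
  have "(\<lambda>p\<in>carrier P. g (\<delta> p)) = (\<lambda>p\<in>carrier P. \<Oplus>\<^bsub>A\<^esub>e\<in>E. (\<lambda>p\<in>carrier P. \<phi> e (\<delta> p)) p)"
    unfolding g_eq using lhom_closed[OF d(1)] by (intro restrict_ext) auto
  then show ?thesis
    using graded_HomI[OF E(1), of "\<lambda>e. \<lambda>p\<in>carrier P. \<phi> e (\<delta> p)" P \<P>]
      homs_of_degree_pullback[OF P d sub E(2)] by simp
qed

end

section \<open>The third syzygy is free of rank one\<close>

context connected_alg begin

abbreviation "triv \<equiv> trivial_module K A \<A>"

lemma triv_simps:
  "carrier triv = carrier K" "\<zero>\<^bsub>triv\<^esub> = \<zero>" "c \<oplus>\<^bsub>triv\<^esub> d = c \<oplus> d"
  "a \<in> carrier A \<Longrightarrow> a \<odot>\<^bsub>triv\<^esub> c = aug a \<otimes> c"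
  by (simp_all add: trivial_module_def augmentation_eq)

lemma aug_one: "aug \<one>\<^bsub>A\<^esub> = \<one>"
  using aug_smult_one[of \<one>] by simp

lemma triv_module: "left_module A triv"
proof (rule left_moduleI)
  show "abelian_group triv"
  proof (rule abelian_groupI)
    fix c assume "c \<in> carrier triv"
    then show "\<exists>d\<in>carrier triv. d \<oplus>\<^bsub>triv\<^esub> c = \<zero>\<^bsub>triv\<^esub>"
      by (intro bexI[of _ "\<ominus> c"]) (auto simp: triv_simps R.l_neg)
  qed (auto simp: triv_simps R.a_ac)
qed (auto simp: triv_simps ring_axioms aug_add aug_mult aug_one R.l_distr R.r_distr R.m_assoc)

lemma triv_gmod: "gmod A \<A> triv (trivial_grading K) (\<lambda>j c. if j = 0 then c else \<zero>)"
  unfolding gmod_def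
proof (intro conjI allI ballI)
  show "left_module A triv" by (rule triv_module)
  show "components triv UNIV (trivial_grading K) (\<lambda>j c. if j = 0 then c else \<zero>)"
  proof (rule componentsI[OF left_module_abelian_group[OF triv_module]])
    fix c show "finite {i \<in> UNIV. (if i = (0::int) then c else \<zero>) \<noteq> \<zero>\<^bsub>triv\<^esub>}"
      by (rule finite_subset[of _ "{0}"]) (auto simp: triv_simps)
    assume "c \<in> carrier triv" "\<And>i::int. i \<in> UNIV \<Longrightarrow> (if i = 0 then c else \<zero>) = \<zero>\<^bsub>triv\<^esub>"
    from this(2)[of 0] show "c = \<zero>\<^bsub>triv\<^esub>" by simp
  qed (auto simp: triv_simps trivial_grading_def split: if_splits)
  fix n j a c assume a: "a \<in> \<A> n" and c: "c \<in> trivial_grading K j"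
  show "a \<odot>\<^bsub>triv\<^esub> c \<in> trivial_grading K (int n + j)"
    using aug_pos[OF a] grade_sub[OF a] c by (cases "n = 0") (auto simp: triv_simps trivial_grading_def split: if_splits)
qed

end

context cubic_presentation begin

definition K3g where "K3g j = Fg 3 j \<inter> K3"

lemma triv_trivial: "trivial_quotient triv aug"
proof -
  have "aug ` carrier A = carrier K"
  proof (intro equalityI subsetI)
    fix c assume "c \<in> carrier K"
    then show "c \<in> aug ` carrier A" by (intro image_eqI[of _ _ "c \<odot>\<^bsub>A\<^esub> \<one>\<^bsub>A\<^esub>"]) (auto simp: aug_smult_one)
  qed auto
  moreover have "lhom A A0 triv aug" by (rule lhomI) (auto simp: triv_simps aug_add aug_mult)
  ultimately show ?thesis by (auto simp: trivial_quotient_def triv_module triv_simps)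
qed

text \<open>\<open>d2\<close> preserves degrees when the basis vectors sit in degree 3 on the left
  and 1 on the right, so its kernel is closed under taking components.\<close>

lemma K3_Fc: "v \<in> K3 \<Longrightarrow> Fc 3 j v \<in> K3"
  using graded_hom_component[OF F_gmod F_gmod d2_graded[of 1, simplified], of v j]
    components_carrier[OF F_components, of j v 3] components_zero[OF FM.M.abelian_group_axioms F_components, of j 1]
  by (auto simp: K3_def)

lemma K3_gmod: "gmod A \<A> K3m K3g (Fc 3)"
  unfolding gmod_def
proof (intro conjI allI ballI)
  show L: "left_module A K3m" by (rule K3_module)
  have "components K3m UNIV (\<lambda>j. Fg 3 j \<inter> K3) (Fc 3)"
    by (rule restrict_carrier_components[OF FM.M.abelian_group_axioms F_components left_module_abelian_group[OF L]])
      (auto simp: K3_sub K3_Fc)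
  then show "components K3m UNIV K3g (Fc 3)" by (simp add: K3g_def[abs_def])
  fix n j a v assume a: "a \<in> \<A> n" and v: "v \<in> K3g j"
  then have "a \<odot>\<^bsub>F\<^esub> v \<in> Fg 3 (int n + j)" using gmod_act[OF F_gmod a] by (simp add: K3g_def)
  moreover have "a \<odot>\<^bsub>F\<^esub> v \<in> K3"
    using left_module.act_closed[OF L grade_sub[OF a], of v] v by (simp add: K3g_def)
  ultimately show "a \<odot>\<^bsub>K3m\<^esub> v \<in> K3g (int n + j)" by (simp add: K3g_def)
qed

end

context regular_cubic begin

text \<open>What the Gorenstein condition yields for one resolution \<open>P\<close>: the facts
  about \<open>Ext\<close> in degrees two and three and the comparison with the explicit complex,
  with all maps named. It is unpacked in \<open>K3_nonzero\<close> and again in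
  \<open>ext_two\<close>.\<close>

definition ext_package where
  "ext_package P \<P> \<epsilon> \<delta> \<Phi> h0 h1 h2 k1 k2 s1 s2 \<longleftrightarrow>
    graded_projective_resolution A \<A> triv (trivial_grading K) P \<P> \<epsilon> \<delta> \<and>
    carrier (Ext_module A \<A> P \<P> \<delta> 2) = {\<zero>\<^bsub>Ext_module A \<A> P \<P> \<delta> 2\<^esub>} \<and>
    \<Phi> \<in> mod_hom (opp A) (Ext_module A \<A> P \<P> \<delta> 3) triv \<and>
    inj_on \<Phi> (carrier (Ext_module A \<A> P \<P> \<delta> 3)) \<and>
    chain_to P \<epsilon> \<delta> aug h0 h1 h2 \<and> graded_hom A (P 2) (\<P> 2) F (Fg 3) h2 \<and>
    lhom A F (P 1) k1 \<and> lhom A F (P 2) k2 \<and> lhom A F F s1 \<and> lhom A F F s2 \<and>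
    (\<forall>u\<in>carrier F. \<delta> 1 (k2 u) = k1 (d2 u)) \<and>
    (\<forall>u\<in>carrier F. s2 u \<in> K3) \<and>
    (\<forall>u\<in>carrier F. h2 (k2 u) = u \<oplus>\<^bsub>F\<^esub> s1 (d2 u) \<oplus>\<^bsub>F\<^esub> s2 u)"

lemma gorenstein_data:
  "\<exists>(P :: nat \<Rightarrow> ('a, 'a \<Rightarrow> 'a) module) \<P> \<epsilon> \<delta> \<Phi> h0 h1 h2 k1 k2 s1 s2.
     ext_package P \<P> \<epsilon> \<delta> \<Phi> h0 h1 h2 k1 k2 s1 s2"
proof -
  have "left_AS_Gorenstein K A \<A> 3" using AS by (simp add: AS_regular_def)
  then obtain P :: "nat \<Rightarrow> ('a, 'a \<Rightarrow> 'a) module" and \<P> \<epsilon> \<delta> where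
    G: "graded_projective_resolution A \<A> triv (trivial_grading K) P \<P> \<epsilon> \<delta> \<and>
    (\<forall>i. i \<noteq> 3 \<longrightarrow> carrier (Ext_module A \<A> P \<P> \<delta> i) = {\<zero>\<^bsub>Ext_module A \<A> P \<P> \<delta> i\<^esub>}) \<and>
    (\<exists>l. graded_module_iso (opp A) (Ext_module A \<A> P \<P> \<delta> 3) (Ext_grading A \<A> P \<P> \<delta> 3)
       triv (shift_grading l (trivial_grading K)))"
    unfolding left_AS_Gorenstein_def by (elim exE) (rule that)
  note P = G[THEN conjunct1] and E = G[THEN conjunct2, THEN conjunct1, rule_format]
  from G[THEN conjunct2, THEN conjunct2] obtain l where
    iso: "graded_module_iso (opp A) (Ext_module A \<A> P \<P> \<delta> 3) (Ext_grading A \<A> P \<P> \<delta> 3)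
       triv (shift_grading l (trivial_grading K))" by (elim exE) (rule that)
  from iso obtain \<Phi> where Phi: "\<Phi> \<in> mod_hom (opp A) (Ext_module A \<A> P \<P> \<delta> 3) triv"
    "inj_on \<Phi> (carrier (Ext_module A \<A> P \<P> \<delta> 3))"
    unfolding graded_module_iso_def bij_betw_def by (elim bexE conjE) (rule that)
  have "aug ` regular_grading A \<A> j \<subseteq> trivial_grading K j" for j
    using aug_pos[of _ "nat j"] aug_zero_iff[of "\<zero>\<^bsub>A\<^esub>"] grade_sub
    by (cases "j = 0"; cases "j < 0") (auto simp: regular_grading_def trivial_grading_def)
  from graded_chain_to_exists[OF triv_trivial P triv_gmod this]
  obtain h0 h1 h2 where h: "chain_to P \<epsilon> \<delta> aug h0 h1 h2" "graded_hom A (P 2) (\<P> 2) F (Fg 3) h2" by blast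
  have "projective_resolution A triv P \<epsilon> \<delta>" using P by (simp add: graded_projective_resolution_def)
  from chain_homotopy[OF triv_trivial this h(1)]
  obtain k1 k2 s1 s2 where k: "lhom A F (P 1) k1" "lhom A F (P 2) k2" "lhom A F F s1" "lhom A F F s2"
    "\<And>u. u \<in> carrier F \<Longrightarrow> \<delta> 1 (k2 u) = k1 (d2 u)"
    "\<And>u. u \<in> carrier F \<Longrightarrow> s2 u \<in> K3"
    "\<And>u. u \<in> carrier F \<Longrightarrow> h2 (k2 u) = u \<oplus>\<^bsub>F\<^esub> s1 (d2 u) \<oplus>\<^bsub>F\<^esub> s2 u" by blast
  have "ext_package P \<P> \<epsilon> \<delta> \<Phi> h0 h1 h2 k1 k2 s1 s2"
    unfolding ext_package_def using P E[of 2] Phi h k by simp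
  then show ?thesis by blast
qed

lemma graded_resolutionD:
  assumes "graded_projective_resolution A \<A> N \<N> P \<P> \<epsilon> \<delta>"
  shows "projective_resolution A N P \<epsilon> \<delta>" "\<P> i j \<subseteq> carrier (P i)" "\<delta> i ` \<P> (Suc i) j \<subseteq> \<P> i j"
proof -
  show "projective_resolution A N P \<epsilon> \<delta>" using assms by (simp add: graded_projective_resolution_def)
  have "graded_module A \<A> (P i) (\<P> i)" using assms unfolding graded_projective_resolution_def by blast
  then obtain c where c: "gmod A \<A> (P i) (\<P> i) c" by (rule graded_module_gmod)
  show "\<P> i j \<subseteq> carrier (P i)" using components_sub[OF gmod_components[OF c] UNIV_I] by auto
  show "\<delta> i ` \<P> (Suc i) j \<subseteq> \<P> i j" using assms unfolding graded_projective_resolution_def by blast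
qed

text \<open>The chain map property gives \<open>d2 h2 \<delta>\<^sub>2 = h1 \<delta>\<^sub>1
  \<delta>\<^sub>2 = 0\<close>.\<close>

lemma chain_K3:
  assumes P: "projective_resolution A N P \<epsilon> \<delta>" and h: "chain_to P \<epsilon> \<delta> \<eta> h0 h1 h2" and p: "p \<in> carrier (P 3)"
  shows "h2 (\<delta> 2 p) \<in> K3"
proof -
  note PD = resolutionD[OF P]
  have l: "lhom A (P 1) F h1" "lhom A (P 2) F h2" and e2: "\<And>u. u \<in> carrier (P 2) \<Longrightarrow> d2 (h2 u) = h1 (\<delta> 1 u)"
    using h by (auto simp: chain_to_def)
  have c: "\<delta> 2 p \<in> carrier (P 2)" using lhom_closed[OF PD(4)[of 2]] p by simp
  have "\<delta> 1 (\<delta> 2 p) = \<zero>\<^bsub>P 1\<^esub>" using PD(8)[of p 1] p by (simp add: numeral_eq_Suc)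
  then have "d2 (h2 (\<delta> 2 p)) = \<zero>\<^bsub>F\<^esub>"
    using e2[OF c] lhom_zero[OF left_module_abelian_group[OF PD(2)] FM.M.abelian_group_axioms l(1)] by simp
  then show ?thesis using lhom_closed[OF l(2) c] by (simp add: K3_def)
qed

lemma coord_lhom: "lhom A F A0 (\<lambda>v. v c)"
  by (rule lhomI) (auto simp: F_carrier)

lemma m_aug: "aug (d2 (unit_vec A i) c) = \<zero>"
proof -
  have "d2 (unit_vec A i) c = m i c" by (cases i) (auto simp: d2_def unit_vec_def)
  then show ?thesis using aug_pos[OF m_grade] by simp
qed

text \<open>If \<open>K3\<close> were zero, the first coordinate of \<open>h2\<close> would be a
  cocycle in degree two, hence a coboundary because \<open>Ext\<^sup>2\<close> vanishes. At the
  image under \<open>k2\<close> of the first basis vector such a coboundary augments to zero, but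
  the coordinate augments to one.\<close>

lemma K3_nonzero: "\<exists>v\<in>K3. v \<noteq> \<zero>\<^bsub>F\<^esub>"
proof (rule ccontr)
  assume "\<not> ?thesis"
  then have K3z: "v = \<zero>\<^bsub>F\<^esub>" if "v \<in> K3" for v using that by blast
  obtain P :: "nat \<Rightarrow> ('a, 'a \<Rightarrow> 'a) module" and \<P> \<epsilon> \<delta> \<Phi> h0 h1 h2 k1 k2 s1 s2 where
    package: "ext_package P \<P> \<epsilon> \<delta> \<Phi> h0 h1 h2 k1 k2 s1 s2"
    using gorenstein_data by blast
  have P: "graded_projective_resolution A \<A> triv (trivial_grading K) P \<P> \<epsilon> \<delta>"
    and E2: "carrier (Ext_module A \<A> P \<P> \<delta> 2) = {\<zero>\<^bsub>Ext_module A \<A> P \<P> \<delta> 2\<^esub>}"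
    and Phi: "\<Phi> \<in> mod_hom (opp A) (Ext_module A \<A> P \<P> \<delta> 3) triv"
       "inj_on \<Phi> (carrier (Ext_module A \<A> P \<P> \<delta> 3))"
    and h: "chain_to P \<epsilon> \<delta> aug h0 h1 h2" "graded_hom A (P 2) (\<P> 2) F (Fg 3) h2"
    and k: "lhom A F (P 1) k1" "lhom A F (P 2) k2" "lhom A F F s1" "lhom A F F s2"
    and dk: "\<And>u. u \<in> carrier F \<Longrightarrow> \<delta> 1 (k2 u) = k1 (d2 u)"
    and s2K: "\<And>u. u \<in> carrier F \<Longrightarrow> s2 u \<in> K3"
    and hk: "\<And>u. u \<in> carrier F \<Longrightarrow> h2 (k2 u) = u \<oplus>\<^bsub>F\<^esub> s1 (d2 u) \<oplus>\<^bsub>F\<^esub> s2 u"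
    using package unfolding ext_package_def by simp_all
  note PD = resolutionD[OF graded_resolutionD(1)[OF P]] and sub = graded_resolutionD(2)[OF P]
  have lh2: "lhom A (P 2) F h2" using h(2) by (simp add: graded_hom_def)
  \<comment> \<open>The basis vectors have degree 3, so taking a coordinate lowers degrees by
    3.\<close>
  have "(\<lambda>v\<in>carrier F. v Vx) \<in> homs_of_degree A \<A> F (Fg 3) (-3)"
    using lhom_restrict[OF FM.left_module_axioms coord_lhom] components_sub[OF F_components]
    by (auto simp: homs_of_degree_iff Fg_def)
  from homs_of_degree_pullback[OF PD(2) lh2 _ sub this]
  have "(\<lambda>p\<in>carrier (P 2). (\<lambda>v\<in>carrier F. v Vx) (h2 p)) \<in> homs_of_degree A \<A> (P 2) (\<P> 2) (-3)" (is "?f \<in> _")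
    using h(2) by (simp add: graded_hom_def)
  moreover have "?f (\<delta> 2 p) = \<zero>\<^bsub>A\<^esub>" if p: "p \<in> carrier (P 3)" for p
  proof -
    have "h2 (\<delta> 2 p) = \<zero>\<^bsub>F\<^esub>" using K3z chain_K3[OF graded_resolutionD(1)[OF P] h(1) p] .
    then show ?thesis using lhom_closed[OF PD(4)[of 2]] p by simp
  qed
  ultimately have "?f \<in> Ext_cocycles A \<A> P \<P> \<delta> (Suc 1)"
    using graded_Hom_homogeneous by (auto simp: Ext_cocycles_def numeral_2_eq_2 numeral_3_eq_3)
  from Ext_vanishing[OF PD(2) sub lhom_closed[OF PD(4)] _ this] E2
  obtain g where g: "g \<in> carrier (graded_Hom A \<A> (P 1) (\<P> 1))" "\<And>p. p \<in> carrier (P 2) \<Longrightarrow> ?f p = g (\<delta> 1 p)"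
    by (auto simp: numeral_2_eq_2)
  have lg: "lhom A (P 1) A0 g" by (rule graded_Hom_lhom(1)[OF PD(2) g(1)])
  define u where "u = (unit_vec A Vx :: var \<Rightarrow> 'a)"
  have u: "u \<in> carrier F" by (simp add: u_def)
  have du: "d2 u \<in> carrier F" "\<And>c. aug (d2 u c) = \<zero>" using lhom_closed[OF d2_lhom u] m_aug by (auto simp: u_def)
  have s2u: "s2 u = \<zero>\<^bsub>F\<^esub>" by (rule K3z[OF s2K[OF u]])
  have k2u: "k2 u \<in> carrier (P 2)" and sc: "s1 (d2 u) \<in> carrier F"
    using lhom_closed[OF k(2) u] lhom_closed[OF k(3) du(1)] by auto
  have "h2 (k2 u) Vx = g (k1 (d2 u))" using g(2)[OF k2u] k2u dk[OF u] lhom_closed[OF lh2 k2u] by simp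
  then have "aug (h2 (k2 u) Vx) = \<zero>" using aug_lhom[OF lhom_compose[OF k(1) lg] du] by simp
  moreover have "h2 (k2 u) Vx = \<one>\<^bsub>A\<^esub> \<oplus>\<^bsub>A\<^esub> s1 (d2 u) Vx"
    using hk[OF u] s2u sc by (simp add: u_def unit_vec_def F_carrier)
  moreover have "aug (s1 (d2 u) Vx) = \<zero>" by (rule aug_lhom[OF lhom_compose[OF k(3) coord_lhom] du])
  ultimately have "\<one> = \<zero>" using sc by (simp add: aug_add aug_one F_carrier)
  then show False by simp
qed

text \<open>
  A homomorphism \<open>K3 \<rightarrow> A\<close> represents a class in \<open>Ext\<^sup>3(K, A)\<close>, which vanishes if and only if the homomorphism
  extends to \<open>A\<^sup>2\<close>; that space is one-dimensional.
\<close>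

lemma ext_two:
  assumes phi: "\<phi>1 \<in> homs_of_degree A \<A> K3m K3g e1" "\<phi>2 \<in> homs_of_degree A \<A> K3m K3g e2"
  obtains \<alpha> \<beta> \<Psi> where "\<alpha> \<in> carrier K" "\<beta> \<in> carrier K" "\<alpha> \<noteq> \<zero> \<or> \<beta> \<noteq> \<zero>" "lhom A F A0 \<Psi>"
    "\<And>z. z \<in> K3 \<Longrightarrow> \<alpha> \<odot>\<^bsub>A\<^esub> \<phi>1 z \<oplus>\<^bsub>A\<^esub> \<beta> \<odot>\<^bsub>A\<^esub> \<phi>2 z = \<Psi> z"
proof -
  obtain P :: "nat \<Rightarrow> ('a, 'a \<Rightarrow> 'a) module" and \<P> \<epsilon> \<delta> \<Phi> h0 h1 h2 k1 k2 s1 s2 where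
    package: "ext_package P \<P> \<epsilon> \<delta> \<Phi> h0 h1 h2 k1 k2 s1 s2"
    using gorenstein_data by blast
  have P: "graded_projective_resolution A \<A> triv (trivial_grading K) P \<P> \<epsilon> \<delta>"
    and E2: "carrier (Ext_module A \<A> P \<P> \<delta> 2) = {\<zero>\<^bsub>Ext_module A \<A> P \<P> \<delta> 2\<^esub>}"
    and Phi: "\<Phi> \<in> mod_hom (opp A) (Ext_module A \<A> P \<P> \<delta> 3) triv"
       "inj_on \<Phi> (carrier (Ext_module A \<A> P \<P> \<delta> 3))"
    and h: "chain_to P \<epsilon> \<delta> aug h0 h1 h2" "graded_hom A (P 2) (\<P> 2) F (Fg 3) h2"
    and k: "lhom A F (P 1) k1" "lhom A F (P 2) k2" "lhom A F F s1" "lhom A F F s2"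
    and dk: "\<And>u. u \<in> carrier F \<Longrightarrow> \<delta> 1 (k2 u) = k1 (d2 u)"
    and s2K: "\<And>u. u \<in> carrier F \<Longrightarrow> s2 u \<in> K3"
    and hk: "\<And>u. u \<in> carrier F \<Longrightarrow> h2 (k2 u) = u \<oplus>\<^bsub>F\<^esub> s1 (d2 u) \<oplus>\<^bsub>F\<^esub> s2 u"
    using package unfolding ext_package_def by simp_all
  note Pr = graded_resolutionD(1)[OF P]
  note PD = resolutionD[OF Pr] and sub = graded_resolutionD(2)[OF P]
  have lh2: "lhom A (P 2) F h2" using h(2) by (simp add: graded_hom_def)
  have nums: "Suc 2 = (3::nat)" "Suc 3 = (4::nat)" by auto
  note dl2 = PD(4)[of 2, unfolded nums] and dl3 = PD(4)[of 3, unfolded nums]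
  have lK: "lhom A (P 3) K3m (\<lambda>p. h2 (\<delta> 2 p))"
    using lhom_compose[OF dl2 lh2] chain_K3[OF Pr h(1)] by (auto simp: lhom_def)
  have gK: "(\<lambda>p. h2 (\<delta> 2 p)) ` \<P> 3 j \<subseteq> K3g j" for j
  proof (rule image_subsetI)
    fix p assume p: "p \<in> \<P> 3 j"
    then have "\<delta> 2 p \<in> \<P> 2 j" using graded_resolutionD(3)[OF P, of 2 j] by (auto simp: nums)
    then have "h2 (\<delta> 2 p) \<in> Fg 3 j" using h(2) by (auto simp: graded_hom_def)
    then show "h2 (\<delta> 2 p) \<in> K3g j" using chain_K3[OF Pr h(1)] sub p by (auto simp: K3g_def)
  qed
  \<comment> \<open>The pullback of a form on \<open>K3\<close> to \<open>P 3\<close>. It is a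
    cocycle because consecutive differentials of \<open>P\<close> compose to zero.\<close>
  define f where "f \<phi> = (\<lambda>p\<in>carrier (P 3). \<phi> (h2 (\<delta> 2 p)))" for \<phi> :: "(var \<Rightarrow> 'a) \<Rightarrow> 'a"
  have fZ: "f \<phi> \<in> Ext_cocycles A \<A> P \<P> \<delta> (Suc 2)" if phi: "\<phi> \<in> homs_of_degree A \<A> K3m K3g e" for \<phi> e
  proof -
    have "f \<phi> \<in> homs_of_degree A \<A> (P 3) (\<P> 3) e"
      unfolding f_def by (rule homs_of_degree_pullback[OF PD(2) lK gK sub phi])
    then have 1: "f \<phi> \<in> carrier (graded_Hom A \<A> (P 3) (\<P> 3))" by (rule graded_Hom_homogeneous)
    have l: "lhom A K3m A0 \<phi>" using phi by (simp add: homs_of_degree_iff)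
    have "f \<phi> (\<delta> 3 p) = \<zero>\<^bsub>A\<^esub>" if p: "p \<in> carrier (P 4)" for p
    proof -
      have c: "\<delta> 3 p \<in> carrier (P 3)" by (rule lhom_closed[OF dl3 p])
      have "\<delta> 2 (\<delta> 3 p) = \<zero>\<^bsub>P 2\<^esub>" using PD(8)[of p 2] p by (simp add: nums)
      then have "\<phi> (h2 (\<delta> 2 (\<delta> 3 p))) = \<phi> \<zero>\<^bsub>K3m\<^esub>"
        using lhom_zero[OF left_module_abelian_group[OF PD(2)] FM.M.abelian_group_axioms lh2] by simp
      also have "\<dots> = \<zero>\<^bsub>A\<^esub>"
        using lhom_zero[OF left_module_abelian_group[OF K3_module] AM.M.abelian_group_axioms l] by simp
      finally show ?thesis using c by (simp add: f_def)
    qed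
    then show ?thesis using 1 by (simp add: Ext_cocycles_def nums)
  qed
  have dg: "(\<lambda>p\<in>carrier (P (Suc 2)). g (\<delta> 2 p)) \<in> carrier (graded_Hom A \<A> (P (Suc 2)) (\<P> (Suc 2)))"
    if "g \<in> carrier (graded_Hom A \<A> (P 2) (\<P> 2))" for g
    by (rule graded_Hom_pullback[OF PD(2) PD(4) graded_resolutionD(3)[OF P] sub that])
  obtain \<alpha> \<beta> g where ab: "\<alpha> \<in> carrier K" "\<beta> \<in> carrier K" "\<alpha> \<noteq> \<zero> \<or> \<beta> \<noteq> \<zero>"
    and g: "g \<in> carrier (graded_Hom A \<A> (P 2) (\<P> 2))"
    and eq: "\<And>p. p \<in> carrier (P 3) \<Longrightarrow> \<alpha> \<odot>\<^bsub>A\<^esub> f \<phi>1 p \<oplus>\<^bsub>A\<^esub> \<beta> \<odot>\<^bsub>A\<^esub> f \<phi>2 p = g (\<delta> 2 p)"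
    using Ext_one_dimensional[OF PD(2) sub PD(4)[of 2] PD(4)[of "Suc 2"] PD(8)[of _ 2] dg Phi[folded nums(1)] fZ[OF phi(1)] fZ[OF phi(2)]]
    unfolding nums by blast
  have lp: "lhom A K3m A0 \<phi>1" "lhom A K3m A0 \<phi>2" using phi by (auto simp: homs_of_degree_iff)
  define \<phi> where "\<phi> z = \<alpha> \<odot>\<^bsub>A\<^esub> \<phi>1 z \<oplus>\<^bsub>A\<^esub> \<beta> \<odot>\<^bsub>A\<^esub> \<phi>2 z" for z
  have lph: "lhom A K3m A0 \<phi>"
    using lhom_closed[OF lp(1)] lhom_closed[OF lp(2)] ab
    by (intro lhomI) (auto simp: \<phi>_def lhom_add[OF lp(1), simplified] lhom_add[OF lp(2), simplified]
         lhom_smult[OF lp(1), simplified] lhom_smult[OF lp(2), simplified]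
         smult_r_distr smult_mult_right r_distr M.add.m_ac)
  have lg: "lhom A (P 2) A0 g" by (rule graded_Hom_lhom(1)[OF PD(2) g])
  have ls: "lhom A F K3m s2" using k(4) s2K by (auto simp: lhom_def)
  \<comment> \<open>On \<open>K3\<close> the round trip \<open>h2 k2\<close> is the identity plus
    \<open>s2\<close>, so \<open>g k2\<close> equals \<open>\<phi>\<close> plus its composite with
    \<open>s2\<close>. Subtracting the latter leaves a form on all of \<open>F\<close> that extends
    \<open>\<phi>\<close>.\<close>
  define \<Psi> where "\<Psi> u = g (k2 u) \<ominus>\<^bsub>A0\<^esub> \<phi> (s2 u)" for u
  have lPsi: "lhom A F A0 \<Psi>"
    unfolding \<Psi>_def[abs_def] by (intro lhom_minusf AM.left_module_axioms lhom_compose[OF k(2) lg] lhom_compose[OF ls lph])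
  have "\<phi> z = \<Psi> z" if z: "z \<in> K3" for z
  proof -
    have zF: "z \<in> carrier F" "d2 z = \<zero>\<^bsub>F\<^esub>" using z by (auto simp: K3_def)
    have "\<delta> 1 (k2 z) = \<zero>\<^bsub>P 1\<^esub>"
      using dk[OF zF(1)] zF(2) lhom_zero[OF FM.M.abelian_group_axioms left_module_abelian_group[OF PD(2)] k(1)] by simp
    then have "\<exists>p\<in>carrier (P 3). \<delta> 2 p = k2 z"
      using PD(9)[of "k2 z" 1] lhom_closed[OF k(2) zF(1)] by (auto simp: numeral_eq_Suc)
    then obtain p where p: "p \<in> carrier (P 3)" "\<delta> 2 p = k2 z" by blast
    have "s1 \<zero>\<^bsub>F\<^esub> = \<zero>\<^bsub>F\<^esub>" by (rule lhom_zero[OF FM.M.abelian_group_axioms FM.M.abelian_group_axioms k(3)])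
    then have hkz: "h2 (k2 z) = z \<oplus>\<^bsub>F\<^esub> s2 z" using hk[OF zF(1)] zF by simp
    have s: "s2 z \<in> K3" using s2K[OF K3_sub[OF z]] .
    have "g (k2 z) = \<phi> (z \<oplus>\<^bsub>F\<^esub> s2 z)" using eq[OF p(1)] p hkz by (simp add: f_def \<phi>_def)
    also have "\<dots> = \<phi> z \<oplus>\<^bsub>A\<^esub> \<phi> (s2 z)" using lhom_add[OF lph, of z "s2 z"] z s by simp
    finally have "g (k2 z) = \<phi> z \<oplus>\<^bsub>A\<^esub> \<phi> (s2 z)" .
    moreover have "\<phi> z \<in> carrier A" "\<phi> (s2 z) \<in> carrier A" using lhom_closed[OF lph] z s by auto
    ultimately show ?thesis by (simp add: \<Psi>_def a_minus_def M.a_assoc M.r_neg)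
  qed
  then show ?thesis using that[OF ab lPsi] by (simp add: \<phi>_def)
qed

end

context regular_cubic begin

section \<open>Syzygies of least degree\<close>

declare F_simps [simp del] F_minus [simp del]

sublocale KM: left_module A K3m by (rule K3_module)

lemma K3_ops: "u \<in> K3 \<Longrightarrow> v \<in> K3 \<Longrightarrow> u \<oplus>\<^bsub>F\<^esub> v \<in> K3" "a \<in> carrier A \<Longrightarrow> u \<in> K3 \<Longrightarrow> a \<odot>\<^bsub>F\<^esub> u \<in> K3"
  "\<zero>\<^bsub>F\<^esub> \<in> K3" "u \<in> K3 \<Longrightarrow> \<ominus>\<^bsub>F\<^esub> u \<in> K3"
proof -
  show "u \<in> K3 \<Longrightarrow> v \<in> K3 \<Longrightarrow> u \<oplus>\<^bsub>F\<^esub> v \<in> K3" using KM.M.a_closed[of u v] by simp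
  show "a \<in> carrier A \<Longrightarrow> u \<in> K3 \<Longrightarrow> a \<odot>\<^bsub>F\<^esub> u \<in> K3" using KM.act_closed[of a u] by simp
  show "\<zero>\<^bsub>F\<^esub> \<in> K3" using KM.M.zero_closed by simp
  show "u \<in> K3 \<Longrightarrow> \<ominus>\<^bsub>F\<^esub> u \<in> K3"
    using lhom_minus[OF FM.M.abelian_group_axioms FM.M.abelian_group_axioms d2_lhom, of u] by (simp add: K3_def)
qed

text \<open>A part of \<open>a\<close> of positive degree would need a component of \<open>u\<close>
  below degree \<open>d\<close>, and there is none.\<close>

lemma Fc_leading_act:
  assumes u: "u \<in> carrier F" and low: "\<And>j. j < d \<Longrightarrow> Fc 3 j u = \<zero>\<^bsub>F\<^esub>" and a: "a \<in> carrier A"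
  shows "Fc 3 d (a \<odot>\<^bsub>F\<^esub> u) = cp 0 a \<odot>\<^bsub>F\<^esub> Fc 3 d u"
  using a
proof (induction a rule: A_induct)
  case zero
  then show ?case
    by (simp only: FM.act_l_null[OF u] cp_zero FM.act_l_null[OF components_carrier[OF F_components UNIV_I u]]
        components_zero[OF FM.M.abelian_group_axioms F_components UNIV_I])
next
  case (add a b)
  then show ?case using u components_carrier[OF F_components UNIV_I u, of 3 d]
    by (simp add: FM.act_l_distr components_add[OF F_components] FM.act_closed cp_add)
next
  case (hom n a)
  have "Fc 3 (int n + (d - int n)) (a \<odot>\<^bsub>F\<^esub> u) = a \<odot>\<^bsub>F\<^esub> Fc 3 (d - int n) u"
    by (rule gmod_component_act[OF F_gmod _ hom(2) u]) (auto simp: grade_sub)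
  then show ?case using hom(2) low[of "d - int n"] grade_sub[OF hom(2)] components_carrier[OF F_components UNIV_I u, of 3 d]
    by (cases "n = 0") (simp_all add: cp_same cp_other)
qed

lemma Fg_low: "v \<in> Fg 3 j \<Longrightarrow> j < 3 \<Longrightarrow> v = \<zero>\<^bsub>F\<^esub>"
  by (auto simp: Fg_def regular_grading_def fun_eq_iff F_simps)

text \<open>Components of \<open>F\<close> below degree 3 vanish, so the degrees that occur are
  natural numbers. The minimum is taken over the whole of \<open>N\<close>, which gives the
  vanishing for every element and not just for \<open>v\<close>.\<close>

lemma least_degree:
  assumes N: "N \<subseteq> carrier F" "\<And>j v. v \<in> N \<Longrightarrow> Fc 3 j v \<in> N" and u: "u \<in> N" "u \<noteq> \<zero>\<^bsub>F\<^esub>"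
  obtains d v where "v \<in> N" "v \<in> Fg 3 d" "v \<noteq> \<zero>\<^bsub>F\<^esub>" "d \<ge> 3" "\<And>w j. w \<in> N \<Longrightarrow> j < d \<Longrightarrow> Fc 3 j w = \<zero>\<^bsub>F\<^esub>"
proof -
  have uF: "u \<in> carrier F" using N(1) u(1) by blast
  have "\<exists>j. Fc 3 j u \<noteq> \<zero>\<^bsub>F\<^esub>"
  proof (rule ccontr)
    assume "\<not> ?thesis"
    then have "Fc 3 j u = Fc 3 j \<zero>\<^bsub>F\<^esub>" for j by (simp add: components_zero[OF FM.M.abelian_group_axioms F_components])
    then have "u = \<zero>\<^bsub>F\<^esub>"
      by (rule components_eqI[OF FM.M.abelian_group_axioms F_components uF FM.M.zero_closed])
    with u(2) show False by simp
  qed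
  then obtain j0 where j0: "Fc 3 j0 u \<noteq> \<zero>\<^bsub>F\<^esub>" by blast
  have mem: "Fc 3 j w \<in> Fg 3 j" if "w \<in> N" for w j using components_closed[OF F_components UNIV_I] N(1) that by blast
  define Q where "Q n \<longleftrightarrow> (\<exists>v\<in>N. Fc 3 (int n) v \<noteq> \<zero>\<^bsub>F\<^esub>)" for n
  have pos: "j \<ge> 3" if "w \<in> N" "Fc 3 j w \<noteq> \<zero>\<^bsub>F\<^esub>" for w j
    using Fg_low[OF mem[OF that(1), of j]] that(2) by force
  have "Q (nat j0)" unfolding Q_def using pos[OF u(1) j0] j0 u(1) by auto
  then have L: "Q (LEAST n. Q n)" by (rule LeastI)
  define d where "d = int (LEAST n. Q n)"
  from L obtain v where v: "v \<in> N" "Fc 3 d v \<noteq> \<zero>\<^bsub>F\<^esub>" by (auto simp: Q_def d_def)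
  have "Fc 3 j w = \<zero>\<^bsub>F\<^esub>" if w: "w \<in> N" "j < d" for w j
  proof (rule ccontr)
    assume n: "Fc 3 j w \<noteq> \<zero>\<^bsub>F\<^esub>"
    then have "Q (nat j)" unfolding Q_def using pos[OF w(1) n] w(1) by (auto intro!: bexI[of _ w])
    then have "(LEAST n. Q n) \<le> nat j" by (rule Least_le)
    then show False using w(2) pos[OF w(1) n] by (simp add: d_def)
  qed
  then show ?thesis using that[of "Fc 3 d v" d] v N(2) mem pos by blast
qed

text \<open>The part of \<open>f\<close> of degree \<open>- d\<close> sends \<open>z\<close> to the
  degree zero component of \<open>f z\<close>, a nonzero scalar that can be normalised.\<close>

lemma coordinate_form:
  assumes z: "z \<in> K3" "z \<in> Fg 3 d" and f: "lhom A K3m A0 f" "aug (f z) \<noteq> \<zero>"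
  obtains \<phi> where "\<phi> \<in> homs_of_degree A \<A> K3m K3g (- d)" "\<phi> z = \<one>\<^bsub>A\<^esub>"
proof -
  obtain f' where f': "lhom A K3m A0 f'" "\<And>j p. p \<in> K3g j \<Longrightarrow> f' p = cpz (j + (- d)) (f p)"
    using degree_component[OF cp K3_gmod regular_gmod f(1)] by blast
  define \<gamma> where "\<gamma> = inv (aug (f z))"
  have fz: "f z \<in> carrier A" using lhom_closed[OF f(1)] z by simp
  have gK: "\<gamma> \<in> carrier K" "\<gamma> \<otimes> aug (f z) = \<one>" using KF.field_Units fz f(2) by (auto simp: \<gamma>_def)
  have hom: "f' \<in> homs_of_degree A \<A> K3m K3g (- d) \<or> True" by simp
  have r: "restrict f' K3 \<in> homs_of_degree A \<A> K3m K3g (- d)"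
    using lhom_restrict[OF K3_module f'(1)] f'(2) components_closed[OF regular_components UNIV_I] lhom_closed[OF f(1)]
    by (auto simp: homs_of_degree_iff K3g_def)
  from homs_of_degree_smult[OF K3_module this gK(1)]
  have "(\<lambda>p\<in>K3. \<gamma> \<odot>\<^bsub>A\<^esub> restrict f' K3 p) \<in> homs_of_degree A \<A> K3m K3g (- d)" by (simp add: K3g_def)
  moreover have "f' z = aug (f z) \<odot>\<^bsub>A\<^esub> \<one>\<^bsub>A\<^esub>"
    using f'(2)[of z d] z fz by (simp add: K3g_def cpz_def aug_eq)
  then have "(\<lambda>p\<in>K3. \<gamma> \<odot>\<^bsub>A\<^esub> restrict f' K3 p) z = \<one>\<^bsub>A\<^esub>"
    using z gK fz by (simp add: smult_assoc1[symmetric])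
  ultimately show ?thesis by (rule that)
qed

text \<open>A nonzero \<open>z\<close> of least degree lies outside \<open>A\<^sub>+ K3\<close>, so
  a linear form takes the value one on it and \<open>K3\<close> splits as \<open>A z\<close> plus
  the kernel of that form. A nonzero kernel would yield a second form in the same way. The two would
  be independent modulo forms that extend to \<open>A\<^sup>2\<close>, against the dimension of
  \<open>Ext\<^sup>3\<close>.\<close>

lemma K3_generator:
  obtains z \<phi> d where "z \<in> K3" "z \<in> Fg 3 d" "z \<noteq> \<zero>\<^bsub>F\<^esub>" "\<phi> \<in> homs_of_degree A \<A> K3m K3g (- d)" "\<phi> z = \<one>\<^bsub>A\<^esub>"
    "\<And>u. u \<in> K3 \<Longrightarrow> u = \<phi> u \<odot>\<^bsub>F\<^esub> z"
proof -
  obtain u0 where "u0 \<in> K3" "u0 \<noteq> \<zero>\<^bsub>F\<^esub>" using K3_nonzero by blast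
  from least_degree[OF _ K3_Fc this] K3_sub
  obtain z d where z: "z \<in> K3" "z \<in> Fg 3 d" "z \<noteq> \<zero>\<^bsub>F\<^esub>"
    and low: "\<And>w j. w \<in> K3 \<Longrightarrow> j < d \<Longrightarrow> Fc 3 j w = \<zero>\<^bsub>F\<^esub>" by (metis subsetI)
  have zF: "z \<in> carrier F" by (rule K3_sub[OF z(1)])
  have ez: "Fc 3 d z = z" by (rule components_same[OF F_components UNIV_I z(2)])
  have nz: "\<exists>f. lhom A K3m A0 f \<and> aug (f z) \<noteq> \<zero>"
  proof (rule ccontr)
    assume "\<not> ?thesis"
    then have f0: "\<And>f. lhom A K3m A0 f \<Longrightarrow> aug (f z) = \<zero>" by blast
    \<comment> \<open>This set contains \<open>A\<^sub>+ K3\<close> because \<open>d\<close> is the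
      least degree in \<open>K3\<close>.\<close>
    have "z \<in> {u \<in> K3. Fc 3 d u = \<zero>\<^bsub>F\<^esub>}"
    proof (rule K3_aug_span[where v = z])
      show "z \<in> K3" by (rule z(1))
      show "aug (f z) = \<zero>" if "lhom A K3m A0 f" for f by (rule f0[OF that])
    next
      fix a u assume a: "a \<in> carrier A" "aug a = \<zero>" and u: "u \<in> K3"
      have "Fc 3 d (a \<odot>\<^bsub>F\<^esub> u) = cp 0 a \<odot>\<^bsub>F\<^esub> Fc 3 d u"
        by (rule Fc_leading_act[OF K3_sub[OF u] low[OF u] a(1)])
      also have "\<dots> = \<zero>\<^bsub>F\<^esub>" using a components_carrier[OF F_components UNIV_I K3_sub[OF u], of 3 d] by (simp add: aug_zero_iff)
      finally show "a \<odot>\<^bsub>F\<^esub> u \<in> {u \<in> K3. Fc 3 d u = \<zero>\<^bsub>F\<^esub>}" using K3_ops a u by simp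
    qed (auto simp: K3_ops K3_sub components_add[OF F_components] components_zero[OF FM.M.abelian_group_axioms F_components])
    with ez z(3) show False by simp
  qed
  then obtain f where "lhom A K3m A0 f" "aug (f z) \<noteq> \<zero>" by blast
  from coordinate_form[OF z(1,2) this]
  obtain \<phi> where phi: "\<phi> \<in> homs_of_degree A \<A> K3m K3g (- d)" "\<phi> z = \<one>\<^bsub>A\<^esub>" by blast
  have lphi: "lhom A K3m A0 \<phi>" using phi(1) by (simp add: homs_of_degree_iff)
  have phc: "\<phi> u \<in> carrier A" if "u \<in> K3" for u using lhom_closed[OF lphi] that by simp
  \<comment> \<open>The projection of \<open>K3\<close> onto the kernel of \<open>\<phi>\<close>
    along \<open>z\<close>.\<close>
  define \<pi> where "\<pi> u = u \<oplus>\<^bsub>F\<^esub> (\<ominus>\<^bsub>A\<^esub> \<phi> u) \<odot>\<^bsub>F\<^esub> z" for u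
  have phadd: "\<phi> (u \<oplus>\<^bsub>F\<^esub> v) = \<phi> u \<oplus>\<^bsub>A\<^esub> \<phi> v" if "u \<in> K3" "v \<in> K3" for u v
    using lhom_add[OF lphi] that by simp
  have phsm: "\<phi> (a \<odot>\<^bsub>F\<^esub> u) = a \<otimes>\<^bsub>A\<^esub> \<phi> u" if "a \<in> carrier A" "u \<in> K3" for a u
    using lhom_smult[OF lphi] that by simp
  define N where "N = {u \<in> K3. \<phi> u = \<zero>\<^bsub>A\<^esub>}"
  have piN: "\<pi> u \<in> N" if u: "u \<in> K3" for u
    using u z phc[OF u] phi(2) by (simp add: N_def \<pi>_def K3_ops phadd phsm M.r_neg)
  have "N \<subseteq> {\<zero>\<^bsub>F\<^esub>}"
  proof (rule ccontr)
    assume "\<not> ?thesis"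
    then obtain n0 where n0: "n0 \<in> N" "n0 \<noteq> \<zero>\<^bsub>F\<^esub>" by blast
    have NF: "N \<subseteq> carrier F" using K3_sub by (auto simp: N_def)
    have gph: "graded_hom A K3m K3g A0 (\<lambda>j. regular_grading A \<A> (j + - d)) \<phi>"
      using phi(1) by (auto simp: graded_hom_def homs_of_degree_iff)
    \<comment> \<open>A form of degree \<open>- d\<close> is a graded map into the shifted algebra,
      which makes its kernel \<open>N\<close> closed under components and
      \<open>least_degree\<close> applicable.\<close>
    have shifted: "gmod A \<A> A0 (\<lambda>j. regular_grading A \<A> (j + - d)) (\<lambda>j. cpz (j + - d))"
    proof -
      have "components A0 UNIV (\<lambda>j. regular_grading A \<A> (j + - d)) (\<lambda>j. cpz (j + - d))"
      proof (rule componentsI[OF AM.M.abelian_group_axioms])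
        note rc = gmod_components[OF regular_gmod]
        fix v assume v: "v \<in> carrier A0"
        have "{i \<in> UNIV. cpz (i + - d) v \<noteq> \<zero>\<^bsub>A0\<^esub>} = (\<lambda>j. j + d) ` {i \<in> UNIV. cpz i v \<noteq> \<zero>\<^bsub>A0\<^esub>}"
          by (auto intro!: image_eqI[of _ _ "_ - d"])
        then show "finite {i \<in> UNIV. cpz (i + - d) v \<noteq> \<zero>\<^bsub>A0\<^esub>}" using components_finite[OF rc v] by simp
        assume "\<And>i. i \<in> UNIV \<Longrightarrow> cpz (i + - d) v = \<zero>\<^bsub>A0\<^esub>"
        from this[of "_ + d"] have "\<And>i. cpz i v = cpz i \<zero>\<^bsub>A0\<^esub>" by (simp add: components_zero[OF A_ab regular_components])
        then show "v = \<zero>\<^bsub>A0\<^esub>" by (rule components_eqI[OF AM.M.abelian_group_axioms rc v AM.M.zero_closed])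
      qed (auto simp: components_closed[OF regular_components] components_add[OF regular_components]
            components_same[OF regular_components] components_other[OF regular_components, of _ "_ - d"]
            dest: components_sub[OF regular_components UNIV_I])
      then show ?thesis using regular_module_is_module regular_grading_act[of _ _ _ "_ - d"]
        by (auto simp: gmod_def add_diff_eq)
    qed
    have NFc: "Fc 3 j u \<in> N" if "u \<in> N" for j u
      using graded_hom_component[OF K3_gmod shifted gph, of u j] that K3_Fc components_zero[OF A_ab regular_components]
      by (simp add: N_def)
    obtain v d' where v: "v \<in> N" "v \<in> Fg 3 d'" "v \<noteq> \<zero>\<^bsub>F\<^esub>"
      and low': "\<And>w j. w \<in> N \<Longrightarrow> j < d' \<Longrightarrow> Fc 3 j w = \<zero>\<^bsub>F\<^esub>"
      by (rule least_degree[OF NF _ n0], rule NFc, assumption, rule that, assumption+)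
    have vK: "v \<in> K3" "\<phi> v = \<zero>\<^bsub>A\<^esub>" using v(1) by (auto simp: N_def)
    have pi_add: "\<pi> (u \<oplus>\<^bsub>F\<^esub> w) = \<pi> u \<oplus>\<^bsub>F\<^esub> \<pi> w" if "u \<in> K3" "w \<in> K3" for u w
      using that phc zF K3_sub
      by (simp add: \<pi>_def phadd M.minus_add FM.act_l_distr FM.act_closed FM.M.a_ac)
    have pi_smult: "\<pi> (a \<odot>\<^bsub>F\<^esub> u) = a \<odot>\<^bsub>F\<^esub> \<pi> u" if "a \<in> carrier A" "u \<in> K3" for a u
      using that phc zF K3_sub
      by (simp add: \<pi>_def phsm FM.act_r_distr FM.act_closed FM.act_assoc[symmetric] r_minus)
    have ph0: "\<phi> \<zero>\<^bsub>F\<^esub> = \<zero>\<^bsub>A\<^esub>" using lhom_zero[OF KM.M.abelian_group_axioms AM.M.abelian_group_axioms lphi] by simp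
    have pv: "\<pi> v = v" using vK zF K3_sub by (simp add: \<pi>_def)
    have "\<exists>f. lhom A K3m A0 f \<and> aug (f v) \<noteq> \<zero>"
    proof (rule ccontr)
      assume "\<not> ?thesis"
      then have f0: "\<And>f. lhom A K3m A0 f \<Longrightarrow> aug (f v) = \<zero>" by blast
      have pF: "\<pi> u \<in> carrier F" if "u \<in> K3" for u using piN[OF that] NF by blast
      \<comment> \<open>The vanishing below \<open>d'\<close> is known on \<open>N\<close>;
        composing with \<open>\<pi>\<close> extends the test to all of \<open>K3\<close>.\<close>
      have "v \<in> {u \<in> K3. Fc 3 d' (\<pi> u) = \<zero>\<^bsub>F\<^esub>}"
      proof (rule K3_aug_span[where v = v])
        show "v \<in> K3" by (rule vK(1))
        show "aug (f v) = \<zero>" if "lhom A K3m A0 f" for f by (rule f0[OF that])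
      next
        fix a u assume a: "a \<in> carrier A" "aug a = \<zero>" and u: "u \<in> K3"
        have "Fc 3 d' (a \<odot>\<^bsub>F\<^esub> \<pi> u) = cp 0 a \<odot>\<^bsub>F\<^esub> Fc 3 d' (\<pi> u)"
          by (rule Fc_leading_act[OF pF[OF u] low'[OF piN[OF u]] a(1)])
        also have "\<dots> = \<zero>\<^bsub>F\<^esub>" using a components_carrier[OF F_components UNIV_I pF[OF u], of 3 d'] by (simp add: aug_zero_iff)
        finally show "a \<odot>\<^bsub>F\<^esub> u \<in> {u \<in> K3. Fc 3 d' (\<pi> u) = \<zero>\<^bsub>F\<^esub>}" using K3_ops a u pi_smult[OF a(1) u] by simp
      next
        have "\<pi> \<zero>\<^bsub>F\<^esub> = \<zero>\<^bsub>F\<^esub>" using zF ph0 by (simp add: \<pi>_def)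
        then show "\<zero>\<^bsub>F\<^esub> \<in> {u \<in> K3. Fc 3 d' (\<pi> u) = \<zero>\<^bsub>F\<^esub>}"
          by (simp add: K3_ops components_zero[OF FM.M.abelian_group_axioms F_components])
      qed (auto simp: K3_ops pF pi_add components_add[OF F_components])
      then have "Fc 3 d' v = \<zero>\<^bsub>F\<^esub>" using pv by simp
      then show False using components_same[OF F_components UNIV_I v(2)] v(3) by simp
    qed
    then obtain f' where "lhom A K3m A0 f'" "aug (f' v) \<noteq> \<zero>" by blast
    from coordinate_form[OF vK(1) v(2) this]
    obtain \<psi> where psi: "\<psi> \<in> homs_of_degree A \<A> K3m K3g (- d')" "\<psi> v = \<one>\<^bsub>A\<^esub>" by blast
    have psc: "\<psi> u \<in> carrier A" if "u \<in> K3" for u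
      using psi(1) that lhom_closed[of A K3m A0 \<psi> u] by (simp add: homs_of_degree_iff)
    obtain \<alpha> \<beta> \<Psi> where ab: "\<alpha> \<in> carrier K" "\<beta> \<in> carrier K" "\<alpha> \<noteq> \<zero> \<or> \<beta> \<noteq> \<zero>" and Psi: "lhom A F A0 \<Psi>"
      "\<And>z. z \<in> K3 \<Longrightarrow> \<alpha> \<odot>\<^bsub>A\<^esub> \<phi> z \<oplus>\<^bsub>A\<^esub> \<beta> \<odot>\<^bsub>A\<^esub> \<psi> z = \<Psi> z"
      using ext_two[OF phi(1) psi(1)] by blast
    \<comment> \<open>By minimality a form that extends to \<open>F\<close> augments to zero on
      \<open>K3\<close>. Evaluation at \<open>v\<close>, where \<open>\<phi>\<close> vanishes, gives
      \<open>\<beta> = \<zero>\<close>, and evaluation at \<open>z\<close> then gives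
      \<open>\<alpha> = \<zero>\<close>.\<close>
    have aP: "aug (\<Psi> u) = \<zero>" if "u \<in> K3" for u by (rule aug_lhom[OF Psi(1) K3_sub[OF that] K3_aug[OF that]])
    have "\<Psi> v = \<beta> \<odot>\<^bsub>A\<^esub> \<one>\<^bsub>A\<^esub>" using Psi(2)[OF vK(1)] vK psi(2) ab by simp
    then have b0: "\<beta> = \<zero>" using aP[OF vK(1)] ab aug_smult_one by simp
    then have "\<Psi> z = \<alpha> \<odot>\<^bsub>A\<^esub> \<one>\<^bsub>A\<^esub>" using Psi(2)[OF z(1)] phi(2) psc[OF z(1)] ab by simp
    then have "\<alpha> = \<zero>" using aP[OF z(1)] ab aug_smult_one by simp
    with b0 ab(3) show False by simp
  qed
  then have "u = \<phi> u \<odot>\<^bsub>F\<^esub> z" if u: "u \<in> K3" for u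
  proof -
    assume N0: "N \<subseteq> {\<zero>\<^bsub>F\<^esub>}"
    have "\<pi> u = \<zero>\<^bsub>F\<^esub>" using piN[OF u] N0 by blast
    then have "u \<ominus>\<^bsub>F\<^esub> \<phi> u \<odot>\<^bsub>F\<^esub> z = \<zero>\<^bsub>F\<^esub>"
      using zF phc[OF u] by (simp add: \<pi>_def a_minus_def FM.act_l_minus)
    then show ?thesis using FM.M.minus_self_eq[OF K3_sub[OF u] FM.act_closed[OF phc[OF u] zF]] by simp
  qed
  then show ?thesis using that[OF z phi] by blast
qed

text \<open>For \<open>b\<close> in \<open>A\<^sub>1\<close> the forms \<open>\<phi>\<close> and
  \<open>\<phi> b\<close> are dependent modulo forms that extend to \<open>A\<^sup>2\<close>, and
  augmenting at \<open>z\<close> shows that \<open>\<phi> b\<close> is the one that extends. Its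
  value at \<open>z\<close> puts \<open>b\<close> into the right ideal of the coordinates of
  \<open>z\<close>. These are homogeneous of one positive degree, which must be one, and they span
  \<open>A\<^sub>1\<close>.\<close>

theorem K3_free:
  obtains z where "\<And>c. z c \<in> \<A> 1" "z \<in> K3" "\<And>u. u \<in> K3 \<Longrightarrow> \<exists>a\<in>carrier A. u = a \<odot>\<^bsub>F\<^esub> z"
    "\<And>b. b \<in> \<A> 1 \<Longrightarrow> \<exists>\<alpha>\<in>carrier K. \<exists>\<beta>\<in>carrier K. b = \<alpha> \<odot>\<^bsub>A\<^esub> z Vx \<oplus>\<^bsub>A\<^esub> \<beta> \<odot>\<^bsub>A\<^esub> z Vy"
proof -
  obtain z \<phi> d where z: "z \<in> K3" "z \<in> Fg 3 d" "z \<noteq> \<zero>\<^bsub>F\<^esub>" and phi: "\<phi> \<in> homs_of_degree A \<A> K3m K3g (- d)" "\<phi> z = \<one>\<^bsub>A\<^esub>"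
    and gen: "\<And>u. u \<in> K3 \<Longrightarrow> u = \<phi> u \<odot>\<^bsub>F\<^esub> z" by (rule K3_generator) (rule that, assumption+)
  have zF: "z \<in> carrier F" by (rule K3_sub[OF z(1)])
  have lphi: "lhom A K3m A0 \<phi>" using phi(1) by (simp add: homs_of_degree_iff)
  have phc: "\<phi> u \<in> carrier A" if "u \<in> K3" for u using lhom_closed[OF lphi] that by simp
  have d3: "d \<ge> 3" using Fg_low[OF z(2)] z(3) by force
  \<comment> \<open>The degree of the coordinates of \<open>z\<close>, since the basis vectors of
    \<open>F\<close> sit in degree 3.\<close>
  define n where "n = nat (d - 3)"
  have zn: "z c \<in> \<A> n" for c using z(2) d3 by (simp add: Fg_def regular_grading_def n_def)
  have zc: "z c \<in> carrier A" for c using grade_sub[OF zn] .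
  have n0: "n \<noteq> 0"
  proof
    assume "n = 0"
    then have "z c = \<zero>\<^bsub>A\<^esub>" for c using K3_aug[OF z(1), of c] zc cp_same[of "z c" 0] zn[of c] by (simp add: aug_zero_iff)
    then show False using z(3) by (auto simp: fun_eq_iff F_simps)
  qed
  have span: "\<exists>y\<in>carrier F. b = z Vx \<otimes>\<^bsub>A\<^esub> y Vx \<oplus>\<^bsub>A\<^esub> z Vy \<otimes>\<^bsub>A\<^esub> y Vy" if b: "b \<in> \<A> 1" for b
  proof -
    have bA: "b \<in> carrier A" by (rule grade_sub[OF b])
    define \<psi> where "\<psi> = (\<lambda>u\<in>K3. \<phi> u \<otimes>\<^bsub>A\<^esub> b)"
    have "lhom A K3m A0 (\<lambda>u. \<phi> u \<otimes>\<^bsub>A\<^esub> b)"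
      using lhom_closed[OF lphi] bA by (intro lhomI) (auto simp: lhom_add[OF lphi, simplified] lhom_smult[OF lphi, simplified] l_distr m_assoc)
    from lhom_restrict[OF K3_module this] have l: "lhom A K3m A0 \<psi>" by (simp add: \<psi>_def)
    have "\<psi> u \<in> regular_grading A \<A> (j + (1 - d))" if "u \<in> K3g j" for u j
    proof -
      have "\<phi> u \<in> regular_grading A \<A> (j + - d)" "u \<in> K3" using phi(1) that by (auto simp: homs_of_degree_iff K3g_def)
      then show ?thesis using regular_grading_act_r[OF b, of "\<phi> u" "j + - d"] by (simp add: \<psi>_def algebra_simps)
    qed
    then have psi: "\<psi> \<in> homs_of_degree A \<A> K3m K3g (1 - d)" using l by (simp add: homs_of_degree_iff \<psi>_def)
    obtain \<alpha> \<beta> \<Psi> where ab: "\<alpha> \<in> carrier K" "\<beta> \<in> carrier K" "\<alpha> \<noteq> \<zero> \<or> \<beta> \<noteq> \<zero>" and Psi: "lhom A F A0 \<Psi>"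
      "\<And>z. z \<in> K3 \<Longrightarrow> \<alpha> \<odot>\<^bsub>A\<^esub> \<phi> z \<oplus>\<^bsub>A\<^esub> \<beta> \<odot>\<^bsub>A\<^esub> \<psi> z = \<Psi> z"
      using ext_two[OF phi(1) psi] by blast
    have eq: "\<alpha> \<odot>\<^bsub>A\<^esub> \<one>\<^bsub>A\<^esub> \<oplus>\<^bsub>A\<^esub> \<beta> \<odot>\<^bsub>A\<^esub> b = \<Psi> z" using Psi(2)[OF z(1)] z phi(2) bA by (simp add: \<psi>_def)
    have "aug (\<Psi> z) = \<zero>" by (rule aug_lhom[OF Psi(1) zF K3_aug[OF z(1)]])
    \<comment> \<open>At \<open>z\<close> the two forms have the values one and \<open>b\<close>;
      the augmentation of \<open>b\<close> is zero, so it leaves just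
      \<open>\<alpha>\<close>.\<close>
    then have a0: "\<alpha> = \<zero>"
      using eq[symmetric] ab bA aug_pos[OF grade_smult[OF ab(2) b]] by (simp add: aug_add aug_smult_one)
    then have b0: "\<beta> \<noteq> \<zero>" using ab by simp
    then have ib: "inv \<beta> \<in> carrier K" "inv \<beta> \<otimes> \<beta> = \<one>" using KF.field_Units ab by auto
    define y where "y c = inv \<beta> \<odot>\<^bsub>A\<^esub> \<Psi> (unit_vec A c)" for c :: var
    have Pc: "\<Psi> (unit_vec A c) \<in> carrier A" for c using lhom_closed[OF Psi(1)] by simp
    have z_eq: "z = z Vx \<odot>\<^bsub>F\<^esub> unit_vec A Vx \<oplus>\<^bsub>F\<^esub> z Vy \<odot>\<^bsub>F\<^esub> unit_vec A Vy"
    proof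
      fix c show "z c = (z Vx \<odot>\<^bsub>F\<^esub> unit_vec A Vx \<oplus>\<^bsub>F\<^esub> z Vy \<odot>\<^bsub>F\<^esub> unit_vec A Vy) c"
        using zc by (cases c) (simp_all add: unit_vec_def F_simps)
    qed
    have "\<Psi> z = z Vx \<otimes>\<^bsub>A\<^esub> \<Psi> (unit_vec A Vx) \<oplus>\<^bsub>A\<^esub> z Vy \<otimes>\<^bsub>A\<^esub> \<Psi> (unit_vec A Vy)"
      using zc by (subst z_eq) (simp add: lhom_add[OF Psi(1)] lhom_smult[OF Psi(1)] FM.act_closed)
    then have "\<beta> \<odot>\<^bsub>A\<^esub> b = z Vx \<otimes>\<^bsub>A\<^esub> \<Psi> (unit_vec A Vx) \<oplus>\<^bsub>A\<^esub> z Vy \<otimes>\<^bsub>A\<^esub> \<Psi> (unit_vec A Vy)"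
      using eq a0 ab bA by simp
    then have "inv \<beta> \<odot>\<^bsub>A\<^esub> (\<beta> \<odot>\<^bsub>A\<^esub> b) = z Vx \<otimes>\<^bsub>A\<^esub> y Vx \<oplus>\<^bsub>A\<^esub> z Vy \<otimes>\<^bsub>A\<^esub> y Vy"
      using zc Pc ib by (simp add: y_def smult_r_distr smult_mult_right)
    moreover have "inv \<beta> \<odot>\<^bsub>A\<^esub> (\<beta> \<odot>\<^bsub>A\<^esub> b) = b" using ib ab bA by (simp add: smult_assoc1[symmetric])
    ultimately show ?thesis using ib Pc by (intro bexI[of _ y]) (auto simp: F_carrier y_def)
  qed
  \<comment> \<open>Comparison of the parts of degree one: for \<open>n > 1\<close> nothing is left,
    and for \<open>n = 1\<close> the constant terms of \<open>y\<close> remain.\<close>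
  have comp: "b = (if n = 1 then cp 0 (y Vx) \<otimes>\<^bsub>A\<^esub> z Vx \<oplus>\<^bsub>A\<^esub> cp 0 (y Vy) \<otimes>\<^bsub>A\<^esub> z Vy else \<zero>\<^bsub>A\<^esub>)"
    if b: "b \<in> \<A> 1" and y: "y \<in> carrier F" "b = z Vx \<otimes>\<^bsub>A\<^esub> y Vx \<oplus>\<^bsub>A\<^esub> z Vy \<otimes>\<^bsub>A\<^esub> y Vy" for b y
  proof -
    have yc: "y c \<in> carrier A" for c using y(1) by (simp add: F_carrier)
    have "b = cp 1 b" using cp_same[OF b] by simp
    also have "\<dots> = cp 1 (z Vx \<otimes>\<^bsub>A\<^esub> y Vx) \<oplus>\<^bsub>A\<^esub> cp 1 (z Vy \<otimes>\<^bsub>A\<^esub> y Vy)" using y(2) zc yc by (simp add: cp_add)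
    also have "\<dots> = (if n = 1 then z Vx \<otimes>\<^bsub>A\<^esub> cp 0 (y Vx) \<oplus>\<^bsub>A\<^esub> z Vy \<otimes>\<^bsub>A\<^esub> cp 0 (y Vy) else \<zero>\<^bsub>A\<^esub>)"
      using n0 zc yc by (auto simp: cp_mult_l[OF zn])
    finally show ?thesis using zc yc by (simp add: aug_eq smult_mult_left smult_mult_right)
  qed
  have n1: "n = 1"
  proof (rule ccontr)
    assume "n \<noteq> 1"
    then have "x Vx = \<zero>\<^bsub>A\<^esub>" using span[OF x_deg[of Vx]] comp[OF x_deg[of Vx]] by auto
    then have "monomial K [Vx] = \<zero>\<^bsub>T\<^esub>"
      using R.monomial_homogeneous[of "[Vx]" 1] by (intro ker_homogeneous_low[of _ 1]) simp_all
    from fun_cong[OF this, of "[Vx]"] have "\<one> = \<zero>" by (simp add: monomial_def free_algebra_simps)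
    then show False by simp
  qed
  show ?thesis
  proof (rule that)
    show "z c \<in> \<A> 1" for c using zn n1 by simp
    show "z \<in> K3" by (rule z(1))
    show "\<exists>a\<in>carrier A. u = a \<odot>\<^bsub>F\<^esub> z" if "u \<in> K3" for u using gen[OF that] phc[OF that] by blast
    show "\<exists>\<alpha>\<in>carrier K. \<exists>\<beta>\<in>carrier K. b = \<alpha> \<odot>\<^bsub>A\<^esub> z Vx \<oplus>\<^bsub>A\<^esub> \<beta> \<odot>\<^bsub>A\<^esub> z Vy" if b: "b \<in> \<A> 1" for b
    proof -
      from span[OF b] obtain y where y: "y \<in> carrier F" "b = z Vx \<otimes>\<^bsub>A\<^esub> y Vx \<oplus>\<^bsub>A\<^esub> z Vy \<otimes>\<^bsub>A\<^esub> y Vy" by blast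
      have yc: "y c \<in> carrier A" for c using y(1) by (simp add: F_carrier)
      have "b = aug (y Vx) \<odot>\<^bsub>A\<^esub> z Vx \<oplus>\<^bsub>A\<^esub> aug (y Vy) \<odot>\<^bsub>A\<^esub> z Vy"
        using comp[OF b y] n1 yc zc by (simp add: aug_eq smult_mult_left)
      then show ?thesis using aug_closed[OF yc] by blast
    qed
  qed
qed

end

section \<open>The potential\<close>

lemma (in field) det_nonzero:
  assumes M: "a \<in> carrier R" "b \<in> carrier R" "c \<in> carrier R" "d \<in> carrier R"
    and inj: "\<And>u v. u \<in> carrier R \<Longrightarrow> v \<in> carrier R \<Longrightarrow> a \<otimes> u \<oplus> b \<otimes> v = \<zero> \<Longrightarrow> c \<otimes> u \<oplus> d \<otimes> v = \<zero> \<Longrightarrow> u = \<zero> \<and> v = \<zero>"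
  shows "a \<otimes> d \<ominus> b \<otimes> c \<noteq> \<zero>"
proof
  assume "a \<otimes> d \<ominus> b \<otimes> c = \<zero>"
  then have eq: "a \<otimes> d = b \<otimes> c" using M by simp
  \<comment> \<open>If the determinant vanishes, the vectors \<open>(d, - c)\<close> and
    \<open>(b, - a)\<close> lie in the kernel, so injectivity makes all four entries zero.\<close>
  have "d = \<zero> \<and> \<ominus> c = \<zero>"
    by (rule inj) (use M eq in \<open>simp_all add: r_minus r_neg m_comm[of d c]\<close>)
  moreover have "b = \<zero> \<and> \<ominus> a = \<zero>"
    by (rule inj) (use M eq in \<open>simp_all add: r_minus r_neg m_comm[of b a] m_comm[of c b] m_comm[of d a]\<close>)
  ultimately have "a = \<zero>" "b = \<zero>" "c = \<zero>" "d = \<zero>" using M by (metis minus_minus minus_zero)+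
  then have "\<one> = \<zero> \<and> \<one> = \<zero>" by (intro inj) auto
  then show False by simp
qed

text \<open>Cramer's rule; \<open>(p, q)\<close> and \<open>(u, v)\<close> are the rows of a left
  inverse.\<close>

lemma (in field) two_by_two_solve:
  assumes M: "a \<in> carrier R" "b \<in> carrier R" "c \<in> carrier R" "d \<in> carrier R" and det: "a \<otimes> d \<ominus> b \<otimes> c \<noteq> \<zero>"
  obtains p q u v where "p \<in> carrier R" "q \<in> carrier R" "u \<in> carrier R" "v \<in> carrier R"
    "p \<otimes> a \<oplus> q \<otimes> c = \<one>" "p \<otimes> b \<oplus> q \<otimes> d = \<zero>" "u \<otimes> a \<oplus> v \<otimes> c = \<zero>" "u \<otimes> b \<oplus> v \<otimes> d = \<one>"
proof -
  define e where "e = inv (a \<otimes> d \<ominus> b \<otimes> c)"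
  have e: "e \<in> carrier R" "e \<otimes> (a \<otimes> d \<ominus> b \<otimes> c) = \<one>" using field_Units det M by (auto simp: e_def)
  have 1: "e \<otimes> d \<otimes> a \<oplus> (\<ominus> (e \<otimes> b)) \<otimes> c = e \<otimes> (a \<otimes> d \<ominus> b \<otimes> c)"
    using M e(1) by (simp add: a_minus_def r_distr l_minus r_minus m_assoc m_comm[of d a])
  have 2: "e \<otimes> d \<otimes> b \<oplus> (\<ominus> (e \<otimes> b)) \<otimes> d = \<zero>"
    using M e(1) by (simp add: l_minus r_neg m_assoc m_comm[of d b])
  have 3: "(\<ominus> (e \<otimes> c)) \<otimes> a \<oplus> e \<otimes> a \<otimes> c = \<zero>"
    using M e(1) by (simp add: l_minus l_neg m_assoc m_comm[of c a])
  have 4: "(\<ominus> (e \<otimes> c)) \<otimes> b \<oplus> e \<otimes> a \<otimes> d = e \<otimes> (a \<otimes> d \<ominus> b \<otimes> c)"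
    using M e(1) by (simp add: a_minus_def r_distr l_minus r_minus m_assoc m_comm[of c b] a_comm)
  show ?thesis using that[of "e \<otimes> d" "\<ominus> (e \<otimes> b)" "\<ominus> (e \<otimes> c)" "e \<otimes> a"] 1 2 3 4 M e by simp
qed

context cubic_presentation begin

lemma homogeneous_1:
  assumes "f \<in> free_homogeneous K 1"
  shows "f = f [Vx] \<odot>\<^bsub>T\<^esub> monomial K [Vx] \<oplus>\<^bsub>T\<^esub> f [Vy] \<odot>\<^bsub>T\<^esub> monomial K [Vy]"
proof
  fix w
  have f: "f w \<in> carrier K" "f [Vx] \<in> carrier K" "f [Vy] \<in> carrier K" "length w \<noteq> 1 \<Longrightarrow> f w = \<zero>" for w
    using assms by (auto simp: free_homogeneous_def free_algebra_simps)
  consider "w = [Vx]" | "w = [Vy]" | "length w \<noteq> 1"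
    by (cases w; cases "tl w") (auto intro: var.exhaust)
  then show "f w = (f [Vx] \<odot>\<^bsub>T\<^esub> monomial K [Vx] \<oplus>\<^bsub>T\<^esub> f [Vy] \<odot>\<^bsub>T\<^esub> monomial K [Vy]) w"
    by cases (use f in \<open>auto simp: free_algebra_simps monomial_def\<close>)
qed

lemma x_indep:
  assumes "\<alpha> \<in> carrier K" "\<beta> \<in> carrier K" "\<alpha> \<odot>\<^bsub>A\<^esub> x Vx \<oplus>\<^bsub>A\<^esub> \<beta> \<odot>\<^bsub>A\<^esub> x Vy = \<zero>\<^bsub>A\<^esub>"
  shows "\<alpha> = \<zero> \<and> \<beta> = \<zero>"
proof -
  let ?f = "\<alpha> \<odot>\<^bsub>T\<^esub> monomial K [Vx] \<oplus>\<^bsub>T\<^esub> \<beta> \<odot>\<^bsub>T\<^esub> monomial K [Vy]"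
  have "ev ?f = \<zero>\<^bsub>A\<^esub>" using assms by (simp add: ev_add ev_smult)
  then have "?f w = \<zero>" if "length w < 3" for w by (rule ker_low(1)[rotated]) (use assms that in auto)
  from this[of "[Vx]"] this[of "[Vy]"] show ?thesis using assms by (simp add: free_algebra_simps monomial_def)
qed

text \<open>An injective square matrix is invertible, so each family of relations consists of
  combinations of the other and both generate the same ideal.\<close>

lemma change_relations:
  assumes s: "\<And>c. s c = \<zeta> Vx c \<odot>\<^bsub>T\<^esub> r Vx \<oplus>\<^bsub>T\<^esub> \<zeta> Vy c \<odot>\<^bsub>T\<^esub> r Vy" and z: "\<And>i c. \<zeta> i c \<in> carrier K"
    and inj: "\<And>u v. u \<in> carrier K \<Longrightarrow> v \<in> carrier K \<Longrightarrow>
       \<zeta> Vx Vx \<otimes> u \<oplus> \<zeta> Vx Vy \<otimes> v = \<zero> \<Longrightarrow> \<zeta> Vy Vx \<otimes> u \<oplus> \<zeta> Vy Vy \<otimes> v = \<zero> \<Longrightarrow> u = \<zero> \<and> v = \<zero>"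
  shows "cubic_presentation K A \<A> x s"
proof -
  have sT: "s c \<in> carrier T" for c using z by (simp add: s)
  have comb: "\<alpha> \<odot>\<^bsub>T\<^esub> s Vx \<oplus>\<^bsub>T\<^esub> \<beta> \<odot>\<^bsub>T\<^esub> s Vy =
      (\<zeta> Vx Vx \<otimes> \<alpha> \<oplus> \<zeta> Vx Vy \<otimes> \<beta>) \<odot>\<^bsub>T\<^esub> r Vx \<oplus>\<^bsub>T\<^esub> (\<zeta> Vy Vx \<otimes> \<alpha> \<oplus> \<zeta> Vy Vy \<otimes> \<beta>) \<odot>\<^bsub>T\<^esub> r Vy"
    if "\<alpha> \<in> carrier K" "\<beta> \<in> carrier K" for \<alpha> \<beta>
  proof -
    have "\<alpha> \<odot>\<^bsub>T\<^esub> s Vx \<oplus>\<^bsub>T\<^esub> \<beta> \<odot>\<^bsub>T\<^esub> s Vy =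
      ((\<alpha> \<otimes> \<zeta> Vx Vx) \<odot>\<^bsub>T\<^esub> r Vx \<oplus>\<^bsub>T\<^esub> (\<alpha> \<otimes> \<zeta> Vy Vx) \<odot>\<^bsub>T\<^esub> r Vy) \<oplus>\<^bsub>T\<^esub>
      ((\<beta> \<otimes> \<zeta> Vx Vy) \<odot>\<^bsub>T\<^esub> r Vx \<oplus>\<^bsub>T\<^esub> (\<beta> \<otimes> \<zeta> Vy Vy) \<odot>\<^bsub>T\<^esub> r Vy)"
      using z that unfolding s by (simp add: TA.smult_r_distr TA.smult_assoc1)
    also have "\<dots> = (\<alpha> \<otimes> \<zeta> Vx Vx \<oplus> \<beta> \<otimes> \<zeta> Vx Vy) \<odot>\<^bsub>T\<^esub> r Vx \<oplus>\<^bsub>T\<^esub> (\<alpha> \<otimes> \<zeta> Vy Vx \<oplus> \<beta> \<otimes> \<zeta> Vy Vy) \<odot>\<^bsub>T\<^esub> r Vy"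
      using z that by (simp add: TA.smult_l_distr TR.a_ac)
    finally show ?thesis using z that by (simp add: R.m_comm)
  qed
  have det: "\<zeta> Vx Vx \<otimes> \<zeta> Vy Vy \<ominus> \<zeta> Vx Vy \<otimes> \<zeta> Vy Vx \<noteq> \<zero>"
    by (rule KF.det_nonzero[OF z z z z]) (rule inj; assumption)
  have det': "\<zeta> Vx Vx \<otimes> \<zeta> Vy Vy \<ominus> \<zeta> Vy Vx \<otimes> \<zeta> Vx Vy \<noteq> \<zero>"
    using det z by (simp add: R.m_comm[of "\<zeta> Vy Vx"])
  obtain p q u v where pq: "p \<in> carrier K" "q \<in> carrier K" "u \<in> carrier K" "v \<in> carrier K"
    "p \<otimes> \<zeta> Vx Vx \<oplus> q \<otimes> \<zeta> Vx Vy = \<one>" "p \<otimes> \<zeta> Vy Vx \<oplus> q \<otimes> \<zeta> Vy Vy = \<zero>"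
    "u \<otimes> \<zeta> Vx Vx \<oplus> v \<otimes> \<zeta> Vx Vy = \<zero>" "u \<otimes> \<zeta> Vy Vx \<oplus> v \<otimes> \<zeta> Vy Vy = \<one>"
    by (rule KF.two_by_two_solve[OF z z z z det'])
  have one: "\<one> \<odot>\<^bsub>T\<^esub> r c = r c" "\<zero> \<odot>\<^bsub>T\<^esub> r c = \<zero>\<^bsub>T\<^esub>" for c by auto
  have rx: "r Vx = p \<odot>\<^bsub>T\<^esub> s Vx \<oplus>\<^bsub>T\<^esub> q \<odot>\<^bsub>T\<^esub> s Vy"
    unfolding comb[OF pq(1,2)] using pq z by (simp add: R.m_comm[of _ p] R.m_comm[of _ q] one)
  have ry: "r Vy = u \<odot>\<^bsub>T\<^esub> s Vx \<oplus>\<^bsub>T\<^esub> v \<odot>\<^bsub>T\<^esub> s Vy"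
    unfolding comb[OF pq(3,4)] using pq z by (simp add: R.m_comm[of _ u] R.m_comm[of _ v] one)
  have smJ: "c \<odot>\<^bsub>T\<^esub> f \<in> I" if "ideal I T" "f \<in> I" "c \<in> carrier K" for c f I
  proof -
    have fT: "f \<in> carrier T" using ideal.Icarr[OF that(1,2)] .
    have "(c \<odot>\<^bsub>T\<^esub> \<one>\<^bsub>T\<^esub>) \<otimes>\<^bsub>T\<^esub> f \<in> I" using that by (intro ideal.I_l_closed) auto
    then show ?thesis using fT that by (simp add: TA.smult_mult_left)
  qed
  have adJ: "f \<oplus>\<^bsub>T\<^esub> g \<in> I" if "ideal I T" "f \<in> I" "g \<in> I" for f g I
    using additive_subgroup.a_closed[OF ideal.axioms(1)[OF that(1)] that(2,3)] .
  have Is: "ideal (Idl\<^bsub>T\<^esub> (range s)) T" by (rule TR.genideal_ideal) (use sT in auto)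
  have gs: "s c \<in> Idl\<^bsub>T\<^esub> (range s)" for c using TR.genideal_self[of "range s"] sT by auto
  have gr: "r c \<in> Idl\<^bsub>T\<^esub> (range r)" for c
  proof -
    have "range r \<subseteq> Idl\<^bsub>T\<^esub> (range r)" by (rule TR.genideal_self) auto
    then show ?thesis by auto
  qed
  have "s c \<in> Idl\<^bsub>T\<^esub> (range r)" for c unfolding s using gr z by (intro adJ smJ ideal_J)
  then have 1: "Idl\<^bsub>T\<^esub> (range s) \<subseteq> Idl\<^bsub>T\<^esub> (range r)" by (intro TR.genideal_minimal ideal_J) auto
  have "r c \<in> Idl\<^bsub>T\<^esub> (range s)" for c
    using gs pq by (cases c) (simp_all only: rx ry, auto intro!: adJ smJ Is)
  then have 2: "Idl\<^bsub>T\<^esub> (range r) \<subseteq> Idl\<^bsub>T\<^esub> (range s)" by (intro TR.genideal_minimal Is) auto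
  show ?thesis
  proof (intro cubic_presentation.intro cubic_presentation_axioms.intro)
    show "connected_alg K A \<A>" "evaluation K A x" by unfold_locales
    show "x c \<in> \<A> 1" for c by (rule x_deg)
    show "s c \<in> free_homogeneous K 3" for c
    proof -
      have "s c w = \<zero>" if "length w \<noteq> 3" for w
      proof -
        have "r Vx w = \<zero>" "r Vy w = \<zero>" using r_hom[of Vx] r_hom[of Vy] that unfolding free_homogeneous_def by blast+
        then show ?thesis using z by (simp add: s free_algebra_simps)
      qed
      then show ?thesis using sT unfolding free_homogeneous_def by blast
    qed
    show "\<alpha> = \<zero> \<and> \<beta> = \<zero>" if "\<alpha> \<in> carrier K" "\<beta> \<in> carrier K" "\<alpha> \<odot>\<^bsub>T\<^esub> s Vx \<oplus>\<^bsub>T\<^esub> \<beta> \<odot>\<^bsub>T\<^esub> s Vy = \<zero>\<^bsub>T\<^esub>" for \<alpha> \<beta>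
    proof -
      have "\<zeta> Vx Vx \<otimes> \<alpha> \<oplus> \<zeta> Vx Vy \<otimes> \<beta> = \<zero> \<and> \<zeta> Vy Vx \<otimes> \<alpha> \<oplus> \<zeta> Vy Vy \<otimes> \<beta> = \<zero>"
        using comb[OF that(1,2)] that z by (intro r_indep) simp_all
      then show ?thesis using inj[OF that(1,2)] by blast
    qed
    show "ev ` carrier T = carrier A" by (rule ev_surj)
    show "ev f = \<zero>\<^bsub>A\<^esub> \<longleftrightarrow> f \<in> Idl\<^bsub>T\<^esub> (range s)" if "f \<in> carrier T" for f using ev_ker[OF that] 1 2 by blast
  qed
qed

end

text \<open>
  The potential \<open>w = (\<Sum>c. c s\<^sub>c)\<close>, where the \<open>s\<^sub>c\<close> are a basis of the relations, chosen such that \<open>w\<close> is also a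
  sum of relations followed by a letter.
\<close>

locale regular_potential = cubic_presentation K A \<A> x "\<lambda>c. lder c w"
  for K :: "('k, 'l) ring_scheme" (structure) and A :: "('k, 'a, 'b) module_scheme" and \<A> x w +
  assumes w_hom: "w \<in> free_homogeneous K 4"
    and w_right: "eval_at K A x (rder c w) = \<zero>\<^bsub>A\<^esub>"
    and K3_generated: "u \<in> K3 \<Longrightarrow> \<exists>a\<in>carrier A. u = (\<lambda>c. a \<otimes>\<^bsub>A\<^esub> x c)"

lemma lder_mult_1:
  assumes "cring K" "f \<in> free_homogeneous K 1" "g \<in> carrier (free_algebra K)"
  shows "lder c (f \<otimes>\<^bsub>free_algebra K\<^esub> g) = f [c] \<odot>\<^bsub>free_algebra K\<^esub> g"
proof
  interpret cring K by fact
  fix w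
  have f: "\<And>w. f w \<in> carrier K" "\<And>w. length w \<noteq> 1 \<Longrightarrow> f w = \<zero>\<^bsub>K\<^esub>" and g: "\<And>w. g w \<in> carrier K"
    using assms by (auto simp: free_homogeneous_def free_algebra_simps)
  have "lder c f = (\<lambda>w. f [c] \<otimes>\<^bsub>K\<^esub> monomial K [] w)"
    using f by (auto simp: lder_def monomial_def fun_eq_iff)
  then show "lder c (f \<otimes>\<^bsub>free_algebra K\<^esub> g) w = (f [c] \<odot>\<^bsub>free_algebra K\<^esub> g) w"
    using f g by (simp add: lder_def[of c "conv K f g"] free_algebra_mult conv_Cons free_algebra_simps(4) conv_smult_l conv_one_l)
qed

context regular_cubic begin

text \<open>Lift the generator \<open>z\<close> of \<open>K3\<close> to linear forms
  \<open>Z\<close> and put \<open>w = Z\<^sub>x r\<^sub>x + Z\<^sub>y r\<^sub>y\<close>. The left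
  derivatives of \<open>w\<close> are combinations of the relations by the coefficient matrix of
  \<open>z\<close>, which is invertible because \<open>z\<close> spans \<open>A\<^sub>1\<close>. The
  right derivatives have the value \<open>d2 z = 0\<close>. For the new relations \<open>x\<close>
  itself is a syzygy, and by degree it is a scalar multiple of the generator.\<close>

theorem potential_exists: "\<exists>w. regular_potential K A \<A> x w"
proof -
  obtain z where z1: "\<And>c. z c \<in> \<A> 1" and zK: "z \<in> K3"
    and span: "\<And>b. b \<in> \<A> 1 \<Longrightarrow> \<exists>\<alpha>\<in>carrier K. \<exists>\<beta>\<in>carrier K. b = \<alpha> \<odot>\<^bsub>A\<^esub> z Vx \<oplus>\<^bsub>A\<^esub> \<beta> \<odot>\<^bsub>A\<^esub> z Vy"
    by (rule K3_free) (rule that, assumption+)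
  have "\<exists>f. f \<in> free_homogeneous K 1 \<and> z c = ev f" for c using grade_ev[OF z1[of c]] by blast
  then obtain Z where Z: "\<And>c. Z c \<in> free_homogeneous K 1" "\<And>c. z c = ev (Z c)" by metis
  have ZT: "Z c \<in> carrier T" for c using R.free_homogeneousD[OF Z(1)] .
  define \<zeta> where "\<zeta> i c = Z i [c]" for i c
  have zt: "\<zeta> i c \<in> carrier K" for i c using ZT[of i] by (simp add: \<zeta>_def free_algebra_simps)
  have zx: "z i = \<zeta> i Vx \<odot>\<^bsub>A\<^esub> x Vx \<oplus>\<^bsub>A\<^esub> \<zeta> i Vy \<odot>\<^bsub>A\<^esub> x Vy" for i
    unfolding Z(2) using zt[of i] by (subst homogeneous_1[OF Z(1)]) (simp add: ev_add ev_smult \<zeta>_def)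
  define w where "w = Z Vx \<otimes>\<^bsub>T\<^esub> r Vx \<oplus>\<^bsub>T\<^esub> Z Vy \<otimes>\<^bsub>T\<^esub> r Vy"
  have wT: "w \<in> carrier T" using ZT by (simp add: w_def)
  have l_add: "lder c (f \<oplus>\<^bsub>T\<^esub> g) = lder c f \<oplus>\<^bsub>T\<^esub> lder c g" "rder c (f \<oplus>\<^bsub>T\<^esub> g) = rder c f \<oplus>\<^bsub>T\<^esub> rder c g" for c f g
    by (auto simp: lder_def rder_def free_algebra_simps)
  have lw: "lder c w = \<zeta> Vx c \<odot>\<^bsub>T\<^esub> r Vx \<oplus>\<^bsub>T\<^esub> \<zeta> Vy c \<odot>\<^bsub>T\<^esub> r Vy" for c
    using lder_mult_1[OF R.is_cring Z(1) r_mem] by (simp add: w_def l_add \<zeta>_def)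
  have r0: "r c [] = \<zero>" for c using r_hom[of c] unfolding free_homogeneous_def by force
  have rT: "rder c (r i) \<in> carrier T" for c i by (rule R.rder_mem[OF r_mem])
  have rw: "rder c w = Z Vx \<otimes>\<^bsub>T\<^esub> rder c (r Vx) \<oplus>\<^bsub>T\<^esub> Z Vy \<otimes>\<^bsub>T\<^esub> rder c (r Vy)" for c
    using ZT rT R.rder_mem[OF ZT] by (simp add: w_def l_add R.rder_mult r0)
  have ew: "ev (rder c w) = \<zero>\<^bsub>A\<^esub>" for c
  proof -
    have "ev (rder c w) = d2 z c" unfolding rw using ZT rT by (simp add: d2_def ev_add ev_mult Z(2) m_def)
    then show ?thesis using zK by (simp add: K3_def free_module_simps)
  qed
  have lc: "lder c w \<in> carrier T" for c by (rule R.lder_mem[OF wT])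
  \<comment> \<open>The coefficients that express \<open>x\<close> through \<open>z\<close> form a
    left inverse of the matrix \<open>\<zeta>\<close>.\<close>
  have inj: "u = \<zero> \<and> v = \<zero>" if uv: "u \<in> carrier K" "v \<in> carrier K"
    "\<zeta> Vx Vx \<otimes> u \<oplus> \<zeta> Vx Vy \<otimes> v = \<zero>" "\<zeta> Vy Vx \<otimes> u \<oplus> \<zeta> Vy Vy \<otimes> v = \<zero>" for u v
  proof -
    have *: "(\<alpha> \<otimes> \<zeta> Vx Vx \<oplus> \<beta> \<otimes> \<zeta> Vy Vx) \<otimes> u \<oplus> (\<alpha> \<otimes> \<zeta> Vx Vy \<oplus> \<beta> \<otimes> \<zeta> Vy Vy) \<otimes> v = \<zero>"
      if "\<alpha> \<in> carrier K" "\<beta> \<in> carrier K" for \<alpha> \<beta>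
    proof -
      have "(\<alpha> \<otimes> \<zeta> Vx Vx \<oplus> \<beta> \<otimes> \<zeta> Vy Vx) \<otimes> u \<oplus> (\<alpha> \<otimes> \<zeta> Vx Vy \<oplus> \<beta> \<otimes> \<zeta> Vy Vy) \<otimes> v
        = \<alpha> \<otimes> (\<zeta> Vx Vx \<otimes> u \<oplus> \<zeta> Vx Vy \<otimes> v) \<oplus> \<beta> \<otimes> (\<zeta> Vy Vx \<otimes> u \<oplus> \<zeta> Vy Vy \<otimes> v)"
        using that uv(1,2) zt by (simp add: R.l_distr R.r_distr R.m_assoc R.a_ac)
      then show ?thesis using uv that by simp
    qed
    have coef: "\<exists>\<alpha>\<in>carrier K. \<exists>\<beta>\<in>carrier K. \<alpha> \<otimes> \<zeta> Vx Vx \<oplus> \<beta> \<otimes> \<zeta> Vy Vx = (if c = Vx then \<one> else \<zero>) \<and>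
        \<alpha> \<otimes> \<zeta> Vx Vy \<oplus> \<beta> \<otimes> \<zeta> Vy Vy = (if c = Vy then \<one> else \<zero>)" for c
    proof -
      obtain \<alpha> \<beta> where ab: "\<alpha> \<in> carrier K" "\<beta> \<in> carrier K" "x c = \<alpha> \<odot>\<^bsub>A\<^esub> z Vx \<oplus>\<^bsub>A\<^esub> \<beta> \<odot>\<^bsub>A\<^esub> z Vy"
        using span[OF x_deg] by blast
      let ?f = "Z Vx" and ?g = "Z Vy"
      \<comment> \<open>An equation in \<open>A\<^sub>1\<close> lifts to the free algebra because
        evaluation has no kernel below degree three.\<close>
      let ?h = "\<alpha> \<odot>\<^bsub>T\<^esub> Z Vx \<oplus>\<^bsub>T\<^esub> \<beta> \<odot>\<^bsub>T\<^esub> Z Vy \<oplus>\<^bsub>T\<^esub> \<ominus>\<^bsub>T\<^esub> monomial K [c]"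
      have hT: "?h \<in> carrier T" using ab ZT by simp
      have "ev ?h = \<zero>\<^bsub>A\<^esub>" using ab ZT Z(2) M.r_neg[OF x_closed[of c]] by (simp add: ev_add ev_smult ev_minus)
      then have hz: "?h v = \<zero>" if "length v < 3" for v using ker_low(1)[OF hT _ that] by simp
      have tm: "\<ominus>\<^bsub>T\<^esub> monomial K [c] = (\<lambda>v. \<ominus> monomial K [c] v)"
      proof (rule TR.minus_equality)
        show "(\<lambda>v. \<ominus> monomial K [c] v) \<oplus>\<^bsub>T\<^esub> monomial K [c] = \<zero>\<^bsub>T\<^esub>" by (auto simp: free_algebra_simps R.l_neg)
        have "{v. \<ominus> monomial K [c] v \<noteq> \<zero>} \<subseteq> {[c]}" by (auto simp: monomial_def)
        then show "(\<lambda>v. \<ominus> monomial K [c] v) \<in> carrier T" by (auto simp: free_algebra_simps intro: finite_subset)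
      qed simp
      have "\<alpha> \<otimes> \<zeta> Vx d \<oplus> \<beta> \<otimes> \<zeta> Vy d = (if c = d then \<one> else \<zero>)" for d
      proof -
        have "\<alpha> \<otimes> \<zeta> Vx d \<oplus> \<beta> \<otimes> \<zeta> Vy d \<ominus> monomial K [c] [d] = \<zero>"
          using hz[of "[d]"] by (simp add: tm free_algebra_simps(3,4) \<zeta>_def a_minus_def)
        then show ?thesis using ab zt by (auto simp: monomial_def)
      qed
      then show ?thesis using ab by (intro bexI[of _ \<alpha>] bexI[of _ \<beta>]) auto
    qed
    obtain \<alpha> \<beta> where "\<alpha> \<in> carrier K" "\<beta> \<in> carrier K" "\<alpha> \<otimes> \<zeta> Vx Vx \<oplus> \<beta> \<otimes> \<zeta> Vy Vx = \<one>"
      "\<alpha> \<otimes> \<zeta> Vx Vy \<oplus> \<beta> \<otimes> \<zeta> Vy Vy = \<zero>" using coef[of Vx] by auto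
    with *[of \<alpha> \<beta>] have "\<one> \<otimes> u \<oplus> \<zero> \<otimes> v = \<zero>" by simp
    moreover obtain \<alpha>' \<beta>' where "\<alpha>' \<in> carrier K" "\<beta>' \<in> carrier K" "\<alpha>' \<otimes> \<zeta> Vx Vx \<oplus> \<beta>' \<otimes> \<zeta> Vy Vx = \<zero>"
      "\<alpha>' \<otimes> \<zeta> Vx Vy \<oplus> \<beta>' \<otimes> \<zeta> Vy Vy = \<one>" using coef[of Vy] by auto
    with *[of \<alpha>' \<beta>'] have "\<zero> \<otimes> u \<oplus> \<one> \<otimes> v = \<zero>" by simp
    ultimately show ?thesis using uv by simp
  qed
  have pres: "cubic_presentation K A \<A> x (\<lambda>c. lder c w)" by (rule change_relations[OF lw zt]) (rule inj)
  interpret S: regular_cubic K A \<A> x "\<lambda>c. lder c w"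
    by (intro regular_cubic.intro pres regular_cubic_axioms.intro AS)
  have w0: "w [] = \<zero>"
    using ZT r0 R.conv_Nil[of "Z Vx" "r Vx"] R.conv_Nil[of "Z Vy" "r Vy"] r_mem[of Vx] r_mem[of Vy]
    by (simp add: w_def free_algebra_simps(1,3) free_algebra_mult)
  \<comment> \<open>Dividing \<open>w\<close> on the left and then on the right exhibits
    \<open>ev (rder c w)\<close> as a coordinate of the new \<open>d2\<close> at
    \<open>x\<close>.\<close>
  have xK: "x \<in> S.K3"
  proof -
    have "S.d2 x c = \<zero>\<^bsub>A\<^esub>" for c
    proof -
      have mc: "monomial K [d] [] = \<zero>" for d :: var by (simp add: monomial_def)
      have "rder c w = rder c (monomial K [Vx] \<otimes>\<^bsub>T\<^esub> lder Vx w \<oplus>\<^bsub>T\<^esub> monomial K [Vy] \<otimes>\<^bsub>T\<^esub> lder Vy w)"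
        using R.left_division[OF wT w0] by simp
      also have "\<dots> = monomial K [Vx] \<otimes>\<^bsub>T\<^esub> rder c (lder Vx w) \<oplus>\<^bsub>T\<^esub> monomial K [Vy] \<otimes>\<^bsub>T\<^esub> rder c (lder Vy w)"
      proof -
        have l0: "lder d w [] = \<zero>" for d using S.r_hom[of d] unfolding free_homogeneous_def by force
        have "rder c (monomial K [d]) \<in> carrier T" for d :: var by (rule R.rder_mem) simp
        then show ?thesis using lc R.rder_mem[OF lc] by (simp add: l_add R.rder_mult l0)
      qed
      finally have "ev (rder c w) = x Vx \<otimes>\<^bsub>A\<^esub> S.m Vx c \<oplus>\<^bsub>A\<^esub> x Vy \<otimes>\<^bsub>A\<^esub> S.m Vy c"
        using R.rder_mem[OF lc] by (simp add: ev_add ev_mult S.m_def)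
      then show ?thesis using ew by (simp add: S.d2_def)
    qed
    then show ?thesis by (auto simp: S.K3_def F_carrier free_module_simps(2))
  qed
  obtain z' where z': "\<And>c. z' c \<in> \<A> 1" and gen: "\<And>u. u \<in> S.K3 \<Longrightarrow> \<exists>a\<in>carrier A. u = a \<odot>\<^bsub>F\<^esub> z'"
    by (rule S.K3_free) (rule that, assumption+)
  obtain a where a: "a \<in> carrier A" "x = a \<odot>\<^bsub>F\<^esub> z'" using gen[OF xK] by blast
  have zc: "z' c \<in> carrier A" for c using grade_sub[OF z'] .
  \<comment> \<open>The coordinates of \<open>x\<close> and of \<open>z'\<close> both have degree
    one, so the constant term of \<open>a\<close> alone contributes.\<close>
  have xa: "x c = aug a \<odot>\<^bsub>A\<^esub> z' c" for c
  proof -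
    have "x c = cp 1 (a \<otimes>\<^bsub>A\<^esub> z' c)" using cp_same[OF x_deg[of c]] a(2) by (metis free_module_simps(4))
    also have "\<dots> = cp 0 a \<otimes>\<^bsub>A\<^esub> z' c" using cp_mult_r[OF z' a(1), of 1] by simp
    finally show ?thesis using a zc by (simp add: aug_eq smult_mult_left)
  qed
  have "aug a \<noteq> \<zero>"
  proof
    assume "aug a = \<zero>"
    then have "x Vx = \<zero>\<^bsub>A\<^esub>" using xa[of Vx] zc by simp
    then have "\<one> = \<zero> \<and> \<zero> = \<zero>" by (intro x_indep) auto
    then show False by simp
  qed
  then have ia: "inv (aug a) \<in> carrier K" "inv (aug a) \<otimes> aug a = \<one>" using KF.field_Units a by auto
  have z'x: "z' c = inv (aug a) \<odot>\<^bsub>A\<^esub> x c" for c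
    using ia a zc unfolding xa by (simp add: smult_assoc1[symmetric])
  have "regular_potential K A \<A> x w"
  proof (intro regular_potential.intro pres regular_potential_axioms.intro)
    show "ev (rder c w) = \<zero>\<^bsub>A\<^esub>" for c by (rule ew)
    show "w \<in> free_homogeneous K 4"
    proof -
      have "w v = \<zero>" if "length v \<noteq> 4" for v
      proof (cases v)
        case Nil then show ?thesis using w0 by simp
      next
        case (Cons c v')
        then have "lder c w v' = \<zero>" using S.r_hom[of c] that unfolding free_homogeneous_def by force
        then show ?thesis using Cons by (simp add: lder_def)
      qed
      then show ?thesis using wT unfolding free_homogeneous_def by blast
    qed
    show "\<exists>b\<in>carrier A. u = (\<lambda>c. b \<otimes>\<^bsub>A\<^esub> x c)" if "u \<in> S.K3" for u
    proof -
      obtain b where b: "b \<in> carrier A" "u = b \<odot>\<^bsub>F\<^esub> z'" using gen[OF \<open>u \<in> S.K3\<close>] by blast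
      have "u = (\<lambda>c. (inv (aug a) \<odot>\<^bsub>A\<^esub> b) \<otimes>\<^bsub>A\<^esub> x c)"
        unfolding b(2) free_module_simps(4) z'x using ia b by (simp add: smult_mult_left smult_mult_right)
      then show ?thesis using ia b by (intro bexI[of _ "inv (aug a) \<odot>\<^bsub>A\<^esub> b"]) auto
    qed
  qed
  then show ?thesis by blast
qed

end

context regular_potential begin

lemma w_mem: "w \<in> carrier T" using w_hom R.free_homogeneousD by blast

text \<open>The left derivatives of \<open>w'\<close> are combinations of those of \<open>w\<close>;
  collecting the coefficients by relation gives linear forms \<open>p\<close> with
  \<open>w' = p\<^sub>x s\<^sub>x + p\<^sub>y s\<^sub>y\<close>, where
  \<open>s\<^sub>c = lder c w\<close>. The condition on the right derivatives says that
  \<open>p\<close> is in \<open>K3\<close>, which is generated by \<open>x\<close>, so by degree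
  \<open>p\<close> is a scalar multiple of \<open>x\<close>.\<close>

theorem potential_unique:
  assumes w': "w' \<in> free_homogeneous K 4" and l: "\<And>c. ev (lder c w') = \<zero>\<^bsub>A\<^esub>" and r: "\<And>c. ev (rder c w') = \<zero>\<^bsub>A\<^esub>"
  obtains \<kappa> where "\<kappa> \<in> carrier K" "w' = \<kappa> \<odot>\<^bsub>T\<^esub> w"
proof -
  have w'T: "w' \<in> carrier T" using w' R.free_homogeneousD by blast
  have "\<exists>\<alpha> \<beta>. \<alpha> \<in> carrier K \<and> \<beta> \<in> carrier K \<and> lder c w' = \<alpha> \<odot>\<^bsub>T\<^esub> lder Vx w \<oplus>\<^bsub>T\<^esub> \<beta> \<odot>\<^bsub>T\<^esub> lder Vy w" for c
    using ker_3[OF _ l[of c]] R.lder_homogeneous[of w' 3 c] w' by (simp add: numeral_eq_Suc) metis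
  then obtain \<alpha> \<beta> where ab: "\<And>c. \<alpha> c \<in> carrier K" "\<And>c. \<beta> c \<in> carrier K"
    "\<And>c. lder c w' = \<alpha> c \<odot>\<^bsub>T\<^esub> lder Vx w \<oplus>\<^bsub>T\<^esub> \<beta> c \<odot>\<^bsub>T\<^esub> lder Vy w" by metis
  define p where "p i = (if i = Vx then \<alpha> Vx \<odot>\<^bsub>A\<^esub> x Vx \<oplus>\<^bsub>A\<^esub> \<alpha> Vy \<odot>\<^bsub>A\<^esub> x Vy else \<beta> Vx \<odot>\<^bsub>A\<^esub> x Vx \<oplus>\<^bsub>A\<^esub> \<beta> Vy \<odot>\<^bsub>A\<^esub> x Vy)" for i
  have p1: "p i \<in> \<A> 1" for i using ab x_deg by (simp add: p_def grade_add grade_smult)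
  have w0: "w' [] = \<zero>" using w' unfolding free_homogeneous_def by force
  have lc: "lder c w \<in> carrier T" "lder c w' \<in> carrier T" for c using R.lder_mem w_mem w'T by auto
  have "d2 p c = \<zero>\<^bsub>A\<^esub>" for c
  proof -
    have l_add: "rder c (f \<oplus>\<^bsub>T\<^esub> g) = rder c f \<oplus>\<^bsub>T\<^esub> rder c g" "rder c (k \<odot>\<^bsub>T\<^esub> f) = k \<odot>\<^bsub>T\<^esub> rder c f" for f g k
      by (auto simp: rder_def free_algebra_simps)
    have l0: "lder d w' [] = \<zero>" for d using w' unfolding free_homogeneous_def lder_def by force
    have rc: "rder c (lder d w) \<in> carrier T" "rder c (lder d w') \<in> carrier T" "rder c (monomial K [d]) \<in> carrier T" for d
      by (intro R.rder_mem lc R.monomial_mem)+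
    have "rder c w' = monomial K [Vx] \<otimes>\<^bsub>T\<^esub> rder c (lder Vx w') \<oplus>\<^bsub>T\<^esub> monomial K [Vy] \<otimes>\<^bsub>T\<^esub> rder c (lder Vy w')"
      using lc rc by (subst R.left_division[OF w'T w0]) (simp add: l_add R.rder_mult l0)
    then have z: "\<zero>\<^bsub>A\<^esub> = x Vx \<otimes>\<^bsub>A\<^esub> ev (rder c (lder Vx w')) \<oplus>\<^bsub>A\<^esub> x Vy \<otimes>\<^bsub>A\<^esub> ev (rder c (lder Vy w'))"
      using r[of c] rc by (simp add: ev_add ev_mult)
    have e: "ev (rder c (lder i w')) = \<alpha> i \<odot>\<^bsub>A\<^esub> m Vx c \<oplus>\<^bsub>A\<^esub> \<beta> i \<odot>\<^bsub>A\<^esub> m Vy c" for i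
      unfolding ab(3) l_add using rc ab by (simp add: ev_add ev_smult m_def)
    show ?thesis using z[unfolded e, symmetric] ab(1,2)
      by (simp add: d2_def p_def l_distr r_distr smult_mult_left smult_mult_right M.a_ac)
  qed
  then have "p \<in> K3" using p1 grade_sub by (auto simp: K3_def F_carrier free_module_simps(2))
  then obtain a where a: "a \<in> carrier A" "p = (\<lambda>c. a \<otimes>\<^bsub>A\<^esub> x c)" using K3_generated by blast
  define \<kappa> where "\<kappa> = aug a"
  have k: "\<kappa> \<in> carrier K" using a by (simp add: \<kappa>_def)
  have pk: "p c = \<kappa> \<odot>\<^bsub>A\<^esub> x c" for c
  proof -
    have "p c = cp 1 (a \<otimes>\<^bsub>A\<^esub> x c)" using cp_same[OF p1[of c]] a(2) by metis
    also have "\<dots> = cp 0 a \<otimes>\<^bsub>A\<^esub> x c" using cp_mult_r[OF x_deg a(1), of 1] by simp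
    finally show ?thesis using a by (simp add: aug_eq smult_mult_left \<kappa>_def)
  qed
  have sub0: "b \<oplus>\<^bsub>A\<^esub> \<ominus>\<^bsub>A\<^esub> b = \<zero>\<^bsub>A\<^esub>" if "b \<in> carrier A" for b using that by (simp add: M.r_neg)
  have "(\<alpha> Vx \<ominus> \<kappa>) = \<zero> \<and> \<alpha> Vy = \<zero>"
  proof (rule x_indep)
    have "(\<alpha> Vx \<ominus> \<kappa>) \<odot>\<^bsub>A\<^esub> x Vx \<oplus>\<^bsub>A\<^esub> \<alpha> Vy \<odot>\<^bsub>A\<^esub> x Vy = p Vx \<oplus>\<^bsub>A\<^esub> \<ominus>\<^bsub>A\<^esub> (\<kappa> \<odot>\<^bsub>A\<^esub> x Vx)"
      using ab k by (simp add: p_def a_minus_def smult_l_distr smult_l_minus M.a_ac)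
    then show "(\<alpha> Vx \<ominus> \<kappa>) \<odot>\<^bsub>A\<^esub> x Vx \<oplus>\<^bsub>A\<^esub> \<alpha> Vy \<odot>\<^bsub>A\<^esub> x Vy = \<zero>\<^bsub>A\<^esub>" using pk k sub0 by simp
  qed (use ab k in auto)
  moreover have "\<beta> Vx = \<zero> \<and> (\<beta> Vy \<ominus> \<kappa>) = \<zero>"
  proof (rule x_indep)
    have "\<beta> Vx \<odot>\<^bsub>A\<^esub> x Vx \<oplus>\<^bsub>A\<^esub> (\<beta> Vy \<ominus> \<kappa>) \<odot>\<^bsub>A\<^esub> x Vy = p Vy \<oplus>\<^bsub>A\<^esub> \<ominus>\<^bsub>A\<^esub> (\<kappa> \<odot>\<^bsub>A\<^esub> x Vy)"
      using ab k by (simp add: p_def a_minus_def smult_l_distr smult_l_minus M.a_ac)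
    then show "\<beta> Vx \<odot>\<^bsub>A\<^esub> x Vx \<oplus>\<^bsub>A\<^esub> (\<beta> Vy \<ominus> \<kappa>) \<odot>\<^bsub>A\<^esub> x Vy = \<zero>\<^bsub>A\<^esub>" using pk k sub0 by simp
  qed (use ab k in auto)
  ultimately have coefs: "\<alpha> Vx = \<kappa>" "\<alpha> Vy = \<zero>" "\<beta> Vx = \<zero>" "\<beta> Vy = \<kappa>" using ab k by auto
  have "w' v = \<kappa> \<otimes> w v" for v
  proof (cases v)
    case Nil
    have "w [] = \<zero>" using w_hom unfolding free_homogeneous_def by force
    then show ?thesis using Nil w0 k by simp
  next
    case (Cons c u)
    have wc: "w u \<in> carrier K" for u using w_mem by (simp add: free_algebra_simps)
    have "lder c w' u = \<alpha> c \<otimes> w (Vx # u) \<oplus> \<beta> c \<otimes> w (Vy # u)"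
      unfolding ab(3) by (simp add: free_algebra_simps lder_def)
    then show ?thesis using Cons coefs wc k by (cases c) (simp_all add: lder_def)
  qed
  then show ?thesis using that[OF k] by (simp add: free_algebra_simps fun_eq_iff)
qed

end

section \<open>Presented algebras and change of generators\<close>

context cring begin

lemma homogeneous_closed:
  shows "\<zero>\<^bsub>T\<^esub> \<in> free_homogeneous R n"
    and "f \<in> free_homogeneous R n \<Longrightarrow> g \<in> free_homogeneous R n \<Longrightarrow> f \<oplus>\<^bsub>T\<^esub> g \<in> free_homogeneous R n"
    and "c \<in> carrier R \<Longrightarrow> f \<in> free_homogeneous R n \<Longrightarrow> c \<odot>\<^bsub>T\<^esub> f \<in> free_homogeneous R n"
proof -
  interpret T: ring "free_algebra R :: ('a, 'v list \<Rightarrow> 'a) module" by (rule free_algebra_ring)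
  interpret TA: assoc_algebra R "free_algebra R :: ('a, 'v list \<Rightarrow> 'a) module" by (rule free_algebra_assoc_algebra)
  show "\<zero>\<^bsub>T\<^esub> \<in> free_homogeneous R n" by (auto simp: free_homogeneous_def free_algebra_simps)
  show "f \<in> free_homogeneous R n \<Longrightarrow> g \<in> free_homogeneous R n \<Longrightarrow> f \<oplus>\<^bsub>T\<^esub> g \<in> free_homogeneous R n"
    for f g :: "'v list \<Rightarrow> 'a"
  proof -
    assume f: "f \<in> free_homogeneous R n" and g: "g \<in> free_homogeneous R n"
    then have "f \<oplus>\<^bsub>T\<^esub> g \<in> carrier T" by (auto simp: free_homogeneous_def)
    moreover have "(f \<oplus>\<^bsub>T\<^esub> g) w = \<zero>" if "length w \<noteq> n" for w
    proof -
      have "f w = \<zero>" "g w = \<zero>" using f g that unfolding free_homogeneous_def by blast+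
      then show ?thesis by (simp add: free_algebra_simps)
    qed
    ultimately show ?thesis unfolding free_homogeneous_def by blast
  qed
  show "c \<in> carrier R \<Longrightarrow> f \<in> free_homogeneous R n \<Longrightarrow> c \<odot>\<^bsub>T\<^esub> f \<in> free_homogeneous R n" for c and f :: "'v list \<Rightarrow> 'a"
  proof -
    assume c: "c \<in> carrier R" and f: "f \<in> free_homogeneous R n"
    then have "c \<odot>\<^bsub>T\<^esub> f \<in> carrier T" by (auto simp: free_homogeneous_def)
    moreover have "(c \<odot>\<^bsub>T\<^esub> f) w = \<zero>" if "length w \<noteq> n" for w
    proof -
      have "f w = \<zero>" using f that unfolding free_homogeneous_def by blast
      then show ?thesis using c by (simp add: free_algebra_simps)
    qed
    ultimately show ?thesis unfolding free_homogeneous_def by blast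
  qed
qed

lemma homogeneous_mult:
  fixes f g :: "'v list \<Rightarrow> 'a"
  assumes f: "f \<in> free_homogeneous R n" and g: "g \<in> free_homogeneous R k"
  shows "f \<otimes>\<^bsub>T\<^esub> g \<in> free_homogeneous R (n + k)"
proof -
  interpret T: ring "free_algebra R :: ('a, 'v list \<Rightarrow> 'a) module" by (rule free_algebra_ring)
  have fT: "f \<in> carrier T" "g \<in> carrier T" using f g by (auto simp: free_homogeneous_def)
  have "length w = n + k" if nz: "(f \<otimes>\<^bsub>T\<^esub> g) w \<noteq> \<zero>" for w
  proof -
    obtain u v where "w = u @ v" "f u \<noteq> \<zero>" "g v \<noteq> \<zero>"
      by (rule conv_support[OF nz[unfolded free_algebra_mult]]) (use fT in \<open>auto simp: free_algebra_simps\<close>)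
    then show ?thesis using f g unfolding free_homogeneous_def by auto
  qed
  then show ?thesis using fT T.m_closed[OF fT] unfolding free_homogeneous_def by blast
qed

lemma eval_homogeneous:
  fixes p :: "'u \<Rightarrow> 'v list \<Rightarrow> 'a"
  assumes p: "\<And>c. p c \<in> free_homogeneous R 1" and f: "f \<in> free_homogeneous R n"
  shows "eval_at R T p f \<in> free_homogeneous R n"
proof -
  interpret T: ring "free_algebra R :: ('a, 'v list \<Rightarrow> 'a) module" by (rule free_algebra_ring)
  have "word_prod T p w \<in> free_homogeneous R (length w)" for w
  proof (induction w)
    case Nil show ?case by (auto simp: word_prod_def free_algebra_simps intro: monomial_homogeneous)
  next
    case (Cons c w)
    then show ?case using homogeneous_mult[OF p[of c] Cons] by (simp add: word_prod_def)
  qed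
  moreover have fn: "length w = n" "f w \<in> carrier R" if "f w \<noteq> \<zero>" for w
    using f that by (auto simp: free_homogeneous_def free_algebra_simps)
  ultimately have mem: "f w \<odot>\<^bsub>T\<^esub> word_prod T p w \<in> free_homogeneous R n" if "f w \<noteq> \<zero>" for w
    using homogeneous_closed(3) that by metis
  have fin: "finite {w. f w \<noteq> \<zero>}" using f by (simp add: free_homogeneous_def free_algebra_simps)
  show ?thesis unfolding eval_at_def lin_ext_def
  proof (rule finsum_induct[where P = "\<lambda>h. h \<in> free_homogeneous R n", OF T.abelian_group_axioms fin])
    fix w assume "w \<in> {w. f w \<noteq> \<zero>}"
    then show "f w \<odot>\<^bsub>T\<^esub> word_prod T p w \<in> carrier T \<and> f w \<odot>\<^bsub>T\<^esub> word_prod T p w \<in> free_homogeneous R n"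
      using mem[of w] free_homogeneousD by blast
  qed (use homogeneous_closed in auto)
qed

text \<open>The quotient map through which presented algebras are handled from now on. The delicate
  point is the scalar multiplication, defined by a union over a coset: representatives differ by
  elements of the ideal, and scalar multiples of these stay in it.\<close>

lemma presented_quotient:
  fixes S :: "('v list \<Rightarrow> 'a) set"
  assumes S: "S \<subseteq> carrier T"
  defines "q \<equiv> \<lambda>t. Idl\<^bsub>T\<^esub> S +>\<^bsub>T\<^esub> t" and "B \<equiv> presented_algebra R S"
  shows "q \<in> ring_hom T B" "q ` carrier T = carrier B"
    "\<And>s t. s \<in> carrier T \<Longrightarrow> t \<in> carrier T \<Longrightarrow> q s = q t \<longleftrightarrow> s \<ominus>\<^bsub>T\<^esub> t \<in> Idl\<^bsub>T\<^esub> S"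
    "\<And>c t. c \<in> carrier R \<Longrightarrow> t \<in> carrier T \<Longrightarrow> q (c \<odot>\<^bsub>T\<^esub> t) = c \<odot>\<^bsub>B\<^esub> q t"
proof -
  interpret T: ring "free_algebra R :: ('a, 'v list \<Rightarrow> 'a) module" by (rule free_algebra_ring)
  interpret TA: assoc_algebra R "free_algebra R :: ('a, 'v list \<Rightarrow> 'a) module" by (rule free_algebra_assoc_algebra)
  interpret J: ideal "Idl\<^bsub>T\<^esub> S" T by (rule T.genideal_ideal[OF S])
  have B: "carrier B = carrier (T Quot Idl\<^bsub>T\<^esub> S)" "monoid.mult B = monoid.mult (T Quot Idl\<^bsub>T\<^esub> S)"
    "\<one>\<^bsub>B\<^esub> = \<one>\<^bsub>T Quot Idl\<^bsub>T\<^esub> S\<^esub>" "\<zero>\<^bsub>B\<^esub> = \<zero>\<^bsub>T Quot Idl\<^bsub>T\<^esub> S\<^esub>" "add B = add (T Quot Idl\<^bsub>T\<^esub> S)"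
    "smult B = (\<lambda>c C. \<Union>f\<in>C. Idl\<^bsub>T\<^esub> S +>\<^bsub>T\<^esub> (c \<odot>\<^bsub>T\<^esub> f))"
    by (simp_all add: B_def presented_algebra_def Let_def)
  have "q \<in> ring_hom T (T Quot Idl\<^bsub>T\<^esub> S)" unfolding q_def by (rule J.rcos_ring_hom)
  then show "q \<in> ring_hom T B" by (simp add: ring_hom_def B)
  show "q ` carrier T = carrier B" unfolding B q_def by (auto simp: FactRing_def A_RCOSETS_def' )
  show 1: "q s = q t \<longleftrightarrow> s \<ominus>\<^bsub>T\<^esub> t \<in> Idl\<^bsub>T\<^esub> S" if "s \<in> carrier T" "t \<in> carrier T" for s t
    unfolding q_def by (rule T.quotient_eq_iff_same_a_r_cos[OF J.ideal_axioms, symmetric]) (use that in auto)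
  show "q (c \<odot>\<^bsub>T\<^esub> t) = c \<odot>\<^bsub>B\<^esub> q t" if c: "c \<in> carrier R" and t: "t \<in> carrier T" for c t
  proof -
    have "q (c \<odot>\<^bsub>T\<^esub> u) = q (c \<odot>\<^bsub>T\<^esub> t)" if u: "u \<in> q t" for u
    proof -
      have uT: "u \<in> carrier T" using u t J.Icarr by (auto simp: q_def a_r_coset_def r_coset_def)
      have "q t = q u" unfolding q_def using u t T.a_repr_independence[OF _ _ J.a_subgroup] by (simp add: q_def)
      then have "t \<ominus>\<^bsub>T\<^esub> u \<in> Idl\<^bsub>T\<^esub> S" using 1[OF t uT] by simp
      then have "(c \<odot>\<^bsub>T\<^esub> \<one>\<^bsub>T\<^esub>) \<otimes>\<^bsub>T\<^esub> (t \<ominus>\<^bsub>T\<^esub> u) \<in> Idl\<^bsub>T\<^esub> S" using c by (intro J.I_l_closed) auto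
      moreover have "(c \<odot>\<^bsub>T\<^esub> \<one>\<^bsub>T\<^esub>) \<otimes>\<^bsub>T\<^esub> (t \<ominus>\<^bsub>T\<^esub> u) = c \<odot>\<^bsub>T\<^esub> t \<ominus>\<^bsub>T\<^esub> c \<odot>\<^bsub>T\<^esub> u"
        using c t uT by (simp add: TA.smult_mult_left a_minus_def TA.smult_r_distr TA.smult_r_minus)
      ultimately show ?thesis using 1[of "c \<odot>\<^bsub>T\<^esub> t" "c \<odot>\<^bsub>T\<^esub> u"] c t uT by simp
    qed
    moreover have "t \<in> q t" unfolding q_def by (rule J.a_rcos_self[OF t])
    ultimately show ?thesis unfolding B q_def by blast
  qed
qed

end

text \<open>The generators are the preimages of the classes of letters. By uniqueness of evaluation
  \<open>eval_at\<close> is the quotient map followed by the inverse isomorphism, from which its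
  image and kernel are read off.\<close>

lemma (in connected_alg) presentation_of_iso:
  assumes r: "\<And>c :: var. r c \<in> free_homogeneous K 3"
    and indep: "\<And>\<alpha> \<beta>. \<lbrakk>\<alpha> \<in> carrier K; \<beta> \<in> carrier K;
        \<alpha> \<odot>\<^bsub>free_algebra K\<^esub> r Vx \<oplus>\<^bsub>free_algebra K\<^esub> \<beta> \<odot>\<^bsub>free_algebra K\<^esub> r Vy = \<zero>\<^bsub>free_algebra K\<^esub>\<rbrakk> \<Longrightarrow> \<alpha> = \<zero> \<and> \<beta> = \<zero>"
    and f: "f \<in> graded_algebra_iso K A \<A> (presented_algebra K (range r)) (presented_grading K (range r))"
  shows "\<exists>x. cubic_presentation K A \<A> x r"
proof -
  let ?T = "free_algebra K :: ('k, var list \<Rightarrow> 'k) module"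
  let ?B = "presented_algebra K (range r)" and ?J = "Idl\<^bsub>?T\<^esub> (range r)"
  define q where "q t = ?J +>\<^bsub>?T\<^esub> t" for t
  have S: "range r \<subseteq> carrier ?T" using r by (auto simp: free_homogeneous_def)
  note Q = R.presented_quotient[OF S, folded q_def]
  interpret T: ring ?T by (rule R.free_algebra_ring)
  have f_iso: "f \<in> ring_iso A ?B" and f_lin: "\<And>c a. c \<in> carrier K \<Longrightarrow> a \<in> carrier A \<Longrightarrow> f (c \<odot>\<^bsub>A\<^esub> a) = c \<odot>\<^bsub>?B\<^esub> f a"
    and f_gr: "\<And>n. f ` \<A> n = presented_grading K (range r) n"
    using f by (auto simp: graded_algebra_iso_def)
  have bij: "bij_betw f (carrier A) (carrier ?B)" and f_hom: "f \<in> ring_hom A ?B" using f_iso by (auto simp: ring_iso_def)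
  define g where "g = inv_into (carrier A) f"
  have g_iso: "g \<in> ring_iso ?B A" unfolding g_def by (rule ring_iso_set_sym[OF ring_axioms f_iso])
  have g_hom: "g \<in> ring_hom ?B A" using g_iso by (simp add: ring_iso_def)
  have gf: "g (f a) = a" if "a \<in> carrier A" for a unfolding g_def by (rule inv_into_f_f[OF bij_betw_imp_inj_on[OF bij] that])
  have fg: "f (g b) = b" if "b \<in> carrier ?B" for b
    unfolding g_def using f_inv_into_f[of b f "carrier A"] bij that by (simp add: bij_betw_def)
  have gc: "g b \<in> carrier A" if "b \<in> carrier ?B" for b using ring_hom_closed[OF g_hom that] .
  have qc: "q t \<in> carrier ?B" if "t \<in> carrier ?T" for t using ring_hom_closed[OF Q(1) that] .
  define x where "x c = g (q (monomial K [c]))" for c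
  have xA: "x c \<in> carrier A" for c unfolding x_def by (intro gc qc R.monomial_mem)
  interpret E: evaluation K A x by unfold_locales (rule xA)
  have h_hom: "(\<lambda>t. g (q t)) \<in> ring_hom ?T A"
    using ring_hom_trans[OF Q(1) g_hom] by (simp add: comp_def)
  have h_lin: "lhom K ?T A (\<lambda>t. g (q t))"
  proof (rule lhomI)
    show "g (q t) \<in> carrier A" if "t \<in> carrier ?T" for t using gc qc that by blast
    show "g (q (s \<oplus>\<^bsub>?T\<^esub> t)) = g (q s) \<oplus>\<^bsub>A\<^esub> g (q t)" if "s \<in> carrier ?T" "t \<in> carrier ?T" for s t
      using ring_hom_add[OF h_hom that] .
    show "g (q (c \<odot>\<^bsub>?T\<^esub> t)) = c \<odot>\<^bsub>A\<^esub> g (q t)" if "c \<in> carrier K" "t \<in> carrier ?T" for c t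
      using f_lin[OF that(1) gc[OF qc[OF that(2)]]] fg[OF qc[OF that(2)]] Q(4)[OF that]
        gf[OF smult_closed[OF that(1) gc[OF qc[OF that(2)]]]] by simp
  qed
  have ev: "eval_at K A x t = g (q t)" if "t \<in> carrier ?T" for t
    by (rule E.ev_unique[OF h_lin h_hom _ that, symmetric]) (simp add: x_def)
  have "cubic_presentation K A \<A> x r"
  proof (intro cubic_presentation.intro cubic_presentation_axioms.intro)
    show "connected_alg K A \<A>" "evaluation K A x" by unfold_locales
    show "x c \<in> \<A> 1" for c
    proof -
      have "q (monomial K [c]) \<in> presented_grading K (range r) 1"
        unfolding presented_grading_def q_def using R.monomial_homogeneous[of "[c]" 1] by auto
      then have "q (monomial K [c]) \<in> f ` \<A> 1" using f_gr by simp
      then obtain a where "a \<in> \<A> 1" "q (monomial K [c]) = f a" by blast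
      then show ?thesis using gf[OF grade_sub] by (simp add: x_def)
    qed
    show "r c \<in> free_homogeneous K 3" for c by (rule r)
    show "eval_at K A x ` carrier ?T = carrier A"
    proof (intro equalityI subsetI)
      fix a assume a: "a \<in> carrier A"
      then have "f a \<in> q ` carrier ?T" using Q(2) ring_hom_closed[OF f_hom] by simp
      then obtain t where "t \<in> carrier ?T" "f a = q t" by blast
      then show "a \<in> eval_at K A x ` carrier ?T" using ev gf[OF a] by (intro image_eqI[of _ _ t]) auto
    qed auto
    show "eval_at K A x t = \<zero>\<^bsub>A\<^esub> \<longleftrightarrow> t \<in> ?J" if t: "t \<in> carrier ?T" for t
    proof -
      have "eval_at K A x \<zero>\<^bsub>?T\<^esub> = \<zero>\<^bsub>A\<^esub>" by (rule E.ev_zero)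
      then have z: "g (q \<zero>\<^bsub>?T\<^esub>) = \<zero>\<^bsub>A\<^esub>" using ev[OF T.zero_closed] by metis
      have "eval_at K A x t = \<zero>\<^bsub>A\<^esub> \<longleftrightarrow> g (q t) = g (q \<zero>\<^bsub>?T\<^esub>)" using ev[OF t] z by simp
      also have "\<dots> \<longleftrightarrow> q t = q \<zero>\<^bsub>?T\<^esub>" using fg[OF qc[OF t]] fg[OF qc[OF T.zero_closed]] by metis
      also have "\<dots> \<longleftrightarrow> t \<in> ?J" using Q(3)[OF t T.zero_closed] t by (simp add: a_minus_def)
      finally show ?thesis .
    qed
  qed (rule indep)
  then show ?thesis by blast
qed

context cubic_presentation begin

text \<open>The converse direction: \<open>f\<close> sends \<open>a\<close> to the class of any
  polynomial with value \<open>a\<close>. Evaluation and quotient map identify the same polynomials,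
  so \<open>f\<close> is well defined and injective.\<close>

lemma iso_to_presented:
  assumes S: "S \<subseteq> carrier T" and J: "\<And>t. t \<in> carrier T \<Longrightarrow> ev t = \<zero>\<^bsub>A\<^esub> \<longleftrightarrow> t \<in> Idl\<^bsub>T\<^esub> S"
  obtains f where "f \<in> graded_algebra_iso K A \<A> (presented_algebra K S) (presented_grading K S)"
    "\<And>c. f (x c) = algebra_gen K S c"
proof -
  let ?B = "presented_algebra K S"
  define q where "q t = Idl\<^bsub>T\<^esub> S +>\<^bsub>T\<^esub> t" for t
  note Q = R.presented_quotient[OF S, folded q_def]
  have eq_iff: "ev s = ev t \<longleftrightarrow> q s = q t" if "s \<in> carrier T" "t \<in> carrier T" for s t
  proof -
    have "ev (s \<ominus>\<^bsub>T\<^esub> t) = ev s \<ominus>\<^bsub>A\<^esub> ev t" using that by (simp add: a_minus_def ev_add ev_minus)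
    then show ?thesis using J[of "s \<ominus>\<^bsub>T\<^esub> t"] Q(3)[OF that] that M.minus_self_eq[of "ev s" "ev t"] by simp
  qed
  define f where "f a = q (SOME t. t \<in> carrier T \<and> ev t = a)" for a
  have fev: "f (ev t) = q t" if t: "t \<in> carrier T" for t
  proof -
    let ?s = "SOME s. s \<in> carrier T \<and> ev s = ev t"
    have "?s \<in> carrier T \<and> ev ?s = ev t" using t by (intro someI[of "\<lambda>s. s \<in> carrier T \<and> ev s = ev t" t]) simp
    then show ?thesis unfolding f_def using eq_iff[of ?s t] t by simp
  qed
  have lift: "\<exists>t\<in>carrier T. a = ev t" if "a \<in> carrier A" for a using ev_surj that by blast
  have hom: "f \<in> ring_hom A ?B"
  proof (rule ring_hom_memI)
    fix a b assume "a \<in> carrier A" "b \<in> carrier A"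
    then obtain s t where st: "s \<in> carrier T" "a = ev s" "t \<in> carrier T" "b = ev t" using lift by blast
    show "f (a \<otimes>\<^bsub>A\<^esub> b) = f a \<otimes>\<^bsub>?B\<^esub> f b" using st ring_hom_mult[OF Q(1) st(1,3)] fev by (simp add: ev_mult[symmetric])
    show "f (a \<oplus>\<^bsub>A\<^esub> b) = f a \<oplus>\<^bsub>?B\<^esub> f b" using st ring_hom_add[OF Q(1) st(1,3)] fev by (simp add: ev_add[symmetric])
  next
    fix a assume "a \<in> carrier A"
    then show "f a \<in> carrier ?B" using lift[of a] fev ring_hom_closed[OF Q(1)] by auto
  next
    show "f \<one>\<^bsub>A\<^esub> = \<one>\<^bsub>?B\<^esub>" using fev[of "\<one>\<^bsub>T\<^esub>"] ring_hom_one[OF Q(1)] by simp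
  qed
  have "inj_on f (carrier A)"
  proof (rule inj_onI)
    fix a b assume "a \<in> carrier A" "b \<in> carrier A" "f a = f b"
    then show "a = b" using lift[of a] lift[of b] fev eq_iff by auto
  qed
  moreover have "f ` carrier A = carrier ?B"
    unfolding ev_surj[symmetric] image_image using fev Q(2) by (simp cong: image_cong)
  ultimately have "f \<in> ring_iso A ?B" using hom by (simp add: ring_iso_def bij_betw_def)
  moreover have "f (c \<odot>\<^bsub>A\<^esub> a) = c \<odot>\<^bsub>?B\<^esub> f a" if "c \<in> carrier K" "a \<in> carrier A" for c a
  proof -
    obtain t where t: "t \<in> carrier T" "a = ev t" using lift[OF \<open>a \<in> carrier A\<close>] by blast
    then have "c \<odot>\<^bsub>A\<^esub> a = ev (c \<odot>\<^bsub>T\<^esub> t)" using that by (simp add: ev_smult)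
    then show ?thesis using fev[OF t(1)] fev[of "c \<odot>\<^bsub>T\<^esub> t"] t Q(4)[OF that(1) t(1)] that by simp
  qed
  moreover have "f ` \<A> n = presented_grading K S n" for n
  proof -
    have "\<A> n = ev ` free_homogeneous K n" using ev_grade grade_ev by blast
    moreover have "f (ev t) = q t" if "t \<in> free_homogeneous K n" for t using fev R.free_homogeneousD[OF that] .
    ultimately show ?thesis unfolding presented_grading_def by (simp add: image_image q_def cong: image_cong)
  qed
  moreover have "f (x c) = algebra_gen K S c" for c
    using fev[of "monomial K [c]"] by (simp add: algebra_gen_def q_def)
  ultimately show ?thesis by (intro that[of f]) (auto simp: graded_algebra_iso_def)
qed

text \<open>A linear change of generators is an automorphism of the free algebra. The forms
  \<open>p\<close> express the new generators through the old and \<open>q\<close> the old through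
  the new; the two substitutions are mutually inverse, and the relations are transported by the
  substitution of \<open>q\<close>.\<close>

lemma base_change:
  assumes x': "\<And>c :: var. x' c \<in> \<A> 1"
    and indep: "\<And>\<alpha> \<beta>. \<lbrakk>\<alpha> \<in> carrier K; \<beta> \<in> carrier K; \<alpha> \<odot>\<^bsub>A\<^esub> x' Vx \<oplus>\<^bsub>A\<^esub> \<beta> \<odot>\<^bsub>A\<^esub> x' Vy = \<zero>\<^bsub>A\<^esub>\<rbrakk> \<Longrightarrow> \<alpha> = \<zero> \<and> \<beta> = \<zero>"
  shows "\<exists>r'. cubic_presentation K A \<A> x' r'"
proof -
  have x'A: "x' c \<in> carrier A" for c using grade_sub[OF x'] .
  interpret E: evaluation K A x' by unfold_locales (rule x'A)
  have "\<exists>p. p \<in> free_homogeneous K 1 \<and> x' c = ev p" for c using grade_ev[OF x'[of c]] by blast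
  then obtain p where p: "\<And>c. p c \<in> free_homogeneous K 1" "\<And>c. x' c = ev (p c)" by metis
  have pT: "p c \<in> carrier T" for c using R.free_homogeneousD[OF p(1)] .
  have e1: "E.ev f = f [Vx] \<odot>\<^bsub>A\<^esub> x' Vx \<oplus>\<^bsub>A\<^esub> f [Vy] \<odot>\<^bsub>A\<^esub> x' Vy" if f: "f \<in> free_homogeneous K 1" for f
  proof -
    have "f [Vx] \<in> carrier K" "f [Vy] \<in> carrier K" using f by (auto simp: free_homogeneous_def free_algebra_simps)
    then show ?thesis using x'A by (subst homogeneous_1[OF f]) (simp add: E.ev_add E.ev_smult)
  qed
  have inj1: "f = g" if f: "f \<in> free_homogeneous K 1" and g: "g \<in> free_homogeneous K 1" and eq: "E.ev f = E.ev g" for f g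
  proof -
    have c: "f [d] \<in> carrier K" "g [d] \<in> carrier K" for d using f g by (auto simp: free_homogeneous_def free_algebra_simps)
    have "f [Vx] \<ominus> g [Vx] = \<zero> \<and> f [Vy] \<ominus> g [Vy] = \<zero>"
    proof (rule indep)
      have "(f [Vx] \<ominus> g [Vx]) \<odot>\<^bsub>A\<^esub> x' Vx \<oplus>\<^bsub>A\<^esub> (f [Vy] \<ominus> g [Vy]) \<odot>\<^bsub>A\<^esub> x' Vy = E.ev f \<oplus>\<^bsub>A\<^esub> \<ominus>\<^bsub>A\<^esub> E.ev g"
        unfolding e1[OF f] e1[OF g] using c x'A
        by (simp add: a_minus_def smult_l_distr smult_l_minus M.minus_add M.a_ac)
      then show "(f [Vx] \<ominus> g [Vx]) \<odot>\<^bsub>A\<^esub> x' Vx \<oplus>\<^bsub>A\<^esub> (f [Vy] \<ominus> g [Vy]) \<odot>\<^bsub>A\<^esub> x' Vy = \<zero>\<^bsub>A\<^esub>"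
        using eq E.ev_closed[OF R.free_homogeneousD[OF g]] by (simp add: M.r_neg)
    qed (use c in auto)
    then have "f [Vx] = g [Vx]" "f [Vy] = g [Vy]" using c by auto
    then show ?thesis using homogeneous_1[OF f] homogeneous_1[OF g] by simp
  qed
  have "\<exists>q. q \<in> free_homogeneous K 1 \<and> x c = E.ev q" for c
  proof -
    define a b u v where "a = p Vx [Vx]" and "b = p Vx [Vy]" and "u = p Vy [Vx]" and "v = p Vy [Vy]"
    have k: "a \<in> carrier K" "b \<in> carrier K" "u \<in> carrier K" "v \<in> carrier K"
      using pT by (auto simp: a_def b_def u_def v_def free_algebra_simps)
    have xp: "x' Vx = a \<odot>\<^bsub>A\<^esub> x Vx \<oplus>\<^bsub>A\<^esub> b \<odot>\<^bsub>A\<^esub> x Vy" "x' Vy = u \<odot>\<^bsub>A\<^esub> x Vx \<oplus>\<^bsub>A\<^esub> v \<odot>\<^bsub>A\<^esub> x Vy"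
      unfolding p(2) using k by (subst homogeneous_1[OF p(1)], simp add: ev_add ev_smult a_def b_def u_def v_def)+
    have comb: "s \<odot>\<^bsub>A\<^esub> x' Vx \<oplus>\<^bsub>A\<^esub> t \<odot>\<^bsub>A\<^esub> x' Vy = (s \<otimes> a \<oplus> t \<otimes> u) \<odot>\<^bsub>A\<^esub> x Vx \<oplus>\<^bsub>A\<^esub> (s \<otimes> b \<oplus> t \<otimes> v) \<odot>\<^bsub>A\<^esub> x Vy"
      if "s \<in> carrier K" "t \<in> carrier K" for s t
      unfolding xp using k that by (simp add: smult_r_distr smult_l_distr smult_assoc1 M.a_ac)
    have "a \<otimes> v \<ominus> u \<otimes> b \<noteq> \<zero>"
    proof (rule KF.det_nonzero)
      fix s t assume st: "s \<in> carrier K" "t \<in> carrier K" "a \<otimes> s \<oplus> u \<otimes> t = \<zero>" "b \<otimes> s \<oplus> v \<otimes> t = \<zero>"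
      then have "s \<odot>\<^bsub>A\<^esub> x' Vx \<oplus>\<^bsub>A\<^esub> t \<odot>\<^bsub>A\<^esub> x' Vy = \<zero>\<^bsub>A\<^esub>"
        unfolding comb[OF st(1,2)] using k by (simp add: R.m_comm)
      then show "s = \<zero> \<and> t = \<zero>" by (rule indep[OF st(1,2)])
    qed (use k in auto)
    then have "a \<otimes> v \<ominus> b \<otimes> u \<noteq> \<zero>" using k by (simp add: R.m_comm)
    then obtain e f g h where m: "e \<in> carrier K" "f \<in> carrier K" "g \<in> carrier K" "h \<in> carrier K"
      "e \<otimes> a \<oplus> f \<otimes> u = \<one>" "e \<otimes> b \<oplus> f \<otimes> v = \<zero>" "g \<otimes> a \<oplus> h \<otimes> u = \<zero>" "g \<otimes> b \<oplus> h \<otimes> v = \<one>"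
      by (rule KF.two_by_two_solve[OF k])
    have "x Vx = e \<odot>\<^bsub>A\<^esub> x' Vx \<oplus>\<^bsub>A\<^esub> f \<odot>\<^bsub>A\<^esub> x' Vy" "x Vy = g \<odot>\<^bsub>A\<^esub> x' Vx \<oplus>\<^bsub>A\<^esub> h \<odot>\<^bsub>A\<^esub> x' Vy"
      using comb m by simp_all
    then obtain s t where st: "s \<in> carrier K" "t \<in> carrier K" "x c = s \<odot>\<^bsub>A\<^esub> x' Vx \<oplus>\<^bsub>A\<^esub> t \<odot>\<^bsub>A\<^esub> x' Vy"
      using m by (cases c) blast+
    let ?q = "s \<odot>\<^bsub>T\<^esub> monomial K [Vx] \<oplus>\<^bsub>T\<^esub> t \<odot>\<^bsub>T\<^esub> monomial K [Vy]"
    have "?q \<in> free_homogeneous K 1" using st by (intro R.homogeneous_closed R.monomial_homogeneous) auto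
    moreover have "E.ev ?q = x c" using st x'A by (simp add: E.ev_add E.ev_smult)
    ultimately show ?thesis by metis
  qed
  then obtain q where q: "\<And>c. q c \<in> free_homogeneous K 1" "\<And>c. x c = E.ev (q c)" by metis
  have qT: "q c \<in> carrier T" for c using R.free_homogeneousD[OF q(1)] .
  interpret S: evaluation K T p by unfold_locales (rule pT)
  interpret U: evaluation K T q by unfold_locales (rule qT)
  let ?\<sigma> = "eval_at K T p" and ?\<tau> = "eval_at K T q"
  have E_ev: "E.ev f = ev (?\<sigma> f)" if "f \<in> carrier T" for f
  proof (rule E.ev_unique[symmetric, OF _ _ _ that])
    show "lhom K T A (\<lambda>f. ev (?\<sigma> f))" by (rule lhom_compose[OF S.ev_lhom ev_lhom])
    show "(\<lambda>f. ev (?\<sigma> f)) \<in> ring_hom T A" using ring_hom_trans[OF S.ev_ring_hom ev_ring_hom] by (simp add: comp_def)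
    show "ev (?\<sigma> (monomial K [c])) = x' c" for c using pT p(2) by simp
  qed
  \<comment> \<open>Both sides are linear forms with the same value in \<open>A\<close>, and
    evaluation has no kernel in degree one.\<close>
  have s_q: "?\<sigma> (q c) = monomial K [c]" for c
  proof -
    have h: "?\<sigma> (q c) \<in> free_homogeneous K 1" by (rule R.eval_homogeneous[OF p(1) q(1)])
    have "?\<sigma> (q c) \<oplus>\<^bsub>T\<^esub> (\<ominus> \<one>) \<odot>\<^bsub>T\<^esub> monomial K [c] = \<zero>\<^bsub>T\<^esub>"
    proof (rule ker_homogeneous_low[of _ 1])
      show "?\<sigma> (q c) \<oplus>\<^bsub>T\<^esub> (\<ominus> \<one>) \<odot>\<^bsub>T\<^esub> monomial K [c] \<in> free_homogeneous K 1"
        by (intro R.homogeneous_closed h R.monomial_homogeneous) auto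
      show "ev (?\<sigma> (q c) \<oplus>\<^bsub>T\<^esub> (\<ominus> \<one>) \<odot>\<^bsub>T\<^esub> monomial K [c]) = \<zero>\<^bsub>A\<^esub>"
        using E_ev[OF qT] q(2)[of c] qT by (simp add: ev_add ev_smult smult_l_minus M.r_neg)
    qed simp
    then have "?\<sigma> (q c) \<ominus>\<^bsub>T\<^esub> monomial K [c] = \<zero>\<^bsub>T\<^esub>" by (simp add: a_minus_def TA.smult_l_minus)
    then show ?thesis using qT by simp
  qed
  have ident: "h f = f" if h: "lhom K T T h" "h \<in> ring_hom T T" "\<And>c. h (monomial K [c]) = monomial K [c]" and f: "f \<in> carrier T" for h f
  proof -
    interpret I: evaluation K T "\<lambda>c. monomial K [c]" by unfold_locales simp
    have "h f = I.ev f" by (rule I.ev_unique[OF h f])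
    moreover have "f = I.ev f"
      by (rule I.ev_unique[where h = "\<lambda>f. f", OF _ _ _ f]) (auto simp: lhom_def ring_hom_def)
    ultimately show ?thesis by simp
  qed
  have st: "?\<sigma> (?\<tau> f) = f" if "f \<in> carrier T" for f
  proof (rule ident[of "\<lambda>f. ?\<sigma> (?\<tau> f)", OF _ _ _ that])
    show "lhom K T T (\<lambda>f. ?\<sigma> (?\<tau> f))" by (rule lhom_compose[OF U.ev_lhom S.ev_lhom])
    show "(\<lambda>f. ?\<sigma> (?\<tau> f)) \<in> ring_hom T T" using ring_hom_trans[OF U.ev_ring_hom S.ev_ring_hom] by (simp add: comp_def)
    show "?\<sigma> (?\<tau> (monomial K [c])) = monomial K [c]" for c using s_q qT by simp
  qed
  have t_p: "?\<tau> (p c) = monomial K [c]" for c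
  proof (rule inj1)
    show "?\<tau> (p c) \<in> free_homogeneous K 1" by (rule R.eval_homogeneous[OF q(1) p(1)])
    show "monomial K [c] \<in> free_homogeneous K 1" by (rule R.monomial_homogeneous) simp
    show "E.ev (?\<tau> (p c)) = E.ev (monomial K [c])"
      using E_ev[OF U.ev_closed[OF pT]] st[OF pT] p(2)[of c] x'A by simp
  qed
  have ts: "?\<tau> (?\<sigma> f) = f" if "f \<in> carrier T" for f
  proof (rule ident[of "\<lambda>f. ?\<tau> (?\<sigma> f)", OF _ _ _ that])
    show "lhom K T T (\<lambda>f. ?\<tau> (?\<sigma> f))" by (rule lhom_compose[OF S.ev_lhom U.ev_lhom])
    show "(\<lambda>f. ?\<tau> (?\<sigma> f)) \<in> ring_hom T T" using ring_hom_trans[OF S.ev_ring_hom U.ev_ring_hom] by (simp add: comp_def)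
    show "?\<tau> (?\<sigma> (monomial K [c])) = monomial K [c]" for c using t_p pT by simp
  qed
  define r' where "r' c = ?\<tau> (r c)" for c
  have r'T: "r' c \<in> carrier T" for c by (simp add: r'_def)
  have preim: "ideal {f \<in> carrier T. h f \<in> I} T" if "ideal I T" "h \<in> ring_hom T T" for h I
  proof -
    interpret H: ring_hom_ring T T h using that(2) TR.ring_axioms by (simp add: ring_hom_ring_def ring_hom_ring_axioms_def)
    show ?thesis by (rule H.ideal_vimage[OF that(1)])
  qed
  have I': "ideal (Idl\<^bsub>T\<^esub> (range r')) T" by (rule TR.genideal_ideal) (use r'T in auto)
  have g': "r' c \<in> Idl\<^bsub>T\<^esub> (range r')" for c using TR.genideal_self[of "range r'"] r'T by auto
  have g: "r c \<in> Idl\<^bsub>T\<^esub> (range r)" for c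
  proof -
    have "range r \<subseteq> Idl\<^bsub>T\<^esub> (range r)" by (rule TR.genideal_self) auto
    then show ?thesis by auto
  qed
  have 1: "f \<in> Idl\<^bsub>T\<^esub> (range r) \<Longrightarrow> ?\<tau> f \<in> Idl\<^bsub>T\<^esub> (range r')" for f
  proof -
    have "range r \<subseteq> {f \<in> carrier T. ?\<tau> f \<in> Idl\<^bsub>T\<^esub> (range r')}" using g' by (auto simp: r'_def)
    then have "Idl\<^bsub>T\<^esub> (range r) \<subseteq> {f \<in> carrier T. ?\<tau> f \<in> Idl\<^bsub>T\<^esub> (range r')}"
      by (intro TR.genideal_minimal preim[OF I' U.ev_ring_hom])
    then show "f \<in> Idl\<^bsub>T\<^esub> (range r) \<Longrightarrow> ?\<tau> f \<in> Idl\<^bsub>T\<^esub> (range r')" by blast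
  qed
  have 2: "f \<in> Idl\<^bsub>T\<^esub> (range r') \<Longrightarrow> ?\<sigma> f \<in> Idl\<^bsub>T\<^esub> (range r)" for f
  proof -
    have "range r' \<subseteq> {f \<in> carrier T. ?\<sigma> f \<in> Idl\<^bsub>T\<^esub> (range r)}" using g st by (auto simp: r'_def)
    then have "Idl\<^bsub>T\<^esub> (range r') \<subseteq> {f \<in> carrier T. ?\<sigma> f \<in> Idl\<^bsub>T\<^esub> (range r)}"
      by (intro TR.genideal_minimal preim[OF ideal_J S.ev_ring_hom])
    then show "f \<in> Idl\<^bsub>T\<^esub> (range r') \<Longrightarrow> ?\<sigma> f \<in> Idl\<^bsub>T\<^esub> (range r)" by blast
  qed
  have "cubic_presentation K A \<A> x' r'"
  proof (intro cubic_presentation.intro cubic_presentation_axioms.intro)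
    show "connected_alg K A \<A>" "evaluation K A x'" by unfold_locales
    show "x' c \<in> \<A> 1" for c by (rule x')
    show "r' c \<in> free_homogeneous K 3" for c unfolding r'_def by (rule R.eval_homogeneous[OF q(1) r_hom])
    show "\<alpha> = \<zero> \<and> \<beta> = \<zero>" if "\<alpha> \<in> carrier K" "\<beta> \<in> carrier K" "\<alpha> \<odot>\<^bsub>T\<^esub> r' Vx \<oplus>\<^bsub>T\<^esub> \<beta> \<odot>\<^bsub>T\<^esub> r' Vy = \<zero>\<^bsub>T\<^esub>" for \<alpha> \<beta>
    proof (rule r_indep[OF that(1,2)])
      have "?\<tau> (\<alpha> \<odot>\<^bsub>T\<^esub> r Vx \<oplus>\<^bsub>T\<^esub> \<beta> \<odot>\<^bsub>T\<^esub> r Vy) = \<zero>\<^bsub>T\<^esub>" using that by (simp add: r'_def U.ev_add U.ev_smult)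
      then have "?\<sigma> (?\<tau> (\<alpha> \<odot>\<^bsub>T\<^esub> r Vx \<oplus>\<^bsub>T\<^esub> \<beta> \<odot>\<^bsub>T\<^esub> r Vy)) = \<zero>\<^bsub>T\<^esub>" by simp
      then show "\<alpha> \<odot>\<^bsub>T\<^esub> r Vx \<oplus>\<^bsub>T\<^esub> \<beta> \<odot>\<^bsub>T\<^esub> r Vy = \<zero>\<^bsub>T\<^esub>" using st that by simp
    qed
    show "E.ev ` carrier T = carrier A"
    proof (intro equalityI subsetI)
      fix a assume "a \<in> carrier A"
      then obtain t where t: "t \<in> carrier T" "a = ev t" using ev_surj by blast
      then show "a \<in> E.ev ` carrier T" using E_ev[of "?\<tau> t"] st by (intro image_eqI[of _ _ "?\<tau> t"]) auto
    qed auto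
    show "E.ev f = \<zero>\<^bsub>A\<^esub> \<longleftrightarrow> f \<in> Idl\<^bsub>T\<^esub> (range r')" if f: "f \<in> carrier T" for f
      using E_ev[OF f] ev_ker[of "?\<sigma> f"] f 1[of "?\<sigma> f"] 2[of f] ts[OF f] by auto
  qed
  then show ?thesis by blast
qed

end

section \<open>Homogeneous potentials over a nonabelian group\<close>

definition word_deg :: "('g, 'c) monoid_scheme \<Rightarrow> ('v \<Rightarrow> 'g) \<Rightarrow> 'v list \<Rightarrow> 'g" where
  "word_deg G d u = foldr (\<lambda>c g. d c \<otimes>\<^bsub>G\<^esub> g) u \<one>\<^bsub>G\<^esub>"

lemma word_deg_simps [simp]:
  "word_deg G d [] = \<one>\<^bsub>G\<^esub>" "word_deg G d (c # u) = d c \<otimes>\<^bsub>G\<^esub> word_deg G d u"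
  by (simp_all add: word_deg_def)

locale group_graded = cubic_presentation K A \<A> x r + G: group G
  for K :: "('k, 'l) ring_scheme" (structure) and A :: "('k, 'a, 'b) module_scheme" and \<A> x r
    and G :: "('g, 'c) monoid_scheme" +
  fixes V :: "'g \<Rightarrow> 'a set" and dg :: "var \<Rightarrow> 'g"
  assumes V_graded: "graded_algebra K A G V"
    and dg_closed [simp]: "dg c \<in> carrier G"
    and x_V: "x c \<in> V (dg c)"
begin

abbreviation wd where "wd \<equiv> word_deg G dg"

lemma wd_closed [simp]: "wd u \<in> carrier G"
  by (induction u) auto

lemma wd_snoc: "wd (u @ [c]) = wd u \<otimes>\<^bsub>G\<^esub> dg c"
  by (induction u) (auto simp: G.m_assoc)

lemma V_smult: "g \<in> carrier G \<Longrightarrow> k \<in> carrier K \<Longrightarrow> v \<in> V g \<Longrightarrow> k \<odot>\<^bsub>A\<^esub> v \<in> V g"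
  using V_graded submodule.smult_closed[of "V g" K A k v] by (simp add: graded_algebra_def)

lemma V_components: obtains cg where "components A (carrier G) V cg"
  using internal_direct_sum_components[OF A_ab] V_graded by (auto simp: graded_algebra_def)

lemma word_prod_V: "word_prod A x u \<in> V (wd u)"
proof (induction u)
  case Nil then show ?case using V_graded by (simp add: graded_algebra_def)
next
  case (Cons c u)
  then show ?case using V_graded x_V[of c] by (simp add: graded_algebra_def)
qed

definition deg_part where "deg_part g f = (\<lambda>u. if wd u = g then f u else \<zero>)"

lemma deg_part_mem: "f \<in> carrier T \<Longrightarrow> deg_part g f \<in> carrier T"
proof -
  assume f: "f \<in> carrier T"
  have "{w. deg_part g f w \<noteq> \<zero>} \<subseteq> {w. f w \<noteq> \<zero>}" by (auto simp: deg_part_def)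
  then show ?thesis using f by (auto simp: free_algebra_simps deg_part_def intro: finite_subset)
qed

lemma ev_deg_part:
  assumes cg: "components A (carrier G) V cg" and g: "g \<in> carrier G" and f: "f \<in> carrier T"
  shows "cg g (ev f) = ev (deg_part g f)"
  using f
proof (induction f rule: R.free_algebra_induct)
  case zero
  have "deg_part g \<zero>\<^bsub>T\<^esub> = \<zero>\<^bsub>T\<^esub>" by (auto simp: deg_part_def free_algebra_simps)
  then show ?case using components_zero[OF A_ab cg g] by simp
next
  case (add c u f)
  have 1: "deg_part g (c \<odot>\<^bsub>T\<^esub> monomial K u \<oplus>\<^bsub>T\<^esub> f) =
     (if wd u = g then c \<odot>\<^bsub>T\<^esub> monomial K u else \<zero>\<^bsub>T\<^esub>) \<oplus>\<^bsub>T\<^esub> deg_part g f"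
    using add(1,2) by (auto simp: deg_part_def free_algebra_simps monomial_def fun_eq_iff)
  have v: "c \<odot>\<^bsub>A\<^esub> word_prod A x u \<in> V (wd u)" using V_smult word_prod_V add by simp
  have "cg g (c \<odot>\<^bsub>A\<^esub> word_prod A x u) = (if wd u = g then c \<odot>\<^bsub>A\<^esub> word_prod A x u else \<zero>\<^bsub>A\<^esub>)"
    using components_same[OF cg g, of "c \<odot>\<^bsub>A\<^esub> word_prod A x u"] components_other[OF cg g wd_closed _ v] v by auto
  then show ?case using add deg_part_mem[OF add(2)] unfolding 1
    by (auto simp: ev_add ev_smult components_add[OF cg g])
qed

text \<open>Evaluation carries the part of degree \<open>g\<close> of a polynomial to the component
  of its value, so the ideal of relations is graded by \<open>G\<close>.\<close>

lemma ker_deg_part: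
  assumes g: "g \<in> carrier G" and f: "f \<in> carrier T" "ev f = \<zero>\<^bsub>A\<^esub>"
  shows "ev (deg_part g f) = \<zero>\<^bsub>A\<^esub>"
proof -
  obtain cg where cg: "components A (carrier G) V cg" by (rule V_components)
  then show ?thesis using ev_deg_part[OF cg g f(1)] f(2) components_zero[OF A_ab cg g] by simp
qed

end

locale graded_potential = regular_potential K A \<A> x w + group_graded K A \<A> x "\<lambda>c. lder c w" G V dg
  for K :: "('k, 'l) ring_scheme" (structure) and A :: "('k, 'a, 'b) module_scheme" and \<A> x w
    and G :: "('g, 'c) monoid_scheme" and V dg +
  assumes noncomm: "dg Vx \<otimes>\<^bsub>G\<^esub> dg Vy \<noteq> dg Vy \<otimes>\<^bsub>G\<^esub> dg Vx"
begin

section \<open>Degrees and rotations of the words in the potential\<close>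

lemma w_closed [simp]: "w u \<in> carrier K"
  using w_mem by (simp add: free_algebra_simps)

lemma w_length: "w u \<noteq> \<zero> \<Longrightarrow> length u = 4"
  using w_hom by (simp add: free_homogeneous_def)

lemma s_nonzero: "\<exists>a b d. w [c, a, b, d] \<noteq> \<zero>"
proof (rule ccontr)
  assume "\<not> ?thesis"
  then have z: "w [c, a, b, d] = \<zero>" for a b d by blast
  have "lder c w u = \<zero>" for u
  proof (rule ccontr)
    assume nz: "lder c w u \<noteq> \<zero>"
    then have "length u = Suc (Suc (Suc 0))" using w_length[of "c # u"] by (simp add: lder_def)
    then obtain a b d where "u = [a, b, d]" by (auto simp: length_Suc_conv)
    then show False using nz z by (simp add: lder_def)
  qed
  then have "lder c w = \<zero>\<^bsub>T\<^esub>" by (auto simp: free_algebra_simps)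
  then have "(if c = Vx then \<one> else \<zero>) = \<zero> \<and> (if c = Vy then \<one> else \<zero>) = \<zero>"
    by (cases c; intro r_indep) (use R.lder_mem[OF w_mem] in auto)
  then show False by (cases c) auto
qed

text \<open>The derivatives of a homogeneous part of \<open>w\<close> are homogeneous parts of
  elements of the kernel, hence lie in the kernel. By \<open>potential_unique\<close> the part is a
  multiple of \<open>w\<close>. It is taken around a word that occurs, so the multiple is not zero
  and the part is everything.\<close>

lemma w_homogeneous: "\<exists>g\<in>carrier G. \<forall>u. w u \<noteq> \<zero> \<longrightarrow> wd u = g"
proof -
  obtain a b d where "w [Vx, a, b, d] \<noteq> \<zero>" using s_nonzero by blast
  then obtain u0 where u0: "w u0 \<noteq> \<zero>" by blast
  let ?g = "wd u0"
  let ?w = "deg_part ?g w"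
  have wT: "?w \<in> carrier T" by (rule deg_part_mem[OF w_mem])
  have wh: "?w \<in> free_homogeneous K 4" using wT w_length by (auto simp: free_homogeneous_def deg_part_def)
  \<comment> \<open>Removing the first letter divides the degree by that letter on the left,
    removing the last one divides it on the right.\<close>
  have l: "lder c ?w = deg_part (inv\<^bsub>G\<^esub> dg c \<otimes>\<^bsub>G\<^esub> ?g) (lder c w)" for c
    by (auto simp: lder_def deg_part_def fun_eq_iff G.inv_solve_left)
  have r: "rder c ?w = deg_part (?g \<otimes>\<^bsub>G\<^esub> inv\<^bsub>G\<^esub> dg c) (rder c w)" for c
    by (auto simp: rder_def deg_part_def fun_eq_iff wd_snoc G.inv_solve_right)
  have "ev (lder c ?w) = \<zero>\<^bsub>A\<^esub>" for c unfolding l by (rule ker_deg_part) (auto intro: r_mem)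
  moreover have "ev (rder c ?w) = \<zero>\<^bsub>A\<^esub>" for c unfolding r
    by (rule ker_deg_part) (auto intro: R.rder_mem w_mem w_right)
  ultimately obtain \<kappa> where k: "\<kappa> \<in> carrier K" "?w = \<kappa> \<odot>\<^bsub>T\<^esub> w"
    using potential_unique[OF wh] by blast
  have "wd u = ?g" if u: "w u \<noteq> \<zero>" for u
  proof (rule ccontr)
    assume "wd u \<noteq> ?g"
    then have "\<kappa> \<otimes> w u = \<zero>" using fun_cong[OF k(2), of u] by (simp add: deg_part_def free_algebra_simps)
    then have "\<kappa> = \<zero>" using KF.integral[of \<kappa> "w u"] u k by auto
    then have "w u0 = \<zero>" using fun_cong[OF k(2), of u0] by (simp add: deg_part_def free_algebra_simps)
    with u0 show False by simp
  qed
  then show ?thesis using wd_closed by blast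
qed

lemma same_degree: "w u \<noteq> \<zero> \<Longrightarrow> w v \<noteq> \<zero> \<Longrightarrow> wd u = wd v"
  using w_homogeneous by metis

lemma dg_distinct: "dg Vx \<noteq> dg Vy"
  using noncomm by auto

text \<open>The right derivatives are relations in degree three, hence combinations of the left
  derivatives. The coefficients do not depend on the word: they form the matrix of the twist in the
  cyclic symmetry of \<open>w\<close>.\<close>

lemma rotation_coefficients:
  "\<exists>\<alpha> \<beta>. \<alpha> \<in> carrier K \<and> \<beta> \<in> carrier K \<and> (\<forall>a b d. w [a, b, d, c] = \<alpha> \<otimes> w [Vx, a, b, d] \<oplus> \<beta> \<otimes> w [Vy, a, b, d])"
proof -
  have "rder c w \<in> free_homogeneous K 3" using R.rder_homogeneous[of w 3 c] w_hom by (simp add: numeral_eq_Suc)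
  from ker_3[OF this w_right] obtain \<alpha> \<beta> where ab: "\<alpha> \<in> carrier K" "\<beta> \<in> carrier K"
    "rder c w = \<alpha> \<odot>\<^bsub>T\<^esub> lder Vx w \<oplus>\<^bsub>T\<^esub> \<beta> \<odot>\<^bsub>T\<^esub> lder Vy w" by blast
  have "w [a, b, d, c] = \<alpha> \<otimes> w [Vx, a, b, d] \<oplus> \<beta> \<otimes> w [Vy, a, b, d]" for a b d
    using fun_cong[OF ab(3), of "[a, b, d]"] by (simp add: rder_def lder_def free_algebra_simps)
  then show ?thesis using ab by blast
qed

text \<open>Cancelling the common tail would give the two letters the same degree.\<close>

lemma one_side: "w [Vx, a, b, d] = \<zero> \<or> w [Vy, a, b, d] = \<zero>"
  using same_degree[of "[Vx, a, b, d]" "[Vy, a, b, d]"] dg_distinct by (auto simp: G.m_assoc[symmetric])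

lemma one_side_r: "w [a, b, d, Vx] = \<zero> \<or> w [a, b, d, Vy] = \<zero>"
  using same_degree[of "[a, b, d, Vx]" "[a, b, d, Vy]"] dg_distinct by auto

text \<open>Degrees leave at most one nonzero entry in each row and column of the twist matrix. An
  empty row would annihilate all words beginning with some letter, and an antidiagonal matrix would
  connect words of distinct degrees. The diagonal entries are \<open>lam\<close> and
  \<open>mu\<close>.\<close>

theorem rotation:
  obtains lam mu where "lam \<in> carrier K - {\<zero>}" "mu \<in> carrier K - {\<zero>}"
    "\<And>a b d. w [a, b, d, Vx] = lam \<otimes> w [Vx, a, b, d]" "\<And>a b d. w [a, b, d, Vy] = mu \<otimes> w [Vy, a, b, d]"
proof -
  obtain p q where pq: "p \<in> carrier K" "q \<in> carrier K"
    and X: "\<And>a b d. w [a, b, d, Vx] = p \<otimes> w [Vx, a, b, d] \<oplus> q \<otimes> w [Vy, a, b, d]"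
    using rotation_coefficients[of Vx] by blast
  obtain u v where uv: "u \<in> carrier K" "v \<in> carrier K"
    and Y: "\<And>a b d. w [a, b, d, Vy] = u \<otimes> w [Vx, a, b, d] \<oplus> v \<otimes> w [Vy, a, b, d]"
    using rotation_coefficients[of Vy] by blast
  have nzm: "k \<otimes> l \<noteq> \<zero>" if "k \<in> carrier K" "l \<in> carrier K" "k \<noteq> \<zero>" "l \<noteq> \<zero>" for k l
    using KF.integral[of k l] that by blast
  obtain a1 b1 d1 where x1: "w [Vx, a1, b1, d1] \<noteq> \<zero>" using s_nonzero by blast
  obtain a2 b2 d2 where y2: "w [Vy, a2, b2, d2] \<noteq> \<zero>" using s_nonzero by blast
  have z1: "w [Vy, a1, b1, d1] = \<zero>" and z2: "w [Vx, a2, b2, d2] = \<zero>" using one_side x1 y2 by blast+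
  have pu: "p = \<zero> \<or> u = \<zero>"
    using one_side_r[of a1 b1 d1] nzm[OF pq(1) w_closed _ x1] nzm[OF uv(1) w_closed _ x1] pq uv
    by (auto simp: X Y z1)
  have qv: "q = \<zero> \<or> v = \<zero>"
    using one_side_r[of a2 b2 d2] nzm[OF pq(2) w_closed _ y2] nzm[OF uv(2) w_closed _ y2] pq uv
    by (auto simp: X Y z2)
  \<comment> \<open>Cancelling the common last letter equates the degrees of the two prefixes; in
    the words before the rotation these prefixes follow different letters.\<close>
  have mixed: "dg Vx = dg Vy" if "w [a1, b1, d1, c] \<noteq> \<zero>" "w [a2, b2, d2, c] \<noteq> \<zero>" for c
  proof -
    define e1 e2 where "e1 = wd [a1, b1, d1]" and "e2 = wd [a2, b2, d2]"
    have e: "e1 \<in> carrier G" "e2 \<in> carrier G" unfolding e1_def e2_def by (rule wd_closed)+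
    have s: "wd [a1, b1, d1, c] = e1 \<otimes>\<^bsub>G\<^esub> dg c" "wd [a2, b2, d2, c] = e2 \<otimes>\<^bsub>G\<^esub> dg c"
      using wd_snoc[of "[a1, b1, d1]" c] wd_snoc[of "[a2, b2, d2]" c] by (simp_all add: e1_def e2_def)
    have "e1 = e2" using same_degree[OF that] e unfolding s by simp
    moreover have "dg Vx \<otimes>\<^bsub>G\<^esub> e1 = dg Vy \<otimes>\<^bsub>G\<^esub> e2"
      using same_degree[OF x1 y2] by (simp add: e1_def e2_def)
    ultimately show ?thesis using e by simp
  qed
  have pq0: "p = \<zero> \<or> q = \<zero>"
    using mixed[of Vx] dg_distinct nzm[OF pq(1) w_closed _ x1] nzm[OF pq(2) w_closed _ y2] pq by (auto simp: X z1 z2)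
  have uv0: "u = \<zero> \<or> v = \<zero>"
    using mixed[of Vy] dg_distinct nzm[OF uv(1) w_closed _ x1] nzm[OF uv(2) w_closed _ y2] uv by (auto simp: Y z1 z2)
  \<comment> \<open>All words of the support would end in \<open>y\<close>. Repeated rotation brings
    an \<open>x\<close> to the end of every word with the first letter considered, so its
    coefficient is zero.\<close>
  have one_x: False if t: "p = \<zero> \<and> q = \<zero>"
  proof -
    have Z: "w [a, b, d, Vx] = \<zero>" for a b d using t by (simp add: X)
    show False
    proof (cases "v = \<zero>")
      case True
      then have E: "w [a, b, d, Vy] = u \<otimes> w [Vx, a, b, d]" for a b d using uv by (simp add: Y)
      have "w [Vy, a, b, d] = \<zero>" for a b d using uv
        by (cases a; cases b; cases d) (simp_all add: Z E)
      with y2 show False by simp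
    next
      case False
      then have E: "w [a, b, d, Vy] = v \<otimes> w [Vy, a, b, d]" for a b d using uv uv0 by (simp add: Y)
      have "w [Vx, a, b, d] = \<zero>" for a b d using uv
        by (cases a; cases b; cases d) (simp_all add: Z E)
      with x1 show False by simp
    qed
  qed
  have one_y: False if t: "u = \<zero> \<and> v = \<zero>"
  proof -
    have Z: "w [a, b, d, Vy] = \<zero>" for a b d using t by (simp add: Y)
    show False
    proof (cases "p = \<zero>")
      case True
      then have E: "w [a, b, d, Vx] = q \<otimes> w [Vy, a, b, d]" for a b d using pq by (simp add: X)
      have "w [Vx, a, b, d] = \<zero>" for a b d using pq
        by (cases a; cases b; cases d) (simp_all add: Z E)
      with x1 show False by simp
    next
      case False
      then have E: "w [a, b, d, Vx] = p \<otimes> w [Vx, a, b, d]" for a b d using pq pq0 by (simp add: X)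
      have "w [Vy, a, b, d] = \<zero>" for a b d using pq
        by (cases a; cases b; cases d) (simp_all add: Z E)
      with y2 show False by simp
    qed
  qed
  show ?thesis
  proof (cases "p = \<zero>")
    case False
    then have "q = \<zero>" "u = \<zero>" "v \<noteq> \<zero>" using pq0 pu one_y by auto
    with False show ?thesis using that[of p v] pq uv X Y by simp
  next
    case True
    then have q: "q \<noteq> \<zero>" and v: "v = \<zero>" and u: "u \<noteq> \<zero>" using one_x qv one_y by auto
    \<comment> \<open>In the antidiagonal case the support is closed under moving the last letter to
      the front while exchanging it for the other letter. The sixteen words form two orbits of
      eight, those of \<open>xxxx\<close> and of \<open>xyxy\<close>, so excluding these two words
      empties the support.\<close>
    have E: "w [a, b, d, Vx] = q \<otimes> w [Vy, a, b, d]" "w [a, b, d, Vy] = u \<otimes> w [Vx, a, b, d]" for a b d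
      using pq uv True v by (simp_all add: X Y)
    have nz: "w [a, b, d, Vx] \<noteq> \<zero> \<longleftrightarrow> w [Vy, a, b, d] \<noteq> \<zero>" "w [a, b, d, Vy] \<noteq> \<zero> \<longleftrightarrow> w [Vx, a, b, d] \<noteq> \<zero>" for a b d
      unfolding E using nzm[OF pq(2) w_closed q] nzm[OF uv(1) w_closed u] pq uv by auto
    have c1: "w [Vx, Vx, Vx, Vx] = \<zero>"
      using one_side_r[of Vx Vx Vx] nz(2)[of Vx Vx Vx] by blast
    \<comment> \<open>The orbit of \<open>xyxy\<close> contains \<open>xyyx\<close>, whose degree
      agrees only if the letters commute.\<close>
    have c2: "w [Vx, Vy, Vx, Vy] = \<zero>"
    proof (rule ccontr)
      assume h: "w [Vx, Vy, Vx, Vy] \<noteq> \<zero>"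
      then have "w [Vx, Vx, Vy, Vx] \<noteq> \<zero>" using nz(2)[of Vx Vy Vx] by blast
      then have "w [Vy, Vx, Vx, Vy] \<noteq> \<zero>" using nz(1)[of Vx Vx Vy] by blast
      then have "w [Vx, Vy, Vx, Vx] \<noteq> \<zero>" using nz(2)[of Vy Vx Vx] by blast
      then have "w [Vy, Vx, Vy, Vx] \<noteq> \<zero>" using nz(1)[of Vx Vy Vx] by blast
      then have "w [Vy, Vy, Vx, Vy] \<noteq> \<zero>" using nz(1)[of Vy Vx Vy] by blast
      then have "w [Vx, Vy, Vy, Vx] \<noteq> \<zero>" using nz(2)[of Vy Vy Vx] by blast
      from same_degree[OF h this] show False using noncomm by simp
    qed
    have zz: "w [a, b, d, Vx] = \<zero> \<longleftrightarrow> w [Vy, a, b, d] = \<zero>" "w [a, b, d, Vy] = \<zero> \<longleftrightarrow> w [Vx, a, b, d] = \<zero>" for a b d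
      using nz by blast+
    have "w [Vx, a, b, d] = \<zero>" for a b d
      using c1 c2 zz[of Vx Vx Vx] zz[of Vx Vx Vy] zz[of Vx Vy Vx] zz[of Vx Vy Vy] zz[of Vy Vx Vx] zz[of Vy Vx Vy] zz[of Vy Vy Vx] zz[of Vy Vy Vy]
      by (cases a; cases b; cases d) blast+
    with x1 show ?thesis by simp
  qed
qed

text \<open>\<open>K3\<close> consists of the multiples \<open>a x\<close> of the vector of
  generators. A zero coordinate means \<open>a x\<^sub>j = 0\<close>, and in the degrees considered
  this kills the component of \<open>a\<close> that matters, because evaluation is injective below
  degree three.\<close>

lemma K3_single:
  assumes n: "n < 3" and b: "b \<in> \<A> n" and K: "(\<lambda>c. if c = i then b else \<zero>\<^bsub>A\<^esub>) \<in> K3"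
  shows "b = \<zero>\<^bsub>A\<^esub>"
proof -
  obtain a where a: "a \<in> carrier A" "(\<lambda>c. if c = i then b else \<zero>\<^bsub>A\<^esub>) = (\<lambda>c. a \<otimes>\<^bsub>A\<^esub> x c)"
    using K3_generated[OF K] by blast
  obtain j where j: "j \<noteq> i" by (cases i) auto
  have bi: "b = a \<otimes>\<^bsub>A\<^esub> x i" and zj: "a \<otimes>\<^bsub>A\<^esub> x j = \<zero>\<^bsub>A\<^esub>"
    using fun_cong[OF a(2), of i] fun_cong[OF a(2), of j] j by auto
  show ?thesis
  proof (cases n)
    case 0
    then show ?thesis using cp_mult_r[OF x_deg[of i] a(1), of 0] bi cp_same[OF b] by simp
  next
    case (Suc k)
    have k: "b = cp k a \<otimes>\<^bsub>A\<^esub> x i" "cp k a \<otimes>\<^bsub>A\<^esub> x j = \<zero>\<^bsub>A\<^esub>"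
      using cp_mult_r[OF x_deg[of i] a(1), of n] cp_mult_r[OF x_deg[of j] a(1), of n] bi zj cp_same[OF b] Suc by simp_all
    obtain h where h: "h \<in> free_homogeneous K k" "cp k a = ev h" using grade_ev[OF cp_mem[OF a(1)]] by blast
    have hT: "h \<in> carrier T" using R.free_homogeneousD[OF h(1)] .
    have "h \<otimes>\<^bsub>T\<^esub> monomial K [j] = \<zero>\<^bsub>T\<^esub>"
    proof (rule ker_homogeneous_low[of _ n])
      show "h \<otimes>\<^bsub>T\<^esub> monomial K [j] \<in> free_homogeneous K n"
        using R.homogeneous_mult[OF h(1) R.monomial_homogeneous[of "[j]" 1]] Suc by simp
      show "ev (h \<otimes>\<^bsub>T\<^esub> monomial K [j]) = \<zero>\<^bsub>A\<^esub>" using hT k h(2) by (simp add: ev_mult)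
    qed (rule n)
    then have "h u = \<zero>" for u using R.mult_letter_r(2)[OF hT, of j u j] by (simp add: free_algebra_simps)
    then have "h = \<zero>\<^bsub>T\<^esub>" by (simp add: free_algebra_simps fun_eq_iff)
    then show ?thesis using k(1) h(2) by simp
  qed
qed

lemma word_nonzero: "length u < 3 \<Longrightarrow> word_prod A x u \<noteq> \<zero>\<^bsub>A\<^esub>"
proof
  assume "length u < 3" "word_prod A x u = \<zero>\<^bsub>A\<^esub>"
  then have "monomial K u u = \<zero>" by (intro ker_low(1)[of "monomial K u"]) auto
  then show False by (simp add: monomial_def)
qed

abbreviation W where "W \<equiv> word_prod A x"

lemma relation_expansion:
  "w [c, Vx, Vx, Vx] \<odot>\<^bsub>A\<^esub> W [Vx, Vx, Vx] \<oplus>\<^bsub>A\<^esub> w [c, Vx, Vx, Vy] \<odot>\<^bsub>A\<^esub> W [Vx, Vx, Vy] \<oplus>\<^bsub>A\<^esub>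
   w [c, Vx, Vy, Vx] \<odot>\<^bsub>A\<^esub> W [Vx, Vy, Vx] \<oplus>\<^bsub>A\<^esub> w [c, Vx, Vy, Vy] \<odot>\<^bsub>A\<^esub> W [Vx, Vy, Vy] \<oplus>\<^bsub>A\<^esub>
   w [c, Vy, Vx, Vx] \<odot>\<^bsub>A\<^esub> W [Vy, Vx, Vx] \<oplus>\<^bsub>A\<^esub> w [c, Vy, Vx, Vy] \<odot>\<^bsub>A\<^esub> W [Vy, Vx, Vy] \<oplus>\<^bsub>A\<^esub>
   w [c, Vy, Vy, Vx] \<odot>\<^bsub>A\<^esub> W [Vy, Vy, Vx] \<oplus>\<^bsub>A\<^esub> w [c, Vy, Vy, Vy] \<odot>\<^bsub>A\<^esub> W [Vy, Vy, Vy] = \<zero>\<^bsub>A\<^esub>"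
  (is "?lhs = _")
proof -
  have "lder c w =
   w [c, Vx, Vx, Vx] \<odot>\<^bsub>T\<^esub> monomial K [Vx, Vx, Vx] \<oplus>\<^bsub>T\<^esub> w [c, Vx, Vx, Vy] \<odot>\<^bsub>T\<^esub> monomial K [Vx, Vx, Vy] \<oplus>\<^bsub>T\<^esub>
   w [c, Vx, Vy, Vx] \<odot>\<^bsub>T\<^esub> monomial K [Vx, Vy, Vx] \<oplus>\<^bsub>T\<^esub> w [c, Vx, Vy, Vy] \<odot>\<^bsub>T\<^esub> monomial K [Vx, Vy, Vy] \<oplus>\<^bsub>T\<^esub>
   w [c, Vy, Vx, Vx] \<odot>\<^bsub>T\<^esub> monomial K [Vy, Vx, Vx] \<oplus>\<^bsub>T\<^esub> w [c, Vy, Vx, Vy] \<odot>\<^bsub>T\<^esub> monomial K [Vy, Vx, Vy] \<oplus>\<^bsub>T\<^esub>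
   w [c, Vy, Vy, Vx] \<odot>\<^bsub>T\<^esub> monomial K [Vy, Vy, Vx] \<oplus>\<^bsub>T\<^esub> w [c, Vy, Vy, Vy] \<odot>\<^bsub>T\<^esub> monomial K [Vy, Vy, Vy]"
    (is "_ = ?s")
  proof
    fix u
    show "lder c w u = ?s u"
    proof (cases "length u = Suc (Suc (Suc 0))")
      case True
      then obtain a b d where "u = [a, b, d]" by (auto simp: length_Suc_conv)
      then show ?thesis
        by (cases a; cases b; cases d) (simp_all add: free_algebra_simps monomial_def lder_def)
    next
      case False
      then have "w (c # u) = \<zero>" using w_length[of "c # u"] by auto
      moreover have "monomial K [a, b, d] u = \<zero>" for a b d using False by (auto simp: monomial_def)
      ultimately show ?thesis by (simp add: free_algebra_simps lder_def)
    qed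
  qed
  then have "ev ?s = \<zero>\<^bsub>A\<^esub>" using ev_r[of c] by simp
  then show ?thesis by (simp add: ev_add ev_smult del: word_prod_simps)
qed

text \<open>
  The letters are coefficients of \<open>w\<close>: \<open>e\<close> at \<open>xxxx\<close>, \<open>f\<close> at \<open>yyyy\<close>, \<open>p\<close> and \<open>p'\<close> at \<open>xxyy\<close> and \<open>yxxy\<close>, \<open>c\<close> and \<open>c'\<close> at
  \<open>xyxy\<close> and \<open>yxyx\<close>. Moving a final \<open>x\<close> or \<open>y\<close> to the front divides the coefficient by \<open>lam\<close> or \<open>mu\<close>.
\<close>

definition coefficients where
  "coefficients lam mu p p' c c' e f \<longleftrightarrow>
    {lam, mu, p, p', c, c', e, f} \<subseteq> carrier K \<and> lam \<noteq> \<zero> \<and> mu \<noteq> \<zero> \<and>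
    e = lam \<otimes> e \<and> f = mu \<otimes> f \<and> p = mu \<otimes> p' \<and> p' = mu \<otimes> (lam \<otimes> (lam \<otimes> p)) \<and> c = mu \<otimes> c' \<and> c' = lam \<otimes> c \<and>
    (p \<noteq> \<zero> \<and> c = \<zero> \<or> p = \<zero> \<and> c \<noteq> \<zero> \<and> e \<noteq> \<zero> \<and> f \<noteq> \<zero>) \<and>
    e \<odot>\<^bsub>A\<^esub> W [Vx, Vx, Vx] \<oplus>\<^bsub>A\<^esub> p \<odot>\<^bsub>A\<^esub> W [Vx, Vy, Vy] \<oplus>\<^bsub>A\<^esub> c \<odot>\<^bsub>A\<^esub> W [Vy, Vx, Vy] \<oplus>\<^bsub>A\<^esub> (lam \<otimes> p) \<odot>\<^bsub>A\<^esub> W [Vy, Vy, Vx] = \<zero>\<^bsub>A\<^esub> \<and>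
    p' \<odot>\<^bsub>A\<^esub> W [Vx, Vx, Vy] \<oplus>\<^bsub>A\<^esub> c' \<odot>\<^bsub>A\<^esub> W [Vx, Vy, Vx] \<oplus>\<^bsub>A\<^esub> (lam \<otimes> (lam \<otimes> p)) \<odot>\<^bsub>A\<^esub> W [Vy, Vx, Vx] \<oplus>\<^bsub>A\<^esub> f \<odot>\<^bsub>A\<^esub> W [Vy, Vy, Vy] = \<zero>\<^bsub>A\<^esub> \<and>
    (p \<noteq> \<zero> \<longrightarrow> wd [Vx, Vx, Vy] = wd [Vy, Vx, Vx] \<and> wd [Vy, Vy, Vx] = wd [Vx, Vy, Vy]) \<and>
    (p \<noteq> \<zero> \<and> (e \<noteq> \<zero> \<or> f \<noteq> \<zero>) \<longrightarrow> wd [Vx, Vx] = wd [Vy, Vy]) \<and>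
    (c \<noteq> \<zero> \<longrightarrow> wd [Vx, Vx, Vx] = wd [Vy, Vx, Vy] \<and> wd [Vy, Vy, Vy] = wd [Vx, Vy, Vx])"

text \<open>The support is closed under rotation. The classes of \<open>xxxy\<close> and
  \<open>xyyy\<close> contain two words whose common degree would make the letters commute, and so
  do the classes of \<open>xxyy\<close> and \<open>xyxy\<close> taken together. A relation
  consisting of a single word is impossible since it creates a syzygy with one nonzero
  coordinate.\<close>

theorem classification_data: "\<exists>lam mu p p' c c' e f. coefficients lam mu p p' c c' e f"
proof -
  obtain lam mu where lm: "lam \<in> carrier K" "lam \<noteq> \<zero>" "mu \<in> carrier K" "mu \<noteq> \<zero>"
    and X: "\<And>a b d. w [a, b, d, Vx] = lam \<otimes> w [Vx, a, b, d]" and Y: "\<And>a b d. w [a, b, d, Vy] = mu \<otimes> w [Vy, a, b, d]"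
    using rotation by (metis DiffE singletonI)
  have nzm: "k \<otimes> w u \<noteq> \<zero> \<longleftrightarrow> w u \<noteq> \<zero>" if "k \<in> carrier K" "k \<noteq> \<zero>" for k u
    using KF.integral[of k "w u"] that by auto
  have nX: "w [a, b, d, Vx] \<noteq> \<zero> \<longleftrightarrow> w [Vx, a, b, d] \<noteq> \<zero>" for a b d unfolding X by (rule nzm) (use lm in auto)
  have nY: "w [a, b, d, Vy] \<noteq> \<zero> \<longleftrightarrow> w [Vy, a, b, d] \<noteq> \<zero>" for a b d unfolding Y by (rule nzm) (use lm in auto)
  define p p' c c' e f where "p = w [Vx, Vx, Vy, Vy]" and "p' = w [Vy, Vx, Vx, Vy]" and "c = w [Vx, Vy, Vx, Vy]"
    and "c' = w [Vy, Vx, Vy, Vx]" and "e = w [Vx, Vx, Vx, Vx]" and "f = w [Vy, Vy, Vy, Vy]"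
  have nc: False if "w u \<noteq> \<zero>" "w v \<noteq> \<zero>" "wd u = wd v \<Longrightarrow> dg Vx \<otimes>\<^bsub>G\<^esub> dg Vy = dg Vy \<otimes>\<^bsub>G\<^esub> dg Vx" for u v
    using same_degree[OF that(1,2)] that(3) noncomm by blast
  \<comment> \<open>Equal degrees of \<open>xxxy\<close> and its rotation \<open>xxyx\<close> would
    give \<open>xy = yx\<close>.\<close>
  have xy_zero: "w [Vx, Vx, Vx, Vy] = \<zero>"
  proof (rule ccontr)
    assume h: "w [Vx, Vx, Vx, Vy] \<noteq> \<zero>"
    then have h2: "w [Vx, Vx, Vy, Vx] \<noteq> \<zero>" using nX nY by blast
    show False by (rule nc[OF h h2]) simp
  qed
  have yx_zero: "w [Vx, Vy, Vy, Vy] = \<zero>"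
  proof (rule ccontr)
    assume h: "w [Vx, Vy, Vy, Vy] \<noteq> \<zero>"
    then have h1: "w [Vy, Vy, Vy, Vx] \<noteq> \<zero>" and h2: "w [Vy, Vy, Vx, Vy] \<noteq> \<zero>" using nX nY by blast+
    show False by (rule nc[OF h1 h2]) simp
  qed
  have zeros: "w [Vx, Vx, Vy, Vx] = \<zero>" "w [Vx, Vy, Vx, Vx] = \<zero>" "w [Vy, Vx, Vx, Vx] = \<zero>"
    "w [Vy, Vx, Vy, Vy] = \<zero>" "w [Vy, Vy, Vx, Vy] = \<zero>" "w [Vy, Vy, Vy, Vx] = \<zero>"
    using xy_zero yx_zero nX nY by blast+
  have pc: "p = \<zero> \<or> c = \<zero>"
  proof (rule ccontr)
    assume h: "\<not> ?thesis"
    then have h1: "w [Vx, Vy, Vx, Vy] \<noteq> \<zero>" and h2: "w [Vx, Vy, Vy, Vx] \<noteq> \<zero>" using nX by (auto simp: p_def c_def)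
    show False by (rule nc[OF h1 h2]) simp
  qed
  have vals: "w [Vx, Vy, Vy, Vx] = lam \<otimes> p" "w [Vy, Vy, Vx, Vx] = lam \<otimes> (lam \<otimes> p)"
    "e = lam \<otimes> e" "f = mu \<otimes> f" "p = mu \<otimes> p'" "p' = mu \<otimes> (lam \<otimes> (lam \<otimes> p))" "c = mu \<otimes> c'" "c' = lam \<otimes> c"
    unfolding p_def p'_def c_def c'_def e_def f_def using X Y by metis+
  have cK: "{lam, mu, p, p', c, c', e, f} \<subseteq> carrier K" using lm by (simp add: p_def p'_def c_def c'_def e_def f_def)
  have Wc: "W u \<in> carrier A" for u by simp
  have rx: "e \<odot>\<^bsub>A\<^esub> W [Vx, Vx, Vx] \<oplus>\<^bsub>A\<^esub> p \<odot>\<^bsub>A\<^esub> W [Vx, Vy, Vy] \<oplus>\<^bsub>A\<^esub> c \<odot>\<^bsub>A\<^esub> W [Vy, Vx, Vy] \<oplus>\<^bsub>A\<^esub> (lam \<otimes> p) \<odot>\<^bsub>A\<^esub> W [Vy, Vy, Vx] = \<zero>\<^bsub>A\<^esub>"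
    using relation_expansion[of Vx] zeros xy_zero yx_zero vals(1) cK
    by (simp add: p_def[symmetric] c_def[symmetric] e_def[symmetric] del: word_prod_simps)
  have ry: "p' \<odot>\<^bsub>A\<^esub> W [Vx, Vx, Vy] \<oplus>\<^bsub>A\<^esub> c' \<odot>\<^bsub>A\<^esub> W [Vx, Vy, Vx] \<oplus>\<^bsub>A\<^esub> (lam \<otimes> (lam \<otimes> p)) \<odot>\<^bsub>A\<^esub> W [Vy, Vx, Vx] \<oplus>\<^bsub>A\<^esub> f \<odot>\<^bsub>A\<^esub> W [Vy, Vy, Vy] = \<zero>\<^bsub>A\<^esub>"
    using relation_expansion[of Vy] zeros vals(2) cK
    by (simp add: p'_def[symmetric] c'_def[symmetric] f_def[symmetric] del: word_prod_simps)
  have mono_cancel: "W u = \<zero>\<^bsub>A\<^esub>" if "k \<in> carrier K" "k \<noteq> \<zero>" "k \<odot>\<^bsub>A\<^esub> W u = \<zero>\<^bsub>A\<^esub>" for k u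
  proof -
    have ik: "inv k \<in> carrier K" "inv k \<otimes> k = \<one>" using KF.field_Units that by auto
    have "W u = (inv k \<otimes> k) \<odot>\<^bsub>A\<^esub> W u" using ik by simp
    also have "\<dots> = inv k \<odot>\<^bsub>A\<^esub> (k \<odot>\<^bsub>A\<^esub> W u)" using ik(1) that(1) by (simp add: smult_assoc1)
    finally show ?thesis using that ik by simp
  qed
  have list3: "\<exists>a b d. v = [a, b, d]" if "length v = Suc (Suc (Suc 0))" for v :: "var list"
    using that by (auto simp: length_Suc_conv)
  \<comment> \<open>If the relation for \<open>i\<close> is a single word, row \<open>i\<close> of
    \<open>m\<close> has a single nonzero entry, and \<open>W v\<close> times it vanishes. Then
    \<open>W v\<close> in coordinate \<open>i\<close> is a syzygy of low degree, against
    \<open>K3_single\<close>.\<close>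
  have excl: False if wz: "\<And>a b d. w [i, a, b, d] \<noteq> \<zero> \<Longrightarrow> [a, b, d] = [a0, b0, d0]" and nz: "w [i, a0, b0, d0] \<noteq> \<zero>"
    and v: "W (v @ [a0, b0]) = \<zero>\<^bsub>A\<^esub>" and lv: "length v < 3" for i a0 b0 d0 v
  proof -
    let ?k = "w [i, a0, b0, d0]"
    have rd: "rder d (lder i w) = (if d = d0 then ?k \<odot>\<^bsub>T\<^esub> monomial K [a0, b0] else \<zero>\<^bsub>T\<^esub>)" for d
    proof
      fix u
      have wu: "w (i # u @ [d]) = \<zero>" if "u @ [d] \<noteq> [a0, b0, d0]"
      proof (rule ccontr)
        assume h: "w (i # u @ [d]) \<noteq> \<zero>"
        then have "length (u @ [d]) = Suc (Suc (Suc 0))" using w_length[OF h] by simp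
        then obtain a b d' where "u @ [d] = [a, b, d']" using list3[of "u @ [d]"] by blast
        then show False using wz[of a b d'] h that by simp
      qed
      show "rder d (lder i w) u = (if d = d0 then ?k \<odot>\<^bsub>T\<^esub> monomial K [a0, b0] else \<zero>\<^bsub>T\<^esub>) u"
        using wu by (auto simp: rder_def lder_def free_algebra_simps monomial_def append_eq_Cons_conv)
    qed
    have mi: "m i d = (if d = d0 then ?k \<odot>\<^bsub>A\<^esub> W [a0, b0] else \<zero>\<^bsub>A\<^esub>)" for d
      unfolding m_def rd by (simp add: ev_smult del: word_prod_simps)
    have vw: "W v \<otimes>\<^bsub>A\<^esub> W [a0, b0] = \<zero>\<^bsub>A\<^esub>" using v by (simp only: word_prod_append)
    have "W v \<otimes>\<^bsub>A\<^esub> m i d = \<zero>\<^bsub>A\<^esub>" for d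
      unfolding mi by (simp add: smult_mult_right vw del: word_prod_simps)
    then have "d2 (\<lambda>d. if d = i then W v else \<zero>\<^bsub>A\<^esub>) d = \<zero>\<^bsub>A\<^esub>" for d
      by (cases i) (simp_all add: d2_def)
    then have "(\<lambda>d. if d = i then W v else \<zero>\<^bsub>A\<^esub>) \<in> K3"
      by (auto simp: K3_def F_carrier free_module_simps(2))
    then have "W v = \<zero>\<^bsub>A\<^esub>" by (rule K3_single[OF lv word_prod_grade])
    then show False using word_nonzero[OF lv] by simp
  qed
  have only_x: "w [Vx, a, b, d] \<noteq> \<zero> \<Longrightarrow> [a, b, d] \<in> {[Vx, Vx, Vx], [Vx, Vy, Vy], [Vy, Vx, Vy], [Vy, Vy, Vx]}" for a b d
    using xy_zero yx_zero zeros by (cases a; cases b; cases d) auto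
  have only_y: "w [Vy, a, b, d] \<noteq> \<zero> \<Longrightarrow> [a, b, d] \<in> {[Vx, Vx, Vy], [Vx, Vy, Vx], [Vy, Vx, Vx], [Vy, Vy, Vy]}" for a b d
    using xy_zero yx_zero zeros by (cases a; cases b; cases d) auto
  have p0: "w [Vx, Vy, Vy, Vx] = \<zero>" "w [Vy, Vx, Vx, Vy] = \<zero>" "w [Vy, Vy, Vx, Vx] = \<zero>" if "p = \<zero>"
    using that nX nY unfolding p_def by blast+
  have c'0: "c' = \<zero> \<longleftrightarrow> c = \<zero>" using nX nY unfolding c_def c'_def by blast
  have n1: "p \<noteq> \<zero> \<or> c \<noteq> \<zero>"
  proof (rule ccontr)
    assume h: "\<not> ?thesis"
    then have pz: "p = \<zero>" and cz: "c = \<zero>" by auto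
    have u: "[a, b, d] = [Vx, Vx, Vx]" if "w [Vx, a, b, d] \<noteq> \<zero>" for a b d
      using only_x[OF that] that p0[OF pz] pz cz unfolding p_def c_def by auto
    then have ez: "e \<noteq> \<zero>" using s_nonzero[of Vx] unfolding e_def by fastforce
    have "e \<odot>\<^bsub>A\<^esub> W [Vx, Vx, Vx] = \<zero>\<^bsub>A\<^esub>" using rx pz cz cK lm by (simp del: word_prod_simps)
    then have vz: "W [Vx, Vx, Vx] = \<zero>\<^bsub>A\<^esub>" using ez cK mono_cancel[of e "[Vx, Vx, Vx]"] by (simp del: word_prod_simps)
    \<comment> \<open>The relation \<open>xxx = 0\<close> is read as \<open>x\<close> times the
      matrix entry \<open>xx\<close>.\<close>
    show False
    proof (rule excl[of Vx Vx Vx Vx "[Vx]"])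
      show "[a, b, d] = [Vx, Vx, Vx]" if "w [Vx, a, b, d] \<noteq> \<zero>" for a b d by (rule u[OF that])
      show "w [Vx, Vx, Vx, Vx] \<noteq> \<zero>" using ez by (simp add: e_def)
    qed (use vz in \<open>simp_all del: word_prod_simps\<close>)
  qed
  have n2: "e \<noteq> \<zero>" if "c \<noteq> \<zero>"
  proof
    assume ez: "e = \<zero>"
    have pz: "p = \<zero>" using pc that by auto
    have u: "[a, b, d] = [Vy, Vx, Vy]" if "w [Vx, a, b, d] \<noteq> \<zero>" for a b d
      using only_x[OF that] that p0[OF pz] pz ez unfolding p_def e_def by auto
    have "c \<odot>\<^bsub>A\<^esub> W [Vy, Vx, Vy] = \<zero>\<^bsub>A\<^esub>" using rx pz ez cK lm by (simp del: word_prod_simps)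
    then have "W [Vy, Vx, Vy] = \<zero>\<^bsub>A\<^esub>" using that cK mono_cancel[of c "[Vy, Vx, Vy]"] by (simp del: word_prod_simps)
    \<comment> \<open>The matrix entry is \<open>yx\<close>. Multiplying \<open>yxy = 0\<close> by
      \<open>x\<close> on the right gives \<open>(yx)(yx) = 0\<close>, so \<open>yx\<close> is the
      multiplier.\<close>
    then have vz: "W ([Vy, Vx, Vy] @ [Vx]) = \<zero>\<^bsub>A\<^esub>" unfolding word_prod_append by (simp del: word_prod_simps)
    show False
    proof (rule excl[of Vx Vy Vx Vy "[Vy, Vx]"])
      show "[a, b, d] = [Vy, Vx, Vy]" if "w [Vx, a, b, d] \<noteq> \<zero>" for a b d by (rule u[OF that])
      show "w [Vx, Vy, Vx, Vy] \<noteq> \<zero>" using that by (simp add: c_def)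
    qed (use vz in \<open>simp_all del: word_prod_simps\<close>)
  qed
  have n3: "f \<noteq> \<zero>" if "c \<noteq> \<zero>"
  proof
    assume fz: "f = \<zero>"
    have pz: "p = \<zero>" using pc that by auto
    have u: "[a, b, d] = [Vx, Vy, Vx]" if "w [Vy, a, b, d] \<noteq> \<zero>" for a b d
      using only_y[OF that] that p0[OF pz] pz fz unfolding f_def by auto
    have c'z: "c' \<noteq> \<zero>" using that c'0 by simp
    have "p' = \<zero>" using p0[OF pz] by (simp add: p'_def)
    then have "c' \<odot>\<^bsub>A\<^esub> W [Vx, Vy, Vx] = \<zero>\<^bsub>A\<^esub>" using ry pz fz cK lm by (simp del: word_prod_simps)
    then have "W [Vx, Vy, Vx] = \<zero>\<^bsub>A\<^esub>" using c'z cK mono_cancel[of c' "[Vx, Vy, Vx]"] by (simp del: word_prod_simps)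
    then have vz: "W ([Vx, Vy, Vx] @ [Vy]) = \<zero>\<^bsub>A\<^esub>" unfolding word_prod_append by (simp del: word_prod_simps)
    show False
    proof (rule excl[of Vy Vx Vy Vx "[Vx, Vy]"])
      show "[a, b, d] = [Vx, Vy, Vx]" if "w [Vy, a, b, d] \<noteq> \<zero>" for a b d by (rule u[OF that])
      show "w [Vy, Vx, Vy, Vx] \<noteq> \<zero>" using c'z by (simp add: c'_def)
    qed (use vz in \<open>simp_all del: word_prod_simps\<close>)
  qed
  have g1: "wd [Vx, Vx, Vy] = wd [Vy, Vx, Vx]" "wd [Vy, Vy, Vx] = wd [Vx, Vy, Vy]" if "p \<noteq> \<zero>"
  proof -
    have h: "w [Vx, Vx, Vy, Vy] \<noteq> \<zero>" "w [Vy, Vx, Vx, Vy] \<noteq> \<zero>" "w [Vx, Vy, Vy, Vx] \<noteq> \<zero>"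
      using that nX nY unfolding p_def by blast+
    have "wd ([Vx, Vx, Vy] @ [Vy]) = wd ([Vy, Vx, Vx] @ [Vy])" using same_degree[OF h(1,2)] by simp
    then show "wd [Vx, Vx, Vy] = wd [Vy, Vx, Vx]" unfolding wd_snoc by (simp del: word_deg_simps)
    show "wd [Vy, Vy, Vx] = wd [Vx, Vy, Vy]" using same_degree[OF h(3,1)] by simp
  qed
  have g2: "wd [Vx, Vx] = wd [Vy, Vy]" if "p \<noteq> \<zero>" "e \<noteq> \<zero> \<or> f \<noteq> \<zero>"
  proof -
    have h: "w [Vx, Vx, Vy, Vy] \<noteq> \<zero>" "w [Vy, Vy, Vx, Vx] \<noteq> \<zero>" using that nX nY unfolding p_def by blast+
    from that(2) show ?thesis
    proof
      assume "e \<noteq> \<zero>" then show ?thesis using same_degree[OF h(1), of "[Vx, Vx, Vx, Vx]"] by (simp add: e_def)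
    next
      assume "f \<noteq> \<zero>" then show ?thesis using same_degree[OF h(2), of "[Vy, Vy, Vy, Vy]"] by (simp add: f_def)
    qed
  qed
  have g3: "wd [Vx, Vx, Vx] = wd [Vy, Vx, Vy]" "wd [Vy, Vy, Vy] = wd [Vx, Vy, Vx]" if "c \<noteq> \<zero>" "e \<noteq> \<zero>" "f \<noteq> \<zero>"
    using same_degree[of "[Vx, Vx, Vx, Vx]" "[Vx, Vy, Vx, Vy]"] same_degree[of "[Vy, Vy, Vy, Vy]" "[Vy, Vx, Vy, Vx]"]
      that c'0 by (simp_all add: c_def e_def f_def c'_def)
  have "coefficients lam mu p p' c c' e f"
  proof (unfold coefficients_def, intro conjI)
    show "p \<noteq> \<zero> \<and> c = \<zero> \<or> p = \<zero> \<and> c \<noteq> \<zero> \<and> e \<noteq> \<zero> \<and> f \<noteq> \<zero>" using n1 n2 n3 pc by argo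
    show "p \<noteq> \<zero> \<longrightarrow> wd [Vx, Vx, Vy] = wd [Vy, Vx, Vx] \<and> wd [Vy, Vy, Vx] = wd [Vx, Vy, Vy]"
      by (intro impI conjI g1)
    show "p \<noteq> \<zero> \<and> (e \<noteq> \<zero> \<or> f \<noteq> \<zero>) \<longrightarrow> wd [Vx, Vx] = wd [Vy, Vy]" by (intro impI g2) auto
    show "c \<noteq> \<zero> \<longrightarrow> wd [Vx, Vx, Vx] = wd [Vy, Vx, Vy] \<and> wd [Vy, Vy, Vy] = wd [Vx, Vy, Vx]"
      by (intro impI conjI g3 n2 n3)
  qed (fact cK lm vals rx ry)+
  then show ?thesis by blast
qed

end

section \<open>Groups with given generators and relations\<close>

definition signed_value :: "('g, 'c) monoid_scheme \<Rightarrow> ('v \<Rightarrow> 'g) \<Rightarrow> 'v group_word \<Rightarrow> 'g" where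
  "signed_value G d u = foldr (\<lambda>(v, b) g. (if b then d v else inv\<^bsub>G\<^esub> d v) \<otimes>\<^bsub>G\<^esub> g) u \<one>\<^bsub>G\<^esub>"

lemma signed_value_simps [simp]:
  "signed_value G d [] = \<one>\<^bsub>G\<^esub>"
  "signed_value G d ((v, b) # u) = (if b then d v else inv\<^bsub>G\<^esub> d v) \<otimes>\<^bsub>G\<^esub> signed_value G d u"
  by (simp_all add: signed_value_def)

context group begin

lemma signed_value_closed: "(\<And>v. d v \<in> carrier G) \<Longrightarrow> signed_value G d u \<in> carrier G"
  by (induction u) auto

lemma signed_value_append:
  "(\<And>v. d v \<in> carrier G) \<Longrightarrow> signed_value G d (u @ v) = signed_value G d u \<otimes> signed_value G d v"
  by (induction u) (auto simp: m_assoc signed_value_closed)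

lemma pres_eq_signed_value:
  assumes d: "\<And>v. d v \<in> carrier G"
    and S: "\<And>u v. (u, v) \<in> S \<Longrightarrow> signed_value G d u = signed_value G d v"
    and e: "pres_eq S u v"
  shows "signed_value G d u = signed_value G d v"
  using e by induction (auto simp: S signed_value_append[OF d] d)

text \<open>The relations hold in \<open>G\<close>, so all words of a class have the same value and
  \<open>p\<close> may evaluate any representative.\<close>

lemma presented_group_epi:
  assumes d: "\<And>v. d v \<in> carrier G"
    and S: "\<And>u v. (u, v) \<in> S \<Longrightarrow> signed_value G d u = signed_value G d v"
    and gen: "generate G (range d) = carrier G"
  shows "\<exists>p\<in>epi (presented_group S) G. \<forall>v. p (group_gen S v) = d v"
proof -
  define p where "p C = signed_value G d (SOME u. u \<in> C)" for C
  have pI: "p C = g" if "u \<in> C" "\<And>v. v \<in> C \<Longrightarrow> signed_value G d v = g" for C u g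
    unfolding p_def by (rule that(2), rule someI, rule that(1))
  have eqv: "signed_value G d u = signed_value G d v" if "pres_eq S u v" for u v
    by (rule pres_eq_signed_value[OF d _ that]) (rule S)
  have pc: "p (Collect (pres_eq S u)) = signed_value G d u" for u
    by (rule pI[of u]) (auto intro: pres_eq.refl eqv[symmetric])
  have "p \<in> hom (presented_group S) G"
  proof (rule homI)
    fix C assume "C \<in> carrier (presented_group S)"
    then show "p C \<in> carrier G" by (auto simp: presented_group_def pc signed_value_closed[OF d])
  next
    fix C D assume "C \<in> carrier (presented_group S)" "D \<in> carrier (presented_group S)"
    then obtain u v where CD: "C = Collect (pres_eq S u)" "D = Collect (pres_eq S v)" by (auto simp: presented_group_def)
    show "p (C \<otimes>\<^bsub>presented_group S\<^esub> D) = p C \<otimes> p D"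
      unfolding CD pc
    proof (rule pI[of "u @ v"])
      show "u @ v \<in> Collect (pres_eq S u) \<otimes>\<^bsub>presented_group S\<^esub> Collect (pres_eq S v)"
        by (auto simp: presented_group_def intro: pres_eq.refl)
      fix t assume "t \<in> Collect (pres_eq S u) \<otimes>\<^bsub>presented_group S\<^esub> Collect (pres_eq S v)"
      then obtain u' v' where e: "pres_eq S u u'" "pres_eq S v v'" "pres_eq S (u' @ v') t"
        by (auto simp: presented_group_def)
      show "signed_value G d t = signed_value G d u \<otimes> signed_value G d v"
        unfolding eqv[OF e(1)] eqv[OF e(2)] eqv[OF e(3), symmetric] by (rule signed_value_append[OF d])
    qed
  qed
  moreover have "carrier G \<subseteq> p ` carrier (presented_group S)"
  proof
    fix g assume "g \<in> carrier G"
    then have "g \<in> generate G (range d)" using gen by simp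
    then have "\<exists>u. g = signed_value G d u"
    proof induction
      case one then show ?case by (intro exI[of _ "[]"]) simp
    next
      case (incl h)
      then obtain v where "h = d v" by blast
      then show ?case using d by (intro exI[of _ "[(v, True)]"]) simp
    next
      case (inv h)
      then obtain v where "h = d v" by blast
      then show ?case using d by (intro exI[of _ "[(v, False)]"]) simp
    next
      case (eng h1 h2)
      then obtain u v where "h1 = signed_value G d u" "h2 = signed_value G d v" by blast
      then show ?case by (intro exI[of _ "u @ v"]) (simp add: signed_value_append[OF d])
    qed
    then obtain u where "g = p (Collect (pres_eq S u))" using pc by auto
    then show "g \<in> p ` carrier (presented_group S)" by (auto simp: presented_group_def)
  qed
  moreover have "p (group_gen S v) = d v" for v using d by (simp add: group_gen_def pc)
  ultimately show ?thesis by (intro bexI[of _ p]) (auto simp: epi_def hom_def)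
qed

text \<open>The elements that commute with a fixed one form a subgroup. This is applied with a
  generator fixed, then with an arbitrary element fixed.\<close>

lemma commuting_generators:
  assumes gen: "generate G H = carrier G" and H: "H \<subseteq> carrier G"
    and comm: "\<And>g h. g \<in> H \<Longrightarrow> h \<in> H \<Longrightarrow> g \<otimes> h = h \<otimes> g"
  shows "comm_group G"
proof -
  have cent: "g \<otimes> h = h \<otimes> g" if "g \<in> generate G H" "h \<in> carrier G" "\<And>k. k \<in> H \<Longrightarrow> k \<otimes> h = h \<otimes> k" for g h
    using that(1)
  proof induction
    case one then show ?case using that by simp
  next
    case (incl k) then show ?case using that(3) by simp
  next
    case (inv k)
    then have k: "k \<in> carrier G" "h \<otimes> k = k \<otimes> h" using H that(3) by auto
    have "inv k \<otimes> h = inv k \<otimes> (h \<otimes> k) \<otimes> inv k" using k(1) that(2) by (simp add: m_assoc)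
    also have "\<dots> = h \<otimes> inv k" unfolding k(2) using k(1) that(2) by (simp add: m_assoc[symmetric])
    finally show ?case .
  next
    case (eng k1 k2)
    then have "k1 \<in> carrier G" "k2 \<in> carrier G" using gen by auto
    then have "k1 \<otimes> k2 \<otimes> h = k1 \<otimes> (k2 \<otimes> h)" "k1 \<otimes> (h \<otimes> k2) = k1 \<otimes> h \<otimes> k2" "h \<otimes> k1 \<otimes> k2 = h \<otimes> (k1 \<otimes> k2)"
      using that(2) by (simp_all add: m_assoc)
    then show ?case using eng.IH by simp
  qed
  have 1: "k \<otimes> h = h \<otimes> k" if "k \<in> H" "h \<in> carrier G" for k h
    using cent[of h k] that comm H gen by auto
  show ?thesis
  proof (rule group_comm_groupI)
    fix g h assume "g \<in> carrier G" "h \<in> carrier G"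
    then show "g \<otimes> h = h \<otimes> g" using cent[of g h, OF _ _ 1] gen by blast
  qed
qed

end

text \<open>The list is the polynomial \<open>X\<^sup>2 - a\<close>, leading coefficient first;
  since it splits, the number of its roots is its degree.\<close>

lemma (in algebraically_closed) square_root:
  assumes a: "a \<in> carrier L"
  shows "\<exists>b\<in>carrier L. b \<otimes> b = a"
proof -
  let ?P = "[\<one>, \<zero>, \<ominus> a]"
  have P: "?P \<in> carrier (poly_ring L)" using a by (simp add: univ_poly_carrier[symmetric] polynomial_def)
  have "splitted ?P" by (rule roots_over_carrier[OF P])
  then have "size (roots ?P) = 2" by (simp add: splitted_def)
  then obtain b where "b \<in># roots ?P" by fastforce
  then have b: "b \<in> carrier L" "eval ?P b = \<zero>" using roots_mem_iff_is_root[OF P] by (auto simp: is_root_def)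
  then have "b \<otimes> b \<oplus> \<ominus> a = \<zero>" using a by (simp add: numeral_eq_Suc)
  then have "b \<otimes> b = a" using a b by (metis a_minus_def m_closed r_right_minus_eq)
  then show ?thesis using b by blast
qed

section \<open>The four families\<close>

context cubic_presentation begin

text \<open>For any generators the relations of degree three form a plane. Two independent elements
  of that plane are a basis of it, so checking that the new relations hold at the new generators is
  enough for a presentation.\<close>

lemma iso_to_relations:
  assumes x': "\<And>c :: var. x' c \<in> \<A> 1"
    and indep: "\<And>\<alpha> \<beta>. \<lbrakk>\<alpha> \<in> carrier K; \<beta> \<in> carrier K; \<alpha> \<odot>\<^bsub>A\<^esub> x' Vx \<oplus>\<^bsub>A\<^esub> \<beta> \<odot>\<^bsub>A\<^esub> x' Vy = \<zero>\<^bsub>A\<^esub>\<rbrakk> \<Longrightarrow> \<alpha> = \<zero> \<and> \<beta> = \<zero>"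
    and s: "\<And>c :: var. s c \<in> free_homogeneous K 3"
    and s_indep: "\<And>\<alpha> \<beta>. \<lbrakk>\<alpha> \<in> carrier K; \<beta> \<in> carrier K; \<alpha> \<odot>\<^bsub>T\<^esub> s Vx \<oplus>\<^bsub>T\<^esub> \<beta> \<odot>\<^bsub>T\<^esub> s Vy = \<zero>\<^bsub>T\<^esub>\<rbrakk> \<Longrightarrow> \<alpha> = \<zero> \<and> \<beta> = \<zero>"
    and z: "\<And>c. eval_at K A x' (s c) = \<zero>\<^bsub>A\<^esub>"
  obtains f where "f \<in> graded_algebra_iso K A \<A> (presented_algebra K (range s)) (presented_grading K (range s))"
    "\<And>c. f (x' c) = algebra_gen K (range s) c"
proof -
  have "\<exists>r'. cubic_presentation K A \<A> x' r'" by (rule base_change) (fact x', rule indep)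
  then obtain r' where r': "cubic_presentation K A \<A> x' r'" by blast
  interpret C: cubic_presentation K A \<A> x' r' by (rule r')
  have "\<exists>\<alpha> \<beta>. \<alpha> \<in> carrier K \<and> \<beta> \<in> carrier K \<and> s c = \<alpha> \<odot>\<^bsub>T\<^esub> r' Vx \<oplus>\<^bsub>T\<^esub> \<beta> \<odot>\<^bsub>T\<^esub> r' Vy" for c
    using C.ker_3[OF s z] by metis
  then obtain \<alpha> \<beta> where ab: "\<And>c. \<alpha> c \<in> carrier K" "\<And>c. \<beta> c \<in> carrier K"
    "\<And>c. s c = \<alpha> c \<odot>\<^bsub>T\<^esub> r' Vx \<oplus>\<^bsub>T\<^esub> \<beta> c \<odot>\<^bsub>T\<^esub> r' Vy" by metis
  define \<zeta> where "\<zeta> i = (if i = Vx then \<alpha> else \<beta>)" for i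
  have zeta: "\<zeta> i c \<in> carrier K" for i c using ab by (simp add: \<zeta>_def)
  have "cubic_presentation K A \<A> x' s"
  proof (rule C.change_relations[of s \<zeta>])
    show "s c = \<zeta> Vx c \<odot>\<^bsub>T\<^esub> r' Vx \<oplus>\<^bsub>T\<^esub> \<zeta> Vy c \<odot>\<^bsub>T\<^esub> r' Vy" for c by (simp add: \<zeta>_def ab(3))
    fix u v assume uv: "u \<in> carrier K" "v \<in> carrier K"
      and e: "\<zeta> Vx Vx \<otimes> u \<oplus> \<zeta> Vx Vy \<otimes> v = \<zero>" "\<zeta> Vy Vx \<otimes> u \<oplus> \<zeta> Vy Vy \<otimes> v = \<zero>"
    have "u \<odot>\<^bsub>T\<^esub> s Vx \<oplus>\<^bsub>T\<^esub> v \<odot>\<^bsub>T\<^esub> s Vy =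
      ((u \<otimes> \<alpha> Vx) \<odot>\<^bsub>T\<^esub> r' Vx \<oplus>\<^bsub>T\<^esub> (u \<otimes> \<beta> Vx) \<odot>\<^bsub>T\<^esub> r' Vy) \<oplus>\<^bsub>T\<^esub>
      ((v \<otimes> \<alpha> Vy) \<odot>\<^bsub>T\<^esub> r' Vx \<oplus>\<^bsub>T\<^esub> (v \<otimes> \<beta> Vy) \<odot>\<^bsub>T\<^esub> r' Vy)"
      using ab(1,2) uv C.r_mem unfolding ab(3) by (simp add: TA.smult_r_distr TA.smult_assoc1)
    also have "\<dots> = (u \<otimes> \<alpha> Vx \<oplus> v \<otimes> \<alpha> Vy) \<odot>\<^bsub>T\<^esub> r' Vx \<oplus>\<^bsub>T\<^esub> (u \<otimes> \<beta> Vx \<oplus> v \<otimes> \<beta> Vy) \<odot>\<^bsub>T\<^esub> r' Vy"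
      using ab(1,2) uv C.r_mem by (simp add: TA.smult_l_distr TR.a_ac)
    also have "\<dots> = \<zero>\<^bsub>T\<^esub>" using e ab(1,2) uv C.r_mem by (simp add: \<zeta>_def R.m_comm[of u] R.m_comm[of v])
    finally show "u = \<zero> \<and> v = \<zero>" by (rule s_indep[OF uv])
  qed (rule zeta)
  then interpret D: cubic_presentation K A \<A> x' s .
  show ?thesis
  proof (rule D.iso_to_presented[of "range s"])
    show "range s \<subseteq> carrier T" using D.r_mem by blast
    show "eval_at K A x' t = \<zero>\<^bsub>A\<^esub> \<longleftrightarrow> t \<in> Idl\<^bsub>T\<^esub> (range s)" if "t \<in> carrier T" for t by (rule D.ev_ker[OF that])
  qed (rule that)
qed

end

locale generated_potential = graded_potential K A \<A> x w G V dg
  for K :: "('k, 'l) ring_scheme" (structure) and A :: "('k, 'a, 'b) module_scheme" and \<A> x w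
    and G :: "('g, 'c) monoid_scheme" and V dg +
  assumes generated: "generate G (range dg) = carrier G"
    and square_roots: "k \<in> carrier K \<Longrightarrow> \<exists>b\<in>carrier K. b \<otimes> b = k"
begin

text \<open>A common factor on both generators multiplies a cubic relation by a scalar, so one
  scaling parameter captures the freedom. The map \<open>\<theta>\<close> will be the identity or
  the exchange of the letters.\<close>

definition rescaled :: "'k \<Rightarrow> (var \<Rightarrow> var) \<Rightarrow> var \<Rightarrow> 'a" where
  "rescaled t \<theta> c = (if c = Vx then t \<odot>\<^bsub>A\<^esub> x (\<theta> Vx) else x (\<theta> Vy))"

lemma rescaled_closed: "t \<in> carrier K \<Longrightarrow> rescaled t \<theta> c \<in> carrier A"
  by (simp add: rescaled_def)

lemma ev_rescaled:
  assumes t: "t \<in> carrier K"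
  shows "eval_at K A (rescaled t \<theta>) (monomial K u) =
    (t [^] count_list u Vx) \<odot>\<^bsub>A\<^esub> W (map \<theta> u)"
    "f \<in> carrier T \<Longrightarrow> g \<in> carrier T \<Longrightarrow>
      eval_at K A (rescaled t \<theta>) (f \<oplus>\<^bsub>T\<^esub> g) = eval_at K A (rescaled t \<theta>) f \<oplus>\<^bsub>A\<^esub> eval_at K A (rescaled t \<theta>) g"
    "k \<in> carrier K \<Longrightarrow> f \<in> carrier T \<Longrightarrow>
      eval_at K A (rescaled t \<theta>) (k \<odot>\<^bsub>T\<^esub> f) = k \<odot>\<^bsub>A\<^esub> eval_at K A (rescaled t \<theta>) f"
proof -
  interpret E: evaluation K A "rescaled t \<theta>" by unfold_locales (rule rescaled_closed[OF t])
  have e: "rescaled t \<theta> Vx = t \<odot>\<^bsub>A\<^esub> x (\<theta> Vx)" "rescaled t \<theta> Vy = x (\<theta> Vy)" by (simp_all add: rescaled_def)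
  have "word_prod A (rescaled t \<theta>) u = (t [^] count_list u Vx) \<odot>\<^bsub>A\<^esub> W (map \<theta> u)"
  proof (induction u)
    case Nil show ?case by simp
  next
    case (Cons c u)
    show ?case
    proof (cases c)
      case Vx
      then show ?thesis using t Cons R.m_comm[of t "t [^] count_list u Vx"]
        by (simp add: e smult_mult_left smult_mult_right smult_assoc1[symmetric])
    next
      case Vy
      then show ?thesis using t Cons by (simp add: e smult_mult_right)
    qed
  qed
  then show "eval_at K A (rescaled t \<theta>) (monomial K u) = (t [^] count_list u Vx) \<odot>\<^bsub>A\<^esub> W (map \<theta> u)"
    by (simp only: E.ev_monomial)
  show "eval_at K A (rescaled t \<theta>) (f \<oplus>\<^bsub>T\<^esub> g) = eval_at K A (rescaled t \<theta>) f \<oplus>\<^bsub>A\<^esub> eval_at K A (rescaled t \<theta>) g"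
    if "f \<in> carrier T" "g \<in> carrier T" for f g using that by (rule E.ev_add)
  show "eval_at K A (rescaled t \<theta>) (k \<odot>\<^bsub>T\<^esub> f) = k \<odot>\<^bsub>A\<^esub> eval_at K A (rescaled t \<theta>) f"
    if "k \<in> carrier K" "f \<in> carrier T" for k f using that by (rule E.ev_smult)
qed

text \<open>The words \<open>u\<close> and \<open>v\<close> witness the independence of the
  relations: each has coefficient one in one of them and is absent from the other.\<close>

lemma graded_iso:
  assumes t: "t \<in> carrier K" "t \<noteq> \<zero>" and \<theta>: "\<theta> Vx \<noteq> \<theta> Vy"
    and s: "s1 \<in> free_homogeneous K 3" "s2 \<in> free_homogeneous K 3"
    and lead: "s1 u = \<one>" "s2 u = \<zero>" "s1 v = \<zero>" "s2 v = \<one>"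
    and z: "eval_at K A (rescaled t \<theta>) s1 = \<zero>\<^bsub>A\<^esub>" "eval_at K A (rescaled t \<theta>) s2 = \<zero>\<^bsub>A\<^esub>"
    and S: "\<And>u v. (u, v) \<in> S \<Longrightarrow> signed_value G (\<lambda>c. dg (\<theta> c)) u = signed_value G (\<lambda>c. dg (\<theta> c)) v"
  shows "graded_iso_to K A \<A> G V {s1, s2} S"
proof -
  let ?s = "\<lambda>c. if c = Vx then s1 else s2"
  have range: "range ?s = {s1, s2}" by (auto simp: var_UNIV)
  have R1: "rescaled t \<theta> c \<in> \<A> 1" for c using t x_deg by (simp add: rescaled_def grade_smult)
  have R2: "\<alpha> = \<zero> \<and> \<beta> = \<zero>"
    if ab: "\<alpha> \<in> carrier K" "\<beta> \<in> carrier K" "\<alpha> \<odot>\<^bsub>A\<^esub> rescaled t \<theta> Vx \<oplus>\<^bsub>A\<^esub> \<beta> \<odot>\<^bsub>A\<^esub> rescaled t \<theta> Vy = \<zero>\<^bsub>A\<^esub>" for \<alpha> \<beta>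
  proof -
    have e: "(\<alpha> \<otimes> t) \<odot>\<^bsub>A\<^esub> x (\<theta> Vx) \<oplus>\<^bsub>A\<^esub> \<beta> \<odot>\<^bsub>A\<^esub> x (\<theta> Vy) = \<zero>\<^bsub>A\<^esub>"
      using ab t by (simp add: rescaled_def smult_assoc1)
    consider "\<theta> Vx = Vx" "\<theta> Vy = Vy" | "\<theta> Vx = Vy" "\<theta> Vy = Vx" using \<theta> by (metis var.exhaust)
    then have "\<alpha> \<otimes> t = \<zero> \<and> \<beta> = \<zero>"
    proof cases
      case 1 then show ?thesis using x_indep[of "\<alpha> \<otimes> t" \<beta>] e ab t by simp
    next
      case 2 then show ?thesis using x_indep[of \<beta> "\<alpha> \<otimes> t"] e ab t by (simp add: M.a_comm)
    qed
    then show ?thesis using KF.integral[of \<alpha> t] ab t by auto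
  qed
  have R3: "\<alpha> = \<zero> \<and> \<beta> = \<zero>"
    if ab: "\<alpha> \<in> carrier K" "\<beta> \<in> carrier K" "\<alpha> \<odot>\<^bsub>T\<^esub> ?s Vx \<oplus>\<^bsub>T\<^esub> \<beta> \<odot>\<^bsub>T\<^esub> ?s Vy = \<zero>\<^bsub>T\<^esub>" for \<alpha> \<beta>
    using fun_cong[OF ab(3), of u] fun_cong[OF ab(3), of v] ab(1,2) lead by (simp add: free_algebra_simps)
  have R4: "?s c \<in> free_homogeneous K 3" "eval_at K A (rescaled t \<theta>) (?s c) = \<zero>\<^bsub>A\<^esub>" for c using s z by simp_all
  obtain f where f: "f \<in> graded_algebra_iso K A \<A> (presented_algebra K (range ?s)) (presented_grading K (range ?s))"
    "\<And>c. f (rescaled t \<theta> c) = algebra_gen K (range ?s) c"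
    by (rule iso_to_relations[OF R1 R2 R4(1) R3 R4(2)]) (assumption+, rule that)
  have "range (\<lambda>c. dg (\<theta> c)) = range dg" using \<theta> unfolding var_UNIV by (cases "\<theta> Vx"; cases "\<theta> Vy") auto
  then obtain p where p: "p \<in> epi (presented_group S) G" "\<And>c. p (group_gen S c) = dg (\<theta> c)"
    using G.presented_group_epi[of "\<lambda>c. dg (\<theta> c)" S] S generated by auto
  have "rescaled t \<theta> c \<in> V (p (group_gen S c))" for c
    using t x_V[of "\<theta> c"] by (cases c) (simp_all add: rescaled_def p(2) V_smult)
  moreover note f[unfolded range]
  ultimately show ?thesis unfolding graded_iso_to_def
    by (intro bexI[of _ f] bexI[of _ p] bexI[of _ "rescaled t \<theta> Vx"] bexI[of _ "rescaled t \<theta> Vy"] conjI p(1))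
qed

text \<open>Two successive square roots of the quotient of \<open>a\<close> by \<open>b\<close>.
  Fourth powers arise because scaling one generator has to reconcile the coefficients of two
  relations.\<close>

lemma fourth_root:
  assumes "a \<in> carrier K" "b \<in> carrier K" "a \<noteq> \<zero>" "b \<noteq> \<zero>"
  obtains t where "t \<in> carrier K" "t \<noteq> \<zero>" "t \<otimes> (t \<otimes> (t \<otimes> (t \<otimes> b))) = a"
proof -
  have ib: "inv b \<in> carrier K" "inv b \<otimes> b = \<one>" using KF.field_Units assms by auto
  obtain u where u: "u \<in> carrier K" "u \<otimes> u = a \<otimes> inv b" using square_roots[of "a \<otimes> inv b"] assms ib by blast
  obtain t where t: "t \<in> carrier K" "t \<otimes> t = u" using square_roots[OF u(1)] by blast
  have "t \<otimes> (t \<otimes> (t \<otimes> (t \<otimes> b))) = (t \<otimes> t) \<otimes> (t \<otimes> t) \<otimes> b" using t(1) assms by (simp add: R.m_assoc)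
  also have "\<dots> = a" unfolding t(2) u(2) using assms ib by (simp add: R.m_assoc)
  finally have e: "t \<otimes> (t \<otimes> (t \<otimes> (t \<otimes> b))) = a" .
  then have "t \<noteq> \<zero>" using assms by auto
  then show ?thesis using that t e by blast
qed

lemma smult_relation:
  assumes "k \<in> carrier K" "a \<in> carrier K" "b \<in> carrier K" "c \<in> carrier K" "d \<in> carrier K"
    and "u \<in> carrier A" "v \<in> carrier A" "y \<in> carrier A" "z \<in> carrier A"
    and "a \<odot>\<^bsub>A\<^esub> u \<oplus>\<^bsub>A\<^esub> b \<odot>\<^bsub>A\<^esub> v \<oplus>\<^bsub>A\<^esub> c \<odot>\<^bsub>A\<^esub> y \<oplus>\<^bsub>A\<^esub> d \<odot>\<^bsub>A\<^esub> z = \<zero>\<^bsub>A\<^esub>"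
  shows "(k \<otimes> a) \<odot>\<^bsub>A\<^esub> u \<oplus>\<^bsub>A\<^esub> (k \<otimes> b) \<odot>\<^bsub>A\<^esub> v \<oplus>\<^bsub>A\<^esub> (k \<otimes> c) \<odot>\<^bsub>A\<^esub> y \<oplus>\<^bsub>A\<^esub> (k \<otimes> d) \<odot>\<^bsub>A\<^esub> z = \<zero>\<^bsub>A\<^esub>"
proof -
  have "k \<odot>\<^bsub>A\<^esub> (a \<odot>\<^bsub>A\<^esub> u \<oplus>\<^bsub>A\<^esub> b \<odot>\<^bsub>A\<^esub> v \<oplus>\<^bsub>A\<^esub> c \<odot>\<^bsub>A\<^esub> y \<oplus>\<^bsub>A\<^esub> d \<odot>\<^bsub>A\<^esub> z) = \<zero>\<^bsub>A\<^esub>"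
    unfolding assms(10) using assms(1) by simp
  then show ?thesis using assms(1-9) by (simp add: smult_r_distr smult_assoc1)
qed

text \<open>
  In the first case \<open>s\<close> is \<open>lam \<otimes> mu\<close>; rotating \<open>xxyy\<close> four times gives \<open>s \<otimes> s = \<one>\<close>.
\<close>

lemma normal_form:
  obtains lam s e f where "lam \<in> carrier K - {\<zero>}" "s \<in> {\<one>, \<ominus> \<one>}" "e \<in> carrier K" "f \<in> carrier K"
    "e \<noteq> \<zero> \<Longrightarrow> lam = \<one>" "f \<noteq> \<zero> \<Longrightarrow> lam = s"
    "e \<odot>\<^bsub>A\<^esub> W [Vx, Vx, Vx] \<oplus>\<^bsub>A\<^esub> W [Vx, Vy, Vy] \<oplus>\<^bsub>A\<^esub> lam \<odot>\<^bsub>A\<^esub> W [Vy, Vy, Vx] = \<zero>\<^bsub>A\<^esub>"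
    "W [Vx, Vx, Vy] \<oplus>\<^bsub>A\<^esub> (s \<otimes> lam) \<odot>\<^bsub>A\<^esub> W [Vy, Vx, Vx] \<oplus>\<^bsub>A\<^esub> f \<odot>\<^bsub>A\<^esub> W [Vy, Vy, Vy] = \<zero>\<^bsub>A\<^esub>"
    "wd [Vx, Vx, Vy] = wd [Vy, Vx, Vx]" "wd [Vy, Vy, Vx] = wd [Vx, Vy, Vy]"
    "e \<noteq> \<zero> \<or> f \<noteq> \<zero> \<Longrightarrow> wd [Vx, Vx] = wd [Vy, Vy]"
  | c d where "c \<in> carrier K - {\<zero>}" "d \<in> carrier K - {\<zero>}"
    "W [Vx, Vx, Vx] \<oplus>\<^bsub>A\<^esub> c \<odot>\<^bsub>A\<^esub> W [Vy, Vx, Vy] = \<zero>\<^bsub>A\<^esub>"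
    "W [Vy, Vy, Vy] \<oplus>\<^bsub>A\<^esub> d \<odot>\<^bsub>A\<^esub> W [Vx, Vy, Vx] = \<zero>\<^bsub>A\<^esub>"
    "wd [Vx, Vx, Vx] = wd [Vy, Vx, Vy]" "wd [Vy, Vy, Vy] = wd [Vx, Vy, Vx]"
proof -
  obtain lam mu p p' c c' e f where D: "coefficients lam mu p p' c c' e f" using classification_data by blast
  then have K: "lam \<in> carrier K" "mu \<in> carrier K" "p \<in> carrier K" "p' \<in> carrier K" "c \<in> carrier K" "c' \<in> carrier K"
    "e \<in> carrier K" "f \<in> carrier K" and nz: "lam \<noteq> \<zero>" "mu \<noteq> \<zero>"
    and eq: "e = lam \<otimes> e" "f = mu \<otimes> f" "p = mu \<otimes> p'" "p' = mu \<otimes> (lam \<otimes> (lam \<otimes> p))" "c' = lam \<otimes> c"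
    and cases: "p \<noteq> \<zero> \<and> c = \<zero> \<or> p = \<zero> \<and> c \<noteq> \<zero> \<and> e \<noteq> \<zero> \<and> f \<noteq> \<zero>"
    and rx: "e \<odot>\<^bsub>A\<^esub> W [Vx, Vx, Vx] \<oplus>\<^bsub>A\<^esub> p \<odot>\<^bsub>A\<^esub> W [Vx, Vy, Vy] \<oplus>\<^bsub>A\<^esub> c \<odot>\<^bsub>A\<^esub> W [Vy, Vx, Vy] \<oplus>\<^bsub>A\<^esub> (lam \<otimes> p) \<odot>\<^bsub>A\<^esub> W [Vy, Vy, Vx] = \<zero>\<^bsub>A\<^esub>"
    and ry: "p' \<odot>\<^bsub>A\<^esub> W [Vx, Vx, Vy] \<oplus>\<^bsub>A\<^esub> c' \<odot>\<^bsub>A\<^esub> W [Vx, Vy, Vx] \<oplus>\<^bsub>A\<^esub> (lam \<otimes> (lam \<otimes> p)) \<odot>\<^bsub>A\<^esub> W [Vy, Vx, Vx] \<oplus>\<^bsub>A\<^esub> f \<odot>\<^bsub>A\<^esub> W [Vy, Vy, Vy] = \<zero>\<^bsub>A\<^esub>"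
    and g1: "p \<noteq> \<zero> \<longrightarrow> wd [Vx, Vx, Vy] = wd [Vy, Vx, Vx] \<and> wd [Vy, Vy, Vx] = wd [Vx, Vy, Vy]"
    and g2: "p \<noteq> \<zero> \<and> (e \<noteq> \<zero> \<or> f \<noteq> \<zero>) \<longrightarrow> wd [Vx, Vx] = wd [Vy, Vy]"
    and g3: "c \<noteq> \<zero> \<longrightarrow> wd [Vx, Vx, Vx] = wd [Vy, Vx, Vy] \<and> wd [Vy, Vy, Vy] = wd [Vx, Vy, Vx]"
    unfolding coefficients_def by blast+
  have inv: "inv k \<in> carrier K" "inv k \<otimes> k = \<one>" if "k \<in> carrier K" "k \<noteq> \<zero>" for k
    using KF.field_Units that by auto
  have inv_zero: "inv k \<otimes> l = \<zero> \<longleftrightarrow> l = \<zero>" if "k \<in> carrier K" "k \<noteq> \<zero>" "l \<in> carrier K" for k l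
    using KF.integral[of "inv k" l] inv[OF that(1,2)] that by auto
  have one: "k = \<one>" if "k \<in> carrier K" "l \<in> carrier K" "l \<noteq> \<zero>" "l = k \<otimes> l" for k l
    using KF.m_rcancel[of l k \<one>] that by simp
  note rel = smult_relation[OF _ _ _ _ _ word_prod_closed word_prod_closed word_prod_closed word_prod_closed]
  from cases show thesis
  proof (elim disjE conjE)
    assume p: "p \<noteq> \<zero>" and c: "c = \<zero>"
    then have p': "p' \<noteq> \<zero>" using eq(3) K by auto
    define s where "s = lam \<otimes> mu"
    have sK: "s \<in> carrier K" using K by (simp add: s_def)
    have "s \<otimes> s = \<one>"
    proof (rule one[OF _ K(4) p'])
      have "p' = mu \<otimes> (lam \<otimes> (lam \<otimes> (mu \<otimes> p')))" using eq(3,4) by simp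
      then show "p' = s \<otimes> s \<otimes> p'" using K by (simp add: s_def R.m_ac)
    qed (use sK in simp)
    then have s: "s \<in> {\<one>, \<ominus> \<one>}" using KF.square_eq_one[OF sK] by blast
    \<comment> \<open>Dividing the second relation by \<open>p'\<close> leaves
      \<open>lam\<^sup>2 p / p' = lam\<^sup>2 mu = s lam\<close> at the word
      \<open>yxx\<close>.\<close>
    have a: "inv p' \<otimes> (lam \<otimes> (lam \<otimes> p)) = s \<otimes> lam"
    proof -
      have "inv p' \<otimes> (lam \<otimes> (lam \<otimes> p)) = inv p' \<otimes> (lam \<otimes> (lam \<otimes> (mu \<otimes> p')))" using eq(3) by simp
      also have "\<dots> = (inv p' \<otimes> p') \<otimes> (s \<otimes> lam)" using K inv(1)[OF K(4) p'] by (simp add: s_def R.m_ac)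
      finally show ?thesis using inv[OF K(4) p'] sK K by simp
    qed
    have b: "inv p \<otimes> (lam \<otimes> p) = lam" using K inv[OF K(3) p] by (simp add: R.m_lcomm)
    show thesis
    proof (rule that(1)[of lam s "inv p \<otimes> e" "inv p' \<otimes> f"])
      show "lam = \<one>" if "inv p \<otimes> e \<noteq> \<zero>" using one[OF K(1) K(7) _ eq(1)] inv_zero[OF K(3) p K(7)] that by blast
      show "lam = s" if "inv p' \<otimes> f \<noteq> \<zero>"
      proof -
        have "mu = \<one>" using one[OF K(2) K(8) _ eq(2)] inv_zero[OF K(4) p' K(8)] that by blast
        then show ?thesis using K by (simp add: s_def)
      qed
      show "(inv p \<otimes> e) \<odot>\<^bsub>A\<^esub> W [Vx, Vx, Vx] \<oplus>\<^bsub>A\<^esub> W [Vx, Vy, Vy] \<oplus>\<^bsub>A\<^esub> lam \<odot>\<^bsub>A\<^esub> W [Vy, Vy, Vx] = \<zero>\<^bsub>A\<^esub>"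
        using rel[OF inv(1)[OF K(3) p] _ _ _ _ rx] K inv[OF K(3) p] unfolding b c by (simp del: word_prod_simps)
      show "W [Vx, Vx, Vy] \<oplus>\<^bsub>A\<^esub> (s \<otimes> lam) \<odot>\<^bsub>A\<^esub> W [Vy, Vx, Vx] \<oplus>\<^bsub>A\<^esub> (inv p' \<otimes> f) \<odot>\<^bsub>A\<^esub> W [Vy, Vy, Vy] = \<zero>\<^bsub>A\<^esub>"
        using rel[OF inv(1)[OF K(4) p'] _ _ _ _ ry] K inv[OF K(4) p'] unfolding a eq(5) c by (simp del: word_prod_simps)
      show "wd [Vx, Vx] = wd [Vy, Vy]" if "inv p \<otimes> e \<noteq> \<zero> \<or> inv p' \<otimes> f \<noteq> \<zero>"
        using that inv_zero[OF K(3) p K(7)] inv_zero[OF K(4) p' K(8)] g2 p by blast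
    qed (use K nz s inv p p' g1 in \<open>simp_all del: word_deg_simps\<close>)
  next
    assume p: "p = \<zero>" and c: "c \<noteq> \<zero>" and e: "e \<noteq> \<zero>" and f: "f \<noteq> \<zero>"
    have lam: "lam = \<one>" using one[OF K(1) K(7) e eq(1)] .
    have c': "c' = c" using eq(5) K lam by simp
    have "mu \<otimes> (lam \<otimes> (lam \<otimes> p)) = \<zero>" using p K by simp
    then have p': "p' = \<zero>" using eq(4) by simp
    show thesis
    proof (rule that(2)[of "inv e \<otimes> c" "inv f \<otimes> c"])
      show "W [Vx, Vx, Vx] \<oplus>\<^bsub>A\<^esub> (inv e \<otimes> c) \<odot>\<^bsub>A\<^esub> W [Vy, Vx, Vy] = \<zero>\<^bsub>A\<^esub>"
        using rel[OF inv(1)[OF K(7) e] _ _ _ _ rx] K inv[OF K(7) e] unfolding p by (simp del: word_prod_simps)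
      have "(inv f \<otimes> c) \<odot>\<^bsub>A\<^esub> W [Vx, Vy, Vx] \<oplus>\<^bsub>A\<^esub> W [Vy, Vy, Vy] = \<zero>\<^bsub>A\<^esub>"
        using rel[OF inv(1)[OF K(8) f] _ _ _ _ ry] K inv[OF K(8) f] unfolding p p' c' by (simp del: word_prod_simps)
      then show "W [Vy, Vy, Vy] \<oplus>\<^bsub>A\<^esub> (inv f \<otimes> c) \<odot>\<^bsub>A\<^esub> W [Vx, Vy, Vx] = \<zero>\<^bsub>A\<^esub>"
        using K inv[OF K(8) f] by (simp add: M.a_comm del: word_prod_simps)
      show "inv e \<otimes> c \<in> carrier K - {\<zero>}" "inv f \<otimes> c \<in> carrier K - {\<zero>}"
        using K inv inv_zero e f c by auto
    qed (use g3 c in blast)+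
  qed
qed

lemma monomial_at: "monomial K u v = (if v = u then \<one> else \<zero>)"
  by (simp add: monomial_def)

lemmas hom3 = R.homogeneous_closed(2,3) R.monomial_homogeneous

theorem classification:
  "(\<exists>q\<in>carrier K - {\<zero>}. \<exists>s\<in>{\<one>, \<ominus> \<one>}. graded_iso_to K A \<A> G V (F_rels K s q) central_squares_rels) \<or>
   (\<exists>s\<in>{\<one>, \<ominus> \<one>}. graded_iso_to K A \<A> G V (G_rels K s) Gamma_rels) \<or>
   (\<exists>q\<in>carrier K - {\<zero>}. graded_iso_to K A \<A> G V (H_rels K q) Gamma_rels) \<or>
   (\<exists>q\<in>carrier K - {\<zero>}. graded_iso_to K A \<A> G V (I_rels K q) G5_rels)"
proof (rule normal_form)
  fix lam s e f assume lam: "lam \<in> carrier K - {\<zero>}" and s: "s \<in> {\<one>, \<ominus> \<one>}" and ef: "e \<in> carrier K" "f \<in> carrier K"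
    and el: "e \<noteq> \<zero> \<Longrightarrow> lam = \<one>" and fl: "f \<noteq> \<zero> \<Longrightarrow> lam = s"
    and rx: "e \<odot>\<^bsub>A\<^esub> W [Vx, Vx, Vx] \<oplus>\<^bsub>A\<^esub> W [Vx, Vy, Vy] \<oplus>\<^bsub>A\<^esub> lam \<odot>\<^bsub>A\<^esub> W [Vy, Vy, Vx] = \<zero>\<^bsub>A\<^esub>"
    and ry: "W [Vx, Vx, Vy] \<oplus>\<^bsub>A\<^esub> (s \<otimes> lam) \<odot>\<^bsub>A\<^esub> W [Vy, Vx, Vx] \<oplus>\<^bsub>A\<^esub> f \<odot>\<^bsub>A\<^esub> W [Vy, Vy, Vy] = \<zero>\<^bsub>A\<^esub>"
    and g: "wd [Vx, Vx, Vy] = wd [Vy, Vx, Vx]" "wd [Vy, Vy, Vx] = wd [Vx, Vy, Vy]"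
    and g2: "e \<noteq> \<zero> \<or> f \<noteq> \<zero> \<Longrightarrow> wd [Vx, Vx] = wd [Vy, Vy]"
  have lK: "lam \<in> carrier K" and sK: "s \<in> carrier K" and s2: "s \<otimes> s = \<one>" using lam s by (auto simp: R.l_minus R.r_minus)
  \<comment> \<open>The family depends on which of the cubes \<open>xxx\<close> and
    \<open>yyy\<close> occur: none gives \<open>F_rels\<close>, exactly one gives
    \<open>G_rels\<close>, both give \<open>H_rels\<close>.\<close>
  show ?thesis
  proof (cases "e = \<zero>"; cases "f = \<zero>")
    assume e: "e = \<zero>" and f: "f = \<zero>"
    have "graded_iso_to K A \<A> G V (F_rels K s lam) central_squares_rels"
      unfolding F_rels_def Let_def
    proof (rule graded_iso[of \<one> "\<lambda>c. c" _ _ "[Vx, Vy, Vy]" "[Vx, Vx, Vy]"])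
      show "eval_at K A (rescaled \<one> (\<lambda>c. c)) (monomial K [Vx, Vy, Vy] \<oplus>\<^bsub>T\<^esub> lam \<odot>\<^bsub>T\<^esub> monomial K [Vy, Vy, Vx]) = \<zero>\<^bsub>A\<^esub>"
        using rx lK by (simp add: e ev_rescaled del: word_prod_simps)
      show "eval_at K A (rescaled \<one> (\<lambda>c. c)) (monomial K [Vx, Vx, Vy] \<oplus>\<^bsub>T\<^esub> s \<odot>\<^bsub>T\<^esub> (lam \<odot>\<^bsub>T\<^esub> monomial K [Vy, Vx, Vx])) = \<zero>\<^bsub>A\<^esub>"
        using ry lK sK by (simp add: f ev_rescaled smult_assoc1 del: word_prod_simps)
      show "signed_value G (\<lambda>c. dg c) u = signed_value G (\<lambda>c. dg c) v" if "(u, v) \<in> central_squares_rels" for u v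
        using that g by (auto simp: central_squares_rels_def)
    qed (rule hom3 | simp add: lK sK free_algebra_simps monomial_at)+
    then show ?thesis using lam s by blast
  next
    assume e: "e \<noteq> \<zero>" and f: "f = \<zero>"
    have l: "lam = \<one>" by (rule el[OF e])
    \<comment> \<open>Replacing \<open>x\<close> by \<open>t x\<close> multiplies \<open>xxx\<close>
      by \<open>t\<^sup>3\<close> and the other words of the first relation by \<open>t\<close>, so
      \<open>t\<^sup>2 = e\<close> absorbs the coefficient.\<close>
    obtain t where t: "t \<in> carrier K" "t \<otimes> t = e" using square_roots[OF ef(1)] by blast
    have tn: "t \<noteq> \<zero>" using t e by auto
    have "graded_iso_to K A \<A> G V (G_rels K s) Gamma_rels"
      unfolding G_rels_def Let_def
    proof (rule graded_iso[of t "\<lambda>c. c" _ _ "[Vx, Vx, Vx]" "[Vx, Vx, Vy]"])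
      have "eval_at K A (rescaled t (\<lambda>c. c)) (monomial K [Vx, Vx, Vx] \<oplus>\<^bsub>T\<^esub> monomial K [Vx, Vy, Vy] \<oplus>\<^bsub>T\<^esub> monomial K [Vy, Vy, Vx])
          = t \<odot>\<^bsub>A\<^esub> (e \<odot>\<^bsub>A\<^esub> W [Vx, Vx, Vx] \<oplus>\<^bsub>A\<^esub> W [Vx, Vy, Vy] \<oplus>\<^bsub>A\<^esub> lam \<odot>\<^bsub>A\<^esub> W [Vy, Vy, Vx])"
        using t(1) by (simp add: l ev_rescaled t(2)[symmetric] smult_r_distr smult_assoc1 del: word_prod_simps)
      then show "eval_at K A (rescaled t (\<lambda>c. c)) (monomial K [Vx, Vx, Vx] \<oplus>\<^bsub>T\<^esub> monomial K [Vx, Vy, Vy] \<oplus>\<^bsub>T\<^esub> monomial K [Vy, Vy, Vx]) = \<zero>\<^bsub>A\<^esub>"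
        unfolding rx using t by simp
      have "eval_at K A (rescaled t (\<lambda>c. c)) (monomial K [Vx, Vx, Vy] \<oplus>\<^bsub>T\<^esub> s \<odot>\<^bsub>T\<^esub> monomial K [Vy, Vx, Vx])
          = e \<odot>\<^bsub>A\<^esub> (W [Vx, Vx, Vy] \<oplus>\<^bsub>A\<^esub> (s \<otimes> lam) \<odot>\<^bsub>A\<^esub> W [Vy, Vx, Vx] \<oplus>\<^bsub>A\<^esub> f \<odot>\<^bsub>A\<^esub> W [Vy, Vy, Vy])"
        using t(1) sK R.m_comm[OF sK, of "t \<otimes> t"]
        by (simp add: l f ev_rescaled t(2)[symmetric] smult_r_distr smult_assoc1[symmetric] del: word_prod_simps)
      then show "eval_at K A (rescaled t (\<lambda>c. c)) (monomial K [Vx, Vx, Vy] \<oplus>\<^bsub>T\<^esub> s \<odot>\<^bsub>T\<^esub> monomial K [Vy, Vx, Vx]) = \<zero>\<^bsub>A\<^esub>"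
        unfolding ry using ef by simp
      show "signed_value G (\<lambda>c. dg c) u = signed_value G (\<lambda>c. dg c) v" if "(u, v) \<in> Gamma_rels" for u v
        using that g2 e by (auto simp: Gamma_rels_def)
    qed (rule hom3 | simp add: t(1) tn sK free_algebra_simps monomial_at)+
    then show ?thesis using s by blast
  next
    assume e: "e = \<zero>" and f: "f \<noteq> \<zero>"
    have l: "lam = s" by (rule fl[OF f])
    obtain t where t: "t \<in> carrier K" "t \<otimes> t = f" using square_roots[OF ef(2)] by blast
    have tn: "t \<noteq> \<zero>" using t f by auto
    \<comment> \<open>The exchange turns the second relation into the first one of
      \<open>G_rels\<close>: as \<open>lam = s\<close>, its coefficient at \<open>yxx\<close> is
      \<open>s s = 1\<close>. The other relation acquires its sign in the right place after
      multiplication by \<open>s\<close>.\<close>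
    let ?o = "\<lambda>c. if c = Vx then Vy else Vx"
    have "graded_iso_to K A \<A> G V (G_rels K s) Gamma_rels"
      unfolding G_rels_def Let_def
    proof (rule graded_iso[of t ?o _ _ "[Vx, Vx, Vx]" "[Vx, Vx, Vy]"])
      have "eval_at K A (rescaled t ?o) (monomial K [Vx, Vx, Vx] \<oplus>\<^bsub>T\<^esub> monomial K [Vx, Vy, Vy] \<oplus>\<^bsub>T\<^esub> monomial K [Vy, Vy, Vx])
          = t \<odot>\<^bsub>A\<^esub> (W [Vx, Vx, Vy] \<oplus>\<^bsub>A\<^esub> (s \<otimes> lam) \<odot>\<^bsub>A\<^esub> W [Vy, Vx, Vx] \<oplus>\<^bsub>A\<^esub> f \<odot>\<^bsub>A\<^esub> W [Vy, Vy, Vy])"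
        using t(1) by (simp add: l s2 ev_rescaled t(2)[symmetric] smult_r_distr smult_assoc1 M.a_ac del: word_prod_simps)
      then show "eval_at K A (rescaled t ?o) (monomial K [Vx, Vx, Vx] \<oplus>\<^bsub>T\<^esub> monomial K [Vx, Vy, Vy] \<oplus>\<^bsub>T\<^esub> monomial K [Vy, Vy, Vx]) = \<zero>\<^bsub>A\<^esub>"
        unfolding ry using t by simp
      have "eval_at K A (rescaled t ?o) (monomial K [Vx, Vx, Vy] \<oplus>\<^bsub>T\<^esub> s \<odot>\<^bsub>T\<^esub> monomial K [Vy, Vx, Vx])
          = (f \<otimes> s) \<odot>\<^bsub>A\<^esub> (e \<odot>\<^bsub>A\<^esub> W [Vx, Vx, Vx] \<oplus>\<^bsub>A\<^esub> W [Vx, Vy, Vy] \<oplus>\<^bsub>A\<^esub> lam \<odot>\<^bsub>A\<^esub> W [Vy, Vy, Vx])"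
        using t(1) sK R.m_comm[OF sK, of "t \<otimes> t"] s2
        by (simp add: l e ev_rescaled t(2)[symmetric] smult_r_distr smult_assoc1[symmetric] R.m_assoc M.a_comm del: word_prod_simps)
      then show "eval_at K A (rescaled t ?o) (monomial K [Vx, Vx, Vy] \<oplus>\<^bsub>T\<^esub> s \<odot>\<^bsub>T\<^esub> monomial K [Vy, Vx, Vx]) = \<zero>\<^bsub>A\<^esub>"
        unfolding rx using ef sK by simp
      show "signed_value G (\<lambda>c. dg (?o c)) u = signed_value G (\<lambda>c. dg (?o c)) v" if "(u, v) \<in> Gamma_rels" for u v
        using that g2 f by (auto simp: Gamma_rels_def)
    qed (rule hom3 | simp add: t(1) tn sK free_algebra_simps monomial_at)+
    then show ?thesis using s by blast
  next
    assume e: "e \<noteq> \<zero>" and f: "f \<noteq> \<zero>"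
    have l: "lam = \<one>" "s = \<one>" using el[OF e] fl[OF f] by simp_all
    \<comment> \<open>With \<open>t x\<close> in place of \<open>x\<close> the two relations require
      \<open>t\<^sup>2 q = e\<close> and \<open>q = t\<^sup>2 f\<close>, hence
      \<open>t\<^sup>4 f = e\<close>.\<close>
    obtain t where t: "t \<in> carrier K" "t \<noteq> \<zero>" "t \<otimes> (t \<otimes> (t \<otimes> (t \<otimes> f))) = e" by (rule fourth_root[OF ef e f])
    define q where "q = t \<otimes> (t \<otimes> f)"
    have qK: "q \<in> carrier K" using t ef by (simp add: q_def)
    have qt: "t \<otimes> (t \<otimes> q) = e" using t by (simp add: q_def)
    have qn: "q \<noteq> \<zero>" using qt e t(1) by auto
    have "graded_iso_to K A \<A> G V (H_rels K q) Gamma_rels"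
      unfolding H_rels_def Let_def
    proof (rule graded_iso[of t "\<lambda>c. c" _ _ "[Vx, Vy, Vy]" "[Vx, Vx, Vy]"])
      have "q \<otimes> (t \<otimes> t \<otimes> t) = t \<otimes> e" unfolding qt[symmetric] using t(1) qK by (simp add: R.m_ac)
      then have "eval_at K A (rescaled t (\<lambda>c. c)) (monomial K [Vx, Vy, Vy] \<oplus>\<^bsub>T\<^esub> monomial K [Vy, Vy, Vx] \<oplus>\<^bsub>T\<^esub> q \<odot>\<^bsub>T\<^esub> monomial K [Vx, Vx, Vx])
          = t \<odot>\<^bsub>A\<^esub> (e \<odot>\<^bsub>A\<^esub> W [Vx, Vx, Vx] \<oplus>\<^bsub>A\<^esub> W [Vx, Vy, Vy] \<oplus>\<^bsub>A\<^esub> lam \<odot>\<^bsub>A\<^esub> W [Vy, Vy, Vx])"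
        using t(1) qK ef by (simp add: l ev_rescaled smult_r_distr smult_assoc1[symmetric] M.a_ac del: word_prod_simps)
      then show "eval_at K A (rescaled t (\<lambda>c. c)) (monomial K [Vx, Vy, Vy] \<oplus>\<^bsub>T\<^esub> monomial K [Vy, Vy, Vx] \<oplus>\<^bsub>T\<^esub> q \<odot>\<^bsub>T\<^esub> monomial K [Vx, Vx, Vx]) = \<zero>\<^bsub>A\<^esub>"
        unfolding rx using t by simp
      have "eval_at K A (rescaled t (\<lambda>c. c)) (monomial K [Vx, Vx, Vy] \<oplus>\<^bsub>T\<^esub> monomial K [Vy, Vx, Vx] \<oplus>\<^bsub>T\<^esub> q \<odot>\<^bsub>T\<^esub> monomial K [Vy, Vy, Vy])
          = (t \<otimes> t) \<odot>\<^bsub>A\<^esub> (W [Vx, Vx, Vy] \<oplus>\<^bsub>A\<^esub> (s \<otimes> lam) \<odot>\<^bsub>A\<^esub> W [Vy, Vx, Vx] \<oplus>\<^bsub>A\<^esub> f \<odot>\<^bsub>A\<^esub> W [Vy, Vy, Vy])"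
        using t(1) ef by (simp add: l q_def ev_rescaled smult_r_distr smult_assoc1[symmetric] R.m_assoc del: word_prod_simps)
      then show "eval_at K A (rescaled t (\<lambda>c. c)) (monomial K [Vx, Vx, Vy] \<oplus>\<^bsub>T\<^esub> monomial K [Vy, Vx, Vx] \<oplus>\<^bsub>T\<^esub> q \<odot>\<^bsub>T\<^esub> monomial K [Vy, Vy, Vy]) = \<zero>\<^bsub>A\<^esub>"
        unfolding ry using t by simp
      show "signed_value G (\<lambda>c. dg c) u = signed_value G (\<lambda>c. dg c) v" if "(u, v) \<in> Gamma_rels" for u v
        using that g2 e by (auto simp: Gamma_rels_def)
    qed (rule hom3 | simp add: t(1,2) qK free_algebra_simps monomial_at)+
    then show ?thesis using qK qn by blast
  qed
next
  fix c d assume cd: "c \<in> carrier K - {\<zero>}" "d \<in> carrier K - {\<zero>}"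
    and rx: "W [Vx, Vx, Vx] \<oplus>\<^bsub>A\<^esub> c \<odot>\<^bsub>A\<^esub> W [Vy, Vx, Vy] = \<zero>\<^bsub>A\<^esub>"
    and ry: "W [Vy, Vy, Vy] \<oplus>\<^bsub>A\<^esub> d \<odot>\<^bsub>A\<^esub> W [Vx, Vy, Vx] = \<zero>\<^bsub>A\<^esub>"
    and g: "wd [Vx, Vx, Vx] = wd [Vy, Vx, Vy]" "wd [Vy, Vy, Vy] = wd [Vx, Vy, Vx]"
  have cdK: "c \<in> carrier K" "d \<in> carrier K" "c \<noteq> \<zero>" "d \<noteq> \<zero>" using cd by auto
  \<comment> \<open>Here the requirements are \<open>q = t\<^sup>2 c\<close> for the first relation
    and \<open>t\<^sup>2 q = d\<close> for the second, hence \<open>t\<^sup>4 c = d\<close>.\<close>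
  obtain t where t: "t \<in> carrier K" "t \<noteq> \<zero>" "t \<otimes> (t \<otimes> (t \<otimes> (t \<otimes> c))) = d" by (rule fourth_root[OF cdK(2,1,4,3)])
  define q where "q = t \<otimes> (t \<otimes> c)"
  have qK: "q \<in> carrier K" using t cdK by (simp add: q_def)
  have qt: "t \<otimes> (t \<otimes> q) = d" using t by (simp add: q_def)
  have qn: "q \<noteq> \<zero>" using qt cdK t(1) by auto
  have "graded_iso_to K A \<A> G V (I_rels K q) G5_rels"
    unfolding I_rels_def Let_def
  proof (rule graded_iso[of t "\<lambda>c. c" _ _ "[Vx, Vx, Vx]" "[Vy, Vy, Vy]"])
    have "q \<otimes> t = t \<otimes> t \<otimes> t \<otimes> c" unfolding q_def using t(1) cdK by (simp add: R.m_ac)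
    then have "eval_at K A (rescaled t (\<lambda>c. c)) (monomial K [Vx, Vx, Vx] \<oplus>\<^bsub>T\<^esub> q \<odot>\<^bsub>T\<^esub> monomial K [Vy, Vx, Vy])
        = (t \<otimes> t \<otimes> t) \<odot>\<^bsub>A\<^esub> (W [Vx, Vx, Vx] \<oplus>\<^bsub>A\<^esub> c \<odot>\<^bsub>A\<^esub> W [Vy, Vx, Vy])"
      using t(1) qK cdK by (simp add: ev_rescaled smult_r_distr smult_assoc1[symmetric] del: word_prod_simps)
    then show "eval_at K A (rescaled t (\<lambda>c. c)) (monomial K [Vx, Vx, Vx] \<oplus>\<^bsub>T\<^esub> q \<odot>\<^bsub>T\<^esub> monomial K [Vy, Vx, Vy]) = \<zero>\<^bsub>A\<^esub>"
      unfolding rx using t by simp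
    have "q \<otimes> (t \<otimes> t) = d" unfolding qt[symmetric] using t(1) qK by (simp add: R.m_ac)
    then show "eval_at K A (rescaled t (\<lambda>c. c)) (monomial K [Vy, Vy, Vy] \<oplus>\<^bsub>T\<^esub> q \<odot>\<^bsub>T\<^esub> monomial K [Vx, Vy, Vx]) = \<zero>\<^bsub>A\<^esub>"
      using t(1) qK ry by (simp add: ev_rescaled smult_assoc1[symmetric] del: word_prod_simps)
    show "signed_value G (\<lambda>c. dg c) u = signed_value G (\<lambda>c. dg c) v" if "(u, v) \<in> G5_rels" for u v
      using that g by (auto simp: G5_rels_def)
  qed (rule hom3 | simp add: t(1,2) qK free_algebra_simps monomial_at)+
  then show ?thesis using qK qn by blast
qed

end

text \<open>Elements homogeneous for both gradings span \<open>A\<^sub>1\<close>. One nonzero such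
  element is chosen, then one outside its line, which exists because the generators \<open>x\<close>
  are independent.\<close>

lemma (in cubic_presentation) homogeneous_basis:
  assumes ref: "internal_direct_sum A I (\<lambda>g. \<A> 1 \<inter> V g) (\<A> 1)"
  obtains u v g h where "g \<in> I" "h \<in> I" "u \<in> \<A> 1 \<inter> V g" "v \<in> \<A> 1 \<inter> V h"
    "\<And>\<alpha> \<beta>. \<lbrakk>\<alpha> \<in> carrier K; \<beta> \<in> carrier K; \<alpha> \<odot>\<^bsub>A\<^esub> u \<oplus>\<^bsub>A\<^esub> \<beta> \<odot>\<^bsub>A\<^esub> v = \<zero>\<^bsub>A\<^esub>\<rbrakk> \<Longrightarrow> \<alpha> = \<zero> \<and> \<beta> = \<zero>"
proof -
  have span: "P a" if P: "P \<zero>\<^bsub>A\<^esub>" "\<And>a b. P a \<Longrightarrow> P b \<Longrightarrow> P (a \<oplus>\<^bsub>A\<^esub> b)" "\<And>g b. g \<in> I \<Longrightarrow> b \<in> \<A> 1 \<inter> V g \<Longrightarrow> P b"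
    and a: "a \<in> \<A> 1" for P a
  proof -
    obtain f where f: "f \<in> (\<Pi>\<^sub>E g\<in>I. \<A> 1 \<inter> V g)" "finite {g\<in>I. f g \<noteq> \<zero>\<^bsub>A\<^esub>}" "a = (\<Oplus>\<^bsub>A\<^esub>g\<in>{g\<in>I. f g \<noteq> \<zero>\<^bsub>A\<^esub>}. f g)"
      using ref a unfolding internal_direct_sum_def by blast
    show ?thesis unfolding f(3)
    proof (rule finsum_induct[OF A_ab f(2)])
      fix g assume "g \<in> {g\<in>I. f g \<noteq> \<zero>\<^bsub>A\<^esub>}"
      then have g: "g \<in> I" "f g \<in> \<A> 1 \<inter> V g" using f(1) by blast+
      then show "f g \<in> carrier A \<and> P (f g)" using P(3) grade_sub by blast
    qed (use P in blast)+
  qed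
  have x0: "x Vx \<noteq> \<zero>\<^bsub>A\<^esub>" using x_indep[of \<one> \<zero>] by auto
  have "\<exists>u g. g \<in> I \<and> u \<in> \<A> 1 \<inter> V g \<and> u \<noteq> \<zero>\<^bsub>A\<^esub>"
  proof (rule ccontr)
    assume h: "\<not> ?thesis"
    have "x Vx = \<zero>\<^bsub>A\<^esub>" by (rule span[OF _ _ _ x_deg[of Vx]]) (use h in auto)
    with x0 show False by simp
  qed
  then obtain u g where u: "g \<in> I" "u \<in> \<A> 1 \<inter> V g" "u \<noteq> \<zero>\<^bsub>A\<^esub>" by blast
  have uA: "u \<in> carrier A" using u(2) grade_sub by blast
  have "\<exists>v h. h \<in> I \<and> v \<in> \<A> 1 \<inter> V h \<and> \<not> (\<exists>k\<in>carrier K. v = k \<odot>\<^bsub>A\<^esub> u)"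
  proof (rule ccontr)
    assume h: "\<not> ?thesis"
    have "\<exists>k\<in>carrier K. a = k \<odot>\<^bsub>A\<^esub> u" if "a \<in> \<A> 1" for a
    proof (rule span[OF _ _ _ that])
      show "\<exists>k\<in>carrier K. \<zero>\<^bsub>A\<^esub> = k \<odot>\<^bsub>A\<^esub> u" using uA by (intro bexI[of _ \<zero>]) auto
      fix a b assume "\<exists>k\<in>carrier K. a = k \<odot>\<^bsub>A\<^esub> u" "\<exists>k\<in>carrier K. b = k \<odot>\<^bsub>A\<^esub> u"
      then obtain k l where "k \<in> carrier K" "l \<in> carrier K" "a = k \<odot>\<^bsub>A\<^esub> u" "b = l \<odot>\<^bsub>A\<^esub> u" by blast
      then show "\<exists>k\<in>carrier K. a \<oplus>\<^bsub>A\<^esub> b = k \<odot>\<^bsub>A\<^esub> u" using uA by (intro bexI[of _ "k \<oplus> l"]) (auto simp: smult_l_distr)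
    next
      fix g' b assume "g' \<in> I" "b \<in> \<A> 1 \<inter> V g'"
      then show "\<exists>k\<in>carrier K. b = k \<odot>\<^bsub>A\<^esub> u" using h by blast
    qed
    then obtain k l where kl: "k \<in> carrier K" "l \<in> carrier K" "x Vx = k \<odot>\<^bsub>A\<^esub> u" "x Vy = l \<odot>\<^bsub>A\<^esub> u"
      using x_deg by meson
    have "l \<odot>\<^bsub>A\<^esub> x Vx \<oplus>\<^bsub>A\<^esub> (\<ominus> k) \<odot>\<^bsub>A\<^esub> x Vy = (l \<otimes> k) \<odot>\<^bsub>A\<^esub> u \<oplus>\<^bsub>A\<^esub> \<ominus>\<^bsub>A\<^esub> ((k \<otimes> l) \<odot>\<^bsub>A\<^esub> u)"
      unfolding kl(3,4) using kl(1,2) uA by (simp add: smult_assoc1 smult_l_minus)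
    also have "\<dots> = \<zero>\<^bsub>A\<^esub>" using kl(1,2) uA by (simp add: R.m_comm[of l k] M.r_neg)
    finally have "\<ominus> k = \<zero>" using x_indep[of l "\<ominus> k"] kl by auto
    then have "k = \<zero>" using kl(1) R.minus_minus[of k] by simp
    then show False using x0 kl(3) uA by simp
  qed
  then obtain v h where v: "h \<in> I" "v \<in> \<A> 1 \<inter> V h" and vu: "\<And>k. k \<in> carrier K \<Longrightarrow> v \<noteq> k \<odot>\<^bsub>A\<^esub> u" by blast
  have vA: "v \<in> carrier A" using v(2) grade_sub by blast
  have inv: "inv k \<in> carrier K" "inv k \<otimes> k = \<one>" if "k \<in> carrier K" "k \<noteq> \<zero>" for k
    using KF.field_Units that by auto
  have "\<alpha> = \<zero> \<and> \<beta> = \<zero>" if ab: "\<alpha> \<in> carrier K" "\<beta> \<in> carrier K" "\<alpha> \<odot>\<^bsub>A\<^esub> u \<oplus>\<^bsub>A\<^esub> \<beta> \<odot>\<^bsub>A\<^esub> v = \<zero>\<^bsub>A\<^esub>" for \<alpha> \<beta>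
  proof -
    have b: "\<beta> = \<zero>"
    proof (rule ccontr)
      assume nz: "\<beta> \<noteq> \<zero>"
      have "\<beta> \<odot>\<^bsub>A\<^esub> v = \<ominus>\<^bsub>A\<^esub> (\<alpha> \<odot>\<^bsub>A\<^esub> u)" using ab uA vA M.minus_equality[of "\<beta> \<odot>\<^bsub>A\<^esub> v" "\<alpha> \<odot>\<^bsub>A\<^esub> u"] by (simp add: M.a_comm)
      then have bv: "\<beta> \<odot>\<^bsub>A\<^esub> v = (\<ominus> \<alpha>) \<odot>\<^bsub>A\<^esub> u" using ab(1) uA by (simp add: smult_l_minus)
      have "v = (inv \<beta> \<otimes> \<beta>) \<odot>\<^bsub>A\<^esub> v" using inv[OF ab(2) nz] vA by simp
      also have "\<dots> = inv \<beta> \<odot>\<^bsub>A\<^esub> (\<beta> \<odot>\<^bsub>A\<^esub> v)" using inv(1)[OF ab(2) nz] ab(2) vA by (simp add: smult_assoc1)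
      also have "\<dots> = (inv \<beta> \<otimes> \<ominus> \<alpha>) \<odot>\<^bsub>A\<^esub> u" unfolding bv using inv(1)[OF ab(2) nz] ab(1) uA by (simp add: smult_assoc1)
      finally show False using vu[of "inv \<beta> \<otimes> \<ominus> \<alpha>"] inv(1)[OF ab(2) nz] ab(1) by simp
    qed
    have "\<alpha> = \<zero>"
    proof (rule ccontr)
      assume nz: "\<alpha> \<noteq> \<zero>"
      have au: "\<alpha> \<odot>\<^bsub>A\<^esub> u = \<zero>\<^bsub>A\<^esub>" using ab b uA vA by simp
      have "u = (inv \<alpha> \<otimes> \<alpha>) \<odot>\<^bsub>A\<^esub> u" using inv[OF ab(1) nz] uA by simp
      also have "\<dots> = inv \<alpha> \<odot>\<^bsub>A\<^esub> (\<alpha> \<odot>\<^bsub>A\<^esub> u)" using inv(1)[OF ab(1) nz] ab(1) uA by (simp add: smult_assoc1)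
      finally show False using u(3) inv(1)[OF ab(1) nz] unfolding au by simp
    qed
    with b show ?thesis by simp
  qed
  then show ?thesis by (rule that[OF u(1) v(1) u(2) v(2)])
qed

text \<open>An element of \<open>V g\<close> is the value of a polynomial all of whose words have
  degree \<open>g\<close>. If it is nonzero, such a word exists, and \<open>g\<close> is a product
  of degrees of letters.\<close>

lemma (in group_graded) degrees_generate:
  assumes faithful: "faithful_grading A G V"
  shows "generate G (range dg) = carrier G"
proof
  have sub: "subgroup (generate G (range dg)) G" by (rule G.generate_is_subgroup) auto
  show "generate G (range dg) \<subseteq> carrier G" using G.subgroupE(1)[OF sub] .
  have word: "wd u \<in> generate G (range dg)" for u
    by (induction u) (auto intro: generate.intros)
  obtain cg where cg: "components A (carrier G) V cg" by (rule V_components)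
  have "{g \<in> carrier G. V g \<noteq> {\<zero>\<^bsub>A\<^esub>}} \<subseteq> generate G (range dg)"
  proof
    fix g assume "g \<in> {g \<in> carrier G. V g \<noteq> {\<zero>\<^bsub>A\<^esub>}}"
    then have g: "g \<in> carrier G" "V g \<noteq> {\<zero>\<^bsub>A\<^esub>}" by auto
    have "\<zero>\<^bsub>A\<^esub> \<in> V g" using components_zero_mem[OF A_ab cg g(1)] .
    then obtain a where a: "a \<in> V g" "a \<noteq> \<zero>\<^bsub>A\<^esub>" using g(2) by blast
    have "a \<in> carrier A" using components_sub[OF cg g(1) a(1)] .
    then obtain f where f: "f \<in> carrier T" "a = ev f" using ev_surj by blast
    have e: "ev (deg_part g f) = a" using ev_deg_part[OF cg g(1) f(1)] components_same[OF cg g(1) a(1)] f(2) by simp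
    have "\<exists>u. wd u = g"
    proof (rule ccontr)
      assume "\<not> ?thesis"
      then have "deg_part g f = \<zero>\<^bsub>T\<^esub>" by (auto simp: deg_part_def free_algebra_simps)
      then show False using e a(2) by simp
    qed
    then show "g \<in> generate G (range dg)" using word by blast
  qed
  then show "carrier G \<subseteq> generate G (range dg)"
    using faithful G.generate_subgroup_incl[OF _ sub] unfolding faithful_grading_def by blast
qed

theorem theorem4p2:
  fixes K :: "('k, 'l) ring_scheme"
    and A :: "('k, 'a, 'b) module_scheme"
    and \<A> :: "nat \<Rightarrow> 'a set"
    and G :: "('g, 'c) monoid_scheme"
    and V :: "'g \<Rightarrow> 'a set"
  assumes "algebraically_closed K"
    and "\<And>n::nat. n > 0 \<Longrightarrow> add_pow K n \<one>\<^bsub>K\<^esub> \<noteq> \<zero>\<^bsub>K\<^esub>"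
    and "cubic_AS_regular K A \<A>"
    and "group G" and "\<not> comm_group G"
    and "graded_algebra K A G V"
    and "faithful_grading A G V"
    and "refines_grading A \<A> G V"
  shows "(\<exists>q\<in>carrier K - {\<zero>\<^bsub>K\<^esub>}. \<exists>s\<in>{\<one>\<^bsub>K\<^esub>, \<ominus>\<^bsub>K\<^esub> \<one>\<^bsub>K\<^esub>}.
            graded_iso_to K A \<A> G V (F_rels K s q) central_squares_rels) \<or>
         (\<exists>s\<in>{\<one>\<^bsub>K\<^esub>, \<ominus>\<^bsub>K\<^esub> \<one>\<^bsub>K\<^esub>}.
            graded_iso_to K A \<A> G V (G_rels K s) Gamma_rels) \<or>
         (\<exists>q\<in>carrier K - {\<zero>\<^bsub>K\<^esub>}.
            graded_iso_to K A \<A> G V (H_rels K q) Gamma_rels) \<or>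
         (\<exists>q\<in>carrier K - {\<zero>\<^bsub>K\<^esub>}.
            graded_iso_to K A \<A> G V (I_rels K q) G5_rels)"
proof -
  interpret KC: algebraically_closed K by fact
  interpret G: group G by fact
  let ?T = "free_algebra K :: ('k, var list \<Rightarrow> 'k) module"
  obtain r1 r2 :: "var list \<Rightarrow> 'k" where AS: "AS_regular K A \<A> 3"
    and r: "r1 \<in> free_homogeneous K 3" "r2 \<in> free_homogeneous K 3"
    and indep: "\<forall>c1\<in>carrier K. \<forall>c2\<in>carrier K. c1 \<odot>\<^bsub>?T\<^esub> r1 \<oplus>\<^bsub>?T\<^esub> c2 \<odot>\<^bsub>?T\<^esub> r2 = \<zero>\<^bsub>?T\<^esub> \<longrightarrow> c1 = \<zero>\<^bsub>K\<^esub> \<and> c2 = \<zero>\<^bsub>K\<^esub>"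
    and iso: "graded_algebra_iso K A \<A> (presented_algebra K {r1, r2}) (presented_grading K {r1, r2}) \<noteq> {}"
    using assms(3) unfolding cubic_AS_regular_def by blast
  have conn: "connected_graded K A \<A>" using AS by (simp add: AS_regular_def)
  have "connected_alg K A \<A>"
    by (intro connected_alg.intro connected_alg_axioms.intro conn KC.field_axioms)
       (use assms(6) in \<open>simp add: graded_algebra_def\<close>)
  then interpret C: connected_alg K A \<A> .
  obtain f where f: "f \<in> graded_algebra_iso K A \<A> (presented_algebra K {r1, r2}) (presented_grading K {r1, r2})"
    using iso by blast
  let ?r = "\<lambda>c. if c = Vx then r1 else r2"
  have range: "range ?r = {r1, r2}" by (auto simp: var_UNIV)
  have "\<exists>x. cubic_presentation K A \<A> x ?r"
  proof (rule C.presentation_of_iso[where f = f])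
    show "?r c \<in> free_homogeneous K 3" for c using r by simp
    show "\<alpha> = \<zero>\<^bsub>K\<^esub> \<and> \<beta> = \<zero>\<^bsub>K\<^esub>" if "\<alpha> \<in> carrier K" "\<beta> \<in> carrier K" "\<alpha> \<odot>\<^bsub>?T\<^esub> ?r Vx \<oplus>\<^bsub>?T\<^esub> \<beta> \<odot>\<^bsub>?T\<^esub> ?r Vy = \<zero>\<^bsub>?T\<^esub>" for \<alpha> \<beta>
      using indep[rule_format, OF that(1,2)] that(3) by simp
    show "f \<in> graded_algebra_iso K A \<A> (presented_algebra K (range ?r)) (presented_grading K (range ?r))"
      unfolding range by (rule f)
  qed
  then obtain x0 where "cubic_presentation K A \<A> x0 ?r" by blast
  then interpret P0: cubic_presentation K A \<A> x0 ?r .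
  \<comment> \<open>The refinement in degree one supplies generators that are homogeneous for
    \<open>G\<close>.\<close>
  have "internal_direct_sum A (carrier G) (\<lambda>g. \<A> 1 \<inter> V g) (\<A> 1)" using assms(8) by (simp add: refines_grading_def)
  then obtain u v g h where uv: "g \<in> carrier G" "h \<in> carrier G" "u \<in> \<A> 1 \<inter> V g" "v \<in> \<A> 1 \<inter> V h"
    and uv_indep: "\<And>\<alpha> \<beta>. \<lbrakk>\<alpha> \<in> carrier K; \<beta> \<in> carrier K; \<alpha> \<odot>\<^bsub>A\<^esub> u \<oplus>\<^bsub>A\<^esub> \<beta> \<odot>\<^bsub>A\<^esub> v = \<zero>\<^bsub>A\<^esub>\<rbrakk> \<Longrightarrow> \<alpha> = \<zero>\<^bsub>K\<^esub> \<and> \<beta> = \<zero>\<^bsub>K\<^esub>"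
    by (rule P0.homogeneous_basis) (rule that; assumption)
  define x where "x c = (if c = Vx then u else v)" for c
  define dg where "dg c = (if c = Vx then g else h)" for c
  have x: "x c \<in> \<A> 1" "x c \<in> V (dg c)" and dg: "dg c \<in> carrier G" for c using uv by (simp_all add: x_def dg_def)
  have "\<exists>r. cubic_presentation K A \<A> x r"
    by (rule P0.base_change[OF x(1)]) (rule uv_indep, simp_all add: x_def)
  then obtain r where "cubic_presentation K A \<A> x r" by blast
  then have "regular_cubic K A \<A> x r" by (intro regular_cubic.intro regular_cubic_axioms.intro AS)
  then obtain w where w: "regular_potential K A \<A> x w" using regular_cubic.potential_exists by blast
  have gr: "group_graded K A \<A> x (\<lambda>c. lder c w) G V dg"
    by (intro group_graded.intro group_graded_axioms.intro regular_potential.axioms(1)[OF w] assms(4,6) dg x(2))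
  have gen: "generate G (range dg) = carrier G" by (rule group_graded.degrees_generate[OF gr assms(7)])
  \<comment> \<open>By faithfulness the two degrees generate \<open>G\<close>, so commuting degrees
    would make \<open>G\<close> abelian.\<close>
  have "dg Vx \<otimes>\<^bsub>G\<^esub> dg Vy \<noteq> dg Vy \<otimes>\<^bsub>G\<^esub> dg Vx"
  proof
    assume c: "dg Vx \<otimes>\<^bsub>G\<^esub> dg Vy = dg Vy \<otimes>\<^bsub>G\<^esub> dg Vx"
    have "comm_group G"
    proof (rule G.commuting_generators[OF gen])
      fix a b assume "a \<in> range dg" "b \<in> range dg"
      then show "a \<otimes>\<^bsub>G\<^esub> b = b \<otimes>\<^bsub>G\<^esub> a" using c unfolding var_UNIV by auto
    qed (use dg in auto)
    then show False using assms(5) by simp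
  qed
  then have "generated_potential K A \<A> x w G V dg"
    by (intro generated_potential.intro generated_potential_axioms.intro graded_potential.intro
        graded_potential_axioms.intro w gr gen KC.square_root)
  then show ?thesis by (rule generated_potential.classification)
qed

end
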